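(* Let $A(t)$, $(P(t,s))$, $\{\mu_s : s\in\mathbb{R}\}$ and $(\mathcal{T}(t))_{t\ge0}$ be, respectively, the $T$-time periodic nonautonomous elliptic operator, its evolution operator on $C_b(\mathbb{R}^N)$, its $T$-periodic evolution system of measures and its evolution semigroup on $C_b(\mathbb{T}\times\mathbb{R}^N)$ specified in the context. Then the semigroup $(\mathcal{T}(t))_{t\ge0}$ is $\tau_c$-mean ergodic. In particular, $$\tau_c\text{-}\lim_{t\to\infty}\frac1t\int_0^t\bigl(P(s,-r)f-m_{-r}f\bigr)\,dr=0$$ for any $s>0$ and any $f\in C_b(\mathbb{R}^N)$, where $m_sf:=\int_{\mathbb{R}^N}f\,d\mu_s$. Moreover, a Liouville type theorem holds: the constants are the only solutions to the parabolic equation $D_tu-A(t)u=0$ which belong to $\bigcap_{q<\infty}W^{1,2}_{q,\mathrm{loc}}(\mathbb{T}\times\mathbb{R}^N,ds\times dx)\cap C_b(\mathbb{T}\times\mathbb{R}^N)$.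
   Context: Fix $T>0$ and let $\mathbb{T}=[0,T]$ mod. $T$; functions on $\mathbb{T}\times\mathbb{R}^N$ are identified with functions on $\mathbb{R}\times\mathbb{R}^N$ that are $T$-periodic in the first variable. Let $$A(s)u(x)=\sum_{i,j=1}^Nq_{ij}(s,x)D_{ij}u(x)+\sum_{i=1}^Nb_i(s,x)D_iu(x),\qquad s\in\mathbb{R},\ x\in\mathbb{R}^N,$$ where: (1) $q_{ij},b_i$ are $T$-time periodic and belong to the parabolic Hölder space $C^{\alpha/2,\alpha}_{\mathrm{loc}}(\mathbb{T}\times\mathbb{R}^N)$ for some $\alpha\in(0,1)$; (2) the matrix $Q(s,x)=(q_{ij}(s,x))$ is symmetric for every $(s,x)\in\mathbb{R}^{1+N}$ and there is $\eta:\mathbb{T}\times\mathbb{R}^N\to\mathbb{R}$ with $\inf_{\mathbb{T}\times\mathbb{R}^N}\eta>0$ and $\langle Q(s,x)\xi,\xi\rangle\ge\eta(s,x)|\xi|^2$ for all $\xi\in\mathbb{R}^N$, $(s,x)\in\mathbb{T}\times\mathbb{R}^N$; (3) there exist a positive function $V\in C^2(\mathbb{R}^N)$ and constants $a,c>0$ such that $\lim_{|x|\to\infty}V(x)=\infty$ and $(A(s)V)(x)\le a-cV(x)$ for all $(s,x)\in\mathbb{T}\times\mathbb{R}^N$. Evolution operator: for $f\in C_b(\mathbb{R}^N)$ and $t\ge s$, $P(t,s)f$ is the value at time $t$ of the unique bounded classical solution $u\in C^{1,2}(]s,\infty[\,\times\mathbb{R}^N)\cap C([s,\infty[\,\times\mathbb{R}^N)$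 of $D_tu(t,x)=A(t)u(t,x)$ for $(t,x)\in\,]s,\infty[\,\times\mathbb{R}^N$, $u(s,x)=f(x)$ for $x\in\mathbb{R}^N$. Each $P(t,s)$ is a contraction on $C_b(\mathbb{R}^N)$ and $P(t+T,s+T)=P(t,s)$. $\{\mu_s : s\in\mathbb{R}\}$ is the unique $T$-periodic ($\mu_{s+T}=\mu_s$) evolution system of measures for $(P(t,s))$, i.e. the unique $T$-periodic family of Borel probability measures on $\mathbb{R}^N$ with $\int_{\mathbb{R}^N}P(t,s)f\,d\mu_t=\int_{\mathbb{R}^N}f\,d\mu_s$ for all $s<t$ and $f\in C_b(\mathbb{R}^N)$ (it exists when, as is assumed here, the coefficients $q_{ij},b_i$ are $T$-time periodic and in $C^{\alpha/2,\alpha}_{\mathrm{loc}}(\mathbb{T}\times\mathbb{R}^N)$, the symmetric matrix $Q$ satisfies $\langle Q(s,x)\xi,\xi\rangle\ge\eta(s,x)|\xi|^2$ with $\inf_{\mathbb{T}\times\mathbb{R}^N}\eta>0$, and there is a positive $V\in C^2(\mathbb{R}^N)$ blowing up as $|x|\to\infty$ with $A(s)V\le a-cV$ on $\mathbb{T}\times\mathbb{R}^N$ for some constants $a,c>0$). Evolution (Howland) semigroup: $(\mathcal{T}(t)f)(s,x)=(P(s,s-t)f(s-t,\cdot))(x)$, for $(s,x)\in\mathbb{R}^{1+N}$, $t\ge0$, $f\in C_b(\mathbb{T}\times\mathbb{R}^N)$. It is a semigroup of contractions on $C_b(\mathbb{T}\times\mathbb{R}^N)$, bi-continuous with respect to the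 topology of uniform convergence on compact subsets of $\mathbb{T}\times\mathbb{R}^N$. $\tau_c$ denotes both the topology of uniform convergence on compact subsets of $\mathbb{T}\times\mathbb{R}^N$ and that of uniform convergence on compact subsets of $\mathbb{R}^N$. $(\mathcal{T}(t))_{t\ge0}$ is $\tau_c$-mean ergodic if for every $f\in C_b(\mathbb{T}\times\mathbb{R}^N)$ the means $\frac1r\int_0^r\mathcal{T}(t)f\,dt$ ($\tau_c$-Riemann integrals) converge with respect to $\tau_c$ to an element of $C_b(\mathbb{T}\times\mathbb{R}^N)$ as $r\to\infty$. $W^{1,2}_{q,\mathrm{loc}}(\mathbb{T}\times\mathbb{R}^N,ds\times dx)$ is the space of functions which, together with their first-order weak time derivative and their first- and second-order weak space derivatives, are in $L^q_{\mathrm{loc}}$ with respect to Lebesgue measure. *)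

theory Defs
  imports "HOL-Probability.Probability"
begin

text \<open>
  Functions on \<open>\<T> \<times> \<real>\<^sup>N\<close>, where \<open>\<T> = [0,T]\<close> mod. \<open>T\<close>, are functions on
  \<^typ>\<open>real \<times> (real ^ 'n)\<close> that are \<open>T\<close>-periodic in the first variable.  Accordingly, local
  properties on \<open>\<T> \<times> \<real>\<^sup>N\<close> are expressed through the compact subsets of \<open>\<real> \<times> \<real>\<^sup>N\<close>.
\<close>

definition time_periodic :: "real \<Rightarrow> (real \<times> 'x \<Rightarrow> 'b) \<Rightarrow> bool" where
  "time_periodic T f \<longleftrightarrow> (\<forall>s x. f (s + T, x) = f (s, x))"

text \<open>The library set \<^const>\<open>bcontfun\<close> of bounded continuous functions plays the role of
  \<open>C\<^sub>b(\<real>\<^sup>N)\<close>.\<close>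

definition Cb_per :: "real \<Rightarrow> (real \<times> (real ^ 'n) \<Rightarrow> real) set" where
  "Cb_per T = {f \<in> bcontfun. time_periodic T f}"

subsection \<open>Partial derivatives and differentiability classes\<close>

definition has_pd :: "'a::real_normed_vector \<Rightarrow> ('a \<Rightarrow> real) \<Rightarrow> 'a \<Rightarrow> bool" where
  "has_pd v u z \<longleftrightarrow> (\<lambda>h::real. u (z + h *\<^sub>R v)) differentiable (at 0)"

definition pd :: "'a::real_normed_vector \<Rightarrow> ('a \<Rightarrow> real) \<Rightarrow> 'a \<Rightarrow> real" where
  "pd v u z = deriv (\<lambda>h::real. u (z + h *\<^sub>R v)) 0"

primrec Ck :: "nat \<Rightarrow> ('a::euclidean_space \<Rightarrow> real) \<Rightarrow> bool" where
  "Ck 0 f \<longleftrightarrow> continuous_on UNIV f"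
| "Ck (Suc k) f \<longleftrightarrow>
     continuous_on UNIV f \<and> (\<forall>v\<in>Basis. (\<forall>z. has_pd v f z) \<and> Ck k (pd v f))"

abbreviation e_time :: "real \<times> (real ^ 'n)" where
  "e_time \<equiv> (1, 0)"

abbreviation e_space :: "'n \<Rightarrow> real \<times> (real ^ 'n)" where
  "e_space i \<equiv> (0, axis i 1)"

definition C12_on :: "(real \<times> (real ^ 'n)) set \<Rightarrow> (real \<times> (real ^ 'n) \<Rightarrow> real) \<Rightarrow> bool" where
  "C12_on S u \<longleftrightarrow>
     continuous_on S u \<and>
     (\<forall>z\<in>S. has_pd e_time u z) \<and> continuous_on S (pd e_time u) \<and>
     (\<forall>i. (\<forall>z\<in>S. has_pd (e_space i) u z) \<and> continuous_on S (pd (e_space i) u)) \<and>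
     (\<forall>i j. (\<forall>z\<in>S. has_pd (e_space i) (pd (e_space j) u) z) \<and>
            continuous_on S (pd (e_space i) (pd (e_space j) u)))"

definition parabolic_holder_loc :: "real \<Rightarrow> (real \<times> (real ^ 'n) \<Rightarrow> real) \<Rightarrow> bool" where
  "parabolic_holder_loc \<alpha> f \<longleftrightarrow>
     (\<forall>K. compact K \<longrightarrow> (\<exists>C. \<forall>s x t y. (s, x) \<in> K \<longrightarrow> (t, y) \<in> K \<longrightarrow>
        \<bar>f (s, x) - f (t, y)\<bar> \<le> C * (\<bar>s - t\<bar> powr (\<alpha> / 2) + norm (x - y) powr \<alpha>)))"

subsection \<open>The operator, its evolution operator and the evolution system of measures\<close>

definition ell_op ::
  "(real \<times> (real ^ 'n) \<Rightarrow> real ^ 'n ^ 'n) \<Rightarrow> (real \<times> (real ^ 'n) \<Rightarrow> real ^ 'n) \<Rightarrow>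
   real \<Rightarrow> (real ^ 'n \<Rightarrow> real) \<Rightarrow> real ^ 'n \<Rightarrow> real" where
  "ell_op Q b s u x =
     (\<Sum>i\<in>UNIV. \<Sum>j\<in>UNIV. Q (s, x) $ i $ j * pd (axis i 1) (pd (axis j 1) u) x) +
     (\<Sum>i\<in>UNIV. b (s, x) $ i * pd (axis i 1) u x)"

definition bounded_classical_solution ::
  "(real \<times> (real ^ 'n) \<Rightarrow> real ^ 'n ^ 'n) \<Rightarrow> (real \<times> (real ^ 'n) \<Rightarrow> real ^ 'n) \<Rightarrow>
   real \<Rightarrow> (real ^ 'n \<Rightarrow> real) \<Rightarrow> (real \<times> (real ^ 'n) \<Rightarrow> real) \<Rightarrow> bool" where
  "bounded_classical_solution Q b s f u \<longleftrightarrow>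
     continuous_on ({s..} \<times> UNIV) u \<and> bounded (u ` ({s..} \<times> UNIV)) \<and>
     C12_on ({s<..} \<times> UNIV) u \<and>
     (\<forall>t>s. \<forall>x. pd e_time u (t, x) = ell_op Q b t (\<lambda>y. u (t, y)) x) \<and>
     (\<forall>x. u (s, x) = f x)"

definition evolution_operator ::
  "(real \<times> (real ^ 'n) \<Rightarrow> real ^ 'n ^ 'n) \<Rightarrow> (real \<times> (real ^ 'n) \<Rightarrow> real ^ 'n) \<Rightarrow>
   (real \<Rightarrow> real \<Rightarrow> (real ^ 'n \<Rightarrow> real) \<Rightarrow> real ^ 'n \<Rightarrow> real) \<Rightarrow> bool" where
  "evolution_operator Q b P \<longleftrightarrow>
     (\<forall>s. \<forall>f\<in>bcontfun.
        bounded_classical_solution Q b s f (\<lambda>(t, x). P t s f x) \<and>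
        (\<forall>u. bounded_classical_solution Q b s f u \<longrightarrow> (\<forall>t\<ge>s. \<forall>x. u (t, x) = P t s f x)))"

definition periodic_evolution_system ::
  "real \<Rightarrow> (real \<Rightarrow> real \<Rightarrow> (real ^ 'n \<Rightarrow> real) \<Rightarrow> real ^ 'n \<Rightarrow> real) \<Rightarrow>
   (real \<Rightarrow> (real ^ 'n) measure) \<Rightarrow> bool" where
  "periodic_evolution_system T P \<mu> \<longleftrightarrow>
     (\<forall>s. prob_space (\<mu> s) \<and> sets (\<mu> s) = sets borel) \<and>
     (\<forall>s. \<mu> (s + T) = \<mu> s) \<and>
     (\<forall>s t. s < t \<longrightarrow> (\<forall>f\<in>bcontfun.
        (LINT x|\<mu> t. P t s f x) = (LINT x|\<mu> s. f x)))"

definition evolution_semigroup ::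
  "(real \<Rightarrow> real \<Rightarrow> (real ^ 'n \<Rightarrow> real) \<Rightarrow> real ^ 'n \<Rightarrow> real) \<Rightarrow>
   real \<Rightarrow> (real \<times> (real ^ 'n) \<Rightarrow> real) \<Rightarrow> real \<times> (real ^ 'n) \<Rightarrow> real" where
  "evolution_semigroup P t f = (\<lambda>(s, x). P s (s - t) (\<lambda>y. f (s - t, y)) x)"

subsection \<open>Mean ergodicity for uniform convergence on compact sets\<close>

definition tauc_tendsto ::
  "('r \<Rightarrow> 'a::topological_space \<Rightarrow> real) \<Rightarrow> ('a \<Rightarrow> real) \<Rightarrow> 'r filter \<Rightarrow> bool" where
  "tauc_tendsto M g F \<longleftrightarrow> (\<forall>K. compact K \<longrightarrow> uniform_limit K M g F)"

text \<open>The Riemann integral: the Riemann sums over tagged divisions converge in \<open>\<tau>\<^sub>c\<close> as the mesh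
  tends to \<open>0\<close> (a constant gauge, in contrast to the Henstock--Kurzweil integral).\<close>

definition has_tauc_integral ::
  "(real \<Rightarrow> 'a::topological_space \<Rightarrow> real) \<Rightarrow> real \<Rightarrow> real \<Rightarrow> ('a \<Rightarrow> real) \<Rightarrow> bool" where
  "has_tauc_integral F l r I \<longleftrightarrow>
     (\<forall>K. compact K \<longrightarrow> (\<forall>e>0. \<exists>d>0. \<forall>p.
        p tagged_division_of {l..r} \<and> (\<lambda>t. ball t d) fine p \<longrightarrow>
        (\<forall>z\<in>K. \<bar>(\<Sum>(t, J)\<in>p. measure lborel J * F t z) - I z\<bar> < e)))"

definition tauc_means_tendsto ::
  "('a::topological_space \<Rightarrow> real) set \<Rightarrow> (real \<Rightarrow> 'a \<Rightarrow> real) \<Rightarrow> ('a \<Rightarrow> real) \<Rightarrow> bool" where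
  "tauc_means_tendsto X F g \<longleftrightarrow>
     (\<exists>I. (\<forall>r>0. I r \<in> X \<and> has_tauc_integral F 0 r (I r)) \<and>
          tauc_tendsto (\<lambda>r z. 1 / r * I r z) g at_top)"

definition tauc_mean_ergodic ::
  "('a::topological_space \<Rightarrow> real) set \<Rightarrow> (real \<Rightarrow> ('a \<Rightarrow> real) \<Rightarrow> 'a \<Rightarrow> real) \<Rightarrow> bool" where
  "tauc_mean_ergodic X S \<longleftrightarrow> (\<forall>f\<in>X. \<exists>g\<in>X. tauc_means_tendsto X (\<lambda>t. S t f) g)"

subsection \<open>Parabolic Sobolev spaces\<close>

definition Lq_loc :: "real \<Rightarrow> ('a::euclidean_space \<Rightarrow> real) \<Rightarrow> bool" where
  "Lq_loc q f \<longleftrightarrow>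
     f \<in> borel_measurable lborel \<and>
     (\<forall>K. compact K \<longrightarrow> set_integrable lborel K (\<lambda>z. \<bar>f z\<bar> powr q))"

definition test_function :: "('a::euclidean_space \<Rightarrow> real) \<Rightarrow> bool" where
  "test_function \<phi> \<longleftrightarrow> (\<forall>k. Ck k \<phi>) \<and> compact (closure {z. \<phi> z \<noteq> 0})"

definition weak_derivative ::
  "'a::euclidean_space \<Rightarrow> ('a \<Rightarrow> real) \<Rightarrow> ('a \<Rightarrow> real) \<Rightarrow> bool" where
  "weak_derivative v u w \<longleftrightarrow>
     Lq_loc 1 u \<and> Lq_loc 1 w \<and>
     (\<forall>\<phi>. test_function \<phi> \<longrightarrow>
        (LINT z|lborel. u z * pd v \<phi> z) = - (LINT z|lborel. w z * \<phi> z))"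

text \<open>\<open>w0\<close>, \<open>w1\<close>, \<open>w2\<close> are the weak time derivative, space gradient and space Hessian of \<open>u\<close>.\<close>

definition weak_jet ::
  "(real \<times> (real ^ 'n) \<Rightarrow> real) \<Rightarrow> (real \<times> (real ^ 'n) \<Rightarrow> real) \<Rightarrow>
   (real \<times> (real ^ 'n) \<Rightarrow> real ^ 'n) \<Rightarrow> (real \<times> (real ^ 'n) \<Rightarrow> real ^ 'n ^ 'n) \<Rightarrow> bool" where
  "weak_jet u w0 w1 w2 \<longleftrightarrow>
     weak_derivative e_time u w0 \<and>
     (\<forall>i. weak_derivative (e_space i) u (\<lambda>z. w1 z $ i)) \<and>
     (\<forall>i j. weak_derivative (e_space i) (\<lambda>z. w1 z $ j) (\<lambda>z. w2 z $ i $ j))"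

text \<open>Periodicity is required of \<open>u\<close> only: the weak derivatives of a periodic function are
  periodic almost everywhere.\<close>

definition W12_loc :: "real \<Rightarrow> real \<Rightarrow> (real \<times> (real ^ 'n) \<Rightarrow> real) set" where
  "W12_loc T q =
     {u. time_periodic T u \<and> Lq_loc q u \<and>
         (\<exists>w0 w1 w2. weak_jet u w0 w1 w2 \<and> Lq_loc q w0 \<and>
            (\<forall>i. Lq_loc q (\<lambda>z. w1 z $ i)) \<and> (\<forall>i j. Lq_loc q (\<lambda>z. w2 z $ i $ j)))}"

definition strong_solution ::
  "(real \<times> (real ^ 'n) \<Rightarrow> real ^ 'n ^ 'n) \<Rightarrow> (real \<times> (real ^ 'n) \<Rightarrow> real ^ 'n) \<Rightarrow>
   (real \<times> (real ^ 'n) \<Rightarrow> real) \<Rightarrow> bool" where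
  "strong_solution Q b u \<longleftrightarrow>
     (\<exists>w0 w1 w2. weak_jet u w0 w1 w2 \<and>
        (AE z in lborel. w0 z -
           ((\<Sum>i\<in>UNIV. \<Sum>j\<in>UNIV. Q z $ i $ j * w2 z $ i $ j) +
            (\<Sum>i\<in>UNIV. b z $ i * w1 z $ i)) = 0))"

end

theory Submission
  imports Defs
begin

text \<open>
  Every step is a maximum principle with an explicit barrier; no interior regularity theory enters.
  Two solutions are compared through the Lyapunov function \<open>V\<close>.  Doubling the space variable and
  coupling the two copies by reflection bounds the oscillation of a solution at a later time, and a
  growing bump spreads positivity from a ball to any larger one.  Together they give a Doeblin
  condition on the sublevel sets of \<open>V\<close>, and Harris' theorem turns it into exponential decay of
  \<open>P(t, s)f - m\<^sub>s f\<close>, locally uniformly in space and uniformly in \<open>s\<close>.  So the means of the semigroup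
  behave like those of the periodic function \<open>s \<mapsto> m\<^sub>s f(s, \<cdot>)\<close>.

  A strong solution \<open>u\<close> is mollified.  Its derivatives are locally in every \<open>L\<^sup>q\<close> and the coefficients
  are Hoelder continuous, so the commutator of mollification and operator tends to zero locally
  uniformly, and comparison yields \<open>u(t, \<cdot>) = P(t, s)u(s, \<cdot>)\<close>.  By periodicity and the decay above,
  \<open>u(s, \<cdot>)\<close> equals \<open>m\<^sub>s u(s, \<cdot>)\<close>.
\<close>

subsection \<open>Second-order directional expansions and the comparison principle\<close>

text \<open>Two features shape the argument. The coefficients are controlled on bounded sets only
  (uniformly in time, by periodicity), so comparisons take place on compact sets and
  \<open>V\<close> has to pay for what lies outside; since \<open>P\<close> acts on bounded
  functions, \<open>V\<close> enters through inequalities between bounded functions or truncated as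
  \<open>min (V x) k\<close>. And the Doeblin condition asks for little regularity: not a full
  modulus of continuity, only that a solution with values in [-1, 1] varies by at most 1/2 near the
  origin after unit time. If it is nonnegative at the origin, it is then at least -1/2 on a fixed
  ball, and a second unit of time carries this gain over -1 to any prescribed ball. Hence the steps
  of length 2. The square root of the distance serves as modulus in the doubling argument because
  its radial second derivative tends to minus infinity at the diagonal and so beats all bounded
  terms. Strong solutions are taken in every finite exponent because a maximum principle needs
  errors that are small uniformly and not only in the mean.\<close>

definition d2 :: "(real \<Rightarrow> real) \<Rightarrow> real \<Rightarrow> real \<Rightarrow> bool" where
  "d2 F p q \<longleftrightarrow> (\<exists>d. (\<forall>\<^sub>F h in nhds 0. (F has_real_derivative d h) (at h)) \<and> d 0 = p \<and>
      (d has_real_derivative q) (at 0))"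

lemma d2_add: "d2 F p q \<Longrightarrow> d2 G p' q' \<Longrightarrow> d2 (\<lambda>h. F h + G h) (p + p') (q + q')"
  unfolding d2_def
proof (elim exE conjE)
  fix d d' assume a: "\<forall>\<^sub>F h in nhds 0. (F has_real_derivative d h) (at h)" "d 0 = p"
    "(d has_real_derivative q) (at 0)" "\<forall>\<^sub>F h in nhds 0. (G has_real_derivative d' h) (at h)"
    "d' 0 = p'" "(d' has_real_derivative q') (at 0)"
  show "\<exists>d. (\<forall>\<^sub>F h in nhds 0. ((\<lambda>h. F h + G h) has_real_derivative d h) (at h)) \<and>
      d 0 = p + p' \<and> (d has_real_derivative q + q') (at 0)"
    by (rule exI[of _ "\<lambda>h. d h + d' h"])
      (use a in \<open>auto intro!: DERIV_add elim: eventually_elim2\<close>)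
qed

lemma d2_cmult: "d2 F p q \<Longrightarrow> d2 (\<lambda>h. k * F h) (k * p) (k * q)"
  unfolding d2_def
proof (elim exE conjE)
  fix d assume a: "\<forall>\<^sub>F h in nhds 0. (F has_real_derivative d h) (at h)" "d 0 = p"
    "(d has_real_derivative q) (at 0)"
  show "\<exists>d. (\<forall>\<^sub>F h in nhds 0. ((\<lambda>h. k * F h) has_real_derivative d h) (at h)) \<and>
      d 0 = k * p \<and> (d has_real_derivative k * q) (at 0)"
    by (rule exI[of _ "\<lambda>h. k * d h"])
      (use a in \<open>auto intro!: DERIV_cmult elim: eventually_mono\<close>)
qed

lemma d2_diff: "d2 F p q \<Longrightarrow> d2 G p' q' \<Longrightarrow> d2 (\<lambda>h. F h - G h) (p - p') (q - q')"
  using d2_add[of F p q "\<lambda>h. - 1 * G h" "- 1 * p'" "- 1 * q'"] d2_cmult[of G p' q' "-1"] by simp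

lemma d2I:
  assumes "\<And>h. (F has_real_derivative d h) (at h)" "d 0 = p" "(d has_real_derivative q) (at 0)"
  shows "d2 F p q"
  unfolding d2_def using assms by (intro exI[of _ d]) auto

lemma d2_const: "d2 (\<lambda>h. k) 0 0"
  by (rule d2I[of _ "\<lambda>_. 0"]) auto

text \<open>The second derivative exists at 0 only, so no Taylor formula with remainder is used: if
  it were positive, the first derivative, zero at 0, would be positive just to the right, and the
  mean value theorem would make \<open>F\<close> exceed its maximum.\<close>

lemma d2_local_max:
  assumes "d2 F p q" and max: "\<forall>\<^sub>F h in nhds 0. F h \<le> F 0"
  shows "p = 0" "q \<le> 0"
proof -
  obtain d where d: "\<forall>\<^sub>F h in nhds 0. (F has_real_derivative d h) (at h)" "d 0 = p"
    "(d has_real_derivative q) (at 0)"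
    using assms unfolding d2_def by blast
  obtain e where e: "e > 0" "\<And>h. \<bar>h\<bar> < e \<Longrightarrow> (F has_real_derivative d h) (at h) \<and> F h \<le> F 0"
    using eventually_conj[OF d(1) max] unfolding eventually_nhds_metric dist_real_def by auto
  have F0: "(F has_real_derivative p) (at 0)" using e(2)[of 0] e(1) d(2) by auto
  show p: "p = 0"
    by (rule DERIV_local_max[OF F0 e(1)]) (use e(2) in auto)
  show "q \<le> 0"
  proof (rule ccontr)
    assume "\<not> q \<le> 0"
    then have "q > 0" by simp
    from DERIV_pos_inc_right[OF d(3) this] obtain e' where
      e': "e' > 0" "\<And>h. 0 < h \<Longrightarrow> h < e' \<Longrightarrow> d 0 < d h" by auto
    define r where "r = min e e' / 2"
    have r: "r > 0" "r < e" "r < e'" using e(1) e'(1) by (auto simp: r_def)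
    have "\<exists>z. 0 < z \<and> z < r \<and> F r - F 0 = (r - 0) * d z"
      by (rule MVT2[OF r(1)]) (use e(2) r in auto)
    then obtain z where z: "0 < z" "z < r" "F r - F 0 = r * d z" by auto
    have "d z > 0" using e'(2)[of z] z r d(2) p by auto
    then have "F r > F 0" using z(3) r(1) by (metis diff_gt_0_iff_gt mult_pos_pos)
    moreover have "F r \<le> F 0" using e(2)[of r] r by auto
    ultimately show False by simp
  qed
qed

text \<open>Of \<open>H\<close> only the quadratic form is recorded. Its antisymmetric part is
  therefore free, and mixed partial derivatives may be listed in either order; a symmetric
  coefficient matrix paired with \<open>H\<close> cannot see the difference.\<close>

definition jet2 ::
  "(real ^ 'n \<Rightarrow> real) \<Rightarrow> real ^ 'n \<Rightarrow> real ^ 'n \<Rightarrow> real ^ 'n ^ 'n \<Rightarrow> bool" where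
  "jet2 f x g H \<longleftrightarrow> (\<forall>\<xi>. d2 (\<lambda>h. f (x + h *\<^sub>R \<xi>)) (g \<bullet> \<xi>) ((H *v \<xi>) \<bullet> \<xi>))"

lemma scaleR_matrix_vector: "(k *\<^sub>R (M :: real^'n^'m)) *v x = k *\<^sub>R (M *v x)"
  by (simp add: scaleR_matrix_vector_assoc)

lemma jet2_add: "jet2 f x g H \<Longrightarrow> jet2 f' x g' H' \<Longrightarrow> jet2 (\<lambda>y. f y + f' y) x (g + g') (H + H')"
  unfolding jet2_def using d2_add
  by (fastforce simp: inner_add_left matrix_vector_mult_add_rdistrib)

lemma jet2_cmult: "jet2 f x g H \<Longrightarrow> jet2 (\<lambda>y. k * f y) x (k *\<^sub>R g) (k *\<^sub>R H)"
  unfolding jet2_def using d2_cmult[where k = k]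
  by (fastforce simp: scaleR_matrix_vector)

lemma jet2_diff: "jet2 f x g H \<Longrightarrow> jet2 f' x g' H' \<Longrightarrow> jet2 (\<lambda>y. f y - f' y) x (g - g') (H - H')"
  using jet2_add[of f x g H "\<lambda>y. - 1 * f' y" "- 1 *\<^sub>R g'" "- 1 *\<^sub>R H'"] jet2_cmult[of f' x g' H' "-1"]
  by simp

lemma jet2_const: "jet2 (\<lambda>y. k) x 0 0"
  unfolding jet2_def by (simp add: d2_const)

lemma jet2_local_max:
  assumes "jet2 f x g H" "\<forall>\<^sub>F y in nhds x. f y \<le> f x"
  shows "g = 0" "(H *v \<xi>) \<bullet> \<xi> \<le> 0"
proof -
  have *: "\<forall>\<^sub>F h in nhds 0. f (x + h *\<^sub>R \<xi>) \<le> f (x + 0 *\<^sub>R \<xi>)" for \<xi>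
  proof -
    have "((\<lambda>h. x + h *\<^sub>R \<xi>) \<longlongrightarrow> x + 0 *\<^sub>R \<xi>) (nhds (0::real))"
      by (intro tendsto_intros filterlim_ident)
    then show ?thesis
      using assms(2) by (auto simp: filterlim_iff)
  qed
  have "g \<bullet> \<xi> = 0 \<and> (H *v \<xi>) \<bullet> \<xi> \<le> 0" for \<xi>
    using assms(1) d2_local_max[OF _ *[of \<xi>]] unfolding jet2_def by blast
  then show "g = 0" "(H *v \<xi>) \<bullet> \<xi> \<le> 0"
    using inner_eq_zero_iff by blast+
qed

section \<open>Positive semidefinite matrices and the trace inequality\<close>

definition psd :: "real ^ 'n ^ 'n \<Rightarrow> bool" where
  "psd M \<longleftrightarrow> transpose M = M \<and> (\<forall>\<xi>. 0 \<le> (M *v \<xi>) \<bullet> \<xi>)"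

definition outer :: "real ^ 'n \<Rightarrow> real ^ 'n ^ 'n" where
  "outer v = (\<chi> i j. v $ i * v $ j)"

lemma outer_mult: "outer v *v \<xi> = (v \<bullet> \<xi>) *\<^sub>R v"
  by (simp add: outer_def matrix_vector_mult_def vec_eq_iff inner_vec_def sum_distrib_left
      sum_distrib_right mult_ac)

text \<open>The inner product on \<open>real ^ 'n ^ 'n\<close> is the entrywise one, that is, the
  trace pairing. It lets the second-order part of the operator be written as the inner product of
  \<open>Q\<close> and the Hessian, and rank-one matrices then pick out second directional
  derivatives.\<close>

lemma outer_inner: "outer v \<bullet> K = (K *v v) \<bullet> v"
  by (simp add: outer_def matrix_vector_mult_def inner_vec_def sum_distrib_left
      sum_distrib_right mult_ac)

lemma outer_scale: "outer (k *\<^sub>R v) = k\<^sup>2 *\<^sub>R outer v"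
  by (simp add: outer_def vec_eq_iff power2_eq_square mult_ac)

lemma transpose_outer: "transpose (outer v) = outer v"
  by (simp add: outer_def transpose_def vec_eq_iff mult_ac)

lemma trace_outer: "trace (outer v) = (norm v)\<^sup>2"
  by (simp add: outer_def trace_def power2_norm_eq_inner inner_vec_def)

lemma transpose_diff_mat: "transpose (A - B) = transpose A - transpose (B :: real^'n^'m)"
  by (simp add: transpose_def vec_eq_iff)

lemma transpose_add_mat: "transpose (A + B) = transpose A + transpose (B :: real^'n^'m)"
  by (simp add: transpose_def vec_eq_iff)

lemma transpose_scaleR_mat: "transpose (k *\<^sub>R A) = k *\<^sub>R transpose (A :: real^'n^'m)"
  by (simp add: transpose_def vec_eq_iff)

lemma psd_sym: "psd M \<Longrightarrow> (M *v x) \<bullet> y = (M *v y) \<bullet> x"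
  unfolding psd_def by (metis dot_lmul_matrix inner_commute transpose_matrix_vector)

text \<open>With \<open>y = M *v x\<close>, the form along \<open>x - t *\<^sub>R y\<close> has no
  constant term, so a nonzero linear coefficient \<open>- 2 * (y \<bullet> y)\<close> would make it
  negative for small positive \<open>t\<close>.\<close>

lemma psd_kernel:
  assumes "psd M" "(M *v x) \<bullet> x = 0" shows "M *v x = 0"
proof -
  define y where "y = M *v x"
  define A where "A = (M *v y) \<bullet> y"
  have A: "A \<ge> 0" using assms by (auto simp: A_def psd_def)
  have q: "0 \<le> t\<^sup>2 * A - 2 * t * (y \<bullet> y)" for t
  proof -
    have "0 \<le> (M *v (x - t *\<^sub>R y)) \<bullet> (x - t *\<^sub>R y)" using assms(1) by (auto simp: psd_def)
    also have "\<dots> = t\<^sup>2 * A - 2 * t * (y \<bullet> y)"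
      using assms(2) psd_sym[OF assms(1), of y x]
      by (simp add: matrix_vector_mult_diff_distrib inner_diff_left inner_diff_right
          matrix_vector_mult_scaleR A_def flip: y_def) (simp add: power2_eq_square algebra_simps)
    finally show ?thesis .
  qed
  have "y \<bullet> y = 0"
  proof (rule ccontr)
    assume "y \<bullet> y \<noteq> 0"
    then have p: "y \<bullet> y > 0" by (simp add: order_less_le)
    \<comment> \<open>The denominator is \<open>A + 1\<close> rather than \<open>A\<close>, because
      \<open>A\<close> may vanish.\<close>
    define t where "t = (y \<bullet> y) / (A + 1)"
    have t: "t > 0" using p A by (auto simp: t_def)
    have "t * A < y \<bullet> y" using p A by (auto simp: t_def field_simps)
    then have "t\<^sup>2 * A - 2 * t * (y \<bullet> y) < 0"
      using mult_strict_left_mono[of "t * A" "y \<bullet> y" t] t mult_pos_pos[OF t p]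
      unfolding power2_eq_square mult.assoc by linarith
    then show False using q[of t] by simp
  qed
  then show ?thesis by (simp add: y_def)
qed

text \<open>This is the Schur complement of a nonzero diagonal entry. Its form at
  \<open>\<xi>\<close> is the form of \<open>M\<close> at
  \<open>\<xi> - t *\<^sub>R axis k 1\<close> with the minimising
  \<open>t = (w \<bullet> \<xi>) / \<gamma>\<close>, hence nonnegative.\<close>

lemma psd_pivot:
  assumes M: "psd M" and k: "M $ k $ k \<noteq> 0"
  defines "w \<equiv> M *v axis k 1" and "\<gamma> \<equiv> M $ k $ k"
  shows "\<gamma> > 0" "psd (M - (1 / \<gamma>) *\<^sub>R outer w)" "(M - (1 / \<gamma>) *\<^sub>R outer w) *v axis k 1 = 0"
proof -
  have w: "w $ i = M $ i $ k" for i
    by (simp add: w_def matrix_vector_mul_component inner_axis)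
  have kk: "(M *v axis k 1) \<bullet> axis k 1 = \<gamma>"
    using w[of k] by (simp add: inner_axis w_def \<gamma>_def)
  then have "\<gamma> \<ge> 0" using M by (metis psd_def)
  then show g: "\<gamma> > 0" using k by (simp add: \<gamma>_def)
  show "(M - (1 / \<gamma>) *\<^sub>R outer w) *v axis k 1 = 0"
    using kk g by (simp add: matrix_vector_mult_diff_rdistrib scaleR_matrix_vector outer_mult
        flip: w_def)
  show "psd (M - (1 / \<gamma>) *\<^sub>R outer w)"
    unfolding psd_def
  proof (intro conjI allI)
    show "transpose (M - (1 / \<gamma>) *\<^sub>R outer w) = M - (1 / \<gamma>) *\<^sub>R outer w"
      using M by (simp add: transpose_diff_mat transpose_scaleR_mat transpose_outer psd_def)
    fix \<xi>
    define t where "t = (w \<bullet> \<xi>) / \<gamma>"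
    have "0 \<le> (M *v (\<xi> - t *\<^sub>R axis k 1)) \<bullet> (\<xi> - t *\<^sub>R axis k 1)" using M by (auto simp: psd_def)
    also have "\<dots> = (M *v \<xi>) \<bullet> \<xi> - 2 * t * (w \<bullet> \<xi>) + t\<^sup>2 * \<gamma>"
      using kk psd_sym[OF M, of \<xi> "axis k 1"]
      by (simp add: matrix_vector_mult_diff_distrib inner_diff_left inner_diff_right
          matrix_vector_mult_scaleR power2_eq_square algebra_simps flip: w_def)
    also have "\<dots> = ((M - (1 / \<gamma>) *\<^sub>R outer w) *v \<xi>) \<bullet> \<xi>"
      using g by (simp add: matrix_vector_mult_diff_rdistrib scaleR_matrix_vector outer_mult
          inner_diff_left t_def field_simps power2_eq_square)
    finally show "0 \<le> ((M - (1 / \<gamma>) *\<^sub>R outer w) *v \<xi>) \<bullet> \<xi>" .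
  qed
qed

text \<open>The vectors \<open>\<sigma>\<close> are found one pivot at a time, as in the Cholesky decomposition.\<close>

lemma psd_sum_outer_on:
  assumes "finite S" "psd M" "\<And>i j. M $ i $ j \<noteq> 0 \<Longrightarrow> i \<in> S \<and> j \<in> S"
  shows "\<exists>\<sigma>. M = (\<Sum>k\<in>S. outer (\<sigma> k))"
  using assms
proof (induction S arbitrary: M rule: finite_induct)
  case empty
  then have "M = 0" by (auto simp: vec_eq_iff)
  then show ?case by simp
next
  case (insert k S)
  have comp: "(M' *v axis k 1) $ i = M' $ i $ k" for M' :: "real^'a^'a" and i
    by (simp add: matrix_vector_mul_component inner_axis)
  \<comment> \<open>A zero pivot is harmless: by \<open>psd_kernel\<close> the whole column is then
    zero, and subtracting nothing already leaves row and column \<open>k\<close> empty.\<close>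
  define v where "v = (if M $ k $ k = 0 then 0 else (1 / sqrt (M $ k $ k)) *\<^sub>R (M *v axis k 1))"
  define M' where "M' = M - outer v"
  have M': "psd M'" "M' *v axis k 1 = 0"
  proof -
    have "psd M' \<and> M' *v axis k 1 = 0"
    proof (cases "M $ k $ k = 0")
      case True
      then have "(M *v axis k 1) \<bullet> axis k 1 = 0" by (simp add: inner_axis comp)
      from psd_kernel[OF insert.prems(1) this] show ?thesis
        using True insert.prems(1) by (simp add: M'_def v_def outer_def vec_eq_iff psd_def
          matrix_vector_mult_def transpose_def)
    next
      case False
      have "M' = M - (1 / (M $ k $ k)) *\<^sub>R outer (M *v axis k 1)"
        using psd_pivot(1)[OF insert.prems(1) False] False
        by (simp add: M'_def v_def outer_scale power_divide)
      then show ?thesis using psd_pivot[OF insert.prems(1) False] by metis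
    qed
    then show "psd M'" "M' *v axis k 1 = 0" by auto
  qed
  have sym': "M' $ i $ j = M' $ j $ i" for i j
    using M'(1) unfolding psd_def transpose_def by (metis vec_lambda_beta)
  have k0: "M' $ i $ k = 0" for i using M'(2) comp[of M' i] by simp
  have vS: "v $ i = 0" if "i \<notin> insert k S" for i
    using that insert.prems(2)[of i k] by (auto simp: v_def comp)
  have "\<exists>\<sigma>. M' = (\<Sum>k\<in>S. outer (\<sigma> k))"
  proof (rule insert.IH[OF M'(1)])
    fix i j assume nz: "M' $ i $ j \<noteq> 0"
    have "i \<noteq> k" "j \<noteq> k" using k0 sym' nz by metis+
    moreover have "i \<in> insert k S \<and> j \<in> insert k S"
    proof (rule ccontr)
      assume "\<not> ?thesis"
      then have "M $ i $ j = 0 \<and> v $ i * v $ j = 0" using insert.prems(2)[of i j] vS by auto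
      then show False using nz by (simp add: M'_def outer_def)
    qed
    ultimately show "i \<in> S \<and> j \<in> S" by auto
  qed
  then obtain \<sigma> where s: "M' = (\<Sum>k\<in>S. outer (\<sigma> k))" by blast
  have "M = (\<Sum>j\<in>insert k S. outer ((\<sigma>(k := v)) j))"
    using insert.hyps s by (simp add: M'_def algebra_simps cong: sum.cong)
      (smt (verit) add_diff_cancel_left' diff_add_cancel sum.cong)
  then show ?case by blast
qed

text \<open>Writing \<open>M\<close> as a sum of rank-one matrices turns the pairing into a sum of
  values of the form of \<open>K\<close>, each bounded separately. With \<open>k = 0\<close> this is
  the sign needed in the maximum principle; other values of \<open>k\<close> are used for the
  coupling.\<close>

lemma psd_inner_le:
  fixes M K :: "real ^ 'n ^ 'n"
  assumes "psd M" and "\<And>\<xi>. (K *v \<xi>) \<bullet> \<xi> \<le> k * (norm \<xi>)\<^sup>2"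
  shows "M \<bullet> K \<le> k * trace M"
proof -
  have "\<exists>\<sigma>. M = (\<Sum>i\<in>(UNIV :: 'n set). outer (\<sigma> i))"
    by (rule psd_sum_outer_on) (auto simp: assms(1))
  then obtain \<sigma> where s: "M = (\<Sum>i\<in>(UNIV :: 'n set). outer (\<sigma> i))" by blast
  have tr: "trace (\<Sum>i\<in>I. F i) = (\<Sum>i\<in>I. trace (F i))" for I and F :: "'n \<Rightarrow> real^'n^'n"
    unfolding trace_def by (subst sum.swap) simp
  have "M \<bullet> K = (\<Sum>i\<in>UNIV. (K *v \<sigma> i) \<bullet> \<sigma> i)"
    by (simp add: s inner_sum_left outer_inner)
  also have "\<dots> \<le> (\<Sum>i\<in>UNIV. k * (norm (\<sigma> i))\<^sup>2)" by (intro sum_mono assms)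
  also have "\<dots> = k * trace M" by (simp add: s tr trace_outer sum_distrib_left)
  finally show ?thesis .
qed

section \<open>From continuous partial derivatives to jets\<close>

lemma has_pd_deriv:
  assumes "has_pd v u (z + h *\<^sub>R v)"
  shows "((\<lambda>h. u (z + h *\<^sub>R v)) has_real_derivative pd v u (z + h *\<^sub>R v)) (at h)"
proof -
  have "((\<lambda>k. u ((z + h *\<^sub>R v) + k *\<^sub>R v)) has_real_derivative pd v u (z + h *\<^sub>R v)) (at 0)"
    using assms unfolding has_pd_def pd_def by (simp add: DERIV_deriv_iff_real_differentiable)
  then have "((\<lambda>k. u (z + (k + h) *\<^sub>R v)) has_real_derivative pd v u (z + h *\<^sub>R v)) (at 0)"
    by (simp add: algebra_simps)
  then show ?thesis
    using DERIV_shift[of "\<lambda>k. u (z + k *\<^sub>R v)" _ 0 h] by simp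
qed

lemma pdI:
  assumes "((\<lambda>h. u (z + h *\<^sub>R v)) has_real_derivative D) (at 0)"
  shows "has_pd v u z" "pd v u z = D"
  using assms unfolding has_pd_def pd_def
  by (auto simp: DERIV_imp_deriv real_differentiable_def)

text \<open>The induction runs over the set of coordinates already moved. Each new coordinate is
  moved by the mean value theorem, and continuity of the partial derivatives allows their value at
  the intermediate point to be replaced by the value at \<open>z\<close>.\<close>

lemma continuous_pd_increment:
  fixes f :: "'a::euclidean_space \<Rightarrow> real"
  assumes "finite S" "S \<subseteq> Basis"
    and pd: "\<And>b z. b \<in> Basis \<Longrightarrow> has_pd b f z" "\<And>b. b \<in> Basis \<Longrightarrow> continuous_on UNIV (pd b f)"
    and "e > 0"
  shows "\<exists>d>0. \<forall>h. norm h < d \<longrightarrow>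
    \<bar>f (z + (\<Sum>b\<in>S. (h \<bullet> b) *\<^sub>R b)) - f z - (\<Sum>b\<in>S. (h \<bullet> b) * pd b f z)\<bar> \<le> e * (\<Sum>b\<in>S. \<bar>h \<bullet> b\<bar>)"
  using assms(1,2)
proof (induction S rule: finite_induct)
  case empty
  show ?case by (intro exI[of _ 1]) auto
next
  case (insert b S)
  then obtain d where d: "d > 0" and dS: "\<And>h. norm h < d \<Longrightarrow>
    \<bar>f (z + (\<Sum>b\<in>S. (h \<bullet> b) *\<^sub>R b)) - f z - (\<Sum>b\<in>S. (h \<bullet> b) * pd b f z)\<bar> \<le> e * (\<Sum>b\<in>S. \<bar>h \<bullet> b\<bar>)"
    by auto
  have b: "b \<in> Basis" using insert.prems by auto
  obtain r where r: "r > 0" "\<And>y. norm (y - z) < r \<Longrightarrow> \<bar>pd b f y - pd b f z\<bar> < e"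
    using pd(2)[OF b] \<open>e > 0\<close> unfolding continuous_on_iff dist_norm real_norm_def by (meson UNIV_I)
  \<comment> \<open>The intermediate point differs from \<open>z\<close> by at most one copy of
    \<open>norm h\<close> for each coordinate in \<open>S\<close> and one for
    \<open>b\<close>.\<close>
  define n where "n = real (card S) + 1"
  have n: "n > 0" by (simp add: n_def)
  show ?case
  proof (intro exI[of _ "min d (r / n)"] conjI allI impI)
    show "0 < min d (r / n)" using d r n by simp
    fix h :: 'a assume h: "norm h < min d (r / n)"
    define y where "y = z + (\<Sum>b\<in>S. (h \<bullet> b) *\<^sub>R b)"
    define k where "k = h \<bullet> b"
    have der: "((\<lambda>k. f (y + k *\<^sub>R b)) has_real_derivative pd b f (y + k *\<^sub>R b)) (at k)" for k
      by (rule has_pd_deriv[OF pd(1)[OF b]])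
    obtain \<theta> where \<theta>: "\<bar>\<theta>\<bar> \<le> \<bar>k\<bar>" "f (y + k *\<^sub>R b) - f y = k * pd b f (y + \<theta> *\<^sub>R b)"
    proof (cases "k = 0")
      case True then show ?thesis using that[of 0] by simp
    next
      case False
      consider "k > 0" | "k < 0" using False by linarith
      then show ?thesis
      proof cases
        case 1
        have "\<exists>\<theta>>0. \<theta> < k \<and>
            f (y + k *\<^sub>R b) - f (y + 0 *\<^sub>R b) = (k - 0) * pd b f (y + \<theta> *\<^sub>R b)"
          by (rule MVT2[OF 1]) (rule der)
        then obtain \<theta> where "0 < \<theta>" "\<theta> < k"
          "f (y + k *\<^sub>R b) - f (y + 0 *\<^sub>R b) = (k - 0) * pd b f (y + \<theta> *\<^sub>R b)" by (elim exE conjE)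
        then show ?thesis using that[of \<theta>] by auto
      next
        case 2
        have "\<exists>\<theta>>k. \<theta> < 0 \<and>
            f (y + 0 *\<^sub>R b) - f (y + k *\<^sub>R b) = (0 - k) * pd b f (y + \<theta> *\<^sub>R b)"
          by (rule MVT2[OF 2]) (rule der)
        then obtain \<theta> where "k < \<theta>" "\<theta> < 0"
          "f (y + 0 *\<^sub>R b) - f (y + k *\<^sub>R b) = (0 - k) * pd b f (y + \<theta> *\<^sub>R b)" by (elim exE conjE)
        then show ?thesis using that[of \<theta>] by auto
      qed
    qed
    have "norm (y + \<theta> *\<^sub>R b - z) \<le> norm (\<Sum>b\<in>S. (h \<bullet> b) *\<^sub>R b) + \<bar>\<theta>\<bar>"
      using norm_triangle_ineq[of "\<Sum>b\<in>S. (h \<bullet> b) *\<^sub>R b" "\<theta> *\<^sub>R b"] b by (simp add: y_def)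
    also have "\<dots> \<le> (\<Sum>b\<in>S. norm h) + norm h"
    proof (intro add_mono order_trans[OF norm_sum] sum_mono)
      fix i assume "i \<in> S"
      then have "i \<in> Basis" using insert.prems by auto
      then show "norm ((h \<bullet> i) *\<^sub>R i) \<le> norm h" by (simp add: Basis_le_norm)
    next
      show "\<bar>\<theta>\<bar> \<le> norm h" using \<theta>(1) Basis_le_norm[OF b, of h] by (simp add: k_def)
    qed
    also have "\<dots> = n * norm h" by (simp add: n_def algebra_simps)
    also have "\<dots> < r" using h n by (simp add: field_simps)
    finally have "\<bar>pd b f (y + \<theta> *\<^sub>R b) - pd b f z\<bar> < e" by (rule r(2))
    then have 1: "\<bar>k * pd b f (y + \<theta> *\<^sub>R b) - k * pd b f z\<bar> \<le> e * \<bar>k\<bar>"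
      by (metis abs_mult mult.commute mult_right_mono abs_ge_zero order_less_imp_le right_diff_distrib)
    have 2: "\<bar>f y - f z - (\<Sum>b\<in>S. (h \<bullet> b) * pd b f z)\<bar> \<le> e * (\<Sum>b\<in>S. \<bar>h \<bullet> b\<bar>)"
      using dS[of h] h by (simp add: y_def)
    have 3: "z + (\<Sum>b\<in>insert b S. (h \<bullet> b) *\<^sub>R b) = y + k *\<^sub>R b"
      "(\<Sum>b\<in>insert b S. (h \<bullet> b) * pd b f z) = k * pd b f z + (\<Sum>b\<in>S. (h \<bullet> b) * pd b f z)"
      "(\<Sum>b\<in>insert b S. \<bar>h \<bullet> b\<bar>) = \<bar>k\<bar> + (\<Sum>b\<in>S. \<bar>h \<bullet> b\<bar>)"
      using insert.hyps by (simp_all add: y_def k_def)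
    show "\<bar>f (z + (\<Sum>b\<in>insert b S. (h \<bullet> b) *\<^sub>R b)) - f z - (\<Sum>b\<in>insert b S. (h \<bullet> b) * pd b f z)\<bar>
        \<le> e * (\<Sum>b\<in>insert b S. \<bar>h \<bullet> b\<bar>)"
      unfolding 3 distrib_left using 1 2 \<theta>(2) by linarith
  qed
qed

lemma continuous_pd_has_derivative:
  fixes f :: "'a::euclidean_space \<Rightarrow> real"
  assumes pd: "\<And>b z. b \<in> Basis \<Longrightarrow> has_pd b f z" "\<And>b. b \<in> Basis \<Longrightarrow> continuous_on UNIV (pd b f)"
  shows "(f has_derivative (\<lambda>h. \<Sum>b\<in>Basis. (h \<bullet> b) * pd b f z)) (at z)"
  unfolding has_derivative_at_alt
proof (intro conjI allI impI)
  show "bounded_linear (\<lambda>h. \<Sum>b\<in>Basis. (h \<bullet> b) * pd b f z)"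
    by (intro bounded_linear_sum bounded_linear_mult_left[THEN bounded_linear_compose]
        bounded_linear_inner_left)
  fix e :: real assume e: "e > 0"
  define e' where "e' = e / real DIM('a)"
  have e': "e' > 0" using e by (simp add: e'_def)
  from continuous_pd_increment[OF finite_Basis order_refl pd e', of z]
  obtain d where d: "d > 0" "\<And>h. norm h < d \<Longrightarrow>
    \<bar>f (z + h) - f z - (\<Sum>b\<in>Basis. (h \<bullet> b) * pd b f z)\<bar> \<le> e' * (\<Sum>b\<in>Basis. \<bar>h \<bullet> b\<bar>)"
    by (auto simp: euclidean_representation)
  show "\<exists>d>0. \<forall>y. norm (y - z) < d \<longrightarrow>
      norm (f y - f z - (\<Sum>b\<in>Basis. ((y - z) \<bullet> b) * pd b f z)) \<le> e * norm (y - z)"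
  proof (intro exI[of _ d] conjI allI impI d(1))
    fix y assume "norm (y - z) < d"
    from d(2)[OF this] have "norm (f y - f z - (\<Sum>b\<in>Basis. ((y - z) \<bullet> b) * pd b f z))
      \<le> e' * (\<Sum>b\<in>Basis. \<bar>(y - z) \<bullet> b\<bar>)" by simp
    also have "\<dots> \<le> e' * (\<Sum>b\<in>(Basis::'a set). norm (y - z))"
      using e' by (intro mult_left_mono sum_mono) (auto simp: Basis_le_norm)
    also have "\<dots> = e * norm (y - z)" by (simp add: e'_def)
    finally show "norm (f y - f z - (\<Sum>b\<in>Basis. ((y - z) \<bullet> b) * pd b f z)) \<le> e * norm (y - z)" .
  qed
qed

lemma sum_Basis_vec: "(\<Sum>b\<in>(Basis :: (real^'n) set). F b) = (\<Sum>i\<in>UNIV. F (axis i 1))"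
proof -
  have *: "Basis = (\<lambda>i::'n. axis i (1::real)) ` UNIV" by (auto simp: Basis_vec_def)
  show ?thesis unfolding * by (subst sum.reindex) (auto simp: inj_on_def axis_eq_axis)
qed

lemma Basis_vecE: "b \<in> (Basis :: (real^'n) set) \<Longrightarrow> \<exists>i. b = axis i 1"
  by (auto simp: Basis_vec_def)

definition grad :: "(real ^ 'n \<Rightarrow> real) \<Rightarrow> real ^ 'n \<Rightarrow> real ^ 'n" where
  "grad f x = (\<chi> i. pd (axis i 1) f x)"

definition hess :: "(real ^ 'n \<Rightarrow> real) \<Rightarrow> real ^ 'n \<Rightarrow> real ^ 'n ^ 'n" where
  "hess f x = (\<chi> i j. pd (axis i 1) (pd (axis j 1) f) x)"

lemma ell_op_eq: "ell_op Q b s u x = Q (s, x) \<bullet> hess u x + b (s, x) \<bullet> grad u x"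
  by (simp add: ell_op_def hess_def grad_def inner_vec_def)

text \<open>The chain rule \<open>D\<close> is used at every point of the line for \<open>f\<close>,
  and once more at the base point for each first partial derivative of \<open>f\<close>.\<close>

lemma jet2_C2:
  fixes f :: "real ^ 'n \<Rightarrow> real"
  assumes "\<And>i z. has_pd (axis i 1) f z" "\<And>i. continuous_on UNIV (pd (axis i 1) f)"
    and "\<And>i j z. has_pd (axis i 1) (pd (axis j 1) f) z"
    and "\<And>i j. continuous_on UNIV (pd (axis i 1) (pd (axis j 1) f))"
  shows "jet2 f x (grad f x) (hess f x)"
  unfolding jet2_def
proof
  fix \<xi> :: "real ^ 'n"
  have D: "((\<lambda>h. F (x + h *\<^sub>R \<xi>)) has_real_derivative grad F (x + h *\<^sub>R \<xi>) \<bullet> \<xi>) (at h)"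
    if "\<And>i z. has_pd (axis i 1) F z" "\<And>i. continuous_on UNIV (pd (axis i 1) F)"
    for F :: "real ^ 'n \<Rightarrow> real" and h
  proof -
    have "(F has_derivative (\<lambda>h. \<Sum>b\<in>Basis. (h \<bullet> b) * pd b F z)) (at z)" for z
      by (rule continuous_pd_has_derivative) (use that in \<open>auto dest!: Basis_vecE\<close>)
    then have "(F has_derivative (\<lambda>h. grad F z \<bullet> h)) (at z)" for z
      by (simp add: sum_Basis_vec grad_def inner_vec_def[of "vec_lambda _"] inner_axis mult.commute)
    moreover have "((\<lambda>h. x + h *\<^sub>R \<xi>) has_derivative (\<lambda>k. k *\<^sub>R \<xi>)) (at h)"
      by (auto intro!: derivative_eq_intros)
    ultimately have "((\<lambda>h. F (x + h *\<^sub>R \<xi>)) has_derivative (\<lambda>k. grad F (x + h *\<^sub>R \<xi>) \<bullet> (k *\<^sub>R \<xi>))) (at h)"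
      using has_derivative_compose by blast
    then show ?thesis by (simp add: has_field_derivative_def mult_commute_abs)
  qed
  show "d2 (\<lambda>h. f (x + h *\<^sub>R \<xi>)) (grad f x \<bullet> \<xi>) ((hess f x *v \<xi>) \<bullet> \<xi>)"
  proof (rule d2I)
    show "((\<lambda>h. f (x + h *\<^sub>R \<xi>)) has_real_derivative grad f (x + h *\<^sub>R \<xi>) \<bullet> \<xi>) (at h)" for h
      by (rule D) (use assms in auto)
    show "grad f (x + 0 *\<^sub>R \<xi>) \<bullet> \<xi> = grad f x \<bullet> \<xi>" by simp
    have e: "(hess f x *v \<xi>) \<bullet> \<xi> = (\<Sum>j\<in>UNIV. (grad (pd (axis j 1) f) x \<bullet> \<xi>) * \<xi> $ j)"
      by (simp add: hess_def grad_def matrix_vector_mult_def inner_vec_def sum_distrib_right)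
        (subst sum.swap, simp add: mult_ac)
    have "((\<lambda>h. \<Sum>j\<in>UNIV. pd (axis j 1) f (x + h *\<^sub>R \<xi>) * \<xi> $ j) has_real_derivative
       (\<Sum>j\<in>UNIV. (grad (pd (axis j 1) f) (x + 0 *\<^sub>R \<xi>) \<bullet> \<xi>) * \<xi> $ j)) (at 0)"
      by (intro DERIV_sum DERIV_cmult_right D) (use assms in auto)
    then show "((\<lambda>h. grad f (x + h *\<^sub>R \<xi>) \<bullet> \<xi>) has_real_derivative (hess f x *v \<xi>) \<bullet> \<xi>) (at 0)"
      unfolding e by (simp add: grad_def inner_vec_def)
  qed
qed

lemma jet2_Ck2: "Ck 2 V \<Longrightarrow> jet2 V x (grad V x) (hess V x)"
  by (rule jet2_C2) (auto simp: numeral_2_eq_2 axis_in_Basis_iff)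

lemma pd_slice: "pd (axis i 1) (\<lambda>y. u (t, y)) x = pd (e_space i) u (t, x)"
  by (simp add: pd_def)

lemma has_pd_slice: "has_pd (axis i 1) (\<lambda>y. u (t, y)) x = has_pd (e_space i) u (t, x)"
  by (simp add: has_pd_def)

lemma C12_on_jet:
  fixes u :: "real \<times> (real ^ 'n) \<Rightarrow> real"
  assumes "C12_on (S \<times> UNIV) u" "t \<in> S"
  shows "jet2 (\<lambda>y. u (t, y)) x (grad (\<lambda>y. u (t, y)) x) (hess (\<lambda>y. u (t, y)) x)"
    and "((\<lambda>\<tau>. u (\<tau>, x)) has_real_derivative pd e_time u (t, x)) (at t)"
proof -
  have sl: "continuous_on UNIV (\<lambda>y. F (t, y))" if "continuous_on (S \<times> UNIV) F"
    for F :: "real \<times> (real ^ 'n) \<Rightarrow> real"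
    by (rule continuous_on_compose2[OF that]) (use assms(2) in \<open>auto intro!: continuous_intros\<close>)
  show "jet2 (\<lambda>y. u (t, y)) x (grad (\<lambda>y. u (t, y)) x) (hess (\<lambda>y. u (t, y)) x)"
    by (rule jet2_C2)
      (use assms sl in \<open>auto simp: C12_on_def has_pd_slice pd_slice[abs_def]\<close>)
  have "has_pd e_time u (0 + t *\<^sub>R 1, x)" using assms by (auto simp: C12_on_def)
  with has_pd_deriv[of e_time u "(0, x)" t]
  show "((\<lambda>\<tau>. u (\<tau>, x)) has_real_derivative pd e_time u (t, x)) (at t)" by simp
qed

lemma parabolic_holder_loc_continuous:
  fixes f :: "real \<times> (real ^ 'n) \<Rightarrow> real"
  assumes "parabolic_holder_loc \<alpha> f" "\<alpha> > 0"
  shows "continuous_on UNIV f"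
proof (rule continuous_at_imp_continuous_on, rule ballI)
  fix z :: "real \<times> (real ^ 'n)"
  obtain s x where z: "z = (s, x)" by (cases z)
  obtain C where C: "\<And>s x t y. (s, x) \<in> cball z 1 \<Longrightarrow> (t, y) \<in> cball z 1 \<Longrightarrow>
      \<bar>f (s, x) - f (t, y)\<bar> \<le> C * (\<bar>s - t\<bar> powr (\<alpha> / 2) + norm (x - y) powr \<alpha>)"
    using assms(1) compact_cball[of z 1] unfolding parabolic_holder_loc_def by blast
  have "\<forall>\<^sub>F w in at z. w \<in> ball z 1"
    by (rule eventually_at_in_open') auto
  then have ev: "\<forall>\<^sub>F w in at z. norm (f w - f z) \<le>
      C * (\<bar>fst w - s\<bar> powr (\<alpha> / 2) + norm (snd w - x) powr \<alpha>)"
  proof eventually_elim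
    case (elim w)
    then show ?case using C[of "fst w" "snd w" s x] by (simp add: z)
  qed
  have "((\<lambda>w. C * (\<bar>fst w - s\<bar> powr (\<alpha> / 2) + norm (snd w - x) powr \<alpha>)) \<longlongrightarrow>
     C * (\<bar>fst z - s\<bar> powr (\<alpha> / 2) + norm (snd z - x) powr \<alpha>)) (at z)"
    by (intro tendsto_intros tendsto_powr') (use assms(2) in auto)
  then have "((\<lambda>w. C * (\<bar>fst w - s\<bar> powr (\<alpha> / 2) + norm (snd w - x) powr \<alpha>)) \<longlongrightarrow> 0) (at z)"
    using assms(2) by (simp add: z)
  from Lim_null_comparison[OF ev this] have "((\<lambda>w. f w - f z) \<longlongrightarrow> 0) (at z)" .
  then show "isCont f z" unfolding isCont_def by (simp add: LIM_zero_iff)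
qed

section \<open>Time-periodic functions\<close>

lemma periodic_multiple:
  assumes "time_periodic T f"
  shows "f (s + real n * T, x) = f (s, x)" "f (s - real n * T, x) = f (s, x)"
proof -
  have 1: "f (s + real n * T, x) = f (s, x)" for s
  proof (induction n)
    case (Suc n)
    have "f (s + real (Suc n) * T, x) = f ((s + real n * T) + T, x)" by (simp add: algebra_simps)
    then show ?case using Suc assms by (simp add: time_periodic_def)
  qed auto
  show "f (s + real n * T, x) = f (s, x)" by (rule 1)
  show "f (s - real n * T, x) = f (s, x)" using 1[of "s - real n * T"] by simp
qed

lemma periodic_shift_obtains:
  assumes "T > (0::real)"
  obtains n :: nat where "0 \<le> s + real n * T \<and> s + real n * T \<le> T \<or>
    0 \<le> s - real n * T \<and> s - real n * T \<le> T"
proof -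
  define m where "m = \<lfloor>s / T\<rfloor>"
  have m: "m \<le> s / T" "s / T < m + 1" by (auto simp: m_def)
  then have m': "m * T \<le> s" "s < (m + 1) * T" using assms by (auto simp: field_simps)
  consider "m \<ge> 0" | "m < 0" by linarith
  then show ?thesis
  proof cases
    case 1
    then have "real (nat m) = of_int m" by simp
    then show ?thesis using that[of "nat m"] m' by (simp add: algebra_simps)
  next
    case 2
    then have "real (nat (-m)) = - of_int m" by simp
    then show ?thesis using that[of "nat (-m)"] m' by (simp add: algebra_simps)
  qed
qed

text \<open>Periodicity reduces time to the compact interval \<open>{0..T}\<close>. This is where
  bounds on the coefficients become uniform in time, and with them all constants of the later
  estimates become independent of the starting time.\<close>

lemma periodic_bounded:
  fixes f :: "real \<times> (real ^ 'n) \<Rightarrow> 'b::real_normed_vector"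
  assumes "T > 0" "time_periodic T f" "continuous_on UNIV f"
  shows "\<exists>C>0. \<forall>s x. norm x \<le> R \<longrightarrow> norm (f (s, x)) \<le> C"
proof -
  have "compact (f ` ({0..T} \<times> cball 0 R))"
    by (intro compact_continuous_image continuous_on_subset[OF assms(3)] compact_Times) auto
  then obtain C where C: "C > 0" "\<And>z. z \<in> f ` ({0..T} \<times> cball 0 R) \<Longrightarrow> norm z \<le> C"
    by (meson bounded_pos compact_imp_bounded)
  show ?thesis
  proof (intro exI[of _ C] conjI allI impI C(1))
    fix s and x :: "real ^ 'n" assume x: "norm x \<le> R"
    obtain n where n: "0 \<le> s + real n * T \<and> s + real n * T \<le> T \<or>
      0 \<le> s - real n * T \<and> s - real n * T \<le> T" using periodic_shift_obtains[OF assms(1)] .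
    then obtain s' where s': "0 \<le> s'" "s' \<le> T" "f (s', x) = f (s, x)"
      using periodic_multiple[OF assms(2)] by metis
    have "f (s', x) \<in> f ` ({0..T} \<times> cball 0 R)" by (rule imageI) (use s' x in auto)
    then show "norm (f (s, x)) \<le> C" using C(2) s'(3) by metis
  qed
qed

text \<open>The ellipticity function enters only through a positive lower bound, here the constant
  \<open>\<delta>\<close>; \<open>\<alpha>\<close> is the common parabolic exponent of the
  coefficients.\<close>

locale lyapunov_operator =
  fixes T \<alpha> \<delta> a c :: real
    and Q :: "real \<times> (real ^ 'n) \<Rightarrow> real ^ 'n ^ 'n"
    and b :: "real \<times> (real ^ 'n) \<Rightarrow> real ^ 'n"
    and V :: "real ^ 'n \<Rightarrow> real"
  assumes T_pos: "T > 0" and \<alpha>_pos: "0 < \<alpha>"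
    and Q_per: "time_periodic T Q" and b_per: "time_periodic T b"
    and Q_holder: "\<And>i j. parabolic_holder_loc \<alpha> (\<lambda>z. Q z $ i $ j)"
    and b_holder: "\<And>i. parabolic_holder_loc \<alpha> (\<lambda>z. b z $ i)"
    and Q_sym: "\<And>z. transpose (Q z) = Q z"
    and \<delta>_pos: "\<delta> > 0" and Q_elliptic: "\<And>z \<xi>. \<delta> * (norm \<xi>)\<^sup>2 \<le> (Q z *v \<xi>) \<bullet> \<xi>"
    and V_C2: "Ck 2 V" and V_pos: "\<And>x. V x > 0"
    and V_lim: "filterlim V at_top at_infinity"
    and a_pos: "a > 0" and c_pos: "c > 0"
    and V_drift: "\<And>s x. ell_op Q b s V x \<le> a - c * V x"
begin

lemma Q_cont: "continuous_on UNIV Q"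
proof -
  have "continuous_on UNIV (\<lambda>z. \<chi> i j. Q z $ i $ j)"
    by (intro continuous_on_vec_lambda parabolic_holder_loc_continuous[OF Q_holder \<alpha>_pos])
  then show ?thesis by simp
qed

lemma b_cont: "continuous_on UNIV b"
proof -
  have "continuous_on UNIV (\<lambda>z. \<chi> i. b z $ i)"
    by (intro continuous_on_vec_lambda parabolic_holder_loc_continuous[OF b_holder \<alpha>_pos])
  then show ?thesis by simp
qed

lemma Q_bounded: "\<exists>C>0. \<forall>s x. norm x \<le> R \<longrightarrow> norm (Q (s, x)) \<le> C"
  by (rule periodic_bounded[OF T_pos Q_per Q_cont])

lemma b_bounded: "\<exists>C>0. \<forall>s x. norm x \<le> R \<longrightarrow> norm (b (s, x)) \<le> C"
  by (rule periodic_bounded[OF T_pos b_per b_cont])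

lemma psd_Q: "psd (Q z)"
  unfolding psd_def using Q_sym Q_elliptic \<delta>_pos
  by (metis mult_nonneg_nonneg order_less_imp_le order_trans zero_le_power2)

lemma V_cont: "continuous_on UNIV V"
  using V_C2 by (simp add: numeral_2_eq_2)

lemma V_jet: "jet2 V x (grad V x) (hess V x)"
  by (rule jet2_Ck2[OF V_C2])

lemma V_drift': "Q (s, x) \<bullet> hess V x + b (s, x) \<bullet> grad V x \<le> a - c * V x"
  using V_drift[of s x] by (simp add: ell_op_eq)

lemma V_sublevel: "\<exists>R>0. \<forall>x. V x \<le> M \<longrightarrow> norm x \<le> R"
proof -
  have "\<forall>\<^sub>F x in at_infinity. V x > M" using V_lim by (simp add: filterlim_at_top_dense)
  then obtain R where R: "\<And>x. norm x \<ge> R \<Longrightarrow> V x > M" unfolding eventually_at_infinity by auto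
  show ?thesis
  proof (intro exI[of _ "max R 1"] conjI allI impI)
    fix x assume "V x \<le> M"
    then have "\<not> norm x \<ge> R" using R[of x] by linarith
    then show "norm x \<le> max R 1" by linarith
  qed simp
qed

lemma V_sublevel_compact: "compact {x. V x \<le> M}"
proof -
  have "closed {x. V x \<le> M}" by (intro closed_Collect_le V_cont continuous_intros)
  moreover have "bounded {x. V x \<le> M}" using V_sublevel[of M] unfolding bounded_iff by auto
  ultimately show ?thesis by (simp add: compact_eq_bounded_closed)
qed

lemma V_bounded_on: "\<exists>M>0. \<forall>x. norm x \<le> R \<longrightarrow> V x \<le> M"
proof -
  have "compact (V ` cball 0 R)" by (intro compact_continuous_image continuous_on_subset[OF V_cont]) auto
  then obtain C where C: "C > 0" "\<And>z. z \<in> V ` cball 0 R \<Longrightarrow> norm z \<le> C"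
    by (meson bounded_pos compact_imp_bounded)
  then show ?thesis by (intro exI[of _ C]) force
qed

text \<open>At a positive maximum over \<open>K\<close> the gradient vanishes and the Hessian is
  nonpositive, so the strict inequality forces a negative time derivative: \<open>w\<close> was
  larger just before, a contradiction. Only earlier times have to stay in \<open>K\<close>, hence
  the final time slice needs no boundary condition. The rest of the boundary is covered by checking
  that \<open>w\<close> cannot be positive there.\<close>

lemma comparison:
  fixes w :: "real \<Rightarrow> real ^ 'n \<Rightarrow> real"
  assumes K: "compact K" and cont: "continuous_on K (\<lambda>(t, x). w t x)"
    and int: "\<And>t x. (t, x) \<in> K \<Longrightarrow> w t x > 0 \<Longrightarrow>
      (\<forall>\<^sub>F \<tau> in at_left t. (\<tau>, x) \<in> K) \<and> (\<forall>\<^sub>F y in nhds x. (t, y) \<in> K) \<and>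
      (\<exists>wt g H. ((\<lambda>\<tau>. w \<tau> x) has_real_derivative wt) (at t) \<and> jet2 (w t) x g H \<and>
          wt < Q (t, x) \<bullet> H + b (t, x) \<bullet> g)"
    and in_K: "(t, x) \<in> K"
  shows "w t x \<le> 0"
proof (rule ccontr)
  assume neg: "\<not> w t x \<le> 0"
  from continuous_attains_sup[OF K _ cont] in_K obtain t0 x0 where
    z0: "(t0, x0) \<in> K" "\<And>\<tau> y. (\<tau>, y) \<in> K \<Longrightarrow> w \<tau> y \<le> w t0 x0" by fastforce
  have "w t0 x0 > 0" using z0(2)[OF in_K] neg by simp
  from int[OF z0(1) this] obtain wt g H where
    *: "\<forall>\<^sub>F \<tau> in at_left t0. (\<tau>, x0) \<in> K" "\<forall>\<^sub>F y in nhds x0. (t0, y) \<in> K"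
    "((\<lambda>\<tau>. w \<tau> x0) has_real_derivative wt) (at t0)" "jet2 (w t0) x0 g H"
    "wt < Q (t0, x0) \<bullet> H + b (t0, x0) \<bullet> g" by blast
  have "\<forall>\<^sub>F y in nhds x0. w t0 y \<le> w t0 x0" using *(2) by eventually_elim (rule z0(2))
  from jet2_local_max[OF *(4) this] have "g = 0" "\<And>\<xi>. (H *v \<xi>) \<bullet> \<xi> \<le> 0" by auto
  moreover from this(2) have "Q (t0, x0) \<bullet> H \<le> 0"
    using psd_inner_le[OF psd_Q, of H 0] by simp
  ultimately have "wt < 0" using *(5) by simp
  from DERIV_neg_dec_left[OF *(3) this] obtain d where
    d: "d > 0" "\<And>h. 0 < h \<Longrightarrow> h < d \<Longrightarrow> w t0 x0 < w (t0 - h) x0" by auto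
  have "\<forall>\<^sub>F \<tau> in at_left t0. \<tau> \<in> {t0 - d<..<t0}"
    using d(1) by (intro eventually_at_left_real) auto
  with *(1) have "\<forall>\<^sub>F \<tau> in at_left t0. False"
  proof eventually_elim
    case (elim \<tau>)
    then show ?case using z0(2)[of \<tau> x0] d(2)[of "t0 - \<tau>"] by auto
  qed
  then show False by (simp add: trivial_limit_at_left_real)
qed

text \<open>A pointwise notion of solution with source \<open>e\<close>: the derivatives need exist
  only at each point, as the maximum principle asks. The source is zero for the evolution operator
  and carries the error of a mollified strong solution.\<close>

definition psol :: "real \<Rightarrow> (real \<Rightarrow> real ^ 'n \<Rightarrow> real) \<Rightarrow> (real \<Rightarrow> real ^ 'n \<Rightarrow> real) \<Rightarrow> bool" where
  "psol s u e \<longleftrightarrow> continuous_on ({s..} \<times> UNIV) (\<lambda>(t, x). u t x) \<and>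
    (\<forall>t>s. \<forall>x. \<exists>ut g H. ((\<lambda>\<tau>. u \<tau> x) has_real_derivative ut) (at t) \<and> jet2 (u t) x g H \<and>
       ut = Q (t, x) \<bullet> H + b (t, x) \<bullet> g + e t x)"

lemma psol_add:
  assumes "psol s u e" "psol s u' e'"
  shows "psol s (\<lambda>t x. u t x + u' t x) (\<lambda>t x. e t x + e' t x)"
  unfolding psol_def
proof (intro conjI allI impI)
  show "continuous_on ({s..} \<times> UNIV) (\<lambda>(t, x). u t x + u' t x)"
    using assms by (auto simp: psol_def case_prod_beta' intro: continuous_on_add)
  fix t x assume t: "t > s"
  then obtain ut g H ut' g' H' where
    *: "((\<lambda>\<tau>. u \<tau> x) has_real_derivative ut) (at t)" "jet2 (u t) x g H"
       "ut = Q (t, x) \<bullet> H + b (t, x) \<bullet> g + e t x"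
       "((\<lambda>\<tau>. u' \<tau> x) has_real_derivative ut') (at t)" "jet2 (u' t) x g' H'"
       "ut' = Q (t, x) \<bullet> H' + b (t, x) \<bullet> g' + e' t x"
    using assms unfolding psol_def by meson
  show "\<exists>ut g H. ((\<lambda>\<tau>. u \<tau> x + u' \<tau> x) has_real_derivative ut) (at t) \<and>
      jet2 (\<lambda>x. u t x + u' t x) x g H \<and>
      ut = Q (t, x) \<bullet> H + b (t, x) \<bullet> g + (e t x + e' t x)"
    by (rule exI[of _ "ut + ut'"], rule exI[of _ "g + g'"], rule exI[of _ "H + H'"])
      (use * in \<open>auto intro!: DERIV_add jet2_add simp: inner_add_right\<close>)
qed

lemma psol_cmult:
  assumes "psol s u e"
  shows "psol s (\<lambda>t x. k * u t x) (\<lambda>t x. k * e t x)"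
  unfolding psol_def
proof (intro conjI allI impI)
  show "continuous_on ({s..} \<times> UNIV) (\<lambda>(t, x). k * u t x)"
    using assms by (auto simp: psol_def case_prod_beta' intro: continuous_on_mult_left)
  fix t x assume t: "t > s"
  then obtain ut g H where
    *: "((\<lambda>\<tau>. u \<tau> x) has_real_derivative ut) (at t)" "jet2 (u t) x g H"
       "ut = Q (t, x) \<bullet> H + b (t, x) \<bullet> g + e t x"
    using assms unfolding psol_def by meson
  show "\<exists>ut g H. ((\<lambda>\<tau>. k * u \<tau> x) has_real_derivative ut) (at t) \<and>
      jet2 (\<lambda>x. k * u t x) x g H \<and> ut = Q (t, x) \<bullet> H + b (t, x) \<bullet> g + k * e t x"
    by (rule exI[of _ "k * ut"], rule exI[of _ "k *\<^sub>R g"], rule exI[of _ "k *\<^sub>R H"])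
      (use * DERIV_cmult[OF *(1), of k] in \<open>auto intro!: jet2_cmult simp: algebra_simps\<close>)
qed

lemma psol_const: "psol s (\<lambda>t x. k) (\<lambda>t x. 0)"
  unfolding psol_def
  by (auto intro!: exI[of _ 0] jet2_const continuous_intros simp: case_prod_beta')

lemma psol_diff:
  assumes "psol s u e" "psol s u' e'"
  shows "psol s (\<lambda>t x. u t x - u' t x) (\<lambda>t x. e t x - e' t x)"
  using psol_add[OF assms(1) psol_cmult[OF assms(2), of "-1"]] by simp

lemma psol_mono: "psol s u e \<Longrightarrow> s \<le> s' \<Longrightarrow> psol s' u e"
  unfolding psol_def by (auto intro: continuous_on_subset)

text \<open>Since \<open>c V \<ge> 0\<close>, the function \<open>V + (a + 1)(t - s)\<close> is a strict supersolution with a margin of \<open>1\<close>,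
  which absorbs both the growth at infinity and a small error on a sublevel set of \<open>V\<close>.\<close>

lemma growth_bound_eps:
  assumes w: "psol s w e" and B: "\<And>t x. s \<le> t \<Longrightarrow> t \<le> S \<Longrightarrow> w t x \<le> B"
    and init: "\<And>x. w s x \<le> k + \<beta> * V x" and \<beta>: "\<beta> \<ge> 0" and \<epsilon>: "\<epsilon> > 0"
    and M: "B - k \<le> \<epsilon> * M"
    and e: "\<And>t x. s < t \<Longrightarrow> t \<le> S \<Longrightarrow> V x \<le> M \<Longrightarrow> e t x \<le> \<epsilon>"
    and t: "s \<le> t" "t \<le> S"
  shows "w t x \<le> k + \<beta> * (exp (- c * (t - s)) * V x + a / c * (1 - exp (- c * (t - s)))) +
     \<epsilon> * (V x + (a + 1) * (t - s))"
proof -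
  \<comment> \<open>In time this solves the linear equation z' = a - c z with initial value
    \<open>V x\<close>; it bounds what the evolution can make of the weight
    \<open>V\<close>.\<close>
  define Z where "Z t x = exp (- c * (t - s)) * V x + a / c * (1 - exp (- c * (t - s)))" for t x
  define Y where "Y t x = k + \<beta> * Z t x + \<epsilon> * (V x + (a + 1) * (t - s))" for t x
  have Z0: "Z t x \<ge> 0" if "s \<le> t" for t x
    using that V_pos[of x] a_pos c_pos by (simp add: Z_def)
  have Y0: "k + \<epsilon> * V x \<le> Y t x" if "s \<le> t" for t x
  proof -
    have "0 \<le> \<beta> * Z t x" "0 \<le> \<epsilon> * ((a + 1) * (t - s))" using that Z0[OF that, of x] \<beta> \<epsilon> a_pos by auto
    then show ?thesis by (simp add: Y_def distrib_left)
  qed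
  \<comment> \<open>Beyond this sublevel set \<open>\<epsilon> * V x\<close> alone exceeds
    \<open>B - k\<close>, so the claim holds there by boundedness of \<open>w\<close>.\<close>
  define K where "K = {s..S} \<times> {x. V x \<le> M}"
  have "w t x - Y t x \<le> 0" if "(t, x) \<in> K" for t x
  proof (rule comparison[OF _ _ _ that])
    show "compact K" unfolding K_def by (intro compact_Times V_sublevel_compact) auto
    have "continuous_on K (\<lambda>(t, x). w t x)"
      by (rule continuous_on_subset[where s = "{s..} \<times> UNIV"]) (use w in \<open>auto simp: psol_def K_def\<close>)
    moreover have "continuous_on K (\<lambda>z. V (snd z))"
      by (rule continuous_on_compose2[OF V_cont]) (auto intro: continuous_intros)
    ultimately show "continuous_on K (\<lambda>(t, x). w t x - Y t x)"
      unfolding Y_def Z_def case_prod_beta' using c_pos by (intro continuous_intros) auto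
  next
    fix t x assume K: "(t, x) \<in> K" and pos: "w t x - Y t x > 0"
    have tS: "s \<le> t" "t \<le> S" using K by (auto simp: K_def)
    have "\<epsilon> * V x < \<epsilon> * M" using pos Y0[OF tS(1), of x] B[OF tS, of x] M by linarith
    then have VM: "V x < M" using \<epsilon> by simp
    have "t \<noteq> s"
      using pos init[of x] mult_pos_pos[OF \<epsilon> V_pos[of x]] by (auto simp: Y_def Z_def)
    then have ts: "s < t" using tS by simp
    have "\<forall>\<^sub>F \<tau> in at_left t. \<tau> \<in> {s<..<t}" using ts by (intro eventually_at_left_real)
    then have 1: "\<forall>\<^sub>F \<tau> in at_left t. (\<tau>, x) \<in> K"
      by eventually_elim (use tS VM in \<open>auto simp: K_def\<close>)
    have "open {y. V y < M}" by (intro open_Collect_less V_cont continuous_intros)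
    then have "\<forall>\<^sub>F y in nhds x. y \<in> {y. V y < M}" using VM by (intro eventually_nhds_in_open) auto
    then have 2: "\<forall>\<^sub>F y in nhds x. (t, y) \<in> K"
      by eventually_elim (use tS in \<open>auto simp: K_def\<close>)
    obtain wt g H where
      wt: "((\<lambda>\<tau>. w \<tau> x) has_real_derivative wt) (at t)" "jet2 (w t) x g H"
       "wt = Q (t, x) \<bullet> H + b (t, x) \<bullet> g + e t x"
      using w ts unfolding psol_def by meson
    define E where "E = exp (- c * (t - s))"
    define Yt where "Yt = \<beta> * (- c * E * V x + a * E) + \<epsilon> * (a + 1)"
    define m where "m = \<beta> * E + \<epsilon>"
    have dY: "((\<lambda>\<tau>. Y \<tau> x) has_real_derivative Yt) (at t)"
      unfolding Y_def Z_def Yt_def E_def using c_pos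
      by (auto intro!: derivative_eq_intros simp: field_simps)
    have Ye: "Y t = (\<lambda>x. (k + \<beta> * (a / c * (1 - E)) + \<epsilon> * (a + 1) * (t - s)) + m * V x)"
      by (simp add: Y_def[abs_def] Z_def E_def m_def algebra_simps)
    have jY: "jet2 (Y t) x (m *\<^sub>R grad V x) (m *\<^sub>R hess V x)"
      using jet2_add[OF jet2_const jet2_cmult[OF V_jet]] unfolding Ye by simp
    \<comment> \<open>Of the surplus \<open>\<epsilon> + \<epsilon> * c * V x\<close>, the first
      summand absorbs the source and the second, positive by \<open>V_pos\<close>, makes the
      inequality strict.\<close>
    have "m * (Q (t, x) \<bullet> hess V x + b (t, x) \<bullet> grad V x) \<le> m * (a - c * V x)"
      using \<beta> \<epsilon> by (intro mult_left_mono V_drift') (simp add: m_def E_def)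
    also have "\<dots> = Yt - \<epsilon> - \<epsilon> * c * V x" by (simp add: m_def Yt_def algebra_simps)
    also have "\<dots> < Yt - \<epsilon>" using \<epsilon> c_pos V_pos[of x] by simp
    finally have lt: "wt - Yt < Q (t, x) \<bullet> (H - m *\<^sub>R hess V x) + b (t, x) \<bullet> (g - m *\<^sub>R grad V x)"
      using wt(3) e[OF ts tS(2), of x] VM by (simp add: inner_diff_right distrib_left)
    show "(\<forall>\<^sub>F \<tau> in at_left t. (\<tau>, x) \<in> K) \<and> (\<forall>\<^sub>F y in nhds x. (t, y) \<in> K) \<and>
      (\<exists>wt g H. ((\<lambda>\<tau>. w \<tau> x - Y \<tau> x) has_real_derivative wt) (at t) \<and>
          jet2 (\<lambda>x. w t x - Y t x) x g H \<and> wt < Q (t, x) \<bullet> H + b (t, x) \<bullet> g)"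
      using 1 2 lt DERIV_diff[OF wt(1) dY] jet2_diff[OF wt(2) jY] by blast
  qed
  then have "w t x \<le> Y t x"
  proof (cases "V x \<le> M")
    case True
    then show ?thesis using \<open>\<And>t x. (t, x) \<in> K \<Longrightarrow> w t x - Y t x \<le> 0\<close>[of t x] t by (simp add: K_def)
  next
    case False
    then have "\<epsilon> * M \<le> \<epsilon> * V x" using \<epsilon> by simp
    then show ?thesis using B[OF t, of x] Y0[OF t(1), of x] M by linarith
  qed
  then show ?thesis by (simp add: Y_def Z_def)
qed

text \<open>Without source every margin is admissible. The sublevel set, of height
  \<open>(B - k) / \<epsilon>\<close>, grows as the margin shrinks, but it does not appear in the
  resulting bound, so the margin can be sent to 0.\<close>

lemma growth_bound:
  assumes w: "psol s w (\<lambda>_ _. 0)" and B: "\<And>t x. s \<le> t \<Longrightarrow> w t x \<le> B"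
    and init: "\<And>x. w s x \<le> k + \<beta> * V x" and \<beta>: "\<beta> \<ge> 0" and t: "s \<le> t"
  shows "w t x \<le> k + \<beta> * (exp (- c * (t - s)) * V x + a / c * (1 - exp (- c * (t - s))))"
proof (rule field_le_epsilon)
  fix e :: real assume e: "e > 0"
  define D where "D = V x + (a + 1) * (t - s)"
  have D: "D > 0" using V_pos[of x] a_pos t by (simp add: D_def add_pos_nonneg)
  have "w t x \<le> k + \<beta> * (exp (- c * (t - s)) * V x + a / c * (1 - exp (- c * (t - s)))) + (e / D) * D"
    unfolding D_def
    by (rule growth_bound_eps[OF w, of t B k \<beta> _ "(B - k) / (e / D)"])
      (use e D B init \<beta> t in \<open>auto simp flip: D_def\<close>)
  then show "w t x \<le> k + \<beta> * (exp (- c * (t - s)) * V x + a / c * (1 - exp (- c * (t - s)))) + e"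
    using D by simp
qed

end

subsection \<open>Barriers and reflection coupling\<close>

lemma trace_eq_inner: "trace A = mat 1 \<bullet> (A :: real ^ 'n ^ 'n)"
  by (simp add: trace_def inner_vec_def mat_def if_distrib [of "\<lambda>x. x * _"] cong: if_cong)

lemma mat_scaleR_mult: "(k *\<^sub>R mat 1 :: real ^ 'n ^ 'n) *v \<xi> = k *\<^sub>R \<xi>"
  by (simp add: scaleR_matrix_vector)

lemma norm_add_scaleR_sq:
  "(norm (x + h *\<^sub>R \<xi>))\<^sup>2 = (norm x)\<^sup>2 + 2 * h * (x \<bullet> \<xi>) + h\<^sup>2 * (norm \<xi>)\<^sup>2" for x :: "'a::real_inner"
  unfolding power2_norm_eq_inner
  by (simp add: inner_add_left inner_add_right inner_commute power2_eq_square algebra_simps)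

lemma jet2_norm_sq:
  fixes x x0 :: "real ^ 'n"
  shows "jet2 (\<lambda>y. (norm (y - x0))\<^sup>2) x (2 *\<^sub>R (x - x0)) (2 *\<^sub>R mat 1)"
  unfolding jet2_def
proof
  fix \<xi> :: "real ^ 'n"
  have *: "(norm (x + h *\<^sub>R \<xi> - x0))\<^sup>2 =
      (norm (x - x0))\<^sup>2 + 2 * h * ((x - x0) \<bullet> \<xi>) + h\<^sup>2 * (norm \<xi>)\<^sup>2" for h
    using norm_add_scaleR_sq[of "x - x0" h \<xi>] by (simp add: algebra_simps)
  show "d2 (\<lambda>h. (norm (x + h *\<^sub>R \<xi> - x0))\<^sup>2) (2 *\<^sub>R (x - x0) \<bullet> \<xi>) (((2 *\<^sub>R mat 1) *v \<xi>) \<bullet> \<xi>)"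
    unfolding * mat_scaleR_mult
    by (rule d2I[of _ "\<lambda>h. 2 * ((x - x0) \<bullet> \<xi>) + 2 * h * (norm \<xi>)\<^sup>2"])
      (auto intro!: derivative_eq_intros simp: power2_norm_eq_inner)
qed

lemma jet2_quartic:
  fixes x :: "real ^ 'n" and D :: real
  defines "d \<equiv> D - (norm x)\<^sup>2"
  shows "jet2 (\<lambda>y. (D - (norm y)\<^sup>2)\<^sup>2) x (- (4 * d) *\<^sub>R x) (8 *\<^sub>R outer x - (4 * d) *\<^sub>R mat 1)"
  unfolding jet2_def
proof
  fix \<xi> :: "real ^ 'n"
  have *: "(D - (norm (x + h *\<^sub>R \<xi>))\<^sup>2)\<^sup>2 = (d - 2 * h * (x \<bullet> \<xi>) - h\<^sup>2 * (\<xi> \<bullet> \<xi>))\<^sup>2" for h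
    by (simp add: norm_add_scaleR_sq d_def power2_norm_eq_inner[of \<xi>] algebra_simps)
  show "d2 (\<lambda>h. (D - (norm (x + h *\<^sub>R \<xi>))\<^sup>2)\<^sup>2) (- (4 * d) *\<^sub>R x \<bullet> \<xi>)
     (((8 *\<^sub>R outer x - (4 * d) *\<^sub>R mat 1) *v \<xi>) \<bullet> \<xi>)"
    unfolding * matrix_vector_mult_diff_rdistrib mat_scaleR_mult scaleR_matrix_vector outer_mult
    by (rule d2I[of _ "\<lambda>h. 2 * (d - 2 * h * (x \<bullet> \<xi>) - h\<^sup>2 * (\<xi> \<bullet> \<xi>)) *
           (- 2 * (x \<bullet> \<xi>) - 2 * h * (\<xi> \<bullet> \<xi>))"])
      (auto intro!: derivative_eq_intros
         simp: power2_eq_square inner_diff_left algebra_simps)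
qed

context lyapunov_operator
begin

text \<open>The barrier is a paraboloid centred at \<open>x0\<close> and lifted linearly in time.
  The point is the uniformity of \<open>C\<close> in the starting time, the solution and
  \<open>x0\<close>: a classical solution is continuous at its initial time, but with no rate that
  survives a change of the datum.\<close>

lemma initial_layer:
  "\<exists>C>0. \<forall>s u x0 k r B. psol s u (\<lambda>_ _. 0) \<longrightarrow> norm x0 \<le> R \<longrightarrow> 0 < r \<longrightarrow> r \<le> 1 \<longrightarrow> B > 0 \<longrightarrow>
     (\<forall>t x. s \<le> t \<longrightarrow> u t x \<le> k + B) \<longrightarrow> (\<forall>y. norm (y - x0) \<le> r \<longrightarrow> u s y \<le> k) \<longrightarrow>
     (\<forall>t\<ge>s. u t x0 \<le> k + B / r\<^sup>2 * C * (t - s))"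
proof -
  define n0 where "n0 = norm (mat 1 :: real ^ 'n ^ 'n)"
  obtain Cq where Cq: "Cq > 0" "\<And>s x. norm x \<le> R + 1 \<Longrightarrow> norm (Q (s, x)) \<le> Cq"
    using Q_bounded[of "R + 1"] by auto
  obtain Cb where Cb: "Cb > 0" "\<And>s x. norm x \<le> R + 1 \<Longrightarrow> norm (b (s, x)) \<le> Cb"
    using b_bounded[of "R + 1"] by auto
  \<comment> \<open>A strict upper bound for the operator applied to the squared distance from
    \<open>x0\<close> on the ball of radius \<open>r\<close>, where \<open>r\<close> is at most
    1.\<close>
  define C where "C = 2 * Cq * n0 + 2 * Cb + 1"
  have "C > 0" using Cq Cb by (simp add: C_def n0_def add_nonneg_pos add_pos_nonneg)
  show ?thesis
  proof (intro exI[of _ C] conjI allI impI \<open>C > 0\<close>)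
    fix s u and x0 :: "real ^ 'n" and k r B t :: real
    assume u: "psol s u (\<lambda>_ _. 0)" and x0: "norm x0 \<le> R" and r: "0 < r" "r \<le> 1" and B: "B > 0"
      and uB: "\<forall>t x. s \<le> t \<longrightarrow> u t x \<le> k + B" and ini: "\<forall>y. norm (y - x0) \<le> r \<longrightarrow> u s y \<le> k"
      and t: "s \<le> t"
    \<comment> \<open>With this slope the paraboloid reaches the a priori bound \<open>k + B\<close>
      on the sphere of radius \<open>r\<close>, so nothing has to be known about \<open>u\<close>
      there.\<close>
    define L where "L = B / r\<^sup>2"
    have L: "L > 0" "L * r\<^sup>2 = B" using B r by (auto simp: L_def)
    define K where "K = {s..t} \<times> cball x0 r"
    have "u t x0 - (k + L * (norm (x0 - x0))\<^sup>2 + L * C * (t - s)) \<le> 0"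
    proof (rule comparison[where K = K and w = "\<lambda>t x. u t x - (k + L * (norm (x - x0))\<^sup>2 + L * C * (t - s))"])
      show "compact K" unfolding K_def by (intro compact_Times) auto
      have "continuous_on K (\<lambda>(t, x). u t x)"
        by (rule continuous_on_subset[where s = "{s..} \<times> UNIV"]) (use u in \<open>auto simp: psol_def K_def\<close>)
      then show "continuous_on K (\<lambda>(t, x). u t x - (k + L * (norm (x - x0))\<^sup>2 + L * C * (t - s)))"
        unfolding case_prod_beta' by (intro continuous_intros) auto
      show "(t, x0) \<in> K" using t r by (auto simp: K_def)
    next
      fix \<tau> x assume K: "(\<tau>, x) \<in> K"
        and pos: "u \<tau> x - (k + L * (norm (x - x0))\<^sup>2 + L * C * (\<tau> - s)) > 0"
      have tS: "s \<le> \<tau>" "\<tau> \<le> t" and xr: "norm (x - x0) \<le> r"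
        using K by (auto simp: K_def dist_norm norm_minus_commute)
      have "\<tau> \<noteq> s"
      proof
        assume "\<tau> = s"
        moreover have "u s x \<le> k" using ini xr by blast
        moreover have "0 \<le> L * (norm (x - x0))\<^sup>2" using L(1) by simp
        ultimately show False using pos by simp
      qed
      then have ts: "s < \<tau>" using tS by simp
      have "norm (x - x0) \<noteq> r"
      proof
        assume eq: "norm (x - x0) = r"
        have "0 \<le> L * C * (\<tau> - s)" using L \<open>C > 0\<close> tS by simp
        then show False using pos uB tS(1) L(2) unfolding eq
          by (metis add_mono_thms_linordered_semiring(1) diff_gt_0_iff_gt le_add_same_cancel1 leD order_trans)
      qed
      then have xr': "norm (x - x0) < r" using xr by simp
      have "\<forall>\<^sub>F \<sigma> in at_left \<tau>. \<sigma> \<in> {s<..<\<tau>}" using ts by (intro eventually_at_left_real)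
      then have 1: "\<forall>\<^sub>F \<sigma> in at_left \<tau>. (\<sigma>, x) \<in> K"
        by eventually_elim (use K in \<open>auto simp: K_def\<close>)
      have "\<forall>\<^sub>F y in nhds x. y \<in> ball x0 r"
        using xr' by (intro eventually_nhds_in_open) (auto simp: dist_norm norm_minus_commute)
      then have 2: "\<forall>\<^sub>F y in nhds x. (\<tau>, y) \<in> K"
        by eventually_elim (use tS in \<open>auto simp: K_def\<close>)
      obtain wt g H where
        wt: "((\<lambda>\<tau>. u \<tau> x) has_real_derivative wt) (at \<tau>)" "jet2 (u \<tau>) x g H"
         "wt = Q (\<tau>, x) \<bullet> H + b (\<tau>, x) \<bullet> g"
        using u ts unfolding psol_def by (metis add.right_neutral)
      have dY: "((\<lambda>\<tau>. k + L * (norm (x - x0))\<^sup>2 + L * C * (\<tau> - s)) has_real_derivative L * C) (at \<tau>)"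
        by (auto intro!: derivative_eq_intros)
      have jY: "jet2 (\<lambda>x. k + L * (norm (x - x0))\<^sup>2 + L * C * (\<tau> - s)) x
         (L *\<^sub>R (2 *\<^sub>R (x - x0))) (L *\<^sub>R (2 *\<^sub>R mat 1))"
        using jet2_add[OF jet2_cmult[OF jet2_norm_sq[of x0 x], of L] jet2_const[of "k + L * C * (\<tau> - s)"]]
        by (simp add: algebra_simps)
      have xR: "norm x \<le> R + 1" using norm_triangle_sub[of x x0] xr r x0 by linarith
      have "Q (\<tau>, x) \<bullet> mat 1 \<le> Cq * n0"
        using order_trans[OF norm_cauchy_schwarz, of "Q (\<tau>, x)" "mat 1" "Cq * n0"]
          mult_right_mono[OF Cq(2)[OF xR], of n0] by (simp add: n0_def)
      moreover have "b (\<tau>, x) \<bullet> (x - x0) \<le> Cb * 1"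
        by (rule order_trans[OF norm_cauchy_schwarz mult_mono[OF Cb(2)[OF xR]]]) (use xr r Cb in auto)
      ultimately have "Q (\<tau>, x) \<bullet> (2 *\<^sub>R mat 1) + b (\<tau>, x) \<bullet> (2 *\<^sub>R (x - x0)) < C"
        by (simp add: C_def)
      then have "L * (Q (\<tau>, x) \<bullet> (2 *\<^sub>R mat 1) + b (\<tau>, x) \<bullet> (2 *\<^sub>R (x - x0))) < L * C"
        using L(1) by (rule mult_strict_left_mono)
      then have "wt - L * C < Q (\<tau>, x) \<bullet> (H - L *\<^sub>R (2 *\<^sub>R mat 1)) + b (\<tau>, x) \<bullet> (g - L *\<^sub>R (2 *\<^sub>R (x - x0)))"
        using wt(3) unfolding inner_diff_right[of _ H] inner_diff_right[of _ g] inner_scaleR_right[of _ L]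
          distrib_left by linarith
      then show "(\<forall>\<^sub>F \<sigma> in at_left \<tau>. (\<sigma>, x) \<in> K) \<and> (\<forall>\<^sub>F y in nhds x. (\<tau>, y) \<in> K) \<and>
       (\<exists>wt g H. ((\<lambda>\<tau>. u \<tau> x - (k + L * (norm (x - x0))\<^sup>2 + L * C * (\<tau> - s))) has_real_derivative wt) (at \<tau>) \<and>
          jet2 (\<lambda>x. u \<tau> x - (k + L * (norm (x - x0))\<^sup>2 + L * C * (\<tau> - s))) x g H \<and>
          wt < Q (\<tau>, x) \<bullet> H + b (\<tau>, x) \<bullet> g)"
        using 1 2 DERIV_diff[OF wt(1) dY] jet2_diff[OF wt(2) jY] by blast
    qed
    then show "u t x0 \<le> k + B / r\<^sup>2 * C * (t - s)" by (simp add: L_def)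
  qed
qed

text \<open>The barrier is a bump \<open>(\<rho>\<^sup>2 - \<bar>x\<bar>\<^sup>2)\<^sup>2\<close> whose radius \<open>\<rho>\<close> grows in time.  Near the edge of its
  support ellipticity makes it a subsolution, inside the factor \<open>exp (- k t)\<close> does.\<close>

lemma positivity_spread:
  assumes r: "r > 0" and R: "R > 0"
  shows "\<exists>p>0. \<forall>s u. psol s u (\<lambda>_ _. 0) \<longrightarrow> (\<forall>t x. s \<le> t \<longrightarrow> 0 \<le> u t x) \<longrightarrow>
    (\<forall>x. norm x \<le> r \<longrightarrow> 1 \<le> u s x) \<longrightarrow> (\<forall>x. norm x \<le> R \<longrightarrow> p \<le> u (s + 1) x)"
proof -
  define n0 where "n0 = norm (mat 1 :: real ^ 'n ^ 'n)"
  \<comment> \<open>The squared radius grows at rate \<open>\<sigma>\<close>: after unit time it is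
    \<open>r\<^sup>2 + (R + 1)\<^sup>2\<close>, so the bump is at least 1 before scaling on the ball
    of radius \<open>R\<close>, while its support stays in the ball of radius
    \<open>R'\<close>.\<close>
  define \<sigma> where "\<sigma> = (R + 1)\<^sup>2"
  define R' where "R' = r + R + 1"
  obtain Cq where Cq: "Cq > 0" "\<And>s x. norm x \<le> R' \<Longrightarrow> norm (Q (s, x)) \<le> Cq"
    using Q_bounded[of R'] by auto
  obtain Cb where Cb: "Cb > 0" "\<And>s x. norm x \<le> R' \<Longrightarrow> norm (b (s, x)) \<le> Cb"
    using b_bounded[of R'] by auto
  define C where "C = 2 * \<sigma> + 8 * \<delta> + 4 * (Cq * n0) + 4 * (Cb * R')"
  have C: "C > 0" using r R \<delta>_pos Cq Cb
    by (simp add: C_def \<sigma>_def n0_def R'_def add_pos_nonneg add_nonneg_pos)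
  \<comment> \<open>Chosen by completing a square, so that \<open>C * D\<close> is at most
    \<open>k * D\<^sup>2 + 2 * \<delta> * r\<^sup>2\<close> for every \<open>D\<close>;
    \<open>C\<close> collects all terms that are linear in the depth \<open>D\<close>.\<close>
  define k where "k = C\<^sup>2 / (8 * \<delta> * r\<^sup>2)"
  have k: "k > 0" using C r \<delta>_pos by (simp add: k_def)
  \<comment> \<open>Normalises the bump to be at most 1 at the initial time.\<close>
  define m where "m = 1 / r ^ 4"
  have m: "m > 0" using r by (simp add: m_def)
  show ?thesis
  proof (intro exI[of _ "m * exp (- k)"] conjI allI impI)
    show "0 < m * exp (- k)" using m by simp
    fix s u and x1 :: "real ^ 'n"
    assume u: "psol s u (\<lambda>_ _. 0)" and u0: "\<forall>t x. s \<le> t \<longrightarrow> 0 \<le> u t x"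
      and ini: "\<forall>x. norm x \<le> r \<longrightarrow> 1 \<le> u s x" and x1: "norm x1 \<le> R"
    define d where "d t x = r\<^sup>2 + \<sigma> * (t - s) - (norm x)\<^sup>2" for t and x :: "real ^ 'n"
    define \<psi> where "\<psi> t x = m * exp (- k * (t - s)) * (d t x)\<^sup>2" for t x
    define K where "K = ({s..s + 1} \<times> UNIV) \<inter> {z. 0 \<le> d (fst z) (snd z)}"
    have d_cont: "continuous_on UNIV (\<lambda>z. d (fst z) (snd z))"
      unfolding d_def by (intro continuous_intros)
    have KR: "norm x \<le> R'" if "d t x \<ge> 0" "t \<le> s + 1" for t x
    proof (rule power2_le_imp_le)
      have "\<sigma> * (t - s) \<le> \<sigma> * 1" using that by (intro mult_left_mono) (auto simp: \<sigma>_def)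
      then have "(norm x)\<^sup>2 \<le> r\<^sup>2 + \<sigma>" using that by (simp add: d_def)
      also have "\<dots> \<le> R'\<^sup>2" using r R by (simp add: R'_def \<sigma>_def power2_eq_square algebra_simps)
      finally show "(norm x)\<^sup>2 \<le> R'\<^sup>2" .
      show "0 \<le> R'" using r R by (simp add: R'_def)
    qed
    have compK: "compact K"
    proof -
      have "closed K" unfolding K_def
        by (intro closed_Int closed_Times closed_Collect_le d_cont continuous_intros closed_UNIV
            closed_atLeastAtMost)
      moreover have "K \<subseteq> {s..s + 1} \<times> cball 0 R'" using KR by (auto simp: K_def)
      then have "bounded K" using bounded_subset bounded_Times bounded_cball bounded_closed_interval
        by metis
      ultimately show ?thesis by (simp add: compact_eq_bounded_closed)
    qed
    have d1: "d (s + 1) x1 \<ge> 1"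
    proof -
      have "(norm x1)\<^sup>2 \<le> R\<^sup>2" using x1 by (intro power_mono) auto
      then have "(norm x1)\<^sup>2 \<le> R\<^sup>2 + (r\<^sup>2 + 2 * R)" using R
        by (intro order_trans[OF _ le_add_same_cancel1[THEN iffD2]]) auto
      then show ?thesis by (simp add: d_def \<sigma>_def power2_eq_square algebra_simps)
    qed
    have "\<psi> (s + 1) x1 - u (s + 1) x1 \<le> 0"
    proof (rule comparison[where K = K and w = "\<lambda>t x. \<psi> t x - u t x", OF compK])
      have "continuous_on K (\<lambda>(t, x). u t x)"
        by (rule continuous_on_subset[where s = "{s..} \<times> UNIV"]) (use u in \<open>auto simp: psol_def K_def\<close>)
      then show "continuous_on K (\<lambda>(t, x). \<psi> t x - u t x)"
        unfolding case_prod_beta' \<psi>_def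
        by (intro continuous_intros continuous_on_subset[OF d_cont]) auto
      show "(s + 1, x1) \<in> K" using d1 by (auto simp: K_def)
    next
      fix t x assume K: "(t, x) \<in> K" and pos: "\<psi> t x - u t x > 0"
      have tS: "s \<le> t" "t \<le> s + 1" and dx: "d t x \<ge> 0" using K by (auto simp: K_def)
      have "d t x \<noteq> 0"
      proof
        assume "d t x = 0"
        moreover have "0 \<le> u t x" using u0 tS(1) by blast
        ultimately show False using pos by (simp add: \<psi>_def)
      qed
      then have d0: "d t x > 0" using dx by simp
      have "t \<noteq> s"
      proof
        assume ts: "t = s"
        then have nx: "(norm x)\<^sup>2 \<le> r\<^sup>2" using dx by (simp add: d_def)
        then have "norm x \<le> r" using r by (intro power2_le_imp_le[OF nx]) simp
        then have "1 \<le> u s x" using ini by blast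
        moreover have "(d t x)\<^sup>2 \<le> (r\<^sup>2)\<^sup>2" using dx ts by (intro power_mono) (auto simp: d_def)
        then have "\<psi> t x \<le> m * (r\<^sup>2)\<^sup>2" using m ts by (simp add: \<psi>_def)
        then have "\<psi> t x \<le> 1" using r by (simp add: m_def)
        ultimately show False using pos ts by simp
      qed
      then have ts: "s < t" using tS by simp
      have "\<forall>\<^sub>F \<tau> in at_left t. \<tau> \<in> {s<..<t}" using ts by (intro eventually_at_left_real)
      moreover have "\<forall>\<^sub>F \<tau> in at_left t. d \<tau> x > 0"
      proof -
        have "open {\<tau>. 0 < d \<tau> x}" unfolding d_def by (intro open_Collect_less continuous_intros)
        then have "\<forall>\<^sub>F \<tau> in nhds t. \<tau> \<in> {\<tau>. 0 < d \<tau> x}" using d0 by (intro eventually_nhds_in_open) auto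
        then show ?thesis by (simp add: eventually_at_filter eventually_mono)
      qed
      ultimately have 1: "\<forall>\<^sub>F \<tau> in at_left t. (\<tau>, x) \<in> K"
        by eventually_elim (use tS in \<open>auto simp: K_def\<close>)
      have "open {y. 0 < d t y}" unfolding d_def by (intro open_Collect_less continuous_intros)
      then have "\<forall>\<^sub>F y in nhds x. y \<in> {y. 0 < d t y}" using d0 by (intro eventually_nhds_in_open) auto
      then have 2: "\<forall>\<^sub>F y in nhds x. (t, y) \<in> K"
        by eventually_elim (use tS in \<open>auto simp: K_def\<close>)
      obtain wt g H where
        wt: "((\<lambda>\<tau>. u \<tau> x) has_real_derivative wt) (at t)" "jet2 (u t) x g H"
         "wt = Q (t, x) \<bullet> H + b (t, x) \<bullet> g"
        using u ts unfolding psol_def by (metis add.right_neutral)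
      define E where "E = m * exp (- k * (t - s))"
      have E: "E > 0" using m by (simp add: E_def)
      define D where "D = d t x"
      have dY: "((\<lambda>\<tau>. \<psi> \<tau> x) has_real_derivative E * (2 * D * \<sigma> - k * D\<^sup>2)) (at t)"
        unfolding \<psi>_def d_def E_def D_def
        by (auto intro!: derivative_eq_intros simp: power2_eq_square algebra_simps)
      have jY: "jet2 (\<psi> t) x (E *\<^sub>R (- (4 * D) *\<^sub>R x)) (E *\<^sub>R (8 *\<^sub>R outer x - (4 * D) *\<^sub>R mat 1))"
        using jet2_cmult[OF jet2_quartic[of "r\<^sup>2 + \<sigma> * (t - s)" x], of E]
        by (simp add: \<psi>_def[abs_def] d_def[abs_def] E_def D_def)
      have xR: "norm x \<le> R'" using KR dx tS by blast
      have "Q (t, x) \<bullet> mat 1 \<le> Cq * n0"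
        using order_trans[OF norm_cauchy_schwarz, of "Q (t, x)" "mat 1" "Cq * n0"]
          mult_right_mono[OF Cq(2)[OF xR], of n0] by (simp add: n0_def)
      then have q1: "D * (Q (t, x) \<bullet> mat 1) \<le> D * (Cq * n0)" using dx by (simp add: D_def mult_left_mono)
      have "b (t, x) \<bullet> x \<le> Cb * R'"
        by (rule order_trans[OF norm_cauchy_schwarz mult_mono[OF Cb(2)[OF xR]]]) (use xR Cb in auto)
      then have q2: "D * (b (t, x) \<bullet> x) \<le> D * (Cb * R')" using dx by (simp add: D_def mult_left_mono)
      have nx: "(norm x)\<^sup>2 \<ge> r\<^sup>2 - D"
        using tS by (simp add: D_def d_def \<sigma>_def)
      have q3: "\<delta> * (r\<^sup>2 - D) \<le> Q (t, x) \<bullet> outer x"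
        using order_trans[OF mult_left_mono[OF nx] Q_elliptic[of x "(t, x)"], of] \<delta>_pos
        by (simp add: outer_inner inner_commute[of "Q _"])
      have sq: "C * D \<le> k * D\<^sup>2 + 2 * \<delta> * r\<^sup>2"
      proof -
        have "C\<^sup>2 / (4 * k) = 2 * \<delta> * r\<^sup>2" using C r \<delta>_pos by (simp add: k_def field_simps)
        moreover have "0 \<le> k * (D - C / (2 * k))\<^sup>2" using k by simp
        moreover have "k * (D - C / (2 * k))\<^sup>2 = k * D\<^sup>2 - C * D + C\<^sup>2 / (4 * k)"
          using k by (simp add: power2_eq_square field_simps)
        ultimately show ?thesis by linarith
      qed
      have "0 < \<delta> * r\<^sup>2" using \<delta>_pos r by simp
      \<comment> \<open>Ellipticity contributes at least
        \<open>8 * \<delta> * (r\<^sup>2 - D)\<close>. Its constant part outweighs the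
        \<open>2 * \<delta> * r\<^sup>2\<close> left over by the completed square; its part in
        \<open>D\<close> has been counted in \<open>C\<close>.\<close>
      then have "2 * D * \<sigma> - k * D\<^sup>2 <
        Q (t, x) \<bullet> (8 *\<^sub>R outer x - (4 * D) *\<^sub>R mat 1) + b (t, x) \<bullet> (- (4 * D) *\<^sub>R x)"
        using q1 q2 q3 sq unfolding inner_diff_right inner_scaleR_right C_def
        by (simp add: algebra_simps)
      then have "E * (2 * D * \<sigma> - k * D\<^sup>2) <
        E * (Q (t, x) \<bullet> (8 *\<^sub>R outer x - (4 * D) *\<^sub>R mat 1) + b (t, x) \<bullet> (- (4 * D) *\<^sub>R x))"
        using E by (rule mult_strict_left_mono)
      then have "E * (2 * D * \<sigma> - k * D\<^sup>2) - wt <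
         Q (t, x) \<bullet> (E *\<^sub>R (8 *\<^sub>R outer x - (4 * D) *\<^sub>R mat 1) - H) + b (t, x) \<bullet> (E *\<^sub>R (- (4 * D) *\<^sub>R
           x) - g)"
        using wt(3) unfolding inner_diff_right[of _ "E *\<^sub>R _"] inner_scaleR_right[of _ E] distrib_left
        by linarith
      then show "(\<forall>\<^sub>F \<tau> in at_left t. (\<tau>, x) \<in> K) \<and> (\<forall>\<^sub>F y in nhds x. (t, y) \<in> K) \<and>
       (\<exists>wt g H. ((\<lambda>\<tau>. \<psi> \<tau> x - u \<tau> x) has_real_derivative wt) (at t) \<and>
          jet2 (\<lambda>x. \<psi> t x - u t x) x g H \<and> wt < Q (t, x) \<bullet> H + b (t, x) \<bullet> g)"
        using 1 2 DERIV_diff[OF dY wt(1)] jet2_diff[OF jY wt(2)] by blast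
    qed
    moreover have "m * exp (- k) \<le> \<psi> (s + 1) x1"
      using m one_le_power[OF d1, of 2] by (simp add: \<psi>_def)
    ultimately show "m * exp (- k) \<le> u (s + 1) x1" by linarith
  qed
qed

end

section \<open>Doubling of the space variable and reflection coupling\<close>

lemma norm_outer: "norm (outer (v :: real ^ 'n)) = (norm v)\<^sup>2"
proof -
  have "(norm (outer v))\<^sup>2 = ((norm v)\<^sup>2)\<^sup>2"
    unfolding power2_norm_eq_inner[of "outer v"] outer_inner outer_mult
    unfolding power2_norm_eq_inner by (simp add: power2_eq_square)
  then show ?thesis by (metis norm_ge_zero power2_eq_iff_nonneg zero_le_power2)
qed

lemma quadratic_form_le_norm: "\<bar>((M :: real ^ 'n ^ 'n) *v \<xi>) \<bullet> \<xi>\<bar> \<le> norm M * (norm \<xi>)\<^sup>2"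
  using Cauchy_Schwarz_ineq2[of "outer \<xi>" M] by (simp add: outer_inner norm_outer mult.commute)

text \<open>Along the radial direction \<open>\<eta> = z\<close> the second derivative is
  \<open>- m / 4 * r\<^sup>2\<close>, where \<open>m\<close> is r to the power -3/2, whereas it is
  positive in nonzero directions orthogonal to \<open>z\<close>. Reflection samples the first kind
  of direction, synchronous motion neither.\<close>

lemma d2_sqrt_norm:
  fixes z \<eta> :: "real ^ 'n"
  assumes z: "z \<noteq> 0"
  defines "r \<equiv> norm z"
  defines "m \<equiv> 1 / (r * sqrt r)"
  shows "d2 (\<lambda>h. sqrt (norm (z + h *\<^sub>R \<eta>))) (m / 2 * (z \<bullet> \<eta>))
     (m / 2 * (norm \<eta>)\<^sup>2 - 3 / 4 * m * (z \<bullet> \<eta>)\<^sup>2 / r\<^sup>2)"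
proof -
  \<comment> \<open>The squared norm along the line is a quadratic polynomial, so the function is a
    double square root of \<open>q\<close>.\<close>
  define q where "q h = r\<^sup>2 + 2 * h * (z \<bullet> \<eta>) + h\<^sup>2 * (norm \<eta>)\<^sup>2" for h
  have q: "norm (z + h *\<^sub>R \<eta>) = sqrt (q h)" for h
    by (metis norm_add_scaleR_sq norm_ge_zero q_def r_def real_sqrt_unique)
  have r: "r > 0" using z by (simp add: r_def)
  define d where "d h = (2 * (z \<bullet> \<eta>) + 2 * h * (norm \<eta>)\<^sup>2) * (1 / (4 * (sqrt (sqrt (q h)) * sqrt (q
    h))))" for h
  have dq: "(q has_real_derivative 2 * (z \<bullet> \<eta>) + 2 * h * (norm \<eta>)\<^sup>2) (at h)" for h
    unfolding q_def by (auto intro!: derivative_eq_intros)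
  have q0: "q 0 = r\<^sup>2" by (simp add: q_def)
  have "isCont q 0" using dq by (rule DERIV_isCont)
  then have "\<forall>\<^sub>F h in at 0. 0 < q h"
    unfolding isCont_def q0 by (rule order_tendstoD) (use r in simp)
  then have ev: "\<forall>\<^sub>F h in nhds 0. 0 < q h" using r q0 by (simp add: eventually_nhds_conv_at)
  have D1: "((\<lambda>h. sqrt (sqrt (q h))) has_real_derivative d h) (at h)" if "0 < q h" for h
    unfolding d_def using that
    by (auto intro!: derivative_eq_intros dq simp: field_simps real_sqrt_mult)
  have s0: "sqrt (q 0) = r" using r by (simp add: q0)
  have sr: "sqrt r > 0" "sqrt r * sqrt r = r" using r by auto
  have D2: "(d has_real_derivative m / 2 * (norm \<eta>)\<^sup>2 - 3 / 4 * m * (z \<bullet> \<eta>)\<^sup>2 / r\<^sup>2) (at 0)"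
  proof -
    define B where "B = z \<bullet> \<eta>"
    define N where "N = (norm \<eta>)\<^sup>2"
    define s where "s = sqrt r"
    have s: "s > 0" "r = s * s" using sr by (auto simp: s_def)
    have E1: "((\<lambda>h. sqrt (q h)) has_real_derivative B / r) (at 0)"
      using r by (auto intro!: derivative_eq_intros dq simp: q0 B_def field_simps)
    have E2: "((\<lambda>h. sqrt (sqrt (q h))) has_real_derivative B / (2 * r * s)) (at 0)"
      using D1[of 0] r by (simp add: q0 d_def B_def s_def field_simps)
    have E3: "((\<lambda>h. sqrt (sqrt (q h)) * sqrt (q h)) has_real_derivative 3 * B / (2 * s)) (at 0)"
      using DERIV_mult[OF E2 E1] s by (simp add: s0 field_simps flip: s_def)
    have E4: "((\<lambda>h. 1 / (4 * (sqrt (sqrt (q h)) * sqrt (q h)))) has_real_derivative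
        - (4 * (3 * B / (2 * s))) / (4 * (s * r))\<^sup>2) (at 0)"
    proof -
      define G where "G h = 4 * (sqrt (sqrt (q h)) * sqrt (q h))" for h
      have G0: "G 0 = 4 * (s * r)" by (simp add: G_def s0 flip: s_def)
      have "(G has_real_derivative 4 * (3 * B / (2 * s))) (at 0)"
        unfolding G_def by (rule DERIV_cmult[OF E3])
      moreover have "G 0 \<noteq> 0" using s r by (simp add: G0)
      ultimately have "((\<lambda>h. inverse (G h)) has_real_derivative
          - (inverse (G 0) * (4 * (3 * B / (2 * s))) * inverse (G 0))) (at 0)"
        by (rule DERIV_inverse')
      moreover have "- (inverse x * k * inverse x) = - k / x\<^sup>2" for k x :: real
        by (simp add: divide_inverse power2_eq_square)
      ultimately have "((\<lambda>h. inverse (G h)) has_real_derivative - (4 * (3 * B / (2 * s))) / (G 0)\<^sup>2) (at 0)"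
        by (simp only:)
      then show ?thesis unfolding G0 unfolding G_def inverse_eq_divide .
    qed
    have E5: "((\<lambda>h. 2 * B + 2 * h * N) has_real_derivative 2 * N) (at 0)"
      by (auto intro!: derivative_eq_intros)
    have "(d has_real_derivative (2 * N) * (1 / (4 * (s * r))) +
        (- (4 * (3 * B / (2 * s))) / (4 * (s * r))\<^sup>2) * (2 * B)) (at 0)"
      using DERIV_mult[OF E5 E4] unfolding d_def[abs_def] B_def[symmetric] N_def[symmetric]
      by (simp add: s0 flip: s_def)
    moreover have "(2 * N) * (1 / (4 * (s * r))) + (- (4 * (3 * B / (2 * s))) / (4 * (s * r))\<^sup>2) * (2 * B)
       = m / 2 * N - 3 / 4 * m * B\<^sup>2 / r\<^sup>2"
      unfolding m_def s_def[symmetric] s(2) using s(1) by (simp add: field_simps power2_eq_square)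
    ultimately show ?thesis by (simp add: B_def N_def)
  qed
  show ?thesis unfolding q d2_def
  proof (intro exI[of _ d] conjI D2)
    show "\<forall>\<^sub>F h in nhds 0. ((\<lambda>h. sqrt (sqrt (q h))) has_real_derivative d h) (at h)"
      using ev by eventually_elim (rule D1)
    show "d 0 = m / 2 * (z \<bullet> \<eta>)" using r by (simp add: d_def s0 m_def field_simps)
  qed
qed

text \<open>The coupling matrix of the doubled equation moves the common part of \<open>Q1\<close> and \<open>Q2\<close>
  synchronously, reflects along \<open>z\<close>, and treats the small remainders independently.\<close>

lemma reflection_coupling:
  fixes Q1 Q2 H1 H2 :: "real ^ 'n ^ 'n" and z :: "real ^ 'n"
  defines "n0 \<equiv> norm (mat 1 :: real ^ 'n ^ 'n)"
  assumes psd: "psd Q1" "psd Q2" and ell: "\<And>\<xi>. \<delta> * (norm \<xi>)\<^sup>2 \<le> (Q1 *v \<xi>) \<bullet> \<xi>"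
    and z: "z \<noteq> 0" and \<delta>: "\<delta> > 0" and \<omega>: "0 \<le> \<omega>" "\<omega> \<le> \<delta> / 2" "norm (Q2 - Q1) \<le> \<omega>"
    and A: "A \<ge> 0"
    and sync: "\<And>\<xi>. ((H1 - H2) *v \<xi>) \<bullet> \<xi> \<le> 8 * (norm \<xi>)\<^sup>2"
    and refl: "((H1 - H2) *v z) \<bullet> z \<le> (8 - A) * (norm z)\<^sup>2"
    and ind1: "\<And>\<xi>. (H1 *v \<xi>) \<bullet> \<xi> \<le> (A / 2 + 4) * (norm \<xi>)\<^sup>2"
    and ind2: "\<And>\<xi>. ((- H2) *v \<xi>) \<bullet> \<xi> \<le> (A / 2 + 4) * (norm \<xi>)\<^sup>2"
  shows "Q1 \<bullet> H1 - Q2 \<bullet> H2 \<le>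
    8 * (n0 * norm Q1) + \<delta> / 2 * (8 - A) + \<omega> * (2 * n0\<^sup>2 + n0) * (A / 2 + 4)"
proof -
  have z2: "(norm z)\<^sup>2 > 0" using z by simp
  \<comment> \<open>\<open>Q1\<close> is split as \<open>M + R + \<omega> *\<^sub>R mat 1\<close>
    and \<open>Q2\<close> as \<open>M + R + E\<close>. Ellipticity leaves room in \<open>M\<close>:
    half of \<open>\<delta>\<close> is spent on the reflected part \<open>R\<close> and at most
    another half on \<open>\<omega>\<close>; adding \<open>\<omega>\<close> also makes
    \<open>E\<close> positive semidefinite.\<close>
  define R where "R = (\<delta> / 2 / (norm z)\<^sup>2) *\<^sub>R outer z"
  define M where "M = Q1 - R - \<omega> *\<^sub>R mat 1"
  define E where "E = Q2 - Q1 + \<omega> *\<^sub>R mat 1"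
  have I: "psd (\<omega> *\<^sub>R mat 1 :: real ^ 'n ^ 'n)"
    using \<omega> by (simp add: psd_def transpose_scaleR_mat mat_scaleR_mult)
  have Rx: "(R *v \<xi>) \<bullet> \<xi> \<le> \<delta> / 2 * (norm \<xi>)\<^sup>2" for \<xi>
  proof -
    have "(z \<bullet> \<xi>)\<^sup>2 \<le> (norm z)\<^sup>2 * (norm \<xi>)\<^sup>2"
      using Cauchy_Schwarz_ineq[of z \<xi>] by (simp add: power2_norm_eq_inner)
    then have "\<delta> / 2 / (norm z)\<^sup>2 * (z \<bullet> \<xi>)\<^sup>2 \<le> \<delta> / 2 / (norm z)\<^sup>2 * ((norm z)\<^sup>2 * (norm \<xi>)\<^sup>2)"
      using \<delta> z2 by (intro mult_left_mono) auto
    also have "\<dots> = \<delta> / 2 * (norm \<xi>)\<^sup>2" using z2 by (simp add: field_simps)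
    finally show ?thesis
      by (simp add: R_def scaleR_matrix_vector outer_mult power2_eq_square)
  qed
  have "psd M"
    unfolding psd_def
  proof (intro conjI allI)
    show "transpose M = M"
      using psd(1) by (simp add: M_def R_def psd_def transpose_diff_mat transpose_scaleR_mat transpose_outer)
    fix \<xi> :: "real ^ 'n"
    have "\<omega> * (norm \<xi>)\<^sup>2 \<le> \<delta> / 2 * (norm \<xi>)\<^sup>2" using \<omega> by (intro mult_right_mono) auto
    then have "0 \<le> (Q1 *v \<xi>) \<bullet> \<xi> - (R *v \<xi>) \<bullet> \<xi> - \<omega> * (norm \<xi>)\<^sup>2"
      using Rx[of \<xi>] ell[of \<xi>] by simp
    then show "0 \<le> (M *v \<xi>) \<bullet> \<xi>"
      by (simp add: M_def matrix_vector_mult_diff_rdistrib mat_scaleR_mult inner_diff_left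
        power2_norm_eq_inner)
  qed
  from psd_inner_le[OF this sync] have 1: "M \<bullet> (H1 - H2) \<le> 8 * trace M" .
  have "psd E"
    unfolding psd_def
  proof (intro conjI allI)
    show "transpose E = E"
      using psd by (simp add: E_def psd_def transpose_diff_mat transpose_add_mat transpose_scaleR_mat)
    fix \<xi> :: "real ^ 'n"
    have "norm (Q2 - Q1) * (norm \<xi>)\<^sup>2 \<le> \<omega> * (norm \<xi>)\<^sup>2" using \<omega> by (intro mult_right_mono) auto
    then have "0 \<le> ((Q2 - Q1) *v \<xi>) \<bullet> \<xi> + \<omega> * (norm \<xi>)\<^sup>2"
      using quadratic_form_le_norm[of "Q2 - Q1" \<xi>] by linarith
    then show "0 \<le> (E *v \<xi>) \<bullet> \<xi>"
      by (simp add: E_def matrix_vector_mult_add_rdistrib mat_scaleR_mult inner_add_left power2_norm_eq_inner)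
  qed
  from psd_inner_le[OF this ind2] have 2: "E \<bullet> (- H2) \<le> (A / 2 + 4) * trace E" .
  from psd_inner_le[OF I ind1] have 3: "(\<omega> *\<^sub>R mat 1) \<bullet> H1 \<le> (A / 2 + 4) * (\<omega> * n0\<^sup>2)"
    by (simp add: trace_eq_inner n0_def power2_norm_eq_inner)
  have "R \<bullet> (H1 - H2) = \<delta> / 2 / (norm z)\<^sup>2 * (((H1 - H2) *v z) \<bullet> z)" by (simp add: R_def outer_inner)
  also have "\<dots> \<le> \<delta> / 2 / (norm z)\<^sup>2 * ((8 - A) * (norm z)\<^sup>2)"
    using \<delta> z2 by (intro mult_left_mono refl) auto
  finally have 4: "R \<bullet> (H1 - H2) \<le> \<delta> / 2 * (8 - A)" using z2 by simp
  have n0: "n0 \<ge> 0" by (simp add: n0_def)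
  have "0 \<le> trace R" using \<delta> by (simp add: R_def trace_eq_inner inner_commute[of _ "outer z"] outer_inner)
  moreover have "0 \<le> trace (\<omega> *\<^sub>R mat 1 :: real ^ 'n ^ 'n)" using \<omega> by (simp add: trace_eq_inner)
  ultimately have "trace M \<le> trace Q1" by (simp add: M_def trace_eq_inner inner_diff_right)
  also have "\<dots> \<le> n0 * norm Q1" unfolding trace_eq_inner n0_def by (rule norm_cauchy_schwarz)
  finally have 5: "trace M \<le> n0 * norm Q1" .
  have "mat 1 \<bullet> (Q2 - Q1) \<le> n0 * norm (Q2 - Q1)" unfolding n0_def by (rule norm_cauchy_schwarz)
  also have "\<dots> \<le> n0 * \<omega>" using \<omega> n0 by (intro mult_left_mono) auto
  finally have "trace E \<le> \<omega> * (n0\<^sup>2 + n0)"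
    by (simp add: E_def trace_eq_inner inner_add_right n0_def power2_norm_eq_inner algebra_simps)
  then have 6: "(A / 2 + 4) * trace E \<le> (A / 2 + 4) * (\<omega> * (n0\<^sup>2 + n0))"
    using A by (intro mult_left_mono) auto
  have "Q1 \<bullet> H1 - Q2 \<bullet> H2 = M \<bullet> (H1 - H2) + R \<bullet> (H1 - H2) + (\<omega> *\<^sub>R mat 1) \<bullet> H1 + E \<bullet> (- H2)"
    by (simp add: M_def E_def inner_diff_left inner_diff_right inner_add_left algebra_simps)
  also have "\<dots> \<le> 8 * (n0 * norm Q1) + \<delta> / 2 * (8 - A) + (A / 2 + 4) * (\<omega> * n0\<^sup>2) + (A / 2 + 4) * (\<omega> *
    (n0\<^sup>2 + n0))"
    using 1 2 3 4 5 6 by linarith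
  also have "\<dots> = 8 * (n0 * norm Q1) + \<delta> / 2 * (8 - A) + \<omega> * (2 * n0\<^sup>2 + n0) * (A / 2 + 4)"
    by (simp add: algebra_simps)
  finally show ?thesis .
qed

context lyapunov_operator
begin

text \<open>Uniform continuity over one period and the unit ball; periodicity extends it to all
  times.\<close>

lemma Q_uniform:
  assumes "\<omega> > 0"
  shows "\<exists>r>0. \<forall>t x y. norm x \<le> 1 \<longrightarrow> norm y \<le> 1 \<longrightarrow> norm (x - y) \<le> r \<longrightarrow> norm (Q (t, y) - Q (t, x)) \<le> \<omega>"
proof -
  have "uniformly_continuous_on ({0..T} \<times> cball 0 1) Q"
    by (intro compact_uniformly_continuous continuous_on_subset[OF Q_cont] compact_Times) auto
  then obtain r where r: "r > 0" "\<And>z z'. z \<in> {0..T} \<times> cball 0 1 \<Longrightarrow> z' \<in> {0..T} \<times> cball 0 1 \<Longrightarrow>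
      dist z' z < r \<Longrightarrow> dist (Q z') (Q z) < \<omega>" using assms unfolding uniformly_continuous_on_def by metis
  show ?thesis
  proof (intro exI[of _ "r / 2"] conjI allI impI)
    show "r / 2 > 0" using r by simp
    fix t and x y :: "real ^ 'n" assume x: "norm x \<le> 1" "norm y \<le> 1" "norm (x - y) \<le> r / 2"
    obtain n where n: "0 \<le> t + real n * T \<and> t + real n * T \<le> T \<or>
      0 \<le> t - real n * T \<and> t - real n * T \<le> T" using periodic_shift_obtains[OF T_pos] .
    then obtain t' where t': "0 \<le> t'" "t' \<le> T" "\<And>x. Q (t', x) = Q (t, x)"
      using periodic_multiple[OF Q_per] by metis
    have "dist (Q (t', y)) (Q (t', x)) < \<omega>"
      by (rule r(2)) (use x t' r(1) in \<open>auto simp: dist_Pair_Pair dist_norm norm_minus_commute\<close>)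
    then show "norm (Q (t, y) - Q (t, x)) \<le> \<omega>" using t'(3) by (simp add: dist_norm)
  qed
qed

text \<open>The functional \<open>\<Phi>\<close> is maximised over a compact set of times and pairs
  of points. Its penalties \<open>2 * (norm x)\<^sup>2\<close>, \<open>2 * (norm y)\<^sup>2\<close>
  and \<open>2 * (s + 1 - t)\<close> each reach 2, the largest possible difference of two values, at
  the edge they guard, so a positive maximum lies off the unit spheres and after time
  \<open>s\<close>. There the concavity of the square root contradicts the equation.\<close>

lemma local_oscillation:
  "\<exists>r>0. \<forall>s u. psol s u (\<lambda>_ _. 0) \<longrightarrow> (\<forall>t x. s \<le> t \<longrightarrow> \<bar>u t x\<bar> \<le> 1) \<longrightarrow>
     (\<forall>x. norm x \<le> r \<longrightarrow> u (s + 1) x - u (s + 1) 0 \<le> 1 / 2)"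
proof -
  define n0 where "n0 = norm (mat 1 :: real ^ 'n ^ 'n)"
  obtain Cq where Cq: "Cq > 0" "\<And>s x. norm x \<le> 1 \<Longrightarrow> norm (Q (s, x)) \<le> Cq"
    using Q_bounded[of 1] by auto
  obtain Cb where Cb: "Cb > 0" "\<And>s x. norm x \<le> 1 \<Longrightarrow> norm (b (s, x)) \<le> Cb"
    using b_bounded[of 1] by auto
  have n0: "n0 \<ge> 0" by (simp add: n0_def)
  define \<kappa> where "\<kappa> = 2 * n0\<^sup>2 + n0 + 1"
  have \<kappa>: "\<kappa> \<ge> 1" using n0 by (simp add: \<kappa>_def)
  \<comment> \<open>The mismatch of \<open>Q\<close> at the two points then costs at most
    \<open>\<delta> / 8 * A\<close> plus a constant in the coupling estimate.\<close>
  define \<omega> where "\<omega> = \<delta> / (4 * \<kappa>)"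
  have \<omega>: "\<omega> > 0" "\<omega> \<le> \<delta> / 2" "\<omega> * (2 * n0\<^sup>2 + n0) \<le> \<delta> / 4"
  proof -
    show "\<omega> > 0" using \<delta>_pos \<kappa> by (simp add: \<omega>_def)
    have "\<delta> / (4 * \<kappa>) \<le> \<delta> / 2" using \<delta>_pos \<kappa> by (intro divide_left_mono) auto
    then show "\<omega> \<le> \<delta> / 2" by (simp add: \<omega>_def)
    have "\<omega> * (2 * n0\<^sup>2 + n0) \<le> \<omega> * \<kappa>" using \<open>\<omega> > 0\<close> by (simp add: \<kappa>_def)
    also have "\<omega> * \<kappa> = \<delta> / 4" using \<kappa> by (simp add: \<omega>_def)
    finally show "\<omega> * (2 * n0\<^sup>2 + n0) \<le> \<delta> / 4" .
  qed
  obtain r1 where r1: "r1 > 0" "\<And>t x y. norm x \<le> 1 \<Longrightarrow> norm y \<le> 1 \<Longrightarrow> norm (x - y) \<le> r1 \<Longrightarrow>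
      norm (Q (t, y) - Q (t, x)) \<le> \<omega>" using Q_uniform[OF \<omega>(1)] by blast
  \<comment> \<open>Within this distance the coefficient matrices differ by at most
    \<open>\<omega>\<close>, the weight \<open>m\<close> of the square root is at least 1, and the
    drift contributes at most \<open>\<delta> / 8 * A\<close> plus a constant.\<close>
  define r0 where "r0 = min (min r1 1) (\<delta> / (8 * Cb))"
  have r0: "r0 > 0" "r0 \<le> r1" "r0 \<le> 1" "r0 * Cb \<le> \<delta> / 8"
  proof -
    show "r0 > 0" "r0 \<le> r1" "r0 \<le> 1" using r1 \<delta>_pos Cb by (auto simp: r0_def)
    have "r0 * Cb \<le> \<delta> / (8 * Cb) * Cb" using Cb by (intro mult_right_mono) (auto simp: r0_def)
    then show "r0 * Cb \<le> \<delta> / 8" using Cb by simp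
  qed
  \<comment> \<open>\<open>C\<close> gathers everything free of \<open>A\<close>, including the 2
    from the time penalty. The terms in \<open>A\<close> add up to -1/2 + 1/8 + 1/8 = -1/4 times
    \<open>\<delta> * A\<close>.\<close>
  define C where "C = 8 * (n0 * Cq) + 4 * \<delta> + \<delta> + 8 * Cb + 2"
  have C: "C > 0" using n0 Cq Cb \<delta>_pos by (simp add: C_def add_nonneg_pos)
  \<comment> \<open>The first summand keeps the two points of a positive maximum closer than
    \<open>r0\<close>; the second makes \<open>\<delta> / 4 * L\<close> exceed
    \<open>C\<close>.\<close>
  define L where "L = 2 / sqrt r0 + C * (4 / \<delta>) + 1"
  have L: "L > 0" "L * sqrt r0 > 2" "\<delta> / 4 * L > C"
  proof -
    have s0: "sqrt r0 > 0" using r0 by simp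
    show "L > 0" using s0 C \<delta>_pos by (simp add: L_def add_pos_pos)
    have "0 < (C * (4 / \<delta>) + 1) * sqrt r0" using s0 C \<delta>_pos by (intro mult_pos_pos add_pos_pos) auto
    moreover have "L * sqrt r0 = 2 + (C * (4 / \<delta>) + 1) * sqrt r0"
      using s0 by (simp add: L_def algebra_simps)
    ultimately show "L * sqrt r0 > 2" by simp
    have "\<delta> / 4 * (C * (4 / \<delta>)) < \<delta> / 4 * L" using s0 \<delta>_pos
      by (intro mult_strict_left_mono) (auto simp: L_def add_pos_pos)
    then show "\<delta> / 4 * L > C" using \<delta>_pos by simp
  qed
  have main: "u (s + 1) x - u (s + 1) y \<le> L * sqrt (norm (x - y)) + 2 * (norm x)\<^sup>2 + 2 * (norm y)\<^sup>2"
    if u: "psol s u (\<lambda>_ _. 0)" and u1: "\<And>t x. s \<le> t \<Longrightarrow> \<bar>u t x\<bar> \<le> 1" and xy: "norm x \<le> 1" "norm y \<le>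
      1" for s u x y
  proof (rule ccontr)
    assume neg: "\<not> ?thesis"
    define \<Phi> where "\<Phi> t x y = u t x - u t y - L * sqrt (norm (x - y)) - 2 * (norm x)\<^sup>2 - 2 * (norm y)\<^sup>2
      - 2 * (s + 1 - t)" for t x y
    define K where "K = {s..s + 1} \<times> (cball (0 :: real ^ 'n) 1 \<times> cball (0 :: real ^ 'n) 1)"
    have "compact K" unfolding K_def by (intro compact_Times) auto
    moreover have "(s + 1, x, y) \<in> K" using xy by (auto simp: K_def)
    moreover have "continuous_on K (\<lambda>z. \<Phi> (fst z) (fst (snd z)) (snd (snd z)))"
    proof -
      have uc: "continuous_on ({s..} \<times> UNIV) (\<lambda>z. u (fst z) (snd z))"
        using u by (auto simp: psol_def case_prod_beta')
      have c1: "continuous_on K (\<lambda>z. u (fst z) (fst (snd z)))"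
        by (rule continuous_on_compose2[OF uc, where f = "\<lambda>z. (fst z, fst (snd z))", simplified])
          (auto simp: K_def intro!: continuous_intros)
      have c2: "continuous_on K (\<lambda>z. u (fst z) (snd (snd z)))"
        by (rule continuous_on_compose2[OF uc, where f = "\<lambda>z. (fst z, snd (snd z))", simplified])
          (auto simp: K_def intro!: continuous_intros)
      show ?thesis unfolding \<Phi>_def by (intro continuous_intros c1 c2)
    qed
    ultimately obtain z0 where "z0 \<in> K" "\<And>z. z \<in> K \<Longrightarrow>
        \<Phi> (fst z) (fst (snd z)) (snd (snd z)) \<le> \<Phi> (fst z0) (fst (snd z0)) (snd (snd z0))"
      using continuous_attains_sup[of K "\<lambda>z. \<Phi> (fst z) (fst (snd z)) (snd (snd z))"] by blast
    then obtain t x0 y0 where K0: "(t, x0, y0) \<in> K"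
      and max: "\<And>\<tau> x y. (\<tau>, x, y) \<in> K \<Longrightarrow> \<Phi> \<tau> x y \<le> \<Phi> t x0 y0"
      by (metis fst_conv prod.collapse snd_conv)
    have "0 < \<Phi> (s + 1) x y" using neg by (simp add: \<Phi>_def)
    then have pos: "0 < \<Phi> t x0 y0" using max[OF \<open>(s + 1, x, y) \<in> K\<close>] by linarith
    have tS: "s \<le> t" "t \<le> s + 1" and nx: "norm x0 \<le> 1" and ny: "norm y0 \<le> 1" using K0 by (auto simp: K_def)
    define z where "z = x0 - y0"
    define r where "r = norm z"
    have du: "u t x0 - u t y0 \<le> 2" using u1[OF tS(1), of x0] u1[OF tS(1), of y0] by linarith
    have p0: "0 \<le> L * sqrt r" "0 \<le> (norm x0)\<^sup>2" "0 \<le> (norm y0)\<^sup>2" using L by (auto simp: r_def)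
    have pos': "L * sqrt r + 2 * (norm x0)\<^sup>2 + 2 * (norm y0)\<^sup>2 + 2 * (s + 1 - t) < u t x0 - u t y0"
      using pos by (simp add: \<Phi>_def r_def z_def)
    have "t \<noteq> s"
    proof
      assume "t = s"
      then have "2 * (s + 1 - t) = 2" by simp
      moreover have "2 * (s + 1 - t) < u t x0 - u t y0" using pos' p0 by argo
      ultimately show False using du by simp
    qed
    then have ts: "s < t" using tS by simp
    have nx': "norm x0 < 1"
      using pos' p0 du tS nx by (cases "norm x0 = 1") auto
    have ny': "norm y0 < 1"
      using pos' p0 du tS ny by (cases "norm y0 = 1") auto
    have "0 < u t x0 - u t y0" using pos' p0 tS by argo
    then have z: "z \<noteq> 0" by (auto simp: z_def)
    then have r: "r > 0" by (simp add: r_def)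
    have "L * sqrt r < L * sqrt r0" using pos' p0 du tS L(2) by argo
    then have rr0: "r < r0" using L(1) by simp
    obtain u1t g1 H1 where j1:
      "((\<lambda>\<tau>. u \<tau> x0) has_real_derivative u1t) (at t)" "jet2 (u t) x0 g1 H1"
      "u1t = Q (t, x0) \<bullet> H1 + b (t, x0) \<bullet> g1"
      using u ts unfolding psol_def by (metis add.right_neutral)
    obtain u2t g2 H2 where j2:
      "((\<lambda>\<tau>. u \<tau> y0) has_real_derivative u2t) (at t)" "jet2 (u t) y0 g2 H2"
      "u2t = Q (t, y0) \<bullet> H2 + b (t, y0) \<bullet> g2"
      using u ts unfolding psol_def by (metis add.right_neutral)
    \<comment> \<open>A negative time derivative of \<open>\<Phi>\<close> would give a larger value
      at an earlier time. The rest of the proof contradicts this inequality.\<close>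
    have "0 \<le> u1t - u2t + 2"
    proof (rule ccontr)
      assume "\<not> ?thesis"
      then have "u1t - u2t + 2 < 0" by simp
      moreover have "((\<lambda>\<tau>. \<Phi> \<tau> x0 y0) has_real_derivative u1t - u2t + 2) (at t)"
        unfolding \<Phi>_def by (auto intro!: derivative_eq_intros j1 j2)
      ultimately obtain d where d: "d > 0" "\<And>h. 0 < h \<Longrightarrow> h < d \<Longrightarrow> \<Phi> t x0 y0 < \<Phi> (t - h) x0 y0"
        using DERIV_neg_dec_left by blast
      define h where "h = min d (t - s) / 2"
      have h: "0 < h" "h < d" "h < t - s" using d ts by (auto simp: h_def)
      then have "(t - h, x0, y0) \<in> K" using tS nx ny by (auto simp: K_def)
      then show False using max d(2)[OF h(1,2)] by fastforce
    qed
    define m where "m = 1 / (r * sqrt r)"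
    have m: "m \<ge> 1"
    proof -
      have "r * sqrt r \<le> 1 * 1" using r rr0 r0 by (intro mult_mono) auto
      then show ?thesis using r by (simp add: m_def)
    qed
    \<comment> \<open>The maximum is tested along lines on which both points move, with velocities
      \<open>\<xi>\<close> and \<open>\<zeta>\<close>. The choice (\<open>\<xi>\<close>,
      \<open>\<xi>\<close>) is the synchronous motion, which leaves the distance fixed;
      (\<open>z\<close>, \<open>- z\<close>) is the reflection; moving one point alone gives the
      gradients and the crude bounds on \<open>H1\<close> and \<open>- H2\<close>.\<close>
    have dir: "g1 \<bullet> \<xi> - g2 \<bullet> \<zeta> - L * (m / 2 * (z \<bullet> (\<xi> - \<zeta>))) - 4 * (x0 \<bullet> \<xi>) - 4 * (y0 \<bullet> \<zeta>) = 0 \<and>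
      (H1 *v \<xi>) \<bullet> \<xi> - (H2 *v \<zeta>) \<bullet> \<zeta> -
        L * (m / 2 * (norm (\<xi> - \<zeta>))\<^sup>2 - 3 / 4 * m * (z \<bullet> (\<xi> - \<zeta>))\<^sup>2 / r\<^sup>2)
        - 4 * (norm \<xi>)\<^sup>2 - 4 * (norm \<zeta>)\<^sup>2 \<le> 0" for \<xi> \<zeta>
    proof -
      define F where "F h = u t (x0 + h *\<^sub>R \<xi>) - u t (y0 + h *\<^sub>R \<zeta>) - L * sqrt (norm (z + h *\<^sub>R (\<xi> - \<zeta>)))
         - 2 * (norm (x0 + h *\<^sub>R \<xi> - 0))\<^sup>2 - 2 * (norm (y0 + h *\<^sub>R \<zeta> - 0))\<^sup>2" for h
      have FP: "F h = \<Phi> t (x0 + h *\<^sub>R \<xi>) (y0 + h *\<^sub>R \<zeta>) + 2 * (s + 1 - t)" for h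
        by (simp add: F_def \<Phi>_def z_def algebra_simps)
      have d2F: "d2 F (g1 \<bullet> \<xi> - g2 \<bullet> \<zeta> - L * (m / 2 * (z \<bullet> (\<xi> - \<zeta>))) - 2 * ((2 *\<^sub>R (x0 - 0)) \<bullet> \<xi>) - 2 *
        ((2 *\<^sub>R (y0 - 0)) \<bullet> \<zeta>))
       ((H1 *v \<xi>) \<bullet> \<xi> - (H2 *v \<zeta>) \<bullet> \<zeta> -
        L * (m / 2 * (norm (\<xi> - \<zeta>))\<^sup>2 - 3 / 4 * m * (z \<bullet> (\<xi> - \<zeta>))\<^sup>2 / r\<^sup>2)
        - 2 * (((2 *\<^sub>R mat 1) *v \<xi>) \<bullet> \<xi>) - 2 * (((2 *\<^sub>R mat 1) *v \<zeta>) \<bullet> \<zeta>))"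
        unfolding F_def[abs_def] m_def r_def
        by (intro d2_diff d2_cmult d2_sqrt_norm z)
          (use j1(2) j2(2) jet2_norm_sq[of 0 x0] jet2_norm_sq[of 0 y0] in \<open>simp_all add: jet2_def\<close>)
      have "\<forall>\<^sub>F h in nhds 0. x0 + h *\<^sub>R \<xi> \<in> ball 0 1 \<and> y0 + h *\<^sub>R \<zeta> \<in> ball 0 1"
      proof (intro eventually_conj)
        have "\<forall>\<^sub>F h in nhds 0. (v + h *\<^sub>R \<nu>) \<in> ball 0 1" if "norm v < 1" for v \<nu> :: "real ^ 'n"
        proof -
          have "((\<lambda>h. v + h *\<^sub>R \<nu>) \<longlongrightarrow> v + 0 *\<^sub>R \<nu>) (nhds (0::real))"
            by (intro tendsto_intros filterlim_ident)
          then show ?thesis by (rule topological_tendstoD) (use that in auto)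
        qed
        then show "\<forall>\<^sub>F h in nhds 0. x0 + h *\<^sub>R \<xi> \<in> ball 0 1" "\<forall>\<^sub>F h in nhds 0. y0 + h *\<^sub>R \<zeta> \<in> ball 0 1"
          using nx' ny' by auto
      qed
      then have "\<forall>\<^sub>F h in nhds 0. F h \<le> F 0"
      proof eventually_elim
        case (elim h)
        then have "(t, x0 + h *\<^sub>R \<xi>, y0 + h *\<^sub>R \<zeta>) \<in> K" using tS by (auto simp: K_def)
        from max[OF this] show ?case unfolding FP by simp
      qed
      from d2_local_max[OF d2F this] show ?thesis
        by (simp add: mat_scaleR_mult power2_norm_eq_inner)
    qed
    define A where "A = L * m"
    have A: "A \<ge> L" using mult_left_mono[OF m, of L] L by (simp add: A_def)
    have rz: "z \<bullet> z = r\<^sup>2" by (simp add: r_def power2_norm_eq_inner)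
    have g1: "g1 = (A / 2) *\<^sub>R z + 4 *\<^sub>R x0"
    proof -
      have "g1 \<bullet> \<xi> = ((A / 2) *\<^sub>R z + 4 *\<^sub>R x0) \<bullet> \<xi>" for \<xi>
        using dir[of \<xi> 0] by (simp add: A_def inner_add_left)
      then show ?thesis using vector_eq_rdot by blast
    qed
    have g2: "g2 = (A / 2) *\<^sub>R z - 4 *\<^sub>R y0"
    proof -
      have "g2 \<bullet> \<xi> = ((A / 2) *\<^sub>R z - 4 *\<^sub>R y0) \<bullet> \<xi>" for \<xi>
        using dir[of 0 \<xi>] by (simp add: A_def inner_diff_left)
      then show ?thesis using vector_eq_rdot by blast
    qed
    have sq: "0 \<le> L * (3 / 4 * m * w\<^sup>2 / r\<^sup>2)" for w
      using L m by (intro mult_nonneg_nonneg divide_nonneg_nonneg) auto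
    have "Q (t, x0) \<bullet> H1 - Q (t, y0) \<bullet> H2 \<le>
      8 * (n0 * norm (Q (t, x0))) + \<delta> / 2 * (8 - A) + \<omega> * (2 * n0\<^sup>2 + n0) * (A / 2 + 4)"
      unfolding n0_def
    proof (rule reflection_coupling[OF psd_Q psd_Q Q_elliptic z \<delta>_pos])
      show "0 \<le> \<omega>" "\<omega> \<le> \<delta> / 2" using \<omega> by auto
      show "norm (Q (t, y0) - Q (t, x0)) \<le> \<omega>"
        by (rule r1(2)[OF nx ny]) (use rr0 r0 in \<open>simp add: r_def z_def\<close>)
      show "0 \<le> A" using A L by simp
      show "((H1 - H2) *v \<xi>) \<bullet> \<xi> \<le> 8 * (norm \<xi>)\<^sup>2" for \<xi>
        using dir[of \<xi> \<xi>] by (simp add: matrix_vector_mult_diff_rdistrib inner_diff_left)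
      \<comment> \<open>For the reflected motion the difference moves by
        \<open>2 *\<^sub>R z\<close>, so the second derivative of the square root is 2 - 3 = -1
        times \<open>m * r\<^sup>2\<close>. This produces the term \<open>- A\<close>.\<close>
      have zz: "z - - z = 2 *\<^sub>R z" by (simp add: scaleR_2)
      have e1: "(norm (2 *\<^sub>R z))\<^sup>2 = 4 * r\<^sup>2" by (simp add: r_def power_mult_distrib)
      have e2: "(z \<bullet> (2 *\<^sub>R z))\<^sup>2 / r\<^sup>2 = 4 * r\<^sup>2" using r by (simp add: rz power2_eq_square)
      have mm: "m / 2 * (norm (2 *\<^sub>R z))\<^sup>2 - 3 / 4 * m * (z \<bullet> (2 *\<^sub>R z))\<^sup>2 / r\<^sup>2 = - m * r\<^sup>2"
        unfolding times_divide_eq_right[symmetric] e1 e2 by (simp add: algebra_simps)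
      have "H2 *v (- z) = - (H2 *v z)" using matrix_vector_mult_diff_distrib[of H2 0 z] by simp
      then have "(H1 *v z) \<bullet> z - (H2 *v z) \<bullet> z - L * (- m * r\<^sup>2) - 4 * r\<^sup>2 - 4 * r\<^sup>2 \<le> 0"
        using conjunct2[OF dir[of z "- z"]] unfolding zz mm by (simp flip: r_def)
      then show "((H1 - H2) *v z) \<bullet> z \<le> (8 - A) * (norm z)\<^sup>2"
        by (simp add: matrix_vector_mult_diff_rdistrib inner_diff_left A_def r_def algebra_simps)
      show "(H1 *v \<xi>) \<bullet> \<xi> \<le> (A / 2 + 4) * (norm \<xi>)\<^sup>2" for \<xi>
        using dir[of \<xi> 0] sq[of "z \<bullet> \<xi>"] by (simp add: A_def right_diff_distrib distrib_right)
      show "((- H2) *v \<xi>) \<bullet> \<xi> \<le> (A / 2 + 4) * (norm \<xi>)\<^sup>2" for \<xi>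
        using dir[of 0 \<xi>] sq[of "z \<bullet> \<xi>"] matrix_vector_mult_diff_rdistrib[of 0 H2 \<xi>]
        by (simp add: A_def right_diff_distrib distrib_right)
    qed
    moreover have "n0 * norm (Q (t, x0)) \<le> n0 * Cq" using n0 Cq(2)[OF nx] by (rule mult_left_mono[rotated])
    moreover have "\<omega> * (2 * n0\<^sup>2 + n0) * (A / 2 + 4) \<le> \<delta> / 4 * (A / 2 + 4)"
      using \<omega>(3) A L by (intro mult_right_mono) auto
    moreover have "b (t, x0) \<bullet> g1 - b (t, y0) \<bullet> g2 \<le> A * (\<delta> / 8) + 8 * Cb"
    proof -
      have i: "b (t, v) \<bullet> w \<le> Cb * k" "- (b (t, v) \<bullet> w) \<le> Cb * k" if "norm v \<le> 1" "norm w \<le>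
        k" for v w :: "real ^ 'n" and k
      proof -
        have "\<bar>b (t, v) \<bullet> w\<bar> \<le> norm (b (t, v)) * norm w" by (rule Cauchy_Schwarz_ineq2)
        also have "\<dots> \<le> Cb * k" using Cb that by (intro mult_mono) auto
        finally show "b (t, v) \<bullet> w \<le> Cb * k" "- (b (t, v) \<bullet> w) \<le> Cb * k" by auto
      qed
      have rC: "r * Cb \<le> \<delta> / 8"
        by (rule order_trans[OF mult_right_mono r0(4)]) (use rr0 Cb(1) in auto)
      have "b (t, x0) \<bullet> z - b (t, y0) \<bullet> z \<le> 2 * (Cb * r)"
        using i(1)[OF nx, of z r] i(2)[OF ny, of z r] by (simp add: r_def)
      also have "2 * (Cb * r) \<le> 2 * (\<delta> / 8)" using rC by (simp add: mult.commute)
      finally have "A / 2 * (b (t, x0) \<bullet> z - b (t, y0) \<bullet> z) \<le> A / 2 * (2 * (\<delta> / 8))"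
        using A L by (intro mult_left_mono) auto
      then show ?thesis using i(1)[OF nx, of x0 1] i(1)[OF ny, of y0 1] nx ny
        by (simp add: g1 g2 inner_add_right inner_diff_right right_diff_distrib)
    qed
    moreover have "\<delta> / 4 * L \<le> \<delta> / 4 * A" using A \<delta>_pos by (intro mult_left_mono) auto
    ultimately have "u1t - u2t + 2 < 0"
      using L(3) unfolding j1(3) j2(3) C_def by (simp add: algebra_simps)
    then show False using \<open>0 \<le> u1t - u2t + 2\<close> by simp
  qed
  \<comment> \<open>The three penalties at (\<open>x\<close>, 0) are then at most 1/4, 1/8 and
    0.\<close>
  define r where "r = min (1 / 4) ((1 / (4 * L))\<^sup>2)"
  have r: "r > 0" "r \<le> 1 / 4" using L by (auto simp: r_def)
  have "sqrt r \<le> sqrt ((1 / (4 * L))\<^sup>2)" unfolding r_def by (rule real_sqrt_le_mono) simp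
  also have "\<dots> = 1 / (4 * L)" using L by (simp add: real_sqrt_abs)
  finally have sr: "L * sqrt r \<le> 1 / 4" using L by (simp add: field_simps)
  show ?thesis
  proof (intro exI[of _ r] conjI allI impI r(1))
    fix s u and x :: "real ^ 'n"
    assume u: "psol s u (\<lambda>_ _. 0)" "\<forall>t x. s \<le> t \<longrightarrow> \<bar>u t x\<bar> \<le> 1" and x: "norm x \<le> r"
    have "u (s + 1) x - u (s + 1) 0 \<le>
      L * sqrt (norm (x - 0)) + 2 * (norm x)\<^sup>2 + 2 * (norm (0 :: real ^ 'n))\<^sup>2"
      by (rule main) (use u x r in auto)
    moreover have "L * sqrt (norm x) \<le> L * sqrt r" using x L by simp
    moreover have "(norm x)\<^sup>2 \<le> (1 / 4)\<^sup>2" using x r by (intro power_mono) auto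
    ultimately show "u (s + 1) x - u (s + 1) 0 \<le> 1 / 2" using sr by (simp add: power2_eq_square)
  qed
qed

end

subsection \<open>Oscillation decay of the evolution operator\<close>

lemma mem_bcontfun: "f \<in> bcontfun \<longleftrightarrow> continuous_on UNIV f \<and> bounded (range f)"
  by (simp add: bcontfun_def)

lemma bcontfun_bound:
  fixes f :: "'a::topological_space \<Rightarrow> real"
  assumes "f \<in> bcontfun" obtains B where "B > 0" "\<And>x. \<bar>f x\<bar> \<le> B"
proof -
  have "bounded (range f)" using assms by (simp add: mem_bcontfun)
  then show ?thesis using that unfolding bounded_pos by auto
qed

lemma bcontfunI:
  fixes f :: "'a::topological_space \<Rightarrow> real"
  assumes "continuous_on UNIV f" "\<And>x. \<bar>f x\<bar> \<le> B" shows "f \<in> bcontfun"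
  using assms by (auto simp: mem_bcontfun bounded_iff)

locale evolution = lyapunov_operator T \<alpha> \<delta> a c Q b V
  for T \<alpha> \<delta> a c :: real
    and Q :: "real \<times> (real ^ 'n) \<Rightarrow> real ^ 'n ^ 'n"
    and b :: "real \<times> (real ^ 'n) \<Rightarrow> real ^ 'n"
    and V :: "real ^ 'n \<Rightarrow> real" +
  fixes P :: "real \<Rightarrow> real \<Rightarrow> (real ^ 'n \<Rightarrow> real) \<Rightarrow> real ^ 'n \<Rightarrow> real"
  assumes evol: "evolution_operator Q b P"
begin

lemma P_classical: "f \<in> bcontfun \<Longrightarrow> bounded_classical_solution Q b s f (\<lambda>(t, x). P t s f x)"
  using evol by (auto simp: evolution_operator_def)

lemma P_unique:
  "f \<in> bcontfun \<Longrightarrow> bounded_classical_solution Q b s f u \<Longrightarrow> s \<le> t \<Longrightarrow> u (t, x) = P t s f x"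
  using evol by (auto simp: evolution_operator_def)

lemma P_init: "f \<in> bcontfun \<Longrightarrow> P s s f x = f x"
  using P_classical[of f s] by (auto simp: bounded_classical_solution_def)

lemma P_psol:
  assumes f: "f \<in> bcontfun" shows "psol s (\<lambda>t. P t s f) (\<lambda>_ _. 0)"
  unfolding psol_def
proof (intro conjI allI impI)
  note bcs = P_classical[OF f, of s, unfolded bounded_classical_solution_def]
  show "continuous_on ({s..} \<times> UNIV) (\<lambda>(t, x). P t s f x)" using bcs by simp
  fix t x assume t: "s < t"
  have C: "C12_on ({s<..} \<times> UNIV) (\<lambda>(t, x). P t s f x)" using bcs by simp
  have e: "pd e_time (\<lambda>(t, x). P t s f x) (t, x) = ell_op Q b t (P t s f) x" using bcs t by simp
  from C12_on_jet[OF C, of t x] t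
  show "\<exists>ut g H. ((\<lambda>\<tau>. P \<tau> s f x) has_real_derivative ut) (at t) \<and> jet2 (P t s f) x g H \<and>
         ut = Q (t, x) \<bullet> H + b (t, x) \<bullet> g + 0"
    by (intro exI conjI) (auto simp: e ell_op_eq)
qed

lemma P_has_bound: "f \<in> bcontfun \<Longrightarrow> \<exists>B. \<forall>t x. s \<le> t \<longrightarrow> \<bar>P t s f x\<bar> \<le> B"
  using P_classical[of f s] unfolding bounded_classical_solution_def bounded_iff by force

text \<open>Weighted comparison of two evolutions. The weight \<open>V\<close> is unbounded and
  \<open>P\<close> cannot be applied to it, so it appears only in a bound on the difference of two
  bounded data. Linearity is used in the form of linearity of \<open>psol\<close>.\<close>

lemma P_diff_bound:
  assumes f: "f \<in> bcontfun" and g: "g \<in> bcontfun" and fg: "\<And>x. f x - g x \<le> k + \<beta> * V x"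
    and \<beta>: "\<beta> \<ge> 0" and t: "s \<le> t"
  shows "P t s f x - P t s g x \<le> k + \<beta> * (exp (- c * (t - s)) * V x + a / c * (1 - exp (- c * (t - s))))"
proof -
  obtain B where B: "\<And>t x. s \<le> t \<Longrightarrow> \<bar>P t s f x\<bar> \<le> B" using P_has_bound[OF f, of s] by blast
  obtain B' where B': "\<And>t x. s \<le> t \<Longrightarrow> \<bar>P t s g x\<bar> \<le> B'" using P_has_bound[OF g, of s] by blast
  have ps: "psol s (\<lambda>t x. P t s f x - P t s g x) (\<lambda>_ _. 0)"
    using psol_diff[OF P_psol[OF f, of s] P_psol[OF g, of s]] by simp
  show ?thesis
  proof (rule growth_bound[OF ps, of "B + B'" k \<beta>])
    show "P t s f x - P t s g x \<le> B + B'" if "s \<le> t" for t x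
      using B[OF that, of x] B'[OF that, of x] by linarith
    show "P s s f x - P s s g x \<le> k + \<beta> * V x" for x using fg by (simp add: P_init f g)
  qed (use \<beta> t in auto)
qed

lemma const_bcontfun: "(\<lambda>_. k) \<in> bcontfun" for k :: real
  by (rule bcontfunI[of _ "\<bar>k\<bar>"]) auto

lemma P_const:
  assumes "s \<le> t" shows "P t s (\<lambda>_. k) x = k"
proof -
  have "bounded_classical_solution Q b s (\<lambda>_. k) (\<lambda>_. k)"
  proof -
    have pd0: "pd v (\<lambda>_. l) = (\<lambda>_. 0)" for v :: "'x::real_normed_vector" and l by (auto simp: pd_def)
    have h: "has_pd v (\<lambda>_. l) z" for v z :: "'x::real_normed_vector" and l by (auto simp: has_pd_def)
    have "bounded ((\<lambda>_. k) ` A)" for A :: "(real \<times> (real ^ 'n)) set"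
      by (rule bounded_subset[of "{k}"]) auto
    then show ?thesis
      by (auto simp: bounded_classical_solution_def C12_on_def pd0 h ell_op_def)
  qed
  from P_unique[OF const_bcontfun this assms, of x] show ?thesis by simp
qed

lemma P_upper:
  assumes f: "f \<in> bcontfun" and "\<And>x. f x \<le> k + \<beta> * V x" "\<beta> \<ge> 0" "s \<le> t"
  shows "P t s f x \<le> k + \<beta> * (exp (- c * (t - s)) * V x + a / c * (1 - exp (- c * (t - s))))"
  using P_diff_bound[OF f const_bcontfun[of 0] _ assms(3,4), of k x] assms(2) P_const[OF assms(4), of 0
    x] by simp

lemma P_lower:
  assumes f: "f \<in> bcontfun" and "\<And>x. k \<le> f x" "s \<le> t"
  shows "k \<le> P t s f x"
  using P_diff_bound[OF const_bcontfun[of 0] f _ order_refl assms(3), of "- k" x] assms(2)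
    P_const[OF assms(3), of 0 x] by simp

lemma P_abs_le:
  assumes f: "f \<in> bcontfun" and "\<And>x. \<bar>f x\<bar> \<le> B" "s \<le> t"
  shows "\<bar>P t s f x\<bar> \<le> B"
proof -
  have "f x \<le> B" "- B \<le> f x" for x using assms(2)[of x] by auto
  then show ?thesis
    using P_upper[OF f _ order_refl assms(3), of B x] P_lower[OF f _ assms(3), of "- B" x] by simp
qed

lemma P_bcontfun:
  assumes f: "f \<in> bcontfun" and "s \<le> t" shows "P t s f \<in> bcontfun"
proof -
  obtain B where B: "\<And>x. \<bar>f x\<bar> \<le> B" using bcontfun_bound[OF f] by blast
  have "continuous_on ({s..} \<times> UNIV) (\<lambda>z. P (fst z) s f (snd z))"
    using P_psol[OF f, of s] by (simp add: psol_def case_prod_beta')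
  then have "continuous_on UNIV (\<lambda>x. P (fst (t, x)) s f (snd (t, x)))"
    by (rule continuous_on_compose2) (use assms(2) in \<open>auto intro!: continuous_intros\<close>)
  then show ?thesis using P_abs_le[OF f B assms(2)] by (intro bcontfunI) auto
qed

text \<open>The solution started at \<open>r\<close>, restricted to times after \<open>s\<close>, is
  a bounded classical solution with initial value \<open>P s r f\<close>; uniqueness identifies
  it.\<close>

lemma P_semigroup:
  assumes f: "f \<in> bcontfun" and "r \<le> s" "s \<le> t"
  shows "P t s (P s r f) x = P t r f x"
proof -
  note bcs = P_classical[OF f, of r, unfolded bounded_classical_solution_def]
  have sub: "{s..} \<times> UNIV \<subseteq> {r..} \<times> (UNIV :: (real ^ 'n) set)"
    "{s<..} \<times> UNIV \<subseteq> {r<..} \<times> (UNIV :: (real ^ 'n) set)" using assms by auto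
  have "bounded_classical_solution Q b s (P s r f) (\<lambda>(t, x). P t r f x)"
    unfolding bounded_classical_solution_def
  proof (intro conjI allI impI)
    show "continuous_on ({s..} \<times> UNIV) (\<lambda>(t, x). P t r f x)"
      using bcs continuous_on_subset[OF _ sub(1)] by blast
    show "bounded ((\<lambda>(t, x). P t r f x) ` ({s..} \<times> UNIV))"
      using bcs bounded_subset[OF _ image_mono[OF sub(1)]] by blast
    have "C12_on ({r<..} \<times> UNIV) (\<lambda>(t, x). P t r f x)" using bcs by simp
    then show "C12_on ({s<..} \<times> UNIV) (\<lambda>(t, x). P t r f x)"
      using sub(2) unfolding C12_on_def by (meson continuous_on_subset subsetD)
  qed (use bcs assms in auto)
  from P_unique[OF P_bcontfun[OF f assms(2)] this assms(3), of x] show ?thesis by simp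
qed

lemma P_periodic:
  assumes f: "f \<in> bcontfun" and "s \<le> t"
  shows "P (t + T) (s + T) f x = P t s f x"
proof -
  define u where "u = (\<lambda>(t, x). P t (s + T) f x)"
  note bcs = P_classical[OF f, of "s + T", folded u_def, unfolded bounded_classical_solution_def]
  define sh where "sh z = (fst z + T, snd z)" for z :: "real \<times> (real ^ 'n)"
  have pd: "pd v (\<lambda>z. F (sh z)) = (\<lambda>z. pd v F (sh z))" "has_pd v (\<lambda>z. F (sh z)) z = has_pd v F (sh z)"
    for F :: "real \<times> (real ^ 'n) \<Rightarrow> real" and v z
  proof -
    have *: "sh (z + w) = sh z + w" for z w by (simp add: sh_def prod_eq_iff)
    show "pd v (\<lambda>z. F (sh z)) = (\<lambda>z. pd v F (sh z))" "has_pd v (\<lambda>z. F (sh z)) z = has_pd v F (sh z)"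
      unfolding pd_def[abs_def] has_pd_def * by (rule refl)+
  qed
  have co: "continuous_on ({s<..} \<times> UNIV) (\<lambda>z. F (sh z))" if "continuous_on ({s + T<..} \<times> UNIV) F"
    for F :: "real \<times> (real ^ 'n) \<Rightarrow> real"
    by (rule continuous_on_compose2[OF that]) (auto simp: sh_def intro!: continuous_intros)
  have per: "Q (t + T, x) = Q (t, x)" "b (t + T, x) = b (t, x)" for t x
    using Q_per b_per by (auto simp: time_periodic_def)
  have "bounded_classical_solution Q b s f (\<lambda>z. u (sh z))"
    unfolding bounded_classical_solution_def
  proof (intro conjI allI impI)
    have "continuous_on ({s + T..} \<times> UNIV) u" using bcs by simp
    then show "continuous_on ({s..} \<times> UNIV) (\<lambda>z. u (sh z))"
      by (rule continuous_on_compose2) (auto simp: sh_def intro!: continuous_intros)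
    have "bounded (u ` ({s + T..} \<times> UNIV))" using bcs by simp
    then show "bounded ((\<lambda>z. u (sh z)) ` ({s..} \<times> UNIV))"
      by (rule bounded_subset) (auto simp: sh_def)
    have C: "C12_on ({s + T<..} \<times> UNIV) u" using bcs by simp
    show "C12_on ({s<..} \<times> UNIV) (\<lambda>z. u (sh z))"
      using C unfolding C12_on_def pd by (auto intro!: co) (simp_all add: sh_def)
    fix t x assume "t > s"
    then have "pd e_time u (t + T, x) = ell_op Q b (t + T) (\<lambda>y. u (t + T, y)) x"
      using bcs by simp
    then show "pd e_time (\<lambda>z. u (sh z)) (t, x) = ell_op Q b t (\<lambda>y. u (sh (t, y))) x"
      unfolding pd by (simp add: sh_def ell_op_def per)
  next
    fix x show "u (sh (s, x)) = f x" using bcs by (simp add: sh_def)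
  qed
  from P_unique[OF f this assms(2), of x] show ?thesis by (simp add: u_def sh_def)
qed

text \<open>After normalisation to [-1, 1], the value at the origin at time \<open>s + 1\<close> has
  one of two signs; by passing to \<open>- u\<close> it may be taken nonnegative. Then
  \<open>u\<close> is bounded away from -1 on a small ball, and spreading gives the lower bound
  \<open>p / 2 - 1\<close> on the sublevel set at time \<open>s + 2\<close>, which cuts the
  oscillation from 2 to \<open>2 - p / 2\<close>.\<close>

lemma doeblin:
  "\<exists>q. 0 \<le> q \<and> q < 1 \<and> (\<forall>s f m \<kappa>. f \<in> bcontfun \<longrightarrow> \<kappa> > 0 \<longrightarrow> (\<forall>x. \<bar>f x - m\<bar> \<le> \<kappa>) \<longrightarrow>
     (\<forall>x y. V x \<le> R \<longrightarrow> V y \<le> R \<longrightarrow> P (s + 2) s f x - P (s + 2) s f y \<le> 2 * \<kappa> * q))"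
proof -
  obtain R1 where R1: "R1 > 0" "\<And>x. V x \<le> R \<Longrightarrow> norm x \<le> R1" using V_sublevel[of R] by auto
  from local_oscillation obtain r where r: "r > 0" and osc: "\<And>s u x. psol s u (\<lambda>_ _. 0) \<Longrightarrow>
     (\<And>t x. s \<le> t \<Longrightarrow> \<bar>u t x\<bar> \<le> 1) \<Longrightarrow> norm x \<le> r \<Longrightarrow> u (s + 1) x - u (s + 1) 0 \<le> 1 / 2" by blast
  from positivity_spread[OF r R1(1)] obtain p where p: "p > 0" and pos: "\<And>s u x. psol s u (\<lambda>_ _. 0) \<Longrightarrow>
    (\<And>t x. s \<le> t \<Longrightarrow> 0 \<le> u t x) \<Longrightarrow> (\<And>x. norm x \<le> r \<Longrightarrow> 1 \<le> u s x) \<Longrightarrow> norm x \<le> R1 \<Longrightarrow> p \<le> u (s + 1) x"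
    by blast
  show ?thesis
  \<comment> \<open>\<open>positivity_spread\<close> only promises \<open>p > 0\<close>, so the
    natural factor \<open>1 - p / 4\<close> is cut off at 0.\<close>
  proof (rule exI[of _ "max 0 (1 - p / 4)"], intro conjI allI impI)
    show "0 \<le> max 0 (1 - p / 4)" "max 0 (1 - p / 4) < 1" using p by auto
    fix s m \<kappa> :: real and f :: "real ^ 'n \<Rightarrow> real" and x y
    assume f: "f \<in> bcontfun" and \<kappa>: "\<kappa> > (0::real)" and fm: "\<forall>x. \<bar>f x - m\<bar> \<le> \<kappa>"
      and V: "V x \<le> R" "V y \<le> R"
    define u where "u t x = 1 / \<kappa> * (P t s f x - m)" for t x
    have u: "psol s u (\<lambda>_ _. 0)"
      using psol_cmult[OF psol_diff[OF P_psol[OF f, of s] psol_const[of s m]], of "1 / \<kappa>"]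
      by (simp add: u_def[abs_def])
    have u1: "\<bar>u t x\<bar> \<le> 1" if "s \<le> t" for t x
    proof -
      have b: "m - \<kappa> \<le> f x" "f x \<le> m + \<kappa>" for x using fm[rule_format, of x] by auto
      have "m - \<kappa> \<le> P t s f x" "P t s f x \<le> m + \<kappa>"
        using P_lower[OF f b(1) that] P_upper[OF f _ order_refl that, of "m + \<kappa>" x] b(2) by auto
      then show ?thesis using \<kappa> by (simp add: u_def abs_le_iff field_simps)
    qed
    have key: "p / 2 - 1 \<le> v (s + 2) z"
      if v: "psol s v (\<lambda>_ _. 0)" "\<And>t x. s \<le> t \<Longrightarrow> \<bar>v t x\<bar> \<le> 1" and v0: "v (s + 1) 0 \<ge> 0" and z: "norm z \<le> R1"
      for v z
    proof -
      have mv: "psol s (\<lambda>t x. - 1 * v t x) (\<lambda>_ _. 0)" using psol_cmult[OF v(1), of "-1"] by simp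
      \<comment> \<open>The oscillation bound is one-sided and is applied to
        \<open>- v\<close>.\<close>
      have low: "- (1 / 2) \<le> v (s + 1) x" if "norm x \<le> r" for x
        using osc[OF mv _ that] v(2) v0 by simp
      have w: "psol (s + 1) (\<lambda>t x. 2 * (v t x + 1)) (\<lambda>_ _. 0)"
        using psol_mono[OF psol_cmult[OF psol_add[OF v(1) psol_const[of s 1]], of 2], of "s + 1"] by simp
      have "p \<le> 2 * (v (s + 1 + 1) z + 1)"
      proof (rule pos[OF w _ _ z])
        show "0 \<le> 2 * (v t x + 1)" if "s + 1 \<le> t" for t x using v(2)[of t x] that by auto
        show "1 \<le> 2 * (v (s + 1) x + 1)" if "norm x \<le> r" for x using low[OF that] by simp
      qed
      then show ?thesis by (simp add: add.assoc)
    qed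
    have nx: "norm x \<le> R1" "norm y \<le> R1" using R1 V by auto
    have s2: "\<bar>u (s + 2) z\<bar> \<le> 1" for z by (rule u1) simp
    have "u (s + 2) x - u (s + 2) y \<le> 2 - p / 2"
    proof (cases "u (s + 1) 0 \<ge> 0")
      case True
      show ?thesis using key[OF u u1 True nx(2)] s2[of x] by linarith
    next
      case False
      have mu: "psol s (\<lambda>t x. - 1 * u t x) (\<lambda>_ _. 0)" using psol_cmult[OF u, of "-1"] by simp
      have "p / 2 - 1 \<le> - 1 * u (s + 2) x"
        by (rule key[OF mu _ _ nx(1)]) (use False u1 in auto)
      then show ?thesis using s2[of y] by linarith
    qed
    also have "\<dots> \<le> 2 * max 0 (1 - p / 4)" by (simp add: max_def)
    finally have "\<kappa> * (u (s + 2) x - u (s + 2) y) \<le> \<kappa> * (2 * max 0 (1 - p / 4))"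
      using \<kappa> by simp
    then show "P (s + 2) s f x - P (s + 2) s f y \<le> 2 * \<kappa> * max 0 (1 - p / 4)"
      using \<kappa> by (simp add: u_def right_diff_distrib diff_divide_distrib mult_ac)
  qed
qed

text \<open>Harris' theorem in the form of Hairer and Mattingly: contraction of the weighted oscillation
  seminorm.  Far out the drift of \<open>V\<close> contracts, on a sublevel set of \<open>V\<close> the Doeblin condition
  is applied to \<open>f\<close> truncated around the constant \<open>k0\<close>.\<close>

lemma harris:
  "\<exists>\<beta> q. \<beta> > 0 \<and> 0 \<le> q \<and> q < 1 \<and> (\<forall>s f \<kappa>. f \<in> bcontfun \<longrightarrow> \<kappa> > 0 \<longrightarrow>
     (\<forall>x y. f x - f y \<le> \<kappa> * (2 + \<beta> * V x + \<beta> * V y)) \<longrightarrow>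
     (\<forall>x y. P (s + 2) s f x - P (s + 2) s f y \<le> q * \<kappa> * (2 + \<beta> * V x + \<beta> * V y)))"
proof -
  define \<gamma> where "\<gamma> = exp (- c * 2)"
  define K where "K = a / c * (1 - \<gamma>)"
  have \<gamma>: "0 < \<gamma>" "\<gamma> < 1" using c_pos by (auto simp: \<gamma>_def)
  have K: "K > 0" using \<gamma> a_pos c_pos by (simp add: K_def)
  \<comment> \<open>At this height the contraction of \<open>V\<close> by \<open>\<gamma>\<close>
    dominates the constant \<open>K\<close>: \<open>(1 - \<gamma>) / 2 * R\<close> equals
    \<open>4 * K\<close>.\<close>
  define R where "R = 8 * K / (1 - \<gamma>)"
  from doeblin[of R] obtain q0 where q0: "0 \<le> q0" "q0 < 1" and db: "\<And>s f m \<kappa> x y. f \<in> bcontfun \<Longrightarrow> \<kappa> > 0 \<Longrightarrow>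
     (\<And>x. \<bar>f x - m\<bar> \<le> \<kappa>) \<Longrightarrow> V x \<le> R \<Longrightarrow> V y \<le> R \<Longrightarrow> P (s + 2) s f x - P (s + 2) s f y \<le> 2 * \<kappa> * q0" by blast
  \<comment> \<open>The weight is small enough that the near case leaves
    \<open>q0 + \<beta> * K = (1 + q0) / 2 < 1\<close>.\<close>
  define \<beta> where "\<beta> = (1 - q0) / (2 * K)"
  have \<beta>: "\<beta> > 0" "\<beta> * K = (1 - q0) / 2" using q0 K by (auto simp: \<beta>_def)
  \<comment> \<open>The second entry serves the near case, the first serves the far case, and the
    third leaves \<open>(1 - \<gamma>) / 2\<close> of the coefficient of the weight to spare in the
    far case.\<close>
  define q where "q = max (1 - \<beta> * K) (max ((1 + q0) / 2) ((1 + \<gamma>) / 2))"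
  have q: "q \<ge> 1 - \<beta> * K" "q \<ge> (1 + q0) / 2" "q \<ge> (1 + \<gamma>) / 2"
    unfolding q_def by (rule max.cobounded1, rule max.coboundedI2, rule max.cobounded1,
      rule max.coboundedI2, rule max.cobounded2)
  have q1: "0 \<le> q" "q < 1" "\<gamma> \<le> q" using q(3) \<gamma> \<beta> K q0 by (auto simp: q_def field_simps)
  show ?thesis
  proof (rule exI[of _ \<beta>], rule exI[of _ q], intro conjI allI impI \<beta>(1) q1(1,2))
    fix s \<kappa> :: real and f :: "real ^ 'n \<Rightarrow> real" and x y
    assume f: "f \<in> bcontfun" and \<kappa>: "\<kappa> > (0::real)"
      and H: "\<forall>x y. f x - f y \<le> \<kappa> * (2 + \<beta> * V x + \<beta> * V y)"
    have ss: "s \<le> s + 2" by simp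
    \<comment> \<open>The two-point hypothesis becomes a one-point one: \<open>f\<close> lies within
      \<open>\<kappa> * (1 + \<beta> * V x)\<close> of this constant.\<close>
    define k0 where "k0 = (SUP x. f x - \<kappa> * (1 + \<beta> * V x))"
    have bd: "f x - \<kappa> * (1 + \<beta> * V x) \<le> f y + \<kappa> * (1 + \<beta> * V y)" for x y
      using H[rule_format, of x y] by (simp add: algebra_simps)
    have up: "f x - \<kappa> * (1 + \<beta> * V x) \<le> k0" for x
      unfolding k0_def by (rule cSUP_upper) (use bd[of _ 0] in \<open>auto intro!: bdd_aboveI2\<close>)
    have lo: "k0 \<le> f y + \<kappa> * (1 + \<beta> * V y)" for y
      unfolding k0_def by (rule cSUP_least) (use bd in auto)
    define S where "S = V x + V y"
    define PV where "PV x = \<gamma> * V x + K" for x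
    have PVe: "exp (- c * (s + 2 - s)) * V x + a / c * (1 - exp (- c * (s + 2 - s))) = PV x" for x
      by (simp add: PV_def K_def \<gamma>_def)
    have e: "q * \<kappa> * (2 + \<beta> * V x + \<beta> * V y) = \<kappa> * (q * (2 + \<beta> * S))" by (simp add: S_def algebra_simps)
    have S: "S > 0" using V_pos[of x] V_pos[of y] by (simp add: S_def)
    have "P (s + 2) s f x - P (s + 2) s f y \<le> \<kappa> * (q * (2 + \<beta> * S))"
    proof (cases "S \<le> R")
      case True
      \<comment> \<open>Truncation to the band of half-width \<open>\<kappa>\<close> around
        \<open>k0\<close> changes \<open>f\<close> by at most
        \<open>\<kappa> * \<beta> * V x\<close>. The truncated function obeys the Doeblin bound, the
        remainder the Lyapunov bound.\<close>
      define g where "g x = max (k0 - \<kappa>) (min (k0 + \<kappa>) (f x))" for x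
      have g: "g \<in> bcontfun"
      proof (rule bcontfunI[of _ "\<bar>k0\<bar> + \<kappa>"])
        have "continuous_on UNIV f" using f by (simp add: mem_bcontfun)
        then show "continuous_on UNIV g"
          unfolding g_def by (intro continuous_on_max continuous_on_min continuous_intros)
        show "\<bar>g x\<bar> \<le> \<bar>k0\<bar> + \<kappa>" for x using \<kappa> by (auto simp: g_def max_def min_def)
      qed
      have gm: "\<bar>g x - k0\<bar> \<le> \<kappa>" for x using \<kappa> by (auto simp: g_def max_def min_def)
      have \<kappa>V: "0 \<le> \<kappa> * \<beta> * V x" for x using \<kappa> \<beta> V_pos[of x] by simp
      have "f x - g x \<le> 0 + \<kappa> * \<beta> * V x" for x
        using up[of x] lo[of x] \<kappa>V[of x] \<kappa> by (auto simp: g_def max_def min_def algebra_simps)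
      from P_diff_bound[OF f g this _ ss, of x] \<kappa> \<beta>
      have 1: "P (s + 2) s f x - P (s + 2) s g x \<le> \<kappa> * \<beta> * PV x" unfolding PVe by simp
      have "g x - f x \<le> 0 + \<kappa> * \<beta> * V x" for x
        using up[of x] lo[of x] \<kappa>V[of x] \<kappa> by (auto simp: g_def max_def min_def algebra_simps)
      from P_diff_bound[OF g f this _ ss, of y] \<kappa> \<beta>
      have 2: "P (s + 2) s g y - P (s + 2) s f y \<le> \<kappa> * \<beta> * PV y" unfolding PVe by simp
      have "V x \<le> R" "V y \<le> R" using True V_pos[of x] V_pos[of y] by (auto simp: S_def)
      from db[OF g \<kappa> gm this, of s]
      have 3: "P (s + 2) s g x - P (s + 2) s g y \<le> 2 * \<kappa> * q0" .
      have "P (s + 2) s f x - P (s + 2) s f y \<le> 2 * \<kappa> * q0 + \<kappa> * \<beta> * PV x + \<kappa> * \<beta> * PV y"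
        using 1 2 3 by linarith
      also have "\<dots> = \<kappa> * (2 * (q0 + \<beta> * K) + \<gamma> * (\<beta> * S))" by (simp add: PV_def S_def algebra_simps)
      also have "\<dots> \<le> \<kappa> * (2 * q + q * (\<beta> * S))"
      proof (rule mult_left_mono, rule add_mono)
        show "2 * (q0 + \<beta> * K) \<le> 2 * q" using \<beta>(2) q(2) by simp
        show "\<gamma> * (\<beta> * S) \<le> q * (\<beta> * S)" using q1(3) \<beta> S by (intro mult_right_mono) auto
      qed (use \<kappa> in auto)
      finally show ?thesis by (simp add: algebra_simps)
    next
      case False
      then have SR: "S \<ge> R" by simp
      have "f x \<le> (k0 + \<kappa>) + \<kappa> * \<beta> * V x" for x using up[of x] by (simp add: algebra_simps)
      from P_upper[OF f this _ ss, of x] \<kappa> \<beta>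
      have 1: "P (s + 2) s f x \<le> (k0 + \<kappa>) + \<kappa> * \<beta> * PV x" unfolding PVe by simp
      have "0 - f x \<le> (- k0 + \<kappa>) + \<kappa> * \<beta> * V x" for x using lo[of x] by (simp add: algebra_simps)
      from P_diff_bound[OF const_bcontfun[of 0] f this _ ss, of y] \<kappa> \<beta>
      have 2: "- P (s + 2) s f y \<le> (- k0 + \<kappa>) + \<kappa> * \<beta> * PV y" unfolding PVe P_const[OF ss] by simp
      have "P (s + 2) s f x - P (s + 2) s f y \<le> \<kappa> * (2 + \<beta> * PV x + \<beta> * PV y)"
        using 1 2 by (simp add: algebra_simps)
      also have "\<dots> = \<kappa> * (2 + 2 * (\<beta> * K) + \<gamma> * (\<beta> * S))" by (simp add: PV_def S_def algebra_simps)
      also have "\<dots> \<le> \<kappa> * (2 * q + q * (\<beta> * S))"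
      proof (rule mult_left_mono)
        \<comment> \<open>The gain in the weight, \<open>4 * (\<beta> * K)\<close>, pays for the
          \<open>2 * (\<beta> * K)\<close> produced by the drift and for the deficit
          \<open>2 - 2 * q\<close>, which is at most \<open>2 * (\<beta> * K)\<close>.\<close>
        have "(1 - \<gamma>) / 2 * (\<beta> * R) \<le> (q - \<gamma>) * (\<beta> * S)"
          using q(3) \<gamma> \<beta> SR K by (intro mult_mono) (auto simp: R_def)
        moreover have "(1 - \<gamma>) / 2 * (\<beta> * R) = 4 * (\<beta> * K)" using \<gamma> by (simp add: R_def field_simps)
        ultimately have "4 * (\<beta> * K) \<le> q * (\<beta> * S) - \<gamma> * (\<beta> * S)" by (simp add: left_diff_distrib)
        then show "2 + 2 * (\<beta> * K) + \<gamma> * (\<beta> * S) \<le> 2 * q + q * (\<beta> * S)" using q(1) by linarith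
      qed (use \<kappa> in auto)
      finally show ?thesis by (simp add: algebra_simps)
    qed
    then show "P (s + 2) s f x - P (s + 2) s f y \<le> q * \<kappa> * (2 + \<beta> * V x + \<beta> * V y)" unfolding e .
  qed
qed

text \<open>Each step of length 2 gains one factor. Time left over is spent before the first step,
  where the sup bound \<open>B\<close> persists; so \<open>t\<close> need not be of the form
  \<open>s + 2 * real n\<close>.\<close>

lemma oscillation_decay:
  "\<exists>\<beta> q. \<beta> > 0 \<and> 0 < q \<and> q < 1 \<and> (\<forall>n s t f B. f \<in> bcontfun \<longrightarrow> B > 0 \<longrightarrow> (\<forall>x. \<bar>f x\<bar> \<le> B) \<longrightarrow> s + 2 * real n \<le> t \<longrightarrow>
     (\<forall>x y. \<bar>P t s f x - P t s f y\<bar> \<le> q ^ n * B * (2 + \<beta> * V x + \<beta> * V y)))"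
proof -
  from harris obtain \<beta> q where \<beta>: "\<beta> > 0" and q: "0 \<le> q" "q < 1"
    and har: "\<And>s f \<kappa> x y. f \<in> bcontfun \<Longrightarrow> \<kappa> > 0 \<Longrightarrow>
     (\<And>x y. f x - f y \<le> \<kappa> * (2 + \<beta> * V x + \<beta> * V y)) \<Longrightarrow>
     P (s + 2) s f x - P (s + 2) s f y \<le> q * \<kappa> * (2 + \<beta> * V x + \<beta> * V y)" by blast
  \<comment> \<open>\<open>harris\<close> allows \<open>q = 0\<close>; a strictly positive factor
    keeps the constants positive, as the hypotheses of \<open>harris\<close> demand.\<close>
  define q' where "q' = (1 + q) / 2"
  have q': "0 < q'" "q \<le> q'" "q' < 1" using q by (auto simp: q'_def)
  have W: "0 \<le> 2 + \<beta> * V x + \<beta> * V y" for x y using \<beta> V_pos[of x] V_pos[of y] by (simp add: add_nonneg_nonneg)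
  have it: "P (s + 2 * real n) s f x - P (s + 2 * real n) s f y \<le> q' ^ n * B * (2 + \<beta> * V x + \<beta> * V y)"
    if f: "f \<in> bcontfun" and B: "B > 0" "\<And>x. \<bar>f x\<bar> \<le> B" for n s f B x y
  proof (induction n arbitrary: x y)
    case 0
    have "f x - f y \<le> B * 2" using B(2)[of x] B(2)[of y] by linarith
    also have "\<dots> \<le> B * (2 + \<beta> * V x + \<beta> * V y)" using B \<beta> V_pos[of x] V_pos[of y]
      by (intro mult_left_mono) (auto simp: add_nonneg_nonneg add.assoc)
    finally show ?case by (simp add: P_init f)
  next
    case (Suc n)
    define t where "t = s + 2 * real n"
    have t: "s \<le> t" "s + 2 * real (Suc n) = t + 2" by (auto simp: t_def)
    have "P (t + 2) t (P t s f) x - P (t + 2) t (P t s f) y \<le> q * (q' ^ n * B) * (2 + \<beta> * V x + \<beta> * V y)"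
      by (rule har[OF P_bcontfun[OF f t(1)]]) (use Suc.IH B q' in \<open>auto simp: t_def\<close>)
    also have "\<dots> \<le> q' * (q' ^ n * B) * (2 + \<beta> * V x + \<beta> * V y)"
      using q' B W by (intro mult_right_mono) auto
    finally show ?case unfolding t(2) using P_semigroup[OF f t(1), of "t + 2"] by (simp add: mult_ac)
  qed
  show ?thesis
  proof (rule exI[of _ \<beta>], rule exI[of _ q'], intro conjI allI impI)
    fix n and s t B :: real and f :: "real ^ 'n \<Rightarrow> real" and x y
    assume f: "f \<in> bcontfun" and B: "(0::real) < B" "\<forall>x. \<bar>f x\<bar> \<le> B" and t: "s + 2 * real n \<le> t"
    define r where "r = t - 2 * real n"
    have r: "s \<le> r" "r \<le> t" "r + 2 * real n = t" using t by (auto simp: r_def)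
    have Pr: "P r s f \<in> bcontfun" "\<And>x. \<bar>P r s f x\<bar> \<le> B"
      using P_bcontfun[OF f r(1)] P_abs_le[OF f _ r(1)] B(2) by auto
    from it[OF Pr(1) B(1) Pr(2), of r n x y] it[OF Pr(1) B(1) Pr(2), of r n y x]
    show "\<bar>P t s f x - P t s f y\<bar> \<le> q' ^ n * B * (2 + \<beta> * V x + \<beta> * V y)"
      unfolding r(3) P_semigroup[OF f r(1,2)] by (simp add: abs_le_iff algebra_simps)
  qed (use \<beta> q' in auto)
qed

end

section \<open>Joint continuity of the evolution operator in both times and in space\<close>

lemma slice_bcontfun:
  fixes f :: "real \<times> 'x::topological_space \<Rightarrow> real"
  assumes "continuous_on UNIV f" "\<And>z. \<bar>f z\<bar> \<le> B"
  shows "(\<lambda>y. f (s, y)) \<in> bcontfun"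
proof (rule bcontfunI)
  show "continuous_on UNIV (\<lambda>y. f (s, y))"
    by (rule continuous_on_compose2[OF assms(1)]) (auto intro!: continuous_intros)
qed (rule assms(2))

context evolution
begin

text \<open>A classical solution is continuous up to its own initial time, whereas here the initial
  time and the datum vary as well. The barrier of \<open>initial_layer\<close>, used for the
  solution and for its negative, does not depend on either.\<close>

lemma initial_continuity:
  fixes f :: "real \<times> (real ^ 'n) \<Rightarrow> real"
  assumes f: "continuous_on UNIV f" and B: "B > 0" "\<And>z. \<bar>f z\<bar> \<le> B" and \<epsilon>: "\<epsilon> > 0"
  shows "\<exists>\<delta>>0. \<forall>s t x. \<bar>s - s0\<bar> < \<delta> \<longrightarrow> s \<le> t \<longrightarrow> t < s + \<delta> \<longrightarrow> norm x \<le> R \<longrightarrow>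
    \<bar>P t s (\<lambda>y. f (s, y)) x - f (s0, x)\<bar> \<le> \<epsilon>"
proof -
  define K where "K = {s0 - 1..s0 + 1} \<times> cball (0 :: real ^ 'n) (R + 1)"
  have "uniformly_continuous_on K f"
    unfolding K_def by (intro compact_uniformly_continuous continuous_on_subset[OF f] compact_Times) auto
  then obtain d where d: "d > 0" "\<And>z z'. z \<in> K \<Longrightarrow> z' \<in> K \<Longrightarrow> dist z' z < d \<Longrightarrow> dist (f z') (f z) < \<epsilon> / 2"
    using \<epsilon> unfolding uniformly_continuous_on_def by (meson half_gt_zero)
  define r where "r = min 1 (d / 3)"
  have r: "r > 0" "r \<le> 1" "2 * r < d" using d by (auto simp: r_def)
  have near: "\<bar>f (s, y) - f (s0, x)\<bar> \<le> \<epsilon> / 2" if "norm x \<le> R" "\<bar>s - s0\<bar> < r" "norm (y - x) \<le> r" for s x y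
  proof -
    have "norm y \<le> R + 1" using norm_triangle_sub[of y x] that(1,3) r(2) by simp
    then have 1: "(s, y) \<in> K" "(s0, x) \<in> K" using that r by (auto simp: K_def)
    have "dist (s, y) (s0, x) \<le> dist s s0 + dist y x" by (simp add: dist_Pair_Pair sqrt_sum_squares_le_sum)
    also have "\<dots> < d" using that r by (simp add: dist_norm)
    finally show ?thesis using d(2)[OF 1(2,1)] by (simp add: dist_norm)
  qed
  obtain C where C: "C > 0"
    and lay': "\<forall>s u x0 k r B. psol s u (\<lambda>_ _. 0) \<longrightarrow> norm x0 \<le> R \<longrightarrow> 0 < r \<longrightarrow> r \<le> 1 \<longrightarrow> B > 0 \<longrightarrow>
     (\<forall>t x. s \<le> t \<longrightarrow> u t x \<le> k + B) \<longrightarrow> (\<forall>y. norm (y - x0) \<le> r \<longrightarrow> u s y \<le> k) \<longrightarrow>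
     (\<forall>t\<ge>s. u t x0 \<le> k + B / r\<^sup>2 * C * (t - s))"
    using initial_layer[of R] by (elim exE conjE) (rule that)
  note lay = lay'[rule_format]
  \<comment> \<open>The local bound \<open>k\<close> may be as low as about \<open>- B\<close>, so
    the gap to the global bound \<open>B\<close> is up to \<open>2 * B\<close>.\<close>
  define D where "D = 2 * B / r\<^sup>2 * C"
  have D: "D > 0" using B C r by (simp add: D_def)
  define \<delta>' where "\<delta>' = min r (\<epsilon> / (2 * D))"
  have \<delta>': "\<delta>' > 0" "\<delta>' \<le> r" using r \<epsilon> D by (auto simp: \<delta>'_def)
  show ?thesis
  proof (intro exI[of _ \<delta>'] conjI allI impI \<delta>'(1))
    fix s t and x :: "real ^ 'n"
    assume s: "\<bar>s - s0\<bar> < \<delta>'" and t: "s \<le> t" "t < s + \<delta>'" and x: "norm x \<le> R"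
    define g where "g = (\<lambda>y. f (s, y))"
    have g: "g \<in> bcontfun" unfolding g_def by (rule slice_bcontfun[OF f B(2)])
    have gB: "\<bar>g y\<bar> \<le> B" for y by (simp add: g_def B)
    have PB: "\<bar>P t s g y\<bar> \<le> B" if "s \<le> t" for t y by (rule P_abs_le[OF g gB that])
    have sr: "\<bar>s - s0\<bar> < r" using s \<delta>' by simp
    have gn: "g y \<le> f (s0, x) + \<epsilon> / 2" "- 1 * g y \<le> - f (s0, x) + \<epsilon> / 2" if "norm (y - x) \<le> r" for y
      using near[OF x sr that] unfolding g_def by argo+
    have f0: "- B \<le> f (s0, x)" "f (s0, x) \<le> B" using B(2)[of "(s0, x)"] by auto
    have "D * (t - s) \<le> D * (\<epsilon> / (2 * D))" using t D by (intro mult_left_mono) (auto simp: \<delta>'_def)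
    then have Dt: "D * (t - s) \<le> \<epsilon> / 2" using D by simp
    have "P t s g x \<le> (f (s0, x) + \<epsilon> / 2) + (2 * B) / r\<^sup>2 * C * (t - s)"
    proof (rule lay[OF P_psol[OF g] x r(1,2) _ _ _ t(1)])
      show "P t s g y \<le> f (s0, x) + \<epsilon> / 2 + 2 * B" if "s \<le> t" for t y
        using PB[OF that, of y] f0 \<epsilon> by linarith
      show "P s s g y \<le> f (s0, x) + \<epsilon> / 2" if "norm (y - x) \<le> r" for y
        unfolding P_init[OF g] using gn[OF that] by argo
    qed (use B in auto)
    moreover have "- 1 * P t s g x \<le> (- f (s0, x) + \<epsilon> / 2) + (2 * B) / r\<^sup>2 * C * (t - s)"
    proof (rule lay[OF _ x r(1,2) _ _ _ t(1), of "\<lambda>t x. - 1 * P t s g x"])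
      show "psol s (\<lambda>t x. - 1 * P t s g x) (\<lambda>_ _. 0)" using psol_cmult[OF P_psol[OF g, of s], of "-1"] by simp
      show "- 1 * P t s g y \<le> - f (s0, x) + \<epsilon> / 2 + 2 * B" if "s \<le> t" for t y
        using PB[OF that, of y] f0 \<epsilon> by linarith
      show "- 1 * P s s g y \<le> - f (s0, x) + \<epsilon> / 2" if "norm (y - x) \<le> r" for y
        unfolding P_init[OF g] using gn[OF that] by argo
    qed (use B in auto)
    ultimately show "\<bar>P t s (\<lambda>y. f (s, y)) x - f (s0, x)\<bar> \<le> \<epsilon>"
      using Dt unfolding D_def[symmetric] g_def[symmetric] by linarith
  qed
qed

text \<open>On the diagonal this is \<open>initial_continuity\<close>. Off it, both evolutions are
  brought to the later of the two starting times, where they are close on a sublevel set of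
  \<open>V\<close> and differ elsewhere by a small multiple of \<open>V\<close>;
  \<open>P_diff_bound\<close> transports this closeness. What remains is continuity for a fixed
  starting time, which is part of being a classical solution.\<close>

lemma evolution_jointly_continuous:
  fixes f :: "real \<times> (real ^ 'n) \<Rightarrow> real"
  assumes f: "continuous_on UNIV f" and B: "\<And>z. \<bar>f z\<bar> \<le> B"
  shows "continuous_on {z. fst z \<le> fst (snd z)}
    (\<lambda>z. P (fst (snd z)) (fst z) (\<lambda>y. f (fst z, y)) (snd (snd z)))"
proof -
  define B' where "B' = \<bar>B\<bar> + 1"
  have B': "B' > 0" "\<bar>f z\<bar> \<le> B'" for z
    using B[of z] abs_ge_self[of B] unfolding B'_def by linarith+
  define F where "F s = (\<lambda>y. f (s, y))" for s
  have F: "F s \<in> bcontfun" for s unfolding F_def by (rule slice_bcontfun[OF f B])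
  have FB: "\<bar>F s y\<bar> \<le> B'" for s y by (simp add: F_def B')
  have main: "\<exists>d>0. \<forall>s t x. s \<le> t \<longrightarrow> \<bar>s - s0\<bar> < d \<longrightarrow> \<bar>t - t0\<bar> < d \<longrightarrow> norm (x - x0) < d \<longrightarrow>
     \<bar>P t s (F s) x - P t0 s0 (F s0) x0\<bar> < e" if st0: "s0 \<le> t0" and e: "e > 0" for s0 t0 x0 e
  proof (cases "s0 = t0")
    case True
    from initial_continuity[OF f B', of "e / 3" s0 "norm x0 + 1"] e obtain d1 where d1: "d1 > 0"
      "\<And>s t x. \<bar>s - s0\<bar> < d1 \<Longrightarrow> s \<le> t \<Longrightarrow> t < s + d1 \<Longrightarrow> norm x \<le> norm x0 + 1 \<Longrightarrow>
        \<bar>P t s (F s) x - f (s0, x)\<bar> \<le> e / 3" by (auto simp: F_def)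
    have "continuous_on UNIV (F s0)" using F[of s0] by (simp add: mem_bcontfun)
    then obtain d2 where d2: "d2 > 0" "\<And>x. dist x x0 < d2 \<Longrightarrow> dist (F s0 x) (F s0 x0) < e / 3"
      using e unfolding continuous_on_iff by (metis UNIV_I divide_pos_pos zero_less_numeral)
    define d where "d = min (d1 / 2) (min d2 1)"
    have d: "d > 0" "2 * d \<le> d1" "d \<le> d2" "d \<le> 1" using d1 d2 by (auto simp: d_def)
    show ?thesis
    proof (intro exI[of _ d] conjI allI impI d(1))
      fix s t x assume h: "s \<le> t" "\<bar>s - s0\<bar> < d" "\<bar>t - t0\<bar> < d" "norm (x - x0) < d"
      have "norm x \<le> norm x0 + 1" using norm_triangle_sub[of x x0] h(4) d(4) by simp
      moreover have "\<bar>s - s0\<bar> < d1" "t < s + d1" using h(1-3) True d(1,2) by argo+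
      ultimately have 1: "\<bar>P t s (F s) x - f (s0, x)\<bar> \<le> e / 3" using h(1) by (intro d1(2))
      have "\<bar>f (s0, x) - f (s0, x0)\<bar> < e / 3" using d2(2)[of x] h(4) d(3) by (simp add: dist_norm F_def)
      moreover have "P t0 s0 (F s0) x0 = f (s0, x0)" using True P_init[OF F[of s0], of s0 x0]
        by (simp add: F_def)
      ultimately show "\<bar>P t s (F s) x - P t0 s0 (F s0) x0\<bar> < e" using 1 e by linarith
    qed
  next
    case False
    then have st: "s0 < t0" using st0 by simp
    obtain W where W: "W > 0" "\<And>x. norm x \<le> norm x0 + 1 \<Longrightarrow> V x \<le> W"
      using V_bounded_on[of "norm x0 + 1"] by auto
    \<comment> \<open>Chosen so that the far part, at most \<open>2 * B' / M * V y\<close>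
      initially, contributes \<open>e / 4\<close> at points near \<open>x0\<close>.\<close>
    define M where "M = 8 * B' * (W + a / c) / e"
    have Wp: "W + a / c > 0" using W a_pos c_pos by (simp add: add_pos_pos)
    have M: "M > 0" using B' Wp e by (simp add: M_def)
    have "2 * B' / (8 * B' * Y / e) * Y = e / 4" if "Y > 0" for Y using that B'(1) e by simp
    from this[OF Wp] have Me: "2 * B' / M * (W + a / c) = e / 4" by (simp only: M_def)
    obtain R where R: "\<And>x. V x \<le> M \<Longrightarrow> norm x \<le> R" using V_sublevel[of M] by auto
    from initial_continuity[OF f B', of "e / 16" s0 R] e obtain d1 where d1: "d1 > 0"
      "\<And>s t x. \<bar>s - s0\<bar> < d1 \<Longrightarrow> s \<le> t \<Longrightarrow> t < s + d1 \<Longrightarrow> norm x \<le> R \<Longrightarrow>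
        \<bar>P t s (F s) x - f (s0, x)\<bar> \<le> e / 16" by (auto simp: F_def)
    have "continuous_on ({s0..} \<times> UNIV) (\<lambda>(t, x). P t s0 (F s0) x)"
      using P_psol[OF F[of s0], of s0] by (simp add: psol_def)
    from this[unfolded continuous_on_iff, rule_format, of "(t0, x0)" "e / 2"]
    have "\<exists>d>0. \<forall>z\<in>{s0..} \<times> UNIV. dist z (t0, x0) < d \<longrightarrow>
        dist (case z of (t, x) \<Rightarrow> P t s0 (F s0) x) (P t0 s0 (F s0) x0) < e / 2"
      using st0 e by simp
    then obtain d2 where d2: "d2 > 0" "\<And>t x. t \<ge> s0 \<Longrightarrow> dist (t, x) (t0, x0) < d2 \<Longrightarrow>
        dist (P t s0 (F s0) x) (P t0 s0 (F s0) x0) < e / 2" by fastforce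
    define d where "d = min (min (d1 / 2) ((t0 - s0) / 2)) (min (d2 / 2) 1)"
    have d: "d > 0" "2 * d \<le> d1" "2 * d \<le> t0 - s0" "2 * d \<le> d2" "d \<le> 1"
      using d1(1) d2(1) st unfolding d_def min_def by argo+
    show ?thesis
    proof (intro exI[of _ d] conjI allI impI d(1))
      fix s t x assume h: "s \<le> t" "\<bar>s - s0\<bar> < d" "\<bar>t - t0\<bar> < d" "norm (x - x0) < d"
      \<comment> \<open>From this time on the two evolutions can be compared as solutions of one and
        the same Cauchy problem.\<close>
      define \<sigma> where "\<sigma> = max s s0"
      have \<sigma>: "s \<le> \<sigma>" "s0 \<le> \<sigma>" "\<sigma> < s + d1" "\<sigma> < s0 + d1" "\<sigma> \<le> t"
        using h(1-3) d(1-3) unfolding \<sigma>_def max_def by argo+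
      define h1 where "h1 = P \<sigma> s (F s)"
      define h2 where "h2 = P \<sigma> s0 (F s0)"
      have hb: "h1 \<in> bcontfun" "h2 \<in> bcontfun" unfolding h1_def h2_def by (auto intro: P_bcontfun F \<sigma>)
      have hB: "\<bar>h1 y\<bar> \<le> B'" "\<bar>h2 y\<bar> \<le> B'" for y unfolding h1_def h2_def by (auto intro!: P_abs_le F FB \<sigma>)
      have "\<bar>h1 y - h2 y\<bar> \<le> e / 8 + 2 * B' / M * V y" for y
      proof (cases "V y \<le> M")
        case True
        have "\<bar>h1 y - f (s0, y)\<bar> \<le> e / 16" "\<bar>h2 y - f (s0, y)\<bar> \<le> e / 16"
          unfolding h1_def h2_def
          by (rule d1(2)[OF _ \<sigma>(1,3) R[OF True]], use h(2) d(1,2) in argo)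
            (rule d1(2)[OF _ \<sigma>(2,4) R[OF True]], use d1(1) in simp)
        moreover have "0 \<le> 2 * B' / M * V y" using B' M V_pos[of y] by simp
        ultimately show ?thesis by linarith
      next
        case False
        then have "2 * B' / M * M \<le> 2 * B' / M * V y" using B' M by (intro mult_left_mono) auto
        then have "2 * B' \<le> 2 * B' / M * V y" using M by simp
        then show ?thesis using hB[of y] e by linarith
      qed
      then have dh: "h1 y - h2 y \<le> e / 8 + 2 * B' / M * V y" "h2 y - h1 y \<le> e / 8 + 2 * B' / M * V y" for y
        by (auto simp: abs_le_iff)
      have "norm x \<le> norm x0 + 1" using norm_triangle_sub[of x x0] h(4) d(5) by simp
      then have Vx: "V x \<le> W" by (rule W(2))
      define E where "E = exp (- c * (t - \<sigma>))"
      have E: "0 \<le> E" "E \<le> 1" using \<sigma> c_pos by (auto simp: E_def)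
      have "E * V x + a / c * (1 - E) \<le> 1 * W + a / c * 1"
        using E Vx V_pos[of x] a_pos c_pos by (intro add_mono mult_mono) auto
      then have "2 * B' / M * (E * V x + a / c * (1 - E)) \<le> 2 * B' / M * (W + a / c)"
        using B' M by (intro mult_left_mono) auto
      then have bd: "2 * B' / M * (E * V x + a / c * (1 - E)) \<le> e / 4" unfolding Me .
      have M0: "0 \<le> 2 * B' / M" using B' M by simp
      have "P t \<sigma> h1 x - P t \<sigma> h2 x \<le> e / 8 + e / 4" "P t \<sigma> h2 x - P t \<sigma> h1 x \<le> e / 8 + e / 4"
        using P_diff_bound[OF hb(1,2) dh(1) M0 \<sigma>(5), of x] P_diff_bound[OF hb(2,1) dh(2) M0 \<sigma>(5), of x] bd
        unfolding E_def by linarith+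
      then have 1: "\<bar>P t s (F s) x - P t s0 (F s0) x\<bar> \<le> 3 / 8 * e"
        unfolding h1_def h2_def P_semigroup[OF F \<sigma>(1,5)] P_semigroup[OF F \<sigma>(2,5)] by linarith
      have "dist (t, x) (t0, x0) \<le> dist t t0 + dist x x0"
        by (simp add: dist_Pair_Pair sqrt_sum_squares_le_sum)
      also have "\<dots> < d2" using h d by (simp add: dist_norm)
      finally have "\<bar>P t s0 (F s0) x - P t0 s0 (F s0) x0\<bar> < e / 2"
        using d2(2)[of t x] \<sigma>(2,5) by (simp add: dist_norm)
      then show "\<bar>P t s (F s) x - P t0 s0 (F s0) x0\<bar> < e" using 1 e by linarith
    qed
  qed
  show ?thesis
    unfolding continuous_on_iff
  proof (intro ballI allI impI)
    fix z :: "real \<times> real \<times> (real ^ 'n)" and e :: real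
    assume "z \<in> {z. fst z \<le> fst (snd z)}" and e: "e > 0"
    then have "fst z \<le> fst (snd z)" by simp
    from main[OF this e, of "snd (snd z)"] obtain d where d: "d > 0"
      "\<And>s t x. s \<le> t \<Longrightarrow> \<bar>s - fst z\<bar> < d \<Longrightarrow> \<bar>t - fst (snd z)\<bar> < d \<Longrightarrow> norm (x - snd (snd z)) < d \<Longrightarrow>
       \<bar>P t s (F s) x - P (fst (snd z)) (fst z) (F (fst z)) (snd (snd z))\<bar> < e" by blast
    show "\<exists>d>0. \<forall>z'\<in>{z. fst z \<le> fst (snd z)}. dist z' z < d \<longrightarrow>
      dist (P (fst (snd z')) (fst z') (\<lambda>y. f (fst z', y)) (snd (snd z')))
           (P (fst (snd z)) (fst z) (\<lambda>y. f (fst z, y)) (snd (snd z))) < e"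
    proof (intro exI[of _ d] conjI ballI impI d(1))
      fix z' assume z': "z' \<in> {z. fst z \<le> fst (snd z)}" "dist z' z < d"
      have "\<bar>P (fst (snd z')) (fst z') (F (fst z')) (snd (snd z')) - P (fst (snd z)) (fst z) (F (fst z))
        (snd (snd z))\<bar> < e"
      proof (rule d(2))
        have 1: "dist (fst z') (fst z) \<le> dist z' z" "dist (snd z') (snd z) \<le> dist z' z"
          by (rule dist_fst_le, rule dist_snd_le)
        have 2: "dist (fst (snd z')) (fst (snd z)) \<le> dist (snd z') (snd z)"
          "dist (snd (snd z')) (snd (snd z)) \<le> dist (snd z') (snd z)"
          by (rule dist_fst_le, rule dist_snd_le)
        show "\<bar>fst z' - fst z\<bar> < d" "\<bar>fst (snd z') - fst (snd z)\<bar> < d" "norm (snd (snd z') - snd (snd z)) < d"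
          using 1 2 z'(2) by (auto simp: dist_norm)
      qed (use z' in simp)
      then show "dist (P (fst (snd z')) (fst z') (\<lambda>y. f (fst z', y)) (snd (snd z')))
           (P (fst (snd z)) (fst z) (\<lambda>y. f (fst z, y)) (snd (snd z))) < e"
        by (simp add: dist_norm F_def)
    qed
  qed
qed

end

subsection \<open>The evolution system of measures\<close>

locale evolution_measures = evolution T \<alpha> \<delta> a c Q b V P
  for T \<alpha> \<delta> a c :: real
    and Q :: "real \<times> (real ^ 'n) \<Rightarrow> real ^ 'n ^ 'n"
    and b :: "real \<times> (real ^ 'n) \<Rightarrow> real ^ 'n"
    and V :: "real ^ 'n \<Rightarrow> real"
    and P :: "real \<Rightarrow> real \<Rightarrow> (real ^ 'n \<Rightarrow> real) \<Rightarrow> real ^ 'n \<Rightarrow> real" +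
  fixes \<mu> :: "real \<Rightarrow> (real ^ 'n) measure"
  assumes pes: "periodic_evolution_system T P \<mu>"
begin

lemma mu_prob: "prob_space (\<mu> s)" and mu_sets: "sets (\<mu> s) = sets borel"
  and mu_per: "\<mu> (s + T) = \<mu> s"
  using pes by (auto simp: periodic_evolution_system_def)

lemma mu_invariant: "s < t \<Longrightarrow> f \<in> bcontfun \<Longrightarrow> (LINT x|\<mu> t. P t s f x) = (LINT x|\<mu> s. f x)"
  using pes by (auto simp: periodic_evolution_system_def)

lemma mu_per': "\<mu> (s - real n * T) = \<mu> s"
proof (induction n)
  case (Suc n)
  have "\<mu> (s - real (Suc n) * T) = \<mu> (s - real (Suc n) * T + T)" by (simp add: mu_per)
  then show ?case using Suc by (simp add: algebra_simps)
qed simp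

lemma continuous_measurable_mu: "continuous_on UNIV f \<Longrightarrow>
  f \<in> borel_measurable (\<mu> s)" for f :: "real ^ 'n \<Rightarrow> real"
  using borel_measurable_continuous_onI measurable_cong_sets[OF mu_sets refl] by blast

lemma mu_integrable:
  fixes f :: "real ^ 'n \<Rightarrow> real"
  assumes "f \<in> bcontfun" shows "integrable (\<mu> s) f"
proof -
  obtain B where B: "\<And>x. \<bar>f x\<bar> \<le> B" using bcontfun_bound[OF assms] by blast
  interpret prob_space "\<mu> s" by (rule mu_prob)
  show ?thesis
    by (rule integrable_const_bound[of _ B])
      (use B assms in \<open>auto simp: mem_bcontfun intro: continuous_measurable_mu\<close>)
qed

text \<open>Invariance of the measures is given for bounded continuous functions, so
  \<open>V\<close> is truncated before being integrated.\<close>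

lemma minV_bcontfun: "k \<ge> 0 \<Longrightarrow> (\<lambda>x. min (V x) k) \<in> bcontfun"
proof (rule bcontfunI[of _ k])
  show "continuous_on UNIV (\<lambda>x. min (V x) k)" by (intro continuous_on_min V_cont continuous_intros)
  show "\<bar>min (V x) k\<bar> \<le> k" if "k \<ge> 0" for x using V_pos[of x] that by (simp add: min_def)
qed

text \<open>By periodicity \<open>\<mu> t\<close> is also the measure \<open>n\<close> periods
  earlier. Invariance over that stretch replaces \<open>V\<close> by
  \<open>exp (- c * (real n * T)) * V x + a / c\<close>, still cut at \<open>k\<close>, and
  dominated convergence removes the first summand. The bound is uniform in the cut and does the work
  of a moment bound for \<open>V\<close>.\<close>

lemma mu_minV:
  assumes k: "k \<ge> 0"
  shows "(LINT x|\<mu> t. min (V x) k) \<le> a / c"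
proof -
  interpret prob_space "\<mu> t" by (rule mu_prob)
  define g where "g n x = min k (exp (- c * (real n * T)) * V x + a / c)" for n :: nat and x
  have gc: "continuous_on UNIV (g n)" for n
    unfolding g_def by (intro continuous_intros continuous_on_min V_cont)
  have gb: "\<bar>g n x\<bar> \<le> k" for n x
    using k V_pos[of x] a_pos c_pos by (auto simp: g_def min_def)
  have "(LINT x|\<mu> t. min (V x) k) \<le> (LINT x|\<mu> t. g n x)" if n: "n > 0" for n
  proof -
    define s where "s = t - real n * T"
    have s: "s < t" using n T_pos by (simp add: s_def)
    have "(LINT x|\<mu> t. min (V x) k) = (LINT x|\<mu> s. min (V x) k)" by (simp add: s_def mu_per')
    also have "\<dots> = (LINT x|\<mu> t. P t s (\<lambda>x. min (V x) k) x)"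
      using mu_invariant[OF s minV_bcontfun[OF k]] by simp
    also have "\<dots> \<le> (LINT x|\<mu> t. g n x)"
    proof (rule integral_mono)
      show "integrable (\<mu> t) (P t s (\<lambda>x. min (V x) k))"
        using s by (intro mu_integrable P_bcontfun minV_bcontfun k) simp
      show "integrable (\<mu> t) (g n)" by (intro mu_integrable bcontfunI[OF gc gb])
      fix x
      have "P t s (\<lambda>x. min (V x) k) x \<le> k"
        using P_upper[OF minV_bcontfun[OF k], of k 0 s t x] s by simp
      moreover have "P t s (\<lambda>x. min (V x) k) x \<le>
        0 + 1 * (exp (- c * (t - s)) * V x + a / c * (1 - exp (- c * (t - s))))"
        by (rule P_upper[OF minV_bcontfun[OF k]]) (use s in auto)
      moreover have "a / c * (1 - exp (- c * (t - s))) \<le> a / c" using a_pos c_pos by (intro mult_left_le) auto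
      ultimately show "P t s (\<lambda>x. min (V x) k) x \<le> g n x" by (simp add: g_def s_def)
    qed
    finally show ?thesis .
  qed
  moreover have "(\<lambda>n. LINT x|\<mu> t. g n x) \<longlonglongrightarrow> (LINT x|\<mu> t. min k (a / c))"
  proof (rule integral_dominated_convergence[where w = "\<lambda>_. k"])
    show "AE x in \<mu> t. (\<lambda>n. g n x) \<longlonglongrightarrow> min k (a / c)"
    proof (rule AE_I2)
      fix x
      have "(\<lambda>n. exp (- (c * T)) ^ n) \<longlonglongrightarrow> 0"
        using c_pos T_pos by (intro LIMSEQ_power_zero) simp
      then have "(\<lambda>n. exp (- c * (real n * T))) \<longlonglongrightarrow> 0"
        by (simp add: exp_of_nat_mult[symmetric] mult_ac)
      then have "(\<lambda>n. min k (exp (- c * (real n * T)) * V x + a / c)) \<longlonglongrightarrow> min k (0 * V x + a / c)"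
        by (intro tendsto_intros tendsto_min)
      then show "(\<lambda>n. g n x) \<longlonglongrightarrow> min k (a / c)" by (simp add: g_def)
    qed
  qed (use gb gc in \<open>auto intro: continuous_measurable_mu\<close>)
  then have "(\<lambda>n. LINT x|\<mu> t. g n x) \<longlonglongrightarrow> min k (a / c)" by (simp add: prob_space)
  ultimately have "(LINT x|\<mu> t. min (V x) k) \<le> min k (a / c)"
    by (intro LIMSEQ_le_const) (auto intro!: exI[of _ 1])
  then show ?thesis by simp
qed

lemma mean_abs_le:
  fixes f :: "real ^ 'n \<Rightarrow> real"
  assumes "f \<in> bcontfun" "\<And>x. \<bar>f x\<bar> \<le> B"
  shows "\<bar>LINT x|\<mu> s. f x\<bar> \<le> B"
proof -
  interpret prob_space "\<mu> s" by (rule mu_prob)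
  have "\<bar>LINT x|\<mu> s. f x\<bar> \<le> (LINT x|\<mu> s. \<bar>f x\<bar>)"
    using integral_norm_bound[of "\<mu> s" f] by simp
  also have "\<dots> \<le> (LINT x|\<mu> s. B)"
    by (intro integral_mono integrable_abs mu_integrable assms const_bcontfun)
  finally show ?thesis by (simp add: prob_space)
qed

text \<open>By invariance the mean of \<open>f\<close> is the \<open>\<mu> t\<close>-average of
  \<open>P t s f y\<close> over \<open>y\<close>, so the oscillation bound is averaged over its
  second argument.\<close>

lemma mean_decay:
  "\<exists>\<beta> q. \<beta> > 0 \<and> 0 < q \<and> q < 1 \<and> (\<forall>n s t f B. f \<in> bcontfun \<longrightarrow> B > 0 \<longrightarrow> (\<forall>x. \<bar>f x\<bar> \<le> B) \<longrightarrow>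
     s + 2 * real n \<le> t \<longrightarrow> s < t \<longrightarrow>
     (\<forall>x. \<bar>P t s f x - (LINT y|\<mu> s. f y)\<bar> \<le> q ^ n * B * (2 + \<beta> * V x + \<beta> * (a / c))))"
proof -
  obtain \<beta> q where \<beta>: "\<beta> > 0" and q: "0 < q" "q < 1"
    and osc': "\<forall>n s t f B. f \<in> bcontfun \<longrightarrow> B > 0 \<longrightarrow> (\<forall>x. \<bar>f x\<bar> \<le> B) \<longrightarrow> s + 2 * real n \<le> t \<longrightarrow>
     (\<forall>x y. \<bar>P t s f x - P t s f y\<bar> \<le> q ^ n * B * (2 + \<beta> * V x + \<beta> * V y))"
    using oscillation_decay by (elim exE conjE) (rule that)
  note osc = osc'[rule_format]
  show ?thesis
  proof (rule exI[of _ \<beta>], rule exI[of _ q], intro conjI allI impI \<beta> q)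
    fix n and s t B :: real and f :: "real ^ 'n \<Rightarrow> real" and x
    assume f: "f \<in> bcontfun" and B: "0 < B" "\<forall>x. \<bar>f x\<bar> \<le> B" and t: "s + 2 * real n \<le> t" "s < t"
    interpret prob_space "\<mu> t" by (rule mu_prob)
    \<comment> \<open>At this height the weight term \<open>r * \<beta> * k\<close> is exactly
      \<open>2 * B\<close>, so above it the trivial bound on the oscillation is at least as good and
      \<open>V\<close> may be replaced by its truncation.\<close>
    define k where "k = 2 / (q ^ n * \<beta>)"
    have k: "k > 0" using q \<beta> by (simp add: k_def)
    define r where "r = q ^ n * B"
    have r: "r > 0" using q B by (simp add: r_def)
    have Pf: "P t s f \<in> bcontfun" using P_bcontfun f t by simp
    have pt: "\<bar>P t s f x - P t s f y\<bar> \<le> r * (2 + \<beta> * V x) + r * \<beta> * min (V y) k" for y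
    proof (cases "V y \<le> k")
      case True
      have "\<bar>P t s f x - P t s f y\<bar> \<le> q ^ n * B * (2 + \<beta> * V x + \<beta> * V y)"
        by (rule osc[OF f B(1) _ t(1)]) (use B in auto)
      then show ?thesis using True by (simp add: min_def r_def algebra_simps)
    next
      case False
      have "\<bar>P t s f z\<bar> \<le> B" for z using P_abs_le[OF f _ less_imp_le[OF t(2)]] B by blast
      from this[of x] this[of y] have "\<bar>P t s f x - P t s f y\<bar> \<le> 2 * B" by linarith
      moreover have "r * \<beta> * k = 2 * B" using q \<beta> by (simp add: r_def k_def)
      moreover have "0 \<le> r * (2 + \<beta> * V x)" using r \<beta> V_pos[of x] by (simp add: add_nonneg_nonneg)
      ultimately show ?thesis using False by (simp add: min_def)
    qed
    have "P t s f x - (LINT y|\<mu> s. f y) = (LINT y|\<mu> t. P t s f x - P t s f y)"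
      using mu_invariant[OF t(2) f] mu_integrable[OF Pf, of t] by (simp add: prob_space)
    also have "\<bar>\<dots>\<bar> \<le> (LINT y|\<mu> t. \<bar>P t s f x - P t s f y\<bar>)"
      using integral_norm_bound[of "\<mu> t" "\<lambda>y. P t s f x - P t s f y"] by simp
    also have "\<dots> \<le> (LINT y|\<mu> t. r * (2 + \<beta> * V x) + r * \<beta> * min (V y) k)"
      using k by (intro integral_mono pt integrable_abs Bochner_Integration.integrable_diff
          Bochner_Integration.integrable_add integrable_mult_right mu_integrable Pf minV_bcontfun
          const_bcontfun) simp
    also have "\<dots> = r * (2 + \<beta> * V x) + r * \<beta> * (LINT y|\<mu> t. min (V y) k)"
      using mu_integrable[OF minV_bcontfun, of k t] k by (simp add: prob_space)
    also have "\<dots> \<le> r * (2 + \<beta> * V x) + r * \<beta> * (a / c)"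
      using r \<beta> mu_minV[of k t] k by (intro add_left_mono mult_left_mono) auto
    finally show "\<bar>P t s f x - (LINT y|\<mu> s. f y)\<bar> \<le> q ^ n * B * (2 + \<beta> * V x + \<beta> * (a / c))"
      by (simp add: r_def algebra_simps)
  qed
qed

text \<open>No continuity of the measures in \<open>s\<close> is assumed. It is inherited from the
  evolution operator: evaluated at the origin after a long time it approximates the mean, with an
  error independent of \<open>s\<close>.\<close>

lemma mean_continuous:
  fixes f :: "real \<times> (real ^ 'n) \<Rightarrow> real"
  assumes f: "continuous_on UNIV f" and B: "\<And>z. \<bar>f z\<bar> \<le> B"
  shows "continuous_on UNIV (\<lambda>s. LINT y|\<mu> s. f (s, y))"
proof -
  define B' where "B' = \<bar>B\<bar> + 1"
  have B': "B' > 0" "\<bar>f z\<bar> \<le> B'" for z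
    using B[of z] abs_ge_self[of B] unfolding B'_def by linarith+
  obtain \<beta> q where \<beta>: "\<beta> > 0" and q: "0 < q" "q < 1"
    and dec': "\<forall>n s t f B. f \<in> bcontfun \<longrightarrow> B > 0 \<longrightarrow> (\<forall>x. \<bar>f x\<bar> \<le> B) \<longrightarrow> s + 2 * real n \<le> t \<longrightarrow> s < t \<longrightarrow>
     (\<forall>x. \<bar>P t s f x - (LINT y|\<mu> s. f y)\<bar> \<le> q ^ n * B * (2 + \<beta> * V x + \<beta> * (a / c)))"
    using mean_decay by (elim exE conjE) (rule that)
  note dec = dec'[rule_format]
  define D where "D = B' * (2 + \<beta> * V 0 + \<beta> * (a / c))"
  \<comment> \<open>The extra 1 keeps the elapsed time positive for \<open>n = 0\<close>.\<close>
  define u where "u n s = P (s + 2 * real n + 1) s (\<lambda>y. f (s, y)) 0" for n :: nat and s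
  have uc: "continuous_on UNIV (u n)" for n
  proof -
    have "continuous_on UNIV (\<lambda>s. (s, s + 2 * real n + 1, 0 :: real ^ 'n))" by (intro continuous_intros)
    from continuous_on_compose2[OF evolution_jointly_continuous[OF f B] this]
    show ?thesis by (simp add: u_def[abs_def] subset_iff image_iff)
  qed
  have "uniform_limit UNIV u (\<lambda>s. LINT y|\<mu> s. f (s, y)) sequentially"
  proof (rule uniform_limitI)
    fix e :: real assume e: "e > 0"
    have "(\<lambda>n. q ^ n * D) \<longlonglongrightarrow> 0 * D" using q by (intro tendsto_intros LIMSEQ_power_zero) auto
    then have "\<forall>\<^sub>F n in sequentially. q ^ n * D < e" using e by (intro order_tendstoD) auto
    then show "\<forall>\<^sub>F n in sequentially. \<forall>s\<in>UNIV. dist (u n s) (LINT y|\<mu> s. f (s, y)) < e"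
    proof eventually_elim
      case (elim n)
      have "\<bar>u n s - (LINT y|\<mu> s. f (s, y))\<bar> \<le> q ^ n * B' * (2 + \<beta> * V 0 + \<beta> * (a / c))" for s
        unfolding u_def by (rule dec[OF slice_bcontfun[OF f B] B'(1)]) (use B' in auto)
      then show ?case using elim by (auto simp: dist_norm D_def mult.assoc intro: le_less_trans)
    qed
  qed
  then show ?thesis
    by (rule uniform_limit_theorem[rotated]) (use uc in auto)
qed

end

subsection \<open>Means of the evolution semigroup\<close>

text \<open>Uniform continuity on the product of the time interval with a compact set yields a mesh
  that works for all points of the set at once, which identifies the integral in the given topology
  with the pointwise one.\<close>

lemma has_tauc_integral_continuous:
  fixes F :: "real \<Rightarrow> 'a::metric_space \<Rightarrow> real"
  assumes r: "0 \<le> r" and cont: "continuous_on ({0..r} \<times> UNIV) (\<lambda>(t, z). F t z)"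
  shows "has_tauc_integral F 0 r (\<lambda>z. integral {0..r} (\<lambda>t. F t z))"
  unfolding has_tauc_integral_def
proof (intro allI impI)
  fix K :: "'a set" and e :: real assume K: "compact K" and e: "e > 0"
  \<comment> \<open>Dividing by \<open>r + 1\<close> covers \<open>r = 0\<close> and makes the final
    inequality strict.\<close>
  define e' where "e' = e / (r + 1)"
  have e': "e' > 0" "e' * r < e" using e r by (auto simp: e'_def field_simps)
  have "uniformly_continuous_on ({0..r} \<times> K) (\<lambda>(t, z). F t z)"
    by (intro compact_uniformly_continuous continuous_on_subset[OF cont] compact_Times K) auto
  then obtain d where d: "d > 0" "\<And>t t' z. t \<in> {0..r} \<Longrightarrow> t' \<in> {0..r} \<Longrightarrow> z \<in> K \<Longrightarrow> dist t' t < d \<Longrightarrow>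
      \<bar>F t' z - F t z\<bar> < e'"
    using e'(1) unfolding uniformly_continuous_on_def by (fastforce simp: dist_Pair_Pair dist_norm)
  show "\<exists>d>0. \<forall>p. p tagged_division_of {0..r} \<and> (\<lambda>t. ball t d) fine p \<longrightarrow>
     (\<forall>z\<in>K. \<bar>(\<Sum>(t, J)\<in>p. measure lborel J * F t z) - integral {0..r} (\<lambda>t. F t z)\<bar> < e)"
  proof (intro exI[of _ d] conjI allI impI ballI d(1))
    fix p z assume p: "p tagged_division_of {0..r} \<and> (\<lambda>t. ball t d) fine p" and z: "z \<in> K"
    then have p1: "p tagged_division_of (cbox 0 r)" by (simp add: box_real)
    have Fc: "continuous_on {0..r} (\<lambda>t. F t z)"
      by (rule continuous_on_compose2[OF cont, of _ "\<lambda>t. (t, z)", simplified]) (auto intro!: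
        continuous_intros)
    have int: "(\<lambda>t. F t z) integrable_on cbox 0 r"
      using integrable_continuous_interval[OF Fc] by (simp add: box_real)
    have eq: "integral {0..r} (\<lambda>t. F t z) = (\<Sum>(t, J)\<in>p. integral J (\<lambda>t. F t z))"
      using integral_combine_tagged_division_topdown[OF int p1] by (simp add: box_real)
    have "(\<Sum>(t, J)\<in>p. measure lborel J * F t z) - (\<Sum>(t, J)\<in>p. integral J (\<lambda>t. F t z)) =
      (\<Sum>(t, J)\<in>p. measure lborel J * F t z - integral J (\<lambda>t. F t z))"
      by (simp add: sum_subtractf case_prod_beta)
    also have "\<bar>\<dots>\<bar> \<le> (\<Sum>(t, J)\<in>p. \<bar>measure lborel J * F t z - integral J (\<lambda>t. F t z)\<bar>)"
      by (rule order_trans[OF sum_abs]) (auto intro: sum_mono)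
    also have "\<dots> \<le> (\<Sum>(t, J)\<in>p. measure lborel J * e')"
    proof (intro sum_mono, clarify)
      fix t J assume tJ: "(t, J) \<in> p"
      obtain u v where J: "J = cbox u v" using tagged_division_ofD(4)[OF p1 tJ] by blast
      have tJ': "t \<in> J" "J \<subseteq> {0..r}" using tagged_division_ofD(2,3)[OF p1 tJ] by (auto simp: box_real)
      have Jd: "J \<subseteq> ball t d" using p tJ by (auto simp: fine_def)
      have intJ: "(\<lambda>t. F t z) integrable_on cbox u v"
        using integrable_on_subcbox[OF int] tJ'(2) unfolding J by (simp add: box_real)
      have "((\<lambda>x. F t z - F x z) has_integral (measure lborel J * F t z - integral J (\<lambda>t. F t z))) (cbox u v)"
        using has_integral_diff[OF has_integral_const[of "F t z" u v] integrable_integral[OF intJ]]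
          unfolding J by simp
      then have "norm (measure lborel J * F t z - integral J (\<lambda>t. F t z)) \<le> e' * measure lborel (cbox u v)"
      proof (rule has_integral_bound[rotated])
        fix x assume "x \<in> cbox u v"
        then have "x \<in> J" by (simp add: J)
        then have "\<bar>F t z - F x z\<bar> < e'" using tJ' Jd z by (intro d(2)) (auto simp: dist_commute)
        then show "norm (F t z - F x z) \<le> e'" by simp
      qed (use e' in auto)
      then show "\<bar>measure lborel J * F t z - integral J (\<lambda>t. F t z)\<bar> \<le> measure lborel J * e'"
        by (simp add: J mult.commute)
    qed
    also have "\<dots> = (\<Sum>(t, J)\<in>p. measure lborel J) * e'" by (simp add: sum_distrib_right case_prod_beta)
    also have "(\<Sum>(t, J)\<in>p. measure lborel J) = r"
      using additive_content_tagged_division[OF p1] r by simp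
    finally show "\<bar>(\<Sum>(t, J)\<in>p. measure lborel J * F t z) - integral {0..r} (\<lambda>t. F t z)\<bar> < e"
      using e'(2) unfolding eq by (simp add: mult.commute)
  qed
qed

lemma parametric_integral_bcontfun:
  fixes F :: "real \<Rightarrow> 'a::metric_space \<Rightarrow> real"
  assumes r: "0 \<le> r" and cont: "continuous_on ({0..r} \<times> UNIV) (\<lambda>(t, z). F t z)"
    and B: "\<And>t z. 0 \<le> t \<Longrightarrow> t \<le> r \<Longrightarrow> \<bar>F t z\<bar> \<le> B"
  shows "(\<lambda>z. integral {0..r} (\<lambda>t. F t z)) \<in> bcontfun"
proof (rule bcontfunI)
  have "continuous_on (UNIV \<times> cbox 0 r) (\<lambda>z. case (snd z, fst z) of (t, z) \<Rightarrow> F t z)"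
    by (rule continuous_on_compose2[OF cont]) (auto intro!: continuous_intros)
  then have "continuous_on (UNIV \<times> cbox 0 r) (\<lambda>(z, t). F t z)" by (simp add: case_prod_beta')
  then show "continuous_on UNIV (\<lambda>z. integral {0..r} (\<lambda>t. F t z))"
    using integral_continuous_on_param[of UNIV 0 r "\<lambda>z t. F t z"] by (simp add: box_real)
  fix z
  have Fc: "continuous_on {0..r} (\<lambda>t. F t z)"
    by (rule continuous_on_compose2[OF cont, of _ "\<lambda>t. (t, z)", simplified]) (auto intro!: continuous_intros)
  show "\<bar>integral {0..r} (\<lambda>t. F t z)\<bar> \<le> B * (r - 0)"
    using integral_bound[OF r Fc, of B] B by simp
qed

text \<open>A Cesaro argument, uniform on \<open>K\<close>: the contribution up to \<open>t0\<close>
  is bounded and disappears after division by \<open>r\<close>, the rest is at most half of the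
  tolerance.\<close>

lemma average_tendsto_zero:
  fixes h :: "real \<Rightarrow> 'a \<Rightarrow> real"
  assumes cont: "\<And>z. z \<in> K \<Longrightarrow> continuous_on {0..} (\<lambda>t. h t z)"
    and C: "\<And>t z. 0 \<le> t \<Longrightarrow> z \<in> K \<Longrightarrow> \<bar>h t z\<bar> \<le> C"
    and lim: "\<And>\<eta>. \<eta> > 0 \<Longrightarrow> \<exists>t0\<ge>0. \<forall>t\<ge>t0. \<forall>z\<in>K. \<bar>h t z\<bar> \<le> \<eta>"
  shows "uniform_limit K (\<lambda>r z. 1 / r * integral {0..r} (\<lambda>t. h t z)) (\<lambda>_. 0) at_top"
proof (rule uniform_limitI)
  fix e :: real assume e: "e > 0"
  from lim[of "e / 2"] e obtain t0 where t0: "t0 \<ge> 0" "\<And>t z. t \<ge> t0 \<Longrightarrow> z \<in> K \<Longrightarrow> \<bar>h t z\<bar> \<le> e / 2" by auto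
  define C' where "C' = \<bar>C\<bar> + 1"
  have "\<forall>\<^sub>F r in at_top. r > max (t0 + 1) (2 * C' * t0 / e + 1)" by (rule eventually_gt_at_top)
  then show "\<forall>\<^sub>F r in at_top. \<forall>z\<in>K. dist (1 / r * integral {0..r} (\<lambda>t. h t z)) 0 < e"
  proof eventually_elim
    case (elim r)
    have r: "r > t0" "r > 0" "r * e > 2 * C' * t0"
      using elim t0(1) e by (auto simp: field_simps)
    show ?case
    proof
      fix z assume z: "z \<in> K"
      have c1: "continuous_on {0..t0} (\<lambda>t. h t z)" "continuous_on {t0..r} (\<lambda>t. h t z)" "continuous_on
        {0..r} (\<lambda>t. h t z)"
        by (rule continuous_on_subset[OF cont[OF z]], use t0 in auto)+
      have hb: "\<bar>h t z\<bar> \<le> C'" if "0 \<le> t" for t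
        using C[OF that z] abs_ge_self[of C] unfolding C'_def by linarith
      have i1: "\<bar>integral {0..t0} (\<lambda>t. h t z)\<bar> \<le> C' * (t0 - 0)"
        using integral_bound[OF t0(1) c1(1), of C'] hb by simp
      have i2: "\<bar>integral {t0..r} (\<lambda>t. h t z)\<bar> \<le> e / 2 * (r - t0)"
        using integral_bound[OF less_imp_le[OF r(1)] c1(2), of "e / 2"] t0(2)[OF _ z] by simp
      have "integral {0..r} (\<lambda>t. h t z) = integral {0..t0} (\<lambda>t. h t z) + integral {t0..r} (\<lambda>t. h t z)"
        using Henstock_Kurzweil_Integration.integral_combine[OF t0(1) less_imp_le[OF r(1)]
          integrable_continuous_interval[OF c1(3)]] by simp
      then have "\<bar>integral {0..r} (\<lambda>t. h t z)\<bar> \<le> C' * t0 + e / 2 * (r - t0)" using i1 i2 by simp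
      also have "\<dots> \<le> C' * t0 + e / 2 * r" using e t0(1) by simp
      also have "\<dots> < r * e" using r(3) by (simp add: field_simps)
      finally have "\<bar>integral {0..r} (\<lambda>t. h t z)\<bar> < r * e" .
      then show "dist (1 / r * integral {0..r} (\<lambda>t. h t z)) 0 < e"
        using r(2) by (simp add: field_simps abs_mult)
    qed
  qed
qed

lemma continuous_antiderivative:
  fixes m :: "real \<Rightarrow> real"
  assumes m: "continuous_on UNIV m"
  obtains \<Phi> where "\<And>x. (\<Phi> has_real_derivative m x) (at x)"
proof -
  \<comment> \<open>An integral over an interval with reversed endpoints is 0, so the two terms are
    active on opposite sides of the origin and together give a signed integral.\<close>
  define \<Phi> where "\<Phi> x = integral {0..x} m - integral {x..0} m" for x
  have mi: "m integrable_on {u..v}" for u v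
    by (rule integrable_continuous_interval[OF continuous_on_subset[OF m]]) simp
  have "(\<Phi> has_real_derivative m x) (at x)" for x
  proof -
    define N where "N = \<bar>x\<bar> + 1"
    have eq: "\<Phi> y = integral {- N..y} m - integral {- N..0} m" if y: "y \<in> {- N..N}" for y
    proof (cases "y \<ge> 0")
      case True
      have "integral {- N..0} m + integral {0..y} m = integral {- N..y} m"
        by (rule Henstock_Kurzweil_Integration.integral_combine[OF _ _ mi]) (use True in \<open>auto simp: N_def\<close>)
      moreover have "integral {y..0} m = 0" using True by (cases "y = 0") auto
      ultimately show ?thesis by (simp add: \<Phi>_def)
    next
      case False
      have "integral {- N..y} m + integral {y..0} m = integral {- N..0} m"
        by (rule Henstock_Kurzweil_Integration.integral_combine[OF _ _ mi]) (use False y in auto)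
      then show ?thesis using False by (simp add: \<Phi>_def)
    qed
    have "((\<lambda>y. integral {- N..y} m) has_real_derivative m x) (at x within {- N..N})"
      by (rule integral_has_real_derivative[OF continuous_on_subset[OF m]]) (auto simp: N_def)
    then have "((\<lambda>y. integral {- N..y} m - integral {- N..0} m) has_real_derivative m x) (at x within {-
      N..N})"
      by (auto intro!: derivative_eq_intros)
    then have "(\<Phi> has_real_derivative m x) (at x within {- N..N})"
      by (rule has_field_derivative_transform_within[of _ _ _ _ 1]) (auto simp: eq N_def)
    moreover have "at x within {- N..N} = at x"
      by (rule at_within_interior) (auto simp: N_def)
    ultimately show ?thesis by simp
  qed
  then show ?thesis by (rule that)
qed

text \<open>The increment of an antiderivative over one period is constant, so the antiderivative is
  \<open>G\<close> times the identity plus a periodic, hence bounded, function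
  \<open>\<Psi>\<close>. Averages differ from \<open>G\<close> by at most \<open>2 * C / r\<close>,
  whatever \<open>s\<close> is.\<close>

lemma periodic_average:
  fixes m :: "real \<Rightarrow> real"
  assumes T: "T > 0" and m: "continuous_on UNIV m" and per: "\<And>s. m (s + T) = m s"
  shows "\<exists>G. uniform_limit UNIV (\<lambda>r s. 1 / r * integral {0..r} (\<lambda>t. m (s - t))) (\<lambda>_. G) at_top"
proof -
  obtain \<Phi> where \<Phi>: "\<And>x. (\<Phi> has_real_derivative m x) (at x)"
    using continuous_antiderivative[OF m] by blast
  have shift: "((\<lambda>x. \<Phi> (x + T)) has_real_derivative m x) (at x)" for x
    using \<Phi>[of "x + T"] per[of x] by (simp add: DERIV_shift)
  have "\<Phi> (x + T) - \<Phi> x = \<Phi> (0 + T) - \<Phi> 0" for x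
    by (rule DERIV_isconst_all[of "\<lambda>x. \<Phi> (x + T) - \<Phi> x"])
      (use DERIV_diff[OF shift \<Phi>] in simp)
  then have \<Phi>T: "\<Phi> (x + T) - \<Phi> x = \<Phi> T - \<Phi> 0" for x by simp
  define G where "G = (\<Phi> T - \<Phi> 0) / T"
  define \<Psi> where "\<Psi> x = \<Phi> x - G * x" for x
  have \<Psi>per: "\<Psi> (x + T) = \<Psi> x" for x
    using \<Phi>T[of x] T by (simp add: \<Psi>_def G_def distrib_left)
  have \<Phi>c: "continuous_on UNIV \<Phi>" using \<Phi> by (meson DERIV_isCont continuous_at_imp_continuous_on)
  \<comment> \<open>A one-dimensional dummy space variable makes \<open>periodic_bounded\<close>
    applicable to a function of time alone.\<close>
  have "\<exists>C>0. \<forall>s (x :: real ^ 1). norm x \<le> 1 \<longrightarrow> norm ((\<lambda>z. \<Psi> (fst z)) (s, x)) \<le> C"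
  proof (rule periodic_bounded[OF T])
    show "time_periodic T (\<lambda>z. \<Psi> (fst z))" by (simp add: time_periodic_def \<Psi>per)
    show "continuous_on UNIV (\<lambda>z. \<Psi> (fst z))"
      unfolding \<Psi>_def by (intro continuous_intros continuous_on_compose2[OF \<Phi>c]) auto
  qed
  then obtain C where C: "C > 0" "\<And>s. \<bar>\<Psi> s\<bar> \<le> C" by (metis fst_conv norm_zero real_norm_def zero_le_one)
  have eq: "integral {0..r} (\<lambda>t. m (s - t)) = G * r + (\<Psi> s - \<Psi> (s - r))" if "r \<ge> 0" for r s
  proof -
    have "((\<lambda>t. m (s - t)) has_integral (- \<Phi> (s - r) - - \<Phi> (s - 0))) {0..r}"
    proof (rule fundamental_theorem_of_calculus[OF that])
      fix t
      have "((\<lambda>t. - \<Phi> (s - t)) has_real_derivative m (s - t)) (at t)"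
        by (auto intro!: derivative_eq_intros DERIV_chain2[OF \<Phi>])
      then show "((\<lambda>t. - \<Phi> (s - t)) has_vector_derivative m (s - t)) (at t within {0..r})"
        using has_field_derivative_at_within has_real_derivative_iff_has_vector_derivative by blast
    qed
    then show ?thesis by (simp add: integral_unique \<Psi>_def algebra_simps)
  qed
  have "uniform_limit UNIV (\<lambda>r s. 1 / r * integral {0..r} (\<lambda>t. m (s - t))) (\<lambda>_. G) at_top"
  proof (rule uniform_limitI)
    fix e :: real assume e: "e > 0"
    have "\<forall>\<^sub>F r in at_top. r > max 1 (2 * C / e)" by (rule eventually_gt_at_top)
    then show "\<forall>\<^sub>F r in at_top. \<forall>s\<in>UNIV. dist (1 / r * integral {0..r} (\<lambda>t. m (s - t))) G < e"
    proof eventually_elim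
      case (elim r)
      then have r: "r > 0" "2 * C < r * e" using e by (auto simp: field_simps)
      show ?case
      proof
        fix s
        have "\<bar>\<Psi> s - \<Psi> (s - r)\<bar> \<le> 2 * C" using C(2)[of s] C(2)[of "s - r"] by linarith
        then have "\<bar>\<Psi> s - \<Psi> (s - r)\<bar> < r * e" using r by simp
        moreover have "1 / r * integral {0..r} (\<lambda>t. m (s - t)) - G = (\<Psi> s - \<Psi> (s - r)) / r"
          using r eq[of r s] by (simp add: field_simps)
        ultimately show "dist (1 / r * integral {0..r} (\<lambda>t. m (s - t))) G < e"
          using r(1) by (simp add: dist_norm field_simps)
      qed
    qed
  qed
  then show ?thesis by blast
qed

context evolution_measures
begin

lemma semigroup_continuous:
  fixes f :: "real \<times> (real ^ 'n) \<Rightarrow> real"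
  assumes f: "continuous_on UNIV f" and B: "\<And>z. \<bar>f z\<bar> \<le> B"
  shows "continuous_on ({0..} \<times> UNIV) (\<lambda>(t, z). evolution_semigroup P t f z)"
proof -
  have "continuous_on ({0..} \<times> UNIV) (\<lambda>w :: real \<times> real \<times> (real ^ 'n). (fst (snd w) - fst w, fst (snd
    w), snd (snd w)))"
    by (intro continuous_intros)
  from continuous_on_compose2[OF evolution_jointly_continuous[OF f B] this]
  have "continuous_on ({0..} \<times> UNIV) (\<lambda>w. P (fst (snd w)) (fst (snd w) - fst w)
      (\<lambda>y. f (fst (snd w) - fst w, y)) (snd (snd w)))" by force
  then show ?thesis by (simp add: evolution_semigroup_def case_prod_beta')
qed

text \<open>The waiting time \<open>t0\<close> serves all starting times and all data with the same
  sup bound. This is essential below, where the data are the slices \<open>f (s - t, _)\<close>,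
  which change with \<open>t\<close>.\<close>

lemma mean_decay_eventually:
  assumes "\<eta> > 0" and "B > 0"
  shows "\<exists>t0>0. \<forall>s t x f. f \<in> bcontfun \<longrightarrow> (\<forall>x. \<bar>f x\<bar> \<le> B) \<longrightarrow> s + t0 \<le> t \<longrightarrow> norm x \<le> R \<longrightarrow>
     \<bar>P t s f x - (LINT y|\<mu> s. f y)\<bar> \<le> \<eta>"
proof -
  obtain \<beta> q where \<beta>: "\<beta> > 0" and q: "0 < q" "q < 1"
    and dec': "\<forall>n s t f B. f \<in> bcontfun \<longrightarrow> B > 0 \<longrightarrow> (\<forall>x. \<bar>f x\<bar> \<le> B) \<longrightarrow> s + 2 * real n \<le> t \<longrightarrow> s < t \<longrightarrow>
     (\<forall>x. \<bar>P t s f x - (LINT y|\<mu> s. f y)\<bar> \<le> q ^ n * B * (2 + \<beta> * V x + \<beta> * (a / c)))"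
    using mean_decay by (elim exE conjE) (rule that)
  note dec = dec'[rule_format]
  obtain M where M: "M > 0" "\<And>x. norm x \<le> R \<Longrightarrow> V x \<le> M" using V_bounded_on[of R] by auto
  define D where "D = B * (2 + \<beta> * M + \<beta> * (a / c))"
  have "(\<lambda>n. q ^ n * D) \<longlonglongrightarrow> 0 * D" using q by (intro tendsto_intros LIMSEQ_power_zero) auto
  then have "\<forall>\<^sub>F n in sequentially. q ^ n * D < \<eta>" using assms(1) by (intro order_tendstoD) auto
  then obtain n where n: "q ^ n * D < \<eta>" by (auto simp: eventually_sequentially)
  show ?thesis
  proof (intro exI[of _ "2 * real n + 1"] conjI allI impI)
    fix s t and x :: "real ^ 'n" and f :: "real ^ 'n \<Rightarrow> real"
    assume f: "f \<in> bcontfun" "\<forall>x. \<bar>f x\<bar> \<le> B" and t: "s + (2 * real n + 1) \<le> t" and x: "norm x \<le> R"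
    have "\<bar>P t s f x - (LINT y|\<mu> s. f y)\<bar> \<le> q ^ n * B * (2 + \<beta> * V x + \<beta> * (a / c))"
      by (rule dec[OF f(1) assms(2)]) (use f t in auto)
    also have "\<dots> \<le> q ^ n * B * (2 + \<beta> * M + \<beta> * (a / c))"
      using q assms(2) \<beta> M(2)[OF x] by (intro mult_left_mono) auto
    also have "\<dots> < \<eta>" using n by (simp add: D_def mult.assoc)
    finally show "\<bar>P t s f x - (LINT y|\<mu> s. f y)\<bar> \<le> \<eta>" by simp
  qed simp
qed

text \<open>The limit is a constant function: the mean over one period of \<open>m s\<close>, the
  integral of \<open>f (s, _)\<close> against \<open>\<mu> s\<close>.\<close>

lemma evolution_semigroup_mean_ergodic: "tauc_mean_ergodic (Cb_per T) (evolution_semigroup P)"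
  unfolding tauc_mean_ergodic_def
proof
  fix f :: "real \<times> (real ^ 'n) \<Rightarrow> real" assume "f \<in> Cb_per T"
  then have fb: "f \<in> bcontfun" and fper: "time_periodic T f" by (auto simp: Cb_per_def)
  have fc: "continuous_on UNIV f" using fb by (simp add: mem_bcontfun)
  obtain B where B: "B > 0" "\<And>z. \<bar>f z\<bar> \<le> B" using bcontfun_bound[OF fb] by blast
  define F where "F t z = evolution_semigroup P t f z" for t z
  have Fe: "F t (s, x) = P s (s - t) (\<lambda>y. f (s - t, y)) x" for t s x
    by (simp add: F_def evolution_semigroup_def)
  have sb: "(\<lambda>y. f (s, y)) \<in> bcontfun" for s by (rule slice_bcontfun[OF fc B(2)])
  have Fc: "continuous_on ({0..} \<times> UNIV) (\<lambda>(t, z). F t z)"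
    unfolding F_def by (rule semigroup_continuous[OF fc B(2)])
  have Fc': "continuous_on ({0..r} \<times> UNIV) (\<lambda>(t, z). F t z)" for r
    by (rule continuous_on_subset[OF Fc]) auto
  have Fz: "continuous_on {0..} (\<lambda>t. F t z)" for z
    by (rule continuous_on_compose2[OF Fc, of _ "\<lambda>t. (t, z)", simplified]) (auto intro!: continuous_intros)
  have FB: "\<bar>F t z\<bar> \<le> B" if "0 \<le> t" for t z
    by (cases z) (use that in \<open>auto simp: Fe intro!: P_abs_le sb B\<close>)
  have Fper: "F t (s + T, x) = F t (s, x)" if "0 \<le> t" for t s x
  proof -
    have "(\<lambda>y. f (s + T - t, y)) = (\<lambda>y. f (s - t, y))"
      using fper unfolding time_periodic_def by (metis diff_add_eq)
    then show ?thesis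
      unfolding Fe using P_periodic[OF sb, of "s - t" s] that by (simp add: diff_add_eq algebra_simps)
  qed
  define m where "m s = (LINT y|\<mu> s. f (s, y))" for s
  have mc: "continuous_on UNIV m" unfolding m_def[abs_def] by (rule mean_continuous[OF fc B(2)])
  have mper: "m (s + T) = m s" for s
    using fper by (simp add: m_def mu_per time_periodic_def)
  have mB: "\<bar>m s\<bar> \<le> B" for s unfolding m_def by (rule mean_abs_le[OF sb B(2)])
  obtain G where G: "uniform_limit UNIV (\<lambda>r s. 1 / r * integral {0..r} (\<lambda>t. m (s - t))) (\<lambda>_. G) at_top"
    using periodic_average[OF T_pos mc mper] by blast
  define I where "I r z = integral {0..r} (\<lambda>t. F t z)" for r z
  have "tauc_means_tendsto (Cb_per T) F (\<lambda>_. G)"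
    unfolding tauc_means_tendsto_def
  proof (intro exI[of _ I] conjI allI impI)
    fix r :: real assume r: "r > 0"
    have "I r \<in> bcontfun" unfolding I_def[abs_def]
      by (rule parametric_integral_bcontfun[OF _ Fc', of r B]) (use r FB in auto)
    moreover have "time_periodic T (I r)"
      unfolding time_periodic_def I_def by (auto intro!: integral_cong Fper)
    ultimately show "I r \<in> Cb_per T" by (simp add: Cb_per_def)
    show "has_tauc_integral F 0 r (I r)"
      unfolding I_def[abs_def] by (rule has_tauc_integral_continuous[OF _ Fc']) (use r in simp)
  next
    show "tauc_tendsto (\<lambda>r z. 1 / r * I r z) (\<lambda>_. G) at_top"
      unfolding tauc_tendsto_def
    proof (intro allI impI)
      fix K :: "(real \<times> (real ^ 'n)) set" assume "compact K"
      then obtain R where R: "\<And>z. z \<in> K \<Longrightarrow> norm z \<le> R" using compact_imp_bounded bounded_iff by metis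
      \<comment> \<open>The semigroup at (\<open>s\<close>, \<open>x\<close>) starts its evolution
        at time \<open>s - t\<close>, so it is compared with the mean at that time. Only the
        difference \<open>h\<close> tends to zero as \<open>t\<close> grows; the subtracted part
        merely averages out.\<close>
      define h where "h t z = F t z - m (fst z - t)" for t z
      have mz: "continuous_on A (\<lambda>t. m (s - t))" for A s
        by (rule continuous_on_compose2[OF mc]) (auto intro!: continuous_intros)
      have 1: "uniform_limit K (\<lambda>r z. 1 / r * integral {0..r} (\<lambda>t. h t z)) (\<lambda>_. 0) at_top"
      proof (rule average_tendsto_zero)
        show "continuous_on {0..} (\<lambda>t. h t z)" for z
          unfolding h_def by (intro continuous_on_diff Fz mz)
        show "\<bar>h t z\<bar> \<le> 2 * B" if "0 \<le> t" for t z
          using FB[OF that, of z] mB[of "fst z - t"] unfolding h_def by linarith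
        fix \<eta> :: real assume \<eta>: "\<eta> > 0"
        from mean_decay_eventually[OF \<eta> B(1), of R] obtain t0 where t0: "t0 > 0" and
          d': "\<forall>s t x f. f \<in> bcontfun \<longrightarrow> (\<forall>x. \<bar>f x\<bar> \<le> B) \<longrightarrow> s + t0 \<le> t \<longrightarrow> norm x \<le> R \<longrightarrow>
             \<bar>P t s f x - (LINT y|\<mu> s. f y)\<bar> \<le> \<eta>" by (elim exE conjE)
        show "\<exists>t0\<ge>0. \<forall>t\<ge>t0. \<forall>z\<in>K. \<bar>h t z\<bar> \<le> \<eta>"
        proof (intro exI[of _ t0] conjI allI impI ballI)
          fix t z assume t: "t0 \<le> t" and z: "z \<in> K"
          obtain s x where sx: "z = (s, x)" by (cases z)
          have "norm x \<le> R" using R[OF z] norm_snd_le[of x s] by (simp add: sx)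
          then have "\<bar>P s (s - t) (\<lambda>y. f (s - t, y)) x - (LINT y|\<mu> (s - t). f (s - t, y))\<bar> \<le> \<eta>"
            using d'[rule_format, OF sb B(2), of "s - t" s x "s - t"] t by simp
          then show "\<bar>h t z\<bar> \<le> \<eta>" by (simp add: h_def Fe m_def sx)
        qed (use t0 in simp)
      qed
      have 2: "uniform_limit K (\<lambda>r z. 1 / r * integral {0..r} (\<lambda>t. m (fst z - t))) (\<lambda>_. G) at_top"
        unfolding uniform_limit_iff
      proof (intro allI impI)
        fix e :: real assume "e > 0"
        then have "\<forall>\<^sub>F r in at_top. \<forall>s\<in>UNIV. dist (1 / r * integral {0..r} (\<lambda>t. m (s - t))) G < e"
          using G unfolding uniform_limit_iff by blast
        then show "\<forall>\<^sub>F r in at_top. \<forall>z\<in>K. dist (1 / r * integral {0..r} (\<lambda>t. m (fst z - t))) G < e"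
          by eventually_elim blast
      qed
      have "1 / r * integral {0..r} (\<lambda>t. h t z) + 1 / r * integral {0..r} (\<lambda>t. m (fst z - t)) =
        1 / r * I r z" for r z
      proof -
        have "(\<lambda>t. F t z) integrable_on {0..r}" "(\<lambda>t. m (fst z - t)) integrable_on {0..r}"
          by (rule integrable_continuous_interval, rule continuous_on_subset[OF Fz], simp)
            (rule integrable_continuous_interval, rule mz)
        then show ?thesis unfolding h_def I_def
          by (simp add: Henstock_Kurzweil_Integration.integral_diff diff_divide_distrib)
      qed
      then show "uniform_limit K (\<lambda>r z. 1 / r * I r z) (\<lambda>_. G) at_top"
        using uniform_limit_add[OF 1 2] by simp
    qed
  qed
  moreover have "(\<lambda>_. G) \<in> Cb_per T"
    by (auto simp: Cb_per_def time_periodic_def intro!: bcontfunI[of _ "\<bar>G\<bar>"])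
  ultimately show "\<exists>g\<in>Cb_per T. tauc_means_tendsto (Cb_per T) (\<lambda>t. evolution_semigroup P t f) g"
    unfolding F_def[abs_def] by blast
qed

text \<open>Here the mean is already subtracted, so the integrand itself tends to zero locally
  uniformly: the elapsed time \<open>s + r\<close> exceeds \<open>r\<close>.\<close>

lemma backward_means_tendsto:
  assumes s: "s > 0" and f: "f \<in> bcontfun"
  shows "tauc_means_tendsto bcontfun (\<lambda>r x. P s (- r) f x - (LINT y|\<mu> (- r). f y)) (\<lambda>_. 0)"
proof -
  obtain B where B: "B > 0" "\<And>x. \<bar>f x\<bar> \<le> B" using bcontfun_bound[OF f] by blast
  define F where "F r x = P s (- r) f x - (LINT y|\<mu> (- r). f y)" for r x
  \<comment> \<open>The datum is read as a function on space-time that does not depend on time, so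
    that the continuity results for time-dependent data apply.\<close>
  have f2c: "continuous_on UNIV (\<lambda>z :: real \<times> (real ^ 'n). f (snd z))"
    by (rule continuous_on_compose2[of UNIV]) (use f in \<open>auto simp: mem_bcontfun intro!: continuous_intros\<close>)
  have c1: "continuous_on ({0..} \<times> UNIV) (\<lambda>w :: real \<times> (real ^ 'n). P s (- fst w) f (snd w))"
  proof -
    have "continuous_on ({0..} \<times> UNIV) (\<lambda>w :: real \<times> (real ^ 'n). (- fst w, s, snd w))"
      by (intro continuous_intros)
    from continuous_on_compose2[OF evolution_jointly_continuous[OF f2c B(2)] this] s
    show ?thesis by force
  qed
  have c2: "continuous_on A (\<lambda>w :: real \<times> (real ^ 'n). LINT y|\<mu> (- fst w). f y)" for A
    using continuous_on_compose2[OF mean_continuous[OF f2c B(2)], of A "\<lambda>w. - fst w"]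
    by (simp add: continuous_intros)
  have Fc: "continuous_on ({0..} \<times> UNIV) (\<lambda>(r, x). F r x)"
    unfolding F_def case_prod_beta' by (intro continuous_on_diff c1 c2)
  have Fc': "continuous_on ({0..r} \<times> UNIV) (\<lambda>(t, z). F t z)" for r
    by (rule continuous_on_subset[OF Fc]) auto
  have Fz: "continuous_on {0..} (\<lambda>t. F t z)" for z
    by (rule continuous_on_compose2[OF Fc, of _ "\<lambda>t. (t, z)", simplified]) (auto intro!: continuous_intros)
  have FB: "\<bar>F t z\<bar> \<le> 2 * B" if "0 \<le> t" for t z
  proof -
    have "\<bar>P s (- t) f z\<bar> \<le> B" by (rule P_abs_le[OF f B(2)]) (use s that in simp)
    then show ?thesis using mean_abs_le[OF f B(2), of "- t"] unfolding F_def by linarith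
  qed
  define I where "I r z = integral {0..r} (\<lambda>t. F t z)" for r z
  have "tauc_means_tendsto bcontfun F (\<lambda>_. 0)"
    unfolding tauc_means_tendsto_def
  proof (intro exI[of _ I] conjI allI impI)
    fix r :: real assume r: "r > 0"
    show "I r \<in> bcontfun" unfolding I_def[abs_def]
      by (rule parametric_integral_bcontfun[OF _ Fc', of r "2 * B"]) (use r FB in auto)
    show "has_tauc_integral F 0 r (I r)"
      unfolding I_def[abs_def] by (rule has_tauc_integral_continuous[OF _ Fc']) (use r in simp)
  next
    show "tauc_tendsto (\<lambda>r z. 1 / r * I r z) (\<lambda>_. 0) at_top"
      unfolding tauc_tendsto_def I_def
    proof (intro allI impI)
      fix K :: "(real ^ 'n) set" assume "compact K"
      then obtain R where R: "\<And>z. z \<in> K \<Longrightarrow> norm z \<le> R" using compact_imp_bounded bounded_iff by metis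
      show "uniform_limit K (\<lambda>r z. 1 / r * integral {0..r} (\<lambda>t. F t z)) (\<lambda>_. 0) at_top"
      proof (rule average_tendsto_zero)
        show "continuous_on {0..} (\<lambda>t. F t z)" for z by (rule Fz)
        show "\<bar>F t z\<bar> \<le> 2 * B" if "0 \<le> t" for t z by (rule FB[OF that])
        fix \<eta> :: real assume \<eta>: "\<eta> > 0"
        from mean_decay_eventually[OF \<eta> B(1), of R] obtain t0 where t0: "t0 > 0" and
          d': "\<forall>s t x f. f \<in> bcontfun \<longrightarrow> (\<forall>x. \<bar>f x\<bar> \<le> B) \<longrightarrow> s + t0 \<le> t \<longrightarrow> norm x \<le> R \<longrightarrow>
             \<bar>P t s f x - (LINT y|\<mu> s. f y)\<bar> \<le> \<eta>" by (elim exE conjE)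
        show "\<exists>t0\<ge>0. \<forall>t\<ge>t0. \<forall>z\<in>K. \<bar>F t z\<bar> \<le> \<eta>"
        proof (intro exI[of _ t0] conjI allI impI ballI)
          fix t z assume t: "t0 \<le> t" and z: "z \<in> K"
          show "\<bar>F t z\<bar> \<le> \<eta>" unfolding F_def
            by (rule d'[rule_format, OF f B(2)]) (use t s R[OF z] in auto)
        qed (use t0 in simp)
      qed
    qed
  qed
  then show ?thesis by (simp add: F_def[abs_def])
qed

end

subsection \<open>Mollifiers\<close>

text \<open>For \<open>m = 0\<close> this is the usual smooth function that is flat at the origin.
  The powers in the denominator are included because the span of the family is closed under
  differentiation.\<close>

definition flat :: "nat \<Rightarrow> real \<Rightarrow> real" where
  "flat m x = (if x > 0 then exp (- (1 / x)) / x ^ m else 0)"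

lemma flat_tendsto_0: "(flat m \<longlongrightarrow> 0) (at_right 0)"
proof -
  have "((\<lambda>x. inverse x ^ m / exp (inverse x)) \<longlongrightarrow> 0) (at_right (0::real))"
    by (rule filterlim_compose[OF tendsto_power_div_exp_0 filterlim_inverse_at_top_right])
  then show ?thesis
  proof (rule Lim_transform_eventually)
    show "\<forall>\<^sub>F x in at_right 0. inverse x ^ m / exp (inverse x) = flat m x"
      using eventually_at_right_less[of 0]
      by eventually_elim (simp add: flat_def exp_minus field_simps power_inverse)
  qed
qed

lemma flat_deriv: "(flat m has_real_derivative (flat (m + 2) x - real m * flat (m + 1) x)) (at x)"
proof -
  consider "x < 0" | "x > 0" | "x = 0" by linarith
  then show ?thesis
  proof cases
    case 1
    have "((\<lambda>_. 0) has_real_derivative 0) (at x)" by simp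
    then have "(flat m has_real_derivative 0) (at x)"
    proof (rule has_field_derivative_transform_within_open)
      show "open {..<0::real}" "x \<in> {..<0}" using 1 by auto
    qed (auto simp: flat_def)
    then show ?thesis using 1 by (simp add: flat_def)
  next
    case 2
    have "((\<lambda>x. exp (- (1 / x)) / x ^ m) has_real_derivative (flat (m + 2) x - real m * flat (m + 1) x))
      (at x)"
    proof (cases m)
      case 0
      then show ?thesis using 2
        by (auto intro!: derivative_eq_intros simp: flat_def field_simps power2_eq_square)
    next
      case (Suc k)
      have 1: "((\<lambda>x. exp (- (1 / x))) has_real_derivative exp (- (1 / x)) / x\<^sup>2) (at x)"
        using 2 by (auto intro!: derivative_eq_intros simp: field_simps power2_eq_square)
      have 3: "((\<lambda>x. x ^ Suc k) has_real_derivative (1 + real k) * x ^ k) (at x)"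
        using DERIV_pow[of "Suc k" x] by simp
      define p where "p = x ^ k"
      have p: "p \<noteq> 0" using 2 by (simp add: p_def)
      have "x ^ Suc k \<noteq> 0" using 2 by simp
      from DERIV_divide[OF 1 3 this]
      have "((\<lambda>x. exp (- (1 / x)) / x ^ Suc k) has_real_derivative
        (flat (m + 2) x - real m * flat (m + 1) x)) (at x)"
      proof (rule DERIV_cong)
        show "(exp (- (1 / x)) / x\<^sup>2 * x ^ Suc k - exp (- (1 / x)) * ((1 + real k) * x ^ k)) / (x ^ Suc
          k * x ^ Suc k) =
          flat (m + 2) x - real m * flat (m + 1) x"
          using 2 p by (simp add: Suc flat_def power2_eq_square flip: p_def) (simp add: field_simps)
      qed
      then show ?thesis by (simp only: Suc)
    qed
    then show ?thesis
    proof (rule has_field_derivative_transform_within_open)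
      show "open {0::real<..}" "x \<in> {0<..}" using 2 by auto
    qed (auto simp: flat_def)
  next
    case 3
    have "((\<lambda>h. (flat m (0 + h) - flat m 0) / h) \<longlongrightarrow> 0) (at_left 0)"
      by (rule tendsto_eventually) (use eventually_at_left_real[of "-1" 0] in \<open>auto simp: flat_def elim:
        eventually_mono\<close>)
    moreover have "((\<lambda>h. (flat m (0 + h) - flat m 0) / h) \<longlongrightarrow> 0) (at_right 0)"
    \<comment> \<open>The difference quotient at 0 is the next member of the family, which tends to
      0.\<close>
    proof (rule Lim_transform_eventually[OF flat_tendsto_0[of "Suc m"]])
      show "\<forall>\<^sub>F x in at_right 0. flat (Suc m) x = (flat m (0 + x) - flat m 0) / x"
        using eventually_at_right_less[of 0] by eventually_elim (simp add: flat_def field_simps)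
    qed
    ultimately have "((\<lambda>h. (flat m (0 + h) - flat m 0) / h) \<longlongrightarrow> 0) (at 0)"
      by (simp add: filterlim_at_split)
    then show ?thesis using 3 by (simp add: DERIV_def flat_def)
  qed
qed

lemma flat_range: "0 \<le> flat 0 x" "flat 0 x \<le> 1"
  by (auto simp: flat_def)

lemma flat_zero_iff: "flat 0 x = 0 \<longleftrightarrow> x \<le> 0"
  by (auto simp: flat_def)

lemma flat_mono: "x \<le> y \<Longrightarrow> flat 0 x \<le> flat 0 y"
  by (auto simp: flat_def frac_le)

lemma flat_tendsto_1:
  assumes "x > 0" shows "(\<lambda>n. flat 0 (real (Suc n) * x)) \<longlonglongrightarrow> 1"
proof -
  have "(\<lambda>n. exp (- ((1 / x) * (1 / real (Suc n))))) \<longlonglongrightarrow> exp (- ((1 / x) * 0))"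
    by (intro tendsto_intros LIMSEQ_Suc[OF lim_1_over_n])
  then show ?thesis using assms by (simp add: flat_def mult.commute)
qed

section \<open>Calculus of the classes \<open>Ck\<close>\<close>

lemma has_pd_at0: "has_pd v u z \<Longrightarrow> ((\<lambda>h. u (z + h *\<^sub>R v)) has_real_derivative pd v u z) (at 0)"
  using has_pd_deriv[of v u z 0] by simp

lemma has_pd_add:
  assumes "has_pd v f z" "has_pd v g z"
  shows "has_pd v (\<lambda>z. f z + g z) z" "pd v (\<lambda>z. f z + g z) z = pd v f z + pd v g z"
  using pdI[of "\<lambda>z. f z + g z" z v, OF DERIV_add[OF has_pd_at0[OF assms(1)] has_pd_at0[OF assms(2)]]] by auto

lemma has_pd_mult:
  assumes "has_pd v f z" "has_pd v g z"
  shows "has_pd v (\<lambda>z. f z * g z) z" "pd v (\<lambda>z. f z * g z) z = pd v f z * g z + f z * pd v g z"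
  using pdI[of "\<lambda>z. f z * g z" z v, OF DERIV_mult[OF has_pd_at0[OF assms(1)] has_pd_at0[OF assms(2)]]]
  by (auto simp: mult.commute)

lemma has_pd_const: "has_pd v (\<lambda>_. k) z" "pd v (\<lambda>_. k) z = 0"
  using pdI[of "\<lambda>_. k" z v 0] by auto

lemma Ck_continuous: "Ck k f \<Longrightarrow> continuous_on UNIV f"
  by (cases k) auto

lemma Ck_Suc_imp: "Ck (Suc k) f \<Longrightarrow> Ck k f"
  by (induction k arbitrary: f) auto

lemma Ck_const: "Ck k (\<lambda>_. l)"
proof (induction k arbitrary: l)
  case (Suc k)
  have "pd v (\<lambda>_. l) = (\<lambda>_. 0)" for v :: 'a by (auto simp: has_pd_const)
  then show ?case using Suc by (auto simp: has_pd_const)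
qed auto

lemma Ck_add: "Ck k f \<Longrightarrow> Ck k g \<Longrightarrow> Ck k (\<lambda>z. f z + g z)"
proof (induction k arbitrary: f g)
  case (Suc k)
  have "pd v (\<lambda>z. f z + g z) = (\<lambda>z. pd v f z + pd v g z)" if "v \<in> Basis" for v
    using Suc.prems that by (auto intro!: has_pd_add)
  then show ?case using Suc by (auto intro!: has_pd_add continuous_intros)
qed (auto intro!: continuous_intros)

lemma Ck_mult: "Ck k f \<Longrightarrow> Ck k g \<Longrightarrow> Ck k (\<lambda>z. f z * g z)"
proof (induction k arbitrary: f g)
  case (Suc k)
  have "pd v (\<lambda>z. f z * g z) = (\<lambda>z. pd v f z * g z + f z * pd v g z)" if "v \<in> Basis" for v
    using Suc.prems that by (auto intro!: has_pd_mult)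
  then show ?case using Suc Ck_Suc_imp[OF Suc.prems(1)] Ck_Suc_imp[OF Suc.prems(2)]
    by (auto intro!: has_pd_mult continuous_intros Ck_add)
qed (auto intro!: continuous_intros)

lemma Ck_prod: "finite S \<Longrightarrow> (\<And>i. i \<in> S \<Longrightarrow> Ck k (F i)) \<Longrightarrow> Ck k (\<lambda>z. \<Prod>i\<in>S. F i z)"
  by (induction S rule: finite_induct) (auto intro!: Ck_const Ck_mult)

text \<open>The induction on \<open>k\<close> covers all \<open>m\<close> simultaneously, since one
  derivative of \<open>flat m\<close> involves \<open>flat (m + 1)\<close> and
  \<open>flat (m + 2)\<close>.\<close>

lemma Ck_flat: "Ck k (\<lambda>z :: 'a::euclidean_space. flat m (w \<bullet> z + l))"
proof (induction k arbitrary: m)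
  case 0
  have "continuous_on UNIV (flat m)"
    using flat_deriv by (meson DERIV_isCont continuous_at_imp_continuous_on)
  then show ?case by (auto intro!: continuous_on_compose2[of UNIV "flat m"] continuous_intros)
next
  case (Suc k)
  have D: "((\<lambda>h. flat m (w \<bullet> (z + h *\<^sub>R v) + l)) has_real_derivative
      (w \<bullet> v) * (flat (m + 2) (w \<bullet> z + l) + - real m * flat (m + 1) (w \<bullet> z + l))) (at 0)" for v z
  proof -
    have "((\<lambda>h. w \<bullet> (z + h *\<^sub>R v) + l) has_real_derivative w \<bullet> v) (at 0)"
      by (auto intro!: derivative_eq_intros simp: inner_add_right)
    from DERIV_chain2[of "flat m", OF _ this, of "flat (m + 2) (w \<bullet> z + l) - real m * flat (m + 1) (w \<bullet>
      z + l)"]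
    show ?thesis using flat_deriv[of m "w \<bullet> z + l"] by (simp add: mult.commute)
  qed
  have pdeq: "pd v (\<lambda>z. flat m (w \<bullet> z + l)) =
     (\<lambda>z. (w \<bullet> v) * (flat (m + 2) (w \<bullet> z + l) + - real m * flat (m + 1) (w \<bullet> z + l)))" for v
    using pdI(2)[OF D] by auto
  have ck: "Ck k (pd v (\<lambda>z. flat m (w \<bullet> z + l)))" for v
    unfolding pdeq by (intro Ck_mult Ck_add Ck_const Suc.IH)
  show ?case
    unfolding Ck.simps by (intro conjI ballI allI Ck_continuous[OF Suc.IH] pdI(1)[OF D] ck)
qed

lemma pd_reflect:
  assumes "has_pd v f (z - y)"
  shows "has_pd v (\<lambda>y. f (z - y)) y" "pd v (\<lambda>y. f (z - y)) y = - pd v f (z - y)"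
proof -
  have "((\<lambda>h. f ((z - y) + (- h) *\<^sub>R v)) has_real_derivative pd v f (z - y) * (- 1)) (at 0)"
    by (rule DERIV_chain2[of "\<lambda>h. f ((z - y) + h *\<^sub>R v)"])
      (use has_pd_at0[OF assms] in \<open>auto intro!: derivative_eq_intros\<close>)
  then have "((\<lambda>h. f (z - (y + h *\<^sub>R v))) has_real_derivative - pd v f (z - y)) (at 0)"
    by (simp add: algebra_simps)
  from pdI[of "\<lambda>y. f (z - y)" y v, OF this]
  show "has_pd v (\<lambda>y. f (z - y)) y" "pd v (\<lambda>y. f (z - y)) y = - pd v f (z - y)" by auto
qed

lemma Ck_reflect: "Ck k f \<Longrightarrow> Ck k (\<lambda>y. f (z - y))"
proof (induction k arbitrary: f)
  case 0
  then show ?case by (auto intro!: continuous_on_compose2[of UNIV f] continuous_intros)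
next
  case (Suc k)
  have "Ck k (pd v (\<lambda>y. f (z - y)))" if v: "v \<in> Basis" for v
  proof -
    have "pd v (\<lambda>y. f (z - y)) = (\<lambda>y. - 1 * pd v f (z - y))"
      using Suc.prems v by (auto simp: pd_reflect(2))
    moreover have "Ck k (\<lambda>y. - 1 * pd v f (z - y))"
      by (intro Ck_mult Ck_const Suc.IH) (use Suc.prems v in auto)
    ultimately show ?thesis by simp
  qed
  moreover have "has_pd v (\<lambda>y. f (z - y)) y" if "v \<in> Basis" for v y
    using Suc.prems that by (intro pd_reflect(1)) auto
  moreover have "continuous_on UNIV (\<lambda>y. f (z - y))"
    using Suc.prems by (auto intro!: continuous_on_compose2[of UNIV f] continuous_intros)
  ultimately show ?case by simp
qed

text \<open>For \<open>n > 0\<close> it is positive exactly on the open box. The parameter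
  \<open>n\<close> is a steepness: letting it grow on a fixed box produces the indicator of the box,
  while \<open>n = 1 / \<epsilon>\<close> on a cube of half-side \<open>\<epsilon>\<close> is the
  rescaling of one fixed profile.\<close>

definition box_bump :: "real \<Rightarrow> 'a::euclidean_space \<Rightarrow> 'a \<Rightarrow> 'a \<Rightarrow> real" where
  "box_bump n l u z = (\<Prod>b\<in>Basis. flat 0 (n * (z \<bullet> b - l \<bullet> b)) * flat 0 (n * (u \<bullet> b - z \<bullet> b)))"

lemma Ck_box_bump: "Ck k (box_bump n l u)"
proof -
  have "Ck k (\<lambda>z. \<Prod>b\<in>Basis. flat 0 ((n *\<^sub>R b) \<bullet> z + (- n * (l \<bullet> b))) * flat 0 ((- n *\<^sub>R b) \<bullet> z + n * (u
    \<bullet> b)))"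
    by (intro Ck_prod Ck_mult Ck_flat) auto
  moreover have "box_bump n l u =
    (\<lambda>z. \<Prod>b\<in>Basis. flat 0 ((n *\<^sub>R b) \<bullet> z + (- n * (l \<bullet> b))) * flat 0 ((- n *\<^sub>R b) \<bullet> z + n * (u \<bullet> b)))"
    by (rule ext) (simp add: box_bump_def inner_commute right_diff_distrib)
  ultimately show ?thesis by simp
qed

lemma box_bump_range: "0 \<le> box_bump n l u z" "box_bump n l u z \<le> 1"
  unfolding box_bump_def
  by (auto intro!: prod_nonneg prod_le_1 mult_nonneg_nonneg mult_le_one flat_range)

lemma box_bump_outside: "n > 0 \<Longrightarrow> z \<notin> box l u \<Longrightarrow> box_bump n l u z = 0"
  by (force simp: box_bump_def mem_box flat_zero_iff mult_le_0_iff not_less)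

lemma test_function_box_supp:
  assumes "\<And>k. Ck k f" "\<And>z. z \<notin> cbox l u \<Longrightarrow> f z = 0"
  shows "test_function f"
proof -
  have "closure {z. f z \<noteq> 0} \<subseteq> cbox l u"
    by (rule closure_minimal) (use assms(2) in \<open>auto simp: closed_cbox\<close>)
  then have "bounded (closure {z. f z \<noteq> 0})" using bounded_cbox bounded_subset by blast
  then show ?thesis using assms(1) by (simp add: test_function_def compact_eq_bounded_closed)
qed

lemma box_bump_test: "n > 0 \<Longrightarrow> test_function (box_bump n l u)"
  by (rule test_function_box_supp[of _ l u]) (use Ck_box_bump box_bump_outside box_subset_cbox in blast)+

lemma pd_outside_support:
  assumes "\<And>z. z \<notin> cbox l u \<Longrightarrow> f z = 0" "z \<notin> cbox l u"
  shows "pd v f z = 0"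
proof -
  have o: "open (- cbox l u)" "z + 0 *\<^sub>R v \<in> - cbox l u" using assms(2)
    by (simp_all add: open_Compl closed_cbox)
  have "((\<lambda>h. z + h *\<^sub>R v) \<longlongrightarrow> z + 0 *\<^sub>R v) (nhds (0::real))"
    by (intro tendsto_intros filterlim_ident)
  from topological_tendstoD[OF this o] have "\<forall>\<^sub>F h in nhds 0. f (z + h *\<^sub>R v) = 0"
    by eventually_elim (simp add: assms(1))
  then have "((\<lambda>h. f (z + h *\<^sub>R v)) has_real_derivative 0) (at 0) \<longleftrightarrow> ((\<lambda>_. 0) has_real_derivative 0) (at
    (0::real))"
    by (rule DERIV_cong_ev[OF refl _ refl])
  then have "((\<lambda>h. f (z + h *\<^sub>R v)) has_real_derivative 0) (at 0)" by simp
  then show ?thesis by (rule pdI(2))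
qed

section \<open>Convolution with smooth kernels of compact support\<close>

lemma compact_support_integral:
  fixes g :: "'a::euclidean_space \<Rightarrow> real"
  assumes "continuous_on UNIV g" "\<And>z. z \<notin> cbox l u \<Longrightarrow> g z = 0"
  shows "integrable lborel g" "(LINT z|lborel. g z) = integral (cbox l u) g"
proof -
  have eq: "(\<lambda>z. indicator (cbox l u) z *\<^sub>R g z) = g"
  proof
    show "indicator (cbox l u) z *\<^sub>R g z = g z" for z
      using assms(2)[of z] by (cases "z \<in> cbox l u") auto
  qed
  have "integrable lborel (\<lambda>z. indicator (cbox l u) z *\<^sub>R g z)"
    by (rule borel_integrable_compact) (auto intro: continuous_on_subset[OF assms(1)])
  then show 1: "integrable lborel g" unfolding eq .
  \<comment> \<open>The passage to a gauge integral over a cube gives access to the rules for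
    integrals depending on a parameter.\<close>
  have "integral UNIV g = integral (cbox l u) g"
  proof (rule integral_spike_set)
    have e: "{x \<in> UNIV - cbox l u. g x \<noteq> 0} = {}" "{x \<in> cbox l u - UNIV. g x \<noteq> 0} = {}"
      using assms(2) by blast+
    show "negligible {x \<in> UNIV - cbox l u. g x \<noteq> 0}" "negligible {x \<in> cbox l u - UNIV. g x \<noteq> 0}"
      unfolding e by (rule negligible_empty)+
  qed
  then show "(LINT z|lborel. g z) = integral (cbox l u) g" using integral_lborel[OF 1] by simp
qed

definition conv :: "('a::euclidean_space \<Rightarrow> real) \<Rightarrow> ('a \<Rightarrow> real) \<Rightarrow> 'a \<Rightarrow> real" where
  "conv w \<phi> z = (LINT y|lborel. w y * \<phi> (z - y))"

text \<open>One integration domain serves all \<open>z\<close> within distance 1 of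
  \<open>z0\<close>, as continuity and differentiation under the integral require.\<close>

lemma conv_local:
  fixes u \<phi> :: "'a::euclidean_space \<Rightarrow> real"
  assumes u: "continuous_on UNIV u" and \<phi>: "continuous_on UNIV \<phi>"
    and supp: "\<And>y. y \<notin> cbox (- (r *\<^sub>R One)) (r *\<^sub>R One) \<Longrightarrow> \<phi> y = 0"
    and z: "norm (z - z0) \<le> 1"
  shows "conv u \<phi> z = integral (cbox (z0 - (r + 1) *\<^sub>R One) (z0 + (r + 1) *\<^sub>R One)) (\<lambda>y. u y * \<phi> (z - y))"
  unfolding conv_def
proof (rule compact_support_integral)
  show "continuous_on UNIV (\<lambda>y. u y * \<phi> (z - y))"
    by (intro continuous_on_mult u continuous_on_compose2[OF \<phi>]) (auto intro!: continuous_intros)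
  fix y assume y: "y \<notin> cbox (z0 - (r + 1) *\<^sub>R One) (z0 + (r + 1) *\<^sub>R One)"
  have "z - y \<notin> cbox (- (r *\<^sub>R One)) (r *\<^sub>R One)"
  proof
    assume a: "z - y \<in> cbox (- (r *\<^sub>R One)) (r *\<^sub>R One)"
    have "z0 \<bullet> b - (r + 1) \<le> y \<bullet> b \<and> y \<bullet> b \<le> z0 \<bullet> b + (r + 1)" if b: "b \<in> Basis" for b
    proof -
      have "\<bar>(z - z0) \<bullet> b\<bar> \<le> 1" using Basis_le_norm[OF b, of "z - z0"] z by simp
      moreover have "- r \<le> (z - y) \<bullet> b \<and> (z - y) \<bullet> b \<le> r" using a b by (auto simp: mem_box)
      ultimately show ?thesis by (simp add: inner_diff_left abs_le_iff)
    qed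
    then show False using y by (simp add: mem_box inner_diff_left inner_add_left)
  qed
  then show "u y * \<phi> (z - y) = 0" using supp by simp
qed

lemma conv_continuous:
  fixes u \<phi> :: "'a::euclidean_space \<Rightarrow> real"
  assumes u: "continuous_on UNIV u" and \<phi>: "continuous_on UNIV \<phi>"
    and supp: "\<And>y. y \<notin> cbox (- (r *\<^sub>R One)) (r *\<^sub>R One) \<Longrightarrow> \<phi> y = 0"
  shows "continuous_on UNIV (conv u \<phi>)"
proof (rule continuous_at_imp_continuous_on, rule ballI)
  fix z0 :: 'a
  let ?c = "cbox (z0 - (r + 1) *\<^sub>R One) (z0 + (r + 1) *\<^sub>R One)"
  have "continuous_on (ball z0 1 \<times> ?c) (\<lambda>w. u (snd w) * \<phi> (fst w - snd w))"
    by (intro continuous_on_mult continuous_on_compose2[OF u] continuous_on_compose2[OF \<phi>])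
      (auto intro!: continuous_intros)
  then have "continuous_on (ball z0 1) (\<lambda>z. integral ?c (\<lambda>y. u y * \<phi> (z - y)))"
    by (intro integral_continuous_on_param) (simp add: case_prod_beta')
  moreover have "conv u \<phi> z = integral ?c (\<lambda>y. u y * \<phi> (z - y))" if "z \<in> ball z0 1" for z
    by (rule conv_local[OF u \<phi> supp]) (use that in \<open>auto simp: dist_norm norm_minus_commute\<close>)
  ultimately have "continuous_on (ball z0 1) (conv u \<phi>)" using continuous_on_cong by (smt (verit))
  then show "isCont (conv u \<phi>) z0" by (simp add: continuous_on_eq_continuous_at)
qed

lemma conv_pd:
  fixes u \<phi> :: "'a::euclidean_space \<Rightarrow> real"
  assumes u: "continuous_on UNIV u" and \<phi>: "Ck 1 \<phi>" and v: "v \<in> Basis"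
    and supp: "\<And>y. y \<notin> cbox (- (r *\<^sub>R One)) (r *\<^sub>R One) \<Longrightarrow> \<phi> y = 0"
  shows "has_pd v (conv u \<phi>) z0" "pd v (conv u \<phi>) z0 = conv u (pd v \<phi>) z0"
proof -
  let ?c = "cbox (z0 - (r + 1) *\<^sub>R One) (z0 + (r + 1) *\<^sub>R One)"
  have \<phi>c: "continuous_on UNIV \<phi>" "continuous_on UNIV (pd v \<phi>)" and \<phi>d: "has_pd v \<phi> z" for z
    using \<phi> v by auto
  have "((\<lambda>h. integral ?c (\<lambda>y. u y * \<phi> (z0 + h *\<^sub>R v - y))) has_real_derivative
     integral ?c (\<lambda>y. u y * pd v \<phi> (z0 + 0 *\<^sub>R v - y))) (at 0 within {-1<..<1})"
  proof (rule leibniz_rule_field_derivative)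
    fix h y
    have "((\<lambda>h. \<phi> ((z0 - y) + h *\<^sub>R v)) has_real_derivative pd v \<phi> ((z0 - y) + h *\<^sub>R v)) (at h)"
      by (rule has_pd_deriv[OF \<phi>d])
    then have "((\<lambda>h. u y * \<phi> (z0 + h *\<^sub>R v - y)) has_real_derivative u y * pd v \<phi> (z0 + h *\<^sub>R v - y)) (at h)"
      by (intro DERIV_cmult) (simp add: algebra_simps)
    then show "((\<lambda>h. u y * \<phi> (z0 + h *\<^sub>R v - y)) has_real_derivative u y * pd v \<phi> (z0 + h *\<^sub>R v - y))
      (at h within {-1<..<1})"
      by (rule has_field_derivative_at_within)
    show "(\<lambda>y. u y * \<phi> (z0 + h *\<^sub>R v - y)) integrable_on ?c"
      by (intro integrable_continuous continuous_on_mult continuous_on_compose2[OF u]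
        continuous_on_compose2[OF \<phi>c(1)])
        (auto intro!: continuous_intros)
  next
    have "continuous_on ({-1<..<1} \<times> ?c) (\<lambda>w. u (snd w) * pd v \<phi> (z0 + fst w *\<^sub>R v - snd w))"
      by (intro continuous_on_mult continuous_on_compose2[OF u] continuous_on_compose2[OF \<phi>c(2)])
        (auto intro!: continuous_intros)
    then show "continuous_on ({-1<..<1} \<times> ?c) (\<lambda>(h, y). u y * pd v \<phi> (z0 + h *\<^sub>R v - y))"
      by (simp add: case_prod_beta')
  qed auto
  then have D: "((\<lambda>h. integral ?c (\<lambda>y. u y * \<phi> (z0 + h *\<^sub>R v - y))) has_real_derivative
     integral ?c (\<lambda>y. u y * pd v \<phi> (z0 - y))) (at 0)"
    using at_within_open[of "0 :: real" "{-1<..<1}"]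
    by (simp only: scaleR_zero_left add_0_right open_greaterThanLessThan greaterThanLessThan_iff
        neg_less_0_iff_less zero_less_one simp_thms)
  have e1: "conv u \<phi> (z0 + h *\<^sub>R v) = integral ?c (\<lambda>y. u y * \<phi> (z0 + h *\<^sub>R v - y))" if "h \<in> {-1<..<1}" for h
    by (rule conv_local[OF u \<phi>c(1) supp]) (use that v in auto)
  have e2: "conv u (pd v \<phi>) z0 = integral ?c (\<lambda>y. u y * pd v \<phi> (z0 - y))"
    by (rule conv_local[OF u \<phi>c(2)]) (auto intro!: pd_outside_support[of "- (r *\<^sub>R One)" "r *\<^sub>R One"] supp)
  have "((\<lambda>h. conv u \<phi> (z0 + h *\<^sub>R v)) has_real_derivative conv u (pd v \<phi>) z0) (at 0)"
    unfolding e2 by (rule has_field_derivative_transform_within_open[OF D, of "{-1<..<1}"]) (auto simp: e1)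
  then show "has_pd v (conv u \<phi>) z0" "pd v (conv u \<phi>) z0 = conv u (pd v \<phi>) z0" by (auto dest: pdI)
qed

text \<open>The reflected kernel is the test function. Its reflection changes the sign of the
  derivative, which cancels the minus sign in the definition of a weak derivative.\<close>

lemma conv_weak_derivative:
  assumes wd: "weak_derivative v u w" and \<phi>: "\<And>k. Ck k \<phi>" and v: "v \<in> Basis"
    and supp: "\<And>y. y \<notin> cbox (- (r *\<^sub>R One)) (r *\<^sub>R One) \<Longrightarrow> \<phi> y = 0"
  shows "conv u (pd v \<phi>) z = conv w \<phi> z"
proof -
  define \<psi> where "\<psi> y = \<phi> (z - y)" for y
  have "test_function \<psi>"
  proof (rule test_function_box_supp[of _ "z - r *\<^sub>R One" "z + r *\<^sub>R One"])
    show "Ck k \<psi>" for k unfolding \<psi>_def[abs_def] by (rule Ck_reflect[OF \<phi>])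
    fix y assume "y \<notin> cbox (z - r *\<^sub>R One) (z + r *\<^sub>R One)"
    then have "z - y \<notin> cbox (- (r *\<^sub>R One)) (r *\<^sub>R One)"
      by (auto simp: mem_box inner_diff_left inner_add_left) (smt (verit))+
    then show "\<psi> y = 0" by (simp add: \<psi>_def supp)
  qed
  then have "(LINT y|lborel. u y * pd v \<psi> y) = - (LINT y|lborel. w y * \<psi> y)"
    using wd by (simp add: weak_derivative_def)
  moreover have "pd v \<psi> y = - pd v \<phi> (z - y)" for y
    unfolding \<psi>_def[abs_def] using \<phi>[of 1] v by (intro pd_reflect(2)) simp
  ultimately show ?thesis by (simp add: conv_def \<psi>_def)
qed

lemma lborel_translate:
  fixes f :: "'a::euclidean_space \<Rightarrow> real"
  assumes "continuous_on UNIV f"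
  shows "(LINT y|lborel. f (y - z)) = (LINT y|lborel. f y)"
proof -
  have "f \<in> borel_measurable borel" using borel_measurable_continuous_onI[OF assms] .
  then have "(LINT y|distr lborel borel ((+) (- z)). f y) = (LINT y|lborel. f (- z + y))"
    by (intro integral_distr) auto
  then show ?thesis unfolding lborel_distr_plus by simp
qed

lemma bounded_subset_cube:
  assumes "bounded (S :: 'a::euclidean_space set)"
  obtains r where "r > 0" "S \<subseteq> cbox (- (r *\<^sub>R One)) (r *\<^sub>R One)"
proof -
  obtain r where r: "r > 0" "\<And>x. x \<in> S \<Longrightarrow> norm x \<le> r" using assms by (meson bounded_pos)
  have "S \<subseteq> cbox (- (r *\<^sub>R One)) (r *\<^sub>R One)"
  proof
    fix x assume x: "x \<in> S"
    have "\<bar>x \<bullet> b\<bar> \<le> r" if "b \<in> Basis" for b using Basis_le_norm[OF that, of x] r(2)[OF x] by linarith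
    then have "- r \<le> x \<bullet> b \<and> x \<bullet> b \<le> r" if "b \<in> Basis" for b using that by fastforce
    then show "x \<in> cbox (- (r *\<^sub>R One)) (r *\<^sub>R One)" by (auto simp: mem_box)
  qed
  then show ?thesis using that r(1) by blast
qed

lemma test_function_supp:
  assumes "test_function (\<phi> :: 'a::euclidean_space \<Rightarrow> real)"
  obtains r where "r > 0" "\<And>y. y \<notin> cbox (- (r *\<^sub>R One)) (r *\<^sub>R One) \<Longrightarrow> \<phi> y = 0"
proof -
  have "bounded (closure {z. \<phi> z \<noteq> 0})" using assms by (simp add: test_function_def compact_imp_bounded)
  then obtain r where r: "r > 0" "closure {z. \<phi> z \<noteq> 0} \<subseteq> cbox (- (r *\<^sub>R One)) (r *\<^sub>R One)"
    by (rule bounded_subset_cube)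
  have "\<phi> y = 0" if "y \<notin> cbox (- (r *\<^sub>R One)) (r *\<^sub>R One)" for y
    using r(2) that closure_subset[of "{z. \<phi> z \<noteq> 0}"] by blast
  then show ?thesis using that r(1) by blast
qed

text \<open>Convolving the constant 1 with the reflected function gives a constant, whose derivative
  vanishes; differentiation under the integral does the rest. This is what shows that constants have
  weak derivative zero.\<close>

lemma integral_pd_test_function:
  assumes \<phi>: "test_function \<phi>" and v: "v \<in> Basis"
  shows "(LINT z|lborel. pd v \<phi> z) = 0"
proof -
  obtain r where r: "r > 0" and supp: "\<And>y. y \<notin> cbox (- (r *\<^sub>R One)) (r *\<^sub>R One) \<Longrightarrow> \<phi> y = 0"
    using test_function_supp[OF \<phi>] by blast
  have Ck: "Ck k \<phi>" for k using \<phi> by (simp add: test_function_def)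
  define \<psi> where "\<psi> y = \<phi> (0 - y)" for y
  have \<psi>: "Ck k \<psi>" for k unfolding \<psi>_def[abs_def] by (rule Ck_reflect[OF Ck])
  have \<psi>s: "\<psi> y = 0" if "y \<notin> cbox (- (r *\<^sub>R One)) (r *\<^sub>R One)" for y
  proof -
    have "0 - y \<notin> cbox (- (r *\<^sub>R One)) (r *\<^sub>R One)"
    proof
      assume "0 - y \<in> cbox (- (r *\<^sub>R One)) (r *\<^sub>R One)"
      then have "y \<in> cbox (- (r *\<^sub>R One)) (r *\<^sub>R One)" by (force simp: mem_box)
      then show False using that by simp
    qed
    then show ?thesis by (simp add: \<psi>_def supp)
  qed
  have "conv (\<lambda>_. 1) \<psi> z = (LINT y|lborel. \<phi> y)" for z
    using lborel_translate[OF Ck_continuous[OF Ck[of 0]], of z] by (simp add: conv_def \<psi>_def)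
  then have "conv (\<lambda>_. 1) \<psi> = (\<lambda>_. LINT y|lborel. \<phi> y)" by auto
  then have "pd v (conv (\<lambda>_. 1) \<psi>) 0 = 0" by (simp add: has_pd_const)
  moreover have "pd v (conv (\<lambda>_. 1) \<psi>) 0 = conv (\<lambda>_. 1) (pd v \<psi>) 0"
    by (rule conv_pd(2)[where r = r]) (use v in \<open>auto simp del: Ck.simps One_nat_def intro: \<psi> \<psi>s\<close>)
  ultimately have "conv (\<lambda>_. 1) (pd v \<psi>) 0 = 0" by simp
  moreover have "pd v \<psi> (0 - y) = - pd v \<phi> y" for y
    unfolding \<psi>_def[abs_def] using Ck[of 1] v pd_reflect(2)[of v \<phi> 0 "0 - y"] by simp
  ultimately show ?thesis by (simp add: conv_def)
qed

section \<open>The fundamental lemma and uniqueness of weak derivatives\<close>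

definition loc_int :: "('a::euclidean_space \<Rightarrow> real) \<Rightarrow> bool" where
  "loc_int f \<longleftrightarrow> f \<in> borel_measurable lborel \<and> (\<forall>K. compact K \<longrightarrow> set_integrable lborel K f)"

lemma Lq_loc_1: "Lq_loc 1 f \<longleftrightarrow> loc_int f"
proof -
  have "set_integrable lborel K (\<lambda>z. \<bar>f z\<bar> powr 1) \<longleftrightarrow> set_integrable lborel K f"
    if "f \<in> borel_measurable lborel" "compact K" for K
  proof -
    have K: "K \<in> sets lborel" using that(2) by (simp add: borel_compact)
    have "(\<lambda>x. indicator K x *\<^sub>R f x) \<in> borel_measurable lborel" using that(1) K by measurable
    moreover have "(\<lambda>x. indicator K x *\<^sub>R \<bar>f x\<bar> powr 1) = (\<lambda>x. norm (indicator K x *\<^sub>R f x))"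
      by (auto simp: indicator_def)
    ultimately show ?thesis unfolding set_integrable_def using integrable_norm_iff by metis
  qed
  then show ?thesis unfolding Lq_loc_def loc_int_def by blast
qed

lemma loc_int_times:
  assumes f: "loc_int f" and \<phi>: "continuous_on UNIV \<phi>" and supp: "\<And>z. z \<notin> cbox l u \<Longrightarrow> \<phi> z = 0"
  shows "integrable lborel (\<lambda>z. f z * \<phi> z)"
proof -
  have "compact (\<phi> ` cbox l u)" by (intro compact_continuous_image continuous_on_subset[OF \<phi>]) auto
  then obtain C where C: "C > 0" "\<And>y. y \<in> \<phi> ` cbox l u \<Longrightarrow> norm y \<le> C"
    by (meson bounded_pos compact_imp_bounded)
  have "integrable lborel (\<lambda>z. C * (indicator (cbox l u) z *\<^sub>R f z))"
    using f by (intro integrable_mult_right) (auto simp: loc_int_def set_integrable_def)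
  then show ?thesis
  proof (rule Bochner_Integration.integrable_bound)
    show "(\<lambda>z. f z * \<phi> z) \<in> borel_measurable lborel"
      using f borel_measurable_continuous_onI[OF \<phi>] by (auto simp: loc_int_def)
    show "AE z in lborel. norm (f z * \<phi> z) \<le> norm (C * (indicator (cbox l u) z *\<^sub>R f z))"
    proof (rule AE_I2)
      fix z
      show "norm (f z * \<phi> z) \<le> norm (C * (indicator (cbox l u) z *\<^sub>R f z))"
      proof (cases "z \<in> cbox l u")
        case True
        then have "\<bar>\<phi> z\<bar> \<le> C" using C(2) by auto
        then have "\<bar>f z\<bar> * \<bar>\<phi> z\<bar> \<le> \<bar>f z\<bar> * C" by (intro mult_left_mono) auto
        then show ?thesis using True C(1) by (simp add: abs_mult mult.commute)
      next
        case False then show ?thesis by (simp add: supp)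
      qed
    qed
  qed
qed

lemma box_bump_tendsto: "(\<lambda>n. box_bump (real (Suc n)) l u z) \<longlonglongrightarrow> indicator (box l u) z"
proof (cases "z \<in> box l u")
  case True
  have "(\<lambda>n. box_bump (real (Suc n)) l u z) \<longlonglongrightarrow> (\<Prod>b\<in>(Basis :: 'a set). 1 * 1)"
    unfolding box_bump_def
    by (intro tendsto_prod tendsto_mult flat_tendsto_1) (use True in \<open>auto simp: mem_box\<close>)
  then show ?thesis using True by simp
next
  case False
  then show ?thesis using box_bump_outside[of "real (Suc _)" z l u] by simp
qed

text \<open>Increasingly steep bumps converge to the indicator of the open box and are dominated by
  that of the closed one.\<close>

lemma loc_int_zero_on_box:
  assumes f: "loc_int f" and zero: "\<And>\<phi>. test_function \<phi> \<Longrightarrow> (LINT z|lborel. f z * \<phi> z) = 0"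
  shows "(LINT z|lborel. indicator (box l u) z * f z) = 0"
proof -
  have fm: "f \<in> borel_measurable lborel" using f by (simp add: loc_int_def)
  have "(\<lambda>n. LINT z|lborel. f z * box_bump (real (Suc n)) l u z) \<longlonglongrightarrow> (LINT z|lborel. f z * indicator (box
    l u) z)"
  proof (rule integral_dominated_convergence[where w = "\<lambda>z. \<bar>indicator (cbox l u) z *\<^sub>R f z\<bar>"])
    show "(\<lambda>z. f z * indicator (box l u) z) \<in> borel_measurable lborel" using fm by measurable
    show "(\<lambda>z. f z * box_bump (real (Suc n)) l u z) \<in> borel_measurable lborel" for n
      by (rule borel_measurable_times[OF fm])
        (use borel_measurable_continuous_onI[OF Ck_continuous[OF Ck_box_bump[of 0]]] in simp)
    show "integrable lborel (\<lambda>z. \<bar>indicator (cbox l u) z *\<^sub>R f z\<bar>)"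
      using f by (intro integrable_abs) (auto simp: loc_int_def set_integrable_def)
    show "AE z in lborel. (\<lambda>n. f z * box_bump (real (Suc n)) l u z) \<longlonglongrightarrow> f z * indicator (box l u) z"
      by (intro AE_I2 tendsto_mult_left box_bump_tendsto)
    show "AE z in lborel. norm (f z * box_bump (real (Suc n)) l u z) \<le> \<bar>indicator (cbox l u) z *\<^sub>R f z\<bar>" for n
    proof (rule AE_I2)
      fix z
      show "norm (f z * box_bump (real (Suc n)) l u z) \<le> \<bar>indicator (cbox l u) z *\<^sub>R f z\<bar>"
      proof (cases "z \<in> cbox l u")
        case True
        then show ?thesis using box_bump_range[of "real (Suc n)" l u z]
          by (simp add: abs_mult mult_left_le)
      next
        case False
        then have "z \<notin> box l u" using box_subset_cbox by blast
        then show ?thesis using box_bump_outside[of "real (Suc n)" z l u] by simp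
      qed
    qed
  qed
  moreover have "(LINT z|lborel. f z * box_bump (real (Suc n)) l u z) = 0" for n
    by (intro zero box_bump_test) simp
  ultimately show ?thesis by (simp add: LIMSEQ_const_iff mult.commute)
qed

text \<open>Open boxes are stable under intersection and generate the Borel sets, so vanishing
  integrals over boxes extend to all Borel sets by induction over disjoint unions and complements.
  The cut to \<open>B N\<close> makes \<open>f\<close> integrable, which the complement step
  needs.\<close>

lemma loc_int_zero_AE:
  fixes f :: "'a::euclidean_space \<Rightarrow> real"
  assumes f: "loc_int f" and zero: "\<And>\<phi>. test_function \<phi> \<Longrightarrow> (LINT z|lborel. f z * \<phi> z) = 0"
  shows "AE z in lborel. f z = 0"
proof -
  have fm: "f \<in> borel_measurable lborel" using f by (simp add: loc_int_def)
  define B where "B N = box (- (real N *\<^sub>R One)) (real N *\<^sub>R One :: 'a)" for N :: nat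
  have "AE z in lborel. indicator (B N) z * f z = 0" for N
  proof (rule density_unique_real)
    define g where "g z = indicator (B N) z * f z" for z
    have gm: "g \<in> borel_measurable lborel" unfolding g_def B_def using fm by measurable
    have "set_integrable lborel (cbox (- (real N *\<^sub>R One)) (real N *\<^sub>R One)) f" using f
      by (auto simp: loc_int_def)
    then have g: "integrable lborel g" unfolding set_integrable_def
    proof (rule Bochner_Integration.integrable_bound)
      have "norm (g z) \<le> norm (indicator (cbox (- (real N *\<^sub>R One)) (real N *\<^sub>R One)) z *\<^sub>R f z)" for z
        using box_subset_cbox[of "- (real N *\<^sub>R One) :: 'a" "real N *\<^sub>R One"]
        by (auto simp: g_def B_def indicator_def)
      then show "AE z in lborel. norm (g z) \<le>
        norm (indicator (cbox (- (real N *\<^sub>R One)) (real N *\<^sub>R One)) z *\<^sub>R f z)"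
        by simp
    qed (rule gm)
    then show "integrable lborel (\<lambda>z. indicator (B N) z * f z)" by (simp add: g_def[abs_def])
    show "integrable lborel (\<lambda>_ :: 'a. 0 :: real)" by simp
    have box0: "(LINT z:A|lborel. g z) = 0" if "A \<in> range (\<lambda>(a, b). box a b)" for A
    proof -
      from that obtain p where "A = (case p of (a, b) \<Rightarrow> box a b)" by (rule imageE)
      then obtain l u where A: "A = box l u" by (cases p) simp
      obtain l' u' where "A \<inter> B N = box l' u'" unfolding A B_def box_Int_box by blast
      then have "indicator A z *\<^sub>R g z = indicator (box l' u') z * f z" for z
        by (auto simp: g_def indicator_def split: if_splits)
      then show ?thesis unfolding set_lebesgue_integral_def using loc_int_zero_on_box[OF f zero] by simp
    qed
    have total: "(LINT z|lborel. g z) = 0"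
      unfolding g_def B_def using loc_int_zero_on_box[OF f zero] .
    fix A :: "'a set" assume "A \<in> sets lborel"
    then have As: "A \<in> sigma_sets UNIV (range (\<lambda>(a, b). box a b))" by (simp add: borel_eq_box)
    have "Int_stable (range (\<lambda>(a :: 'a, b :: 'a). box a b))"
      by (auto simp: Int_stable_def box_Int_box)
    moreover have "range (\<lambda>(a :: 'a, b :: 'a). box a b) \<subseteq> Pow UNIV" by simp
    ultimately have "(LINT z:A|lborel. g z) = 0"
      using As
    proof (induction rule: sigma_sets_induct_disjoint)
      case (compl A)
      have A: "A \<in> sets lborel" using compl(1) by (simp add: borel_eq_box)
      have "(LINT z:(UNIV - A)|lborel. g z) = (LINT z|lborel. g z - indicator A z *\<^sub>R g z)"
        unfolding set_lebesgue_integral_def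
          by (intro Bochner_Integration.integral_cong) (auto simp: indicator_def)
      also have "\<dots> = (LINT z|lborel. g z) - (LINT z|lborel. indicator A z *\<^sub>R g z)"
        by (intro Bochner_Integration.integral_diff g integrable_mult_indicator A)
      also have "\<dots> = 0" using total compl(2) by (simp add: set_lebesgue_integral_def)
      finally show ?case .
    next
      case (union A)
      have A: "A i \<in> sets lborel" for i using union(2) by (auto simp: borel_eq_box)
      have "(LINT z:(\<Union>i. A i)|lborel. g z) = (\<Sum>i. (LINT z:(A i)|lborel. g z))"
      proof (rule lebesgue_integral_countable_add)
        show "\<And>i j. i \<noteq> j \<Longrightarrow> A i \<inter> A j = {}" using union(1) by (auto simp: disjoint_family_on_def)
        show "set_integrable lborel (\<Union>i. A i) g"
          unfolding set_integrable_def using A by (intro integrable_mult_indicator g) auto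
      qed (rule A)
      then show ?case using union(3) by simp
    qed (use box0 in \<open>auto simp: set_lebesgue_integral_def\<close>)
    then show "(LINT z:A|lborel. indicator (B N) z * f z) = (LINT z:A|lborel. 0)"
      by (simp add: g_def set_lebesgue_integral_def)
  qed
  then have "AE z in lborel. \<forall>N. indicator (B N) z * f z = 0" unfolding AE_all_countable by blast
  then show ?thesis
  proof eventually_elim
    case (elim z)
    obtain N :: nat where N: "norm z < real N" using reals_Archimedean2 by blast
    have "\<bar>z \<bullet> b\<bar> < real N" if "b \<in> Basis" for b using Basis_le_norm[OF that, of z] N by linarith
    then have "z \<in> B N" by (auto simp: B_def mem_box abs_less_iff minus_less_iff)
    then show ?case using elim[rule_format, of N] by simp
  qed
qed

lemma test_function_pd:
  assumes "test_function \<phi>" "v \<in> Basis"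
  shows "continuous_on UNIV (pd v \<phi>)" "continuous_on UNIV \<phi>"
  using assms unfolding test_function_def by (metis Ck.simps(2) Ck_continuous)+

text \<open>The equation and the membership in each Sobolev space assert the existence of weak
  derivatives separately. Uniqueness shows that the derivatives in the equation are those that are
  locally integrable to a high power.\<close>

lemma weak_derivative_unique:
  assumes "weak_derivative v u w" "weak_derivative v u w'"
  shows "AE z in lborel. w z = w' z"
proof -
  have w: "loc_int w" "loc_int w'" using assms by (auto simp: weak_derivative_def Lq_loc_1)
  have "AE z in lborel. w z - w' z = 0"
  proof (rule loc_int_zero_AE)
    show "loc_int (\<lambda>z. w z - w' z)" using w by (auto simp: loc_int_def intro: set_integral_diff)
    fix \<phi> :: "'a \<Rightarrow> real" assume \<phi>: "test_function \<phi>"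
    obtain r where "r > 0" and supp: "\<And>y. y \<notin> cbox (- (r *\<^sub>R One)) (r *\<^sub>R One) \<Longrightarrow> \<phi> y = 0"
      using test_function_supp[OF \<phi>] by blast
    have \<phi>c: "continuous_on UNIV \<phi>" using \<phi> by (auto simp: test_function_def intro: Ck_continuous)
    have "(LINT z|lborel. (w z - w' z) * \<phi> z) = (LINT z|lborel. w z * \<phi> z) - (LINT z|lborel. w' z * \<phi> z)"
      using loc_int_times[OF w(1) \<phi>c supp] loc_int_times[OF w(2) \<phi>c supp] by (simp add: left_diff_distrib)
    also have "\<dots> = 0" using assms \<phi> by (auto simp: weak_derivative_def)
    finally show "(LINT z|lborel. (w z - w' z) * \<phi> z) = 0" .
  qed
  then show ?thesis by simp
qed

text \<open>Second weak derivatives are derivatives of a chosen representative of the gradient;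
  changing the representative must not affect them.\<close>

lemma weak_derivative_cong_AE:
  assumes "weak_derivative v u w" "Lq_loc 1 u'" "AE z in lborel. u z = u' z" "v \<in> Basis"
  shows "weak_derivative v u' w"
  unfolding weak_derivative_def
proof (intro conjI allI impI)
  fix \<phi> :: "'a \<Rightarrow> real" assume \<phi>: "test_function \<phi>"
  have "pd v \<phi> \<in> borel_measurable lborel"
    using borel_measurable_continuous_onI[OF test_function_pd(1)[OF \<phi> assms(4)]] by simp
  then have "(LINT z|lborel. u' z * pd v \<phi> z) = (LINT z|lborel. u z * pd v \<phi> z)"
    using assms(1-3) by (intro integral_cong_AE) (auto simp: weak_derivative_def Lq_loc_def elim:
      eventually_mono)
  then show "(LINT z|lborel. u' z * pd v \<phi> z) = - (LINT z|lborel. w z * \<phi> z)"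
    using assms(1) \<phi> by (simp add: weak_derivative_def)
qed (use assms in \<open>auto simp: weak_derivative_def\<close>)

section \<open>The mollifier, its mass and uniform approximation\<close>

definition mollifier :: "real \<Rightarrow> 'a::euclidean_space \<Rightarrow> real" where
  "mollifier \<epsilon> = box_bump (1 / \<epsilon>) (- (\<epsilon> *\<^sub>R One)) (\<epsilon> *\<^sub>R One)"

text \<open>The mollifier has values in [0, 1] and is not normalised; its integral is divided out
  only where approximation is at stake. The second argument carries the space, which
  \<open>\<epsilon>\<close> does not determine.\<close>

definition mass :: "real \<Rightarrow> 'a::euclidean_space itself \<Rightarrow> real" where
  "mass \<epsilon> _ = (LINT y|lborel. mollifier \<epsilon> (y :: 'a))"

lemma mollifier_Ck: "Ck k (mollifier \<epsilon>)"
  unfolding mollifier_def by (rule Ck_box_bump)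

lemma mollifier_range: "0 \<le> mollifier \<epsilon> y" "mollifier \<epsilon> y \<le> 1"
  unfolding mollifier_def by (rule box_bump_range)+

lemma mollifier_supp: "\<epsilon> > 0 \<Longrightarrow> y \<notin> cbox (- (\<epsilon> *\<^sub>R One)) (\<epsilon> *\<^sub>R One) \<Longrightarrow> mollifier \<epsilon> y = 0"
  unfolding mollifier_def using box_subset_cbox by (intro box_bump_outside) auto

lemma mollifier_even: "mollifier \<epsilon> (- y) = mollifier \<epsilon> y"
  unfolding mollifier_def box_bump_def by (intro prod.cong refl) (simp add: add.commute mult.commute)

lemma mollifier_continuous: "continuous_on UNIV (mollifier \<epsilon>)"
  using Ck_continuous[OF mollifier_Ck[of 0]] .

lemma mollifier_integrable: "\<epsilon> > 0 \<Longrightarrow> integrable lborel (mollifier \<epsilon>)"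
  using compact_support_integral(1)[OF mollifier_continuous mollifier_supp] by blast

lemma mollifier_shift_supp:
  assumes "\<epsilon> > 0" "y \<notin> cbox (z - \<epsilon> *\<^sub>R One) (z + \<epsilon> *\<^sub>R One)" shows "mollifier \<epsilon> (z - y) = 0"
proof (rule mollifier_supp[OF assms(1)])
  show "z - y \<notin> cbox (- (\<epsilon> *\<^sub>R One)) (\<epsilon> *\<^sub>R One)"
  proof
    assume "z - y \<in> cbox (- (\<epsilon> *\<^sub>R One)) (\<epsilon> *\<^sub>R One)"
    then have "y \<in> cbox (z - \<epsilon> *\<^sub>R One) (z + \<epsilon> *\<^sub>R One)"
      by (auto simp: mem_box inner_diff_left inner_add_left algebra_simps)
    then show False using assms(2) by simp
  qed
qed

lemma mollifier_shift_continuous: "continuous_on UNIV (\<lambda>y. mollifier \<epsilon> (z - y))"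
  by (rule continuous_on_compose2[OF mollifier_continuous]) (auto intro!: continuous_intros)

lemma mollifier_shift_integrable:
  assumes "\<epsilon> > 0"
  shows "integrable lborel (\<lambda>y. mollifier \<epsilon> (z - y))"
    "(LINT y|lborel. mollifier \<epsilon> (z - (y :: 'a::euclidean_space))) = mass \<epsilon> TYPE('a)"
proof -
  show "integrable lborel (\<lambda>y. mollifier \<epsilon> (z - y))"
    by (rule compact_support_integral(1)[OF mollifier_shift_continuous mollifier_shift_supp[OF assms]])
  have "mollifier \<epsilon> (z - y) = mollifier \<epsilon> (y - z)" for y using mollifier_even[of \<epsilon> "y - z"] by simp
  then show "(LINT y|lborel. mollifier \<epsilon> (z - (y :: 'a))) = mass \<epsilon> TYPE('a)"
    using lborel_translate[OF mollifier_continuous, of \<epsilon> z] by (simp add: mass_def)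
qed

text \<open>On the concentric cube of half the side every factor is at least
  \<open>flat 0 (1 / 2)\<close>. So the mass has the order of the volume, and errors measured in
  powers of \<open>\<epsilon>\<close> can be compared with it.\<close>

lemma mass_lower:
  assumes "\<epsilon> > 0"
  shows "(flat 0 (1 / 2) * flat 0 (1 / 2)) ^ DIM('a) * \<epsilon> ^ DIM('a) \<le> mass \<epsilon> TYPE('a::euclidean_space)"
proof -
  define k where "k = (flat 0 (1 / 2) * flat 0 (1 / 2)) ^ DIM('a)"
  define C where "C = cbox (- ((\<epsilon> / 2) *\<^sub>R One)) ((\<epsilon> / 2) *\<^sub>R One :: 'a)"
  have "measure lborel C =
      (\<Prod>b\<in>Basis. ((\<epsilon> / 2) *\<^sub>R One :: 'a) \<bullet> b - (- ((\<epsilon> / 2) *\<^sub>R One)) \<bullet> b)"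
    unfolding C_def by (rule content_cbox) (use assms in auto)
  also have "\<dots> = (\<Prod>b\<in>(Basis :: 'a set). \<epsilon>)" by (rule prod.cong) auto
  finally have mC: "measure lborel C = \<epsilon> ^ DIM('a)" by simp
  have int: "integrable lborel (\<lambda>y :: 'a. k * indicator C y)"
    unfolding C_def by (intro integrable_mult_right integrable_real_indicator) (auto simp:
      emeasure_lborel_cbox_eq)
  have "k * \<epsilon> ^ DIM('a) = (LINT y|lborel. k * indicator C y)"
    using mC by (simp add: C_def)
  also have "\<dots> \<le> mass \<epsilon> TYPE('a)"
    unfolding mass_def
  proof (rule integral_mono[OF int mollifier_integrable[OF assms]])
    fix y :: 'a
    show "k * indicator C y \<le> mollifier \<epsilon> y"
    proof (cases "y \<in> C")
      case True
      have "flat 0 (1 / 2) * flat 0 (1 / 2) \<le>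
        flat 0 (1 / \<epsilon> * (y \<bullet> b - (- (\<epsilon> *\<^sub>R One)) \<bullet> b)) * flat 0 (1 / \<epsilon> * ((\<epsilon> *\<^sub>R One) \<bullet> b - y \<bullet> b))"
        if b: "b \<in> Basis" for b
      proof (intro mult_mono flat_mono flat_range)
        have "- (\<epsilon> / 2) \<le> y \<bullet> b" "y \<bullet> b \<le> \<epsilon> / 2" using True b by (auto simp: C_def mem_box)
        then show "1 / 2 \<le> 1 / \<epsilon> * (y \<bullet> b - (- (\<epsilon> *\<^sub>R One)) \<bullet> b)" "1 / 2 \<le> 1 / \<epsilon> * ((\<epsilon> *\<^sub>R One) \<bullet> b - y \<bullet> b)"
          using assms b by (auto simp: field_simps)
      qed
      then have "(\<Prod>b\<in>(Basis :: 'a set). flat 0 (1 / 2) * flat 0 (1 / 2)) \<le> mollifier \<epsilon> y"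
        unfolding mollifier_def box_bump_def by (intro prod_mono) (auto intro!: mult_nonneg_nonneg flat_range)
      then show ?thesis using True by (simp add: k_def)
    next
      case False then show ?thesis by (simp add: mollifier_range)
    qed
  qed
  finally show ?thesis by (simp add: k_def)
qed

lemma mass_pos:
  assumes "\<epsilon> > 0" shows "mass \<epsilon> TYPE('a::euclidean_space) > 0"
proof -
  have "flat 0 (1 / 2) > 0" by (simp add: flat_def)
  then have "0 < (flat 0 (1 / 2) * flat 0 (1 / 2)) ^ DIM('a) * \<epsilon> ^ DIM('a)" using assms by simp
  then show ?thesis using mass_lower[OF assms, where 'a = 'a] by linarith
qed

lemma conv_mollifier_integrable:
  assumes "\<epsilon> > 0" "loc_int w"
  shows "integrable lborel (\<lambda>y. w y * mollifier \<epsilon> (z - y))"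
  by (rule loc_int_times[OF assms(2) mollifier_shift_continuous mollifier_shift_supp[OF assms(1)]])

lemma continuous_loc_int: "continuous_on UNIV f \<Longrightarrow> loc_int f"
  unfolding loc_int_def set_integrable_def
  by (auto simp: borel_measurable_continuous_onI simp del: real_scaleR_def
      intro!: borel_integrable_compact intro: continuous_on_subset)

text \<open>After normalisation the mollification is a weighted mean over a small cube. With
  \<open>k = u z\<close> this gives approximation, with \<open>k = 0\<close> the preservation of a
  sup bound.\<close>

lemma mollify_close:
  fixes u :: "'a::euclidean_space \<Rightarrow> real"
  assumes e: "\<epsilon> > 0" and u: "continuous_on UNIV u"
    and close: "\<And>y. y \<in> cbox (z - \<epsilon> *\<^sub>R One) (z + \<epsilon> *\<^sub>R One) \<Longrightarrow> \<bar>u y - k\<bar> \<le> \<eta>"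
  shows "\<bar>conv u (mollifier \<epsilon>) z / mass \<epsilon> TYPE('a) - k\<bar> \<le> \<eta>"
proof -
  define c where "c = mass \<epsilon> TYPE('a)"
  have c: "c > 0" unfolding c_def by (rule mass_pos[OF e])
  have i1: "integrable lborel (\<lambda>y. u y * mollifier \<epsilon> (z - y))"
    by (rule conv_mollifier_integrable[OF e continuous_loc_int[OF u]])
  have i2: "integrable lborel (\<lambda>y. l * mollifier \<epsilon> (z - y))" for l
    by (intro integrable_mult_right mollifier_shift_integrable(1)[OF e])
  have i3: "integrable lborel (\<lambda>y. (u y - k) * mollifier \<epsilon> (z - y))"
    using Bochner_Integration.integrable_diff[OF i1 i2[of k]] by (simp add: left_diff_distrib)
  have m1: "(LINT y|lborel. mollifier \<epsilon> (z - y)) = c"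
    using mollifier_shift_integrable(2)[OF e, of z] by (simp add: c_def)
  have m: "(LINT y|lborel. l * mollifier \<epsilon> (z - y)) = l * c" for l
    by (simp add: m1)
  have "conv u (mollifier \<epsilon>) z - k * c = (LINT y|lborel. (u y - k) * mollifier \<epsilon> (z - y))"
    using Bochner_Integration.integral_diff[OF i1 i2[of k]] m1 by (simp add: conv_def left_diff_distrib)
  also have "\<bar>\<dots>\<bar> \<le> (LINT y|lborel. \<bar>(u y - k) * mollifier \<epsilon> (z - y)\<bar>)"
    using integral_norm_bound[of lborel "\<lambda>y. (u y - k) * mollifier \<epsilon> (z - y)"] by simp
  also have "\<dots> \<le> (LINT y|lborel. \<eta> * mollifier \<epsilon> (z - y))"
  proof (rule integral_mono[OF integrable_abs[OF i3] i2])
    fix y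
    show "\<bar>(u y - k) * mollifier \<epsilon> (z - y)\<bar> \<le> \<eta> * mollifier \<epsilon> (z - y)"
    proof (cases "y \<in> cbox (z - \<epsilon> *\<^sub>R One) (z + \<epsilon> *\<^sub>R One)")
      case True
      then show ?thesis using close[OF True] mollifier_range(1)[of \<epsilon> "z - y"]
        by (simp add: abs_mult mult_right_mono)
    next
      case False
      then show ?thesis using mollifier_shift_supp[OF e False] by simp
    qed
  qed
  also have "\<dots> = \<eta> * c" by (rule m)
  finally have "\<bar>conv u (mollifier \<epsilon>) z - k * c\<bar> / c \<le> \<eta>" using c by (simp add: pos_divide_le_eq)
  moreover have "conv u (mollifier \<epsilon>) z / c - k = (conv u (mollifier \<epsilon>) z - k * c) / c"
    using c by (simp add: field_simps)
  ultimately show ?thesis using c unfolding c_def[symmetric] by (simp add: abs_divide)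
qed

section \<open>Commutators of mollification with Hoelder coefficients\<close>

lemma young_split:
  assumes "w \<ge> 0" "k > 0" "q \<ge> 1"
  shows "w \<le> k powr (q - 1) * w powr q + 1 / (k :: real)"
\<comment> \<open>Either \<open>w\<close> is at most \<open>1 / k\<close>, or multiplying it by the
  factor \<open>(k * w) powr (q - 1)\<close>, then at least 1, increases it.\<close>
proof (cases "k * w \<le> 1")
  case True
  then have "w \<le> 1 / k" using assms by (simp add: field_simps)
  moreover have "0 \<le> k powr (q - 1) * w powr q" by simp
  ultimately show ?thesis by linarith
next
  case False
  then have w: "w > 0" using assms by (cases "w = 0") auto
  have "1 \<le> (k * w) powr (q - 1)" using False assms by (intro ge_one_powr_ge_zero) auto
  then have "w * 1 \<le> w * (k * w) powr (q - 1)" using w by (intro mult_left_mono) auto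
  also have "\<dots> = k powr (q - 1) * (w powr (q - 1) * w powr 1)"
    using w assms by (simp add: powr_mult)
  also have "\<dots> = k powr (q - 1) * w powr q" using powr_add[of w "q - 1" 1] by simp
  finally show ?thesis using assms by (simp add: add_increasing2)
qed

lemma cube_subset:
  assumes "z \<in> cbox (- (r *\<^sub>R One)) (r *\<^sub>R One)" "0 < \<epsilon>" "\<epsilon> \<le> 1" "y \<in> cbox (z - \<epsilon> *\<^sub>R One) (z + \<epsilon> *\<^sub>R One)"
  shows "y \<in> cbox (- ((r + 1) *\<^sub>R One)) ((r + 1) *\<^sub>R One :: 'a::euclidean_space)"
  using assms by (fastforce simp: mem_box inner_diff_left inner_add_left)

lemma loc_int_cube:
  assumes "loc_int w"
  shows "integrable lborel (\<lambda>y. \<bar>w y\<bar> * indicator (cbox l u) y)"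
proof -
  have "set_integrable lborel (cbox l u) w" using assms by (simp add: loc_int_def)
  from integrable_abs[OF this[unfolded set_integrable_def]] show ?thesis
    by (simp add: abs_mult mult.commute)
qed

text \<open>The exponent is tuned to the factor \<open>\<epsilon> powr \<theta>\<close>. Splitting
  at \<open>k = \<epsilon> powr (\<theta> / 2)\<close> makes \<open>k powr (p - 1)\<close> equal to
  the volume order, so the integral over a cube is at most that order times
  \<open>J + 2 ^ D / k\<close>; half of the power of \<open>\<epsilon>\<close> pays for
  \<open>1 / k\<close> and the other half tends to zero. The bound \<open>J\<close> is taken on a
  fixed larger cube, hence the uniformity in \<open>z\<close>.\<close>

lemma small_average:
  fixes w :: "'a::euclidean_space \<Rightarrow> real"
  assumes w: "loc_int w" and \<theta>: "\<theta> > 0" and q: "Lq_loc (1 + 2 * real DIM('a) / \<theta>) w"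
    and K: "bounded K" and \<eta>: "\<eta> > 0"
  shows "\<forall>\<^sub>F \<epsilon> in at_right 0. \<forall>z\<in>K. \<epsilon> powr \<theta> *
    (LINT y|lborel. \<bar>w y\<bar> * indicator (cbox (z - \<epsilon> *\<^sub>R One) (z + \<epsilon> *\<^sub>R One)) y) \<le> \<eta> * \<epsilon> ^ DIM('a)"
proof -
  define D where "D = DIM('a)"
  define p where "p = 1 + 2 * real D / \<theta>"
  have p: "p \<ge> 1" using \<theta> by (simp add: p_def)
  obtain r where r: "K \<subseteq> cbox (- (r *\<^sub>R One)) (r *\<^sub>R One)" using bounded_subset_cube[OF K] by blast
  define K1 where "K1 = cbox (- ((r + 1) *\<^sub>R One)) ((r + 1) *\<^sub>R One :: 'a)"
  have wp: "integrable lborel (\<lambda>y. indicator K1 y *\<^sub>R (\<bar>w y\<bar> powr p))"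
  proof -
    have "compact K1" by (simp add: K1_def)
    with q[folded D_def, folded p_def] show ?thesis by (simp add: Lq_loc_def set_integrable_def)
  qed
  define J where "J = (LINT y|lborel. indicator K1 y *\<^sub>R (\<bar>w y\<bar> powr p))"
  have "((\<lambda>\<epsilon>. \<epsilon> powr \<theta> * J + \<epsilon> powr (\<theta> / 2) * 2 ^ D) \<longlongrightarrow> 0 * J + 0 * 2 ^ D) (at_right 0)"
    using \<theta> by (intro tendsto_add tendsto_mult tendsto_const) (auto intro!: tendsto_powr'[THEN
      tendsto_eq_rhs] intro: eventually_mono[OF eventually_at_right_less])
  then have "\<forall>\<^sub>F \<epsilon> in at_right 0. \<epsilon> powr \<theta> * J + \<epsilon> powr (\<theta> / 2) * 2 ^ D < \<eta>"
    using \<eta> by (intro order_tendstoD) auto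
  moreover have "\<forall>\<^sub>F \<epsilon> in at_right (0::real). \<epsilon> \<in> {0<..<1}" by (rule eventually_at_right_real) simp
  ultimately show ?thesis
  proof eventually_elim
    case (elim \<epsilon>)
    then have e: "0 < \<epsilon>" "\<epsilon> \<le> 1" by auto
    define k where "k = \<epsilon> powr (\<theta> / 2)"
    have l: "k > 0" using e by (simp add: k_def)
    have lp: "k powr (p - 1) = \<epsilon> ^ D"
      using e \<theta> by (simp add: k_def p_def powr_powr powr_realpow)
    show ?case
    proof
      fix z assume z: "z \<in> K"
      define C where "C = cbox (z - \<epsilon> *\<^sub>R One) (z + \<epsilon> *\<^sub>R One)"
      have CK: "C \<subseteq> K1" using cube_subset[OF _ e] z r unfolding C_def K1_def by blast
      have "measure lborel C = (\<Prod>b\<in>Basis. (z + \<epsilon> *\<^sub>R One) \<bullet> b - (z - \<epsilon> *\<^sub>R One) \<bullet> b)"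
        unfolding C_def by (rule content_cbox) (use e in \<open>auto simp: inner_diff_left inner_add_left\<close>)
      also have "\<dots> = (\<Prod>b\<in>(Basis :: 'a set). 2 * \<epsilon>)"
        by (rule prod.cong) (auto simp: inner_diff_left inner_add_left)
      finally have mC: "measure lborel C = (2 * \<epsilon>) ^ D" by (simp add: D_def)
      have iC: "integrable lborel (indicator C :: 'a \<Rightarrow> real)"
        unfolding C_def by (intro integrable_real_indicator) (auto simp: emeasure_lborel_cbox_eq)
      have iw: "integrable lborel (\<lambda>y. \<bar>w y\<bar> * indicator C y)"
        unfolding C_def by (rule loc_int_cube[OF w])
      have "(LINT y|lborel. \<bar>w y\<bar> * indicator C y) \<le>
         (LINT y|lborel. k powr (p - 1) * (indicator K1 y *\<^sub>R (\<bar>w y\<bar> powr p)) + 1 / k * indicator C y)"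
      proof (rule integral_mono[OF iw])
        show "integrable lborel (\<lambda>y. k powr (p - 1) * (indicator K1 y *\<^sub>R (\<bar>w y\<bar> powr p)) + 1 / k *
          indicator C y)"
          by (intro Bochner_Integration.integrable_add integrable_mult_right wp iC)
        fix y
        show "\<bar>w y\<bar> * indicator C y \<le> k powr (p - 1) * (indicator K1 y *\<^sub>R (\<bar>w y\<bar> powr p)) + 1 / k *
          indicator C y"
        proof (cases "y \<in> C")
          case True
          then show ?thesis using CK young_split[OF _ l p, of "\<bar>w y\<bar>"] by (simp add: subset_iff)
        qed simp
      qed
      also have "\<dots> = k powr (p - 1) * J + 1 / k * (2 * \<epsilon>) ^ D"
        using Bochner_Integration.integral_add[OF integrable_mult_right[OF wp, of "k powr (p - 1)"]
          integrable_mult_right[OF iC, of "1 / k"]] mC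
        by (simp add: J_def C_def)
      also have "\<dots> = \<epsilon> ^ D * (J + 2 ^ D / k)" by (simp add: lp power_mult_distrib algebra_simps)
      finally have "\<epsilon> powr \<theta> * (LINT y|lborel. \<bar>w y\<bar> * indicator C y) \<le> \<epsilon> powr \<theta> * (\<epsilon> ^ D * (J + 2 ^ D / k))"
        by (intro mult_left_mono) auto
      also have "\<dots> = (\<epsilon> powr \<theta> * J + \<epsilon> powr (\<theta> / 2) * 2 ^ D) * \<epsilon> ^ D"
      proof -
        have "\<epsilon> powr \<theta> = k * k" by (simp add: k_def flip: powr_add)
        then show ?thesis unfolding k_def[symmetric] using l by (simp add: field_simps)
      qed
      also have "\<dots> \<le> \<eta> * \<epsilon> ^ D" using elim e by (intro mult_right_mono) auto
      finally show "\<epsilon> powr \<theta> * (LINT y|lborel. \<bar>w y\<bar> * indicator (cbox (z - \<epsilon> *\<^sub>R One) (z + \<epsilon> *\<^sub>R One))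
        y) \<le> \<eta> * \<epsilon> ^ DIM('a)"
        by (simp add: C_def D_def)
    qed
  qed
qed

text \<open>The cubes are isotropic although the scaling is parabolic. The time exponent
  \<open>\<alpha> / 2\<close> is the worse one and sets the rate; the spatial increment is weakened
  to it by \<open>\<epsilon> \<le> 1\<close>.\<close>

lemma holder_cube:
  fixes A :: "real \<times> (real ^ 'n) \<Rightarrow> real"
  assumes A: "parabolic_holder_loc \<alpha> A" and \<alpha>: "\<alpha> > 0" and K: "bounded K"
  shows "\<exists>C\<ge>0. \<forall>\<epsilon> z y. 0 < \<epsilon> \<longrightarrow> \<epsilon> \<le> 1 \<longrightarrow> z \<in> K \<longrightarrow> y \<in> cbox (z - \<epsilon> *\<^sub>R One) (z + \<epsilon> *\<^sub>R One) \<longrightarrow>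
    \<bar>A y - A z\<bar> \<le> C * \<epsilon> powr (\<alpha> / 2)"
proof -
  obtain r where r: "K \<subseteq> cbox (- (r *\<^sub>R One)) (r *\<^sub>R One)" using bounded_subset_cube[OF K] by blast
  define K1 where "K1 = cbox (- ((r + 1) *\<^sub>R One)) ((r + 1) *\<^sub>R One :: real \<times> (real ^ 'n))"
  have "compact K1" by (simp add: K1_def)
  then obtain C where C: "\<And>s x t y. (s, x) \<in> K1 \<Longrightarrow> (t, y) \<in> K1 \<Longrightarrow>
      \<bar>A (s, x) - A (t, y)\<bar> \<le> C * (\<bar>s - t\<bar> powr (\<alpha> / 2) + norm (x - y) powr \<alpha>)"
    using A unfolding parabolic_holder_loc_def by blast
  define N where "N = real CARD('n)"
  define C' where "C' = \<bar>C\<bar> * (1 + N powr \<alpha>)"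
  show ?thesis
  proof (intro exI[of _ C'] conjI allI impI)
    show "0 \<le> C'" by (simp add: C'_def)
    fix \<epsilon> :: real and z y :: "real \<times> (real ^ 'n)"
    assume e: "0 < \<epsilon>" "\<epsilon> \<le> 1" and z: "z \<in> K" and y: "y \<in> cbox (z - \<epsilon> *\<^sub>R One) (z + \<epsilon> *\<^sub>R One)"
    have zr: "z \<in> cbox (- (r *\<^sub>R One)) (r *\<^sub>R One)" using z r by blast
    have K1: "y \<in> K1" unfolding K1_def by (rule cube_subset[OF zr e y])
    have "z \<in> cbox (z - \<epsilon> *\<^sub>R One) (z + \<epsilon> *\<^sub>R One)" using e
      by (auto simp: mem_box inner_diff_left inner_add_left)
    from cube_subset[OF zr e this] have K2: "z \<in> K1" by (simp add: K1_def)
    have comp: "\<bar>(y - z) \<bullet> b\<bar> \<le> \<epsilon>" if "b \<in> Basis" for b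
    proof -
      have "z \<bullet> b - \<epsilon> \<le> y \<bullet> b \<and> y \<bullet> b \<le> z \<bullet> b + \<epsilon>"
        using y that by (auto simp: mem_box inner_diff_left inner_add_left)
      then show ?thesis by (simp add: inner_diff_left abs_le_iff)
    qed
    have t: "\<bar>fst y - fst z\<bar> \<le> \<epsilon>" using comp[of "(1, 0)"] by (simp add: Basis_prod_def inner_prod_def)
    have "norm (snd y - snd z) \<le> (\<Sum>i\<in>UNIV. \<bar>(snd y - snd z) $ i\<bar>)" by (rule norm_le_l1_cart)
    also have "\<dots> \<le> (\<Sum>i\<in>(UNIV :: 'n set). \<epsilon>)"
    proof (rule sum_mono)
      fix i :: 'n
      have "(0, axis i 1) \<in> (Basis :: (real \<times> (real ^ 'n)) set)"
        by (simp add: Basis_prod_def axis_in_Basis_iff)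
      from comp[OF this] show "\<bar>(snd y - snd z) $ i\<bar> \<le> \<epsilon>" by (simp add: inner_prod_def inner_axis)
    qed
    finally have x: "norm (snd y - snd z) \<le> N * \<epsilon>" by (simp add: N_def)
    have "(N * \<epsilon>) powr \<alpha> = N powr \<alpha> * \<epsilon> powr \<alpha>" by (rule powr_mult)
    also have "\<dots> \<le> N powr \<alpha> * \<epsilon> powr (\<alpha> / 2)" using e \<alpha> by (intro mult_left_mono powr_mono') auto
    finally have Ne: "(N * \<epsilon>) powr \<alpha> \<le> N powr \<alpha> * \<epsilon> powr (\<alpha> / 2)" .
    have "norm (snd y - snd z) powr \<alpha> \<le> (N * \<epsilon>) powr \<alpha>" using x \<alpha> by (intro powr_mono2) auto
    with Ne have 1: "norm (snd y - snd z) powr \<alpha> \<le> N powr \<alpha> * \<epsilon> powr (\<alpha> / 2)" by linarith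
    have 2: "\<bar>fst y - fst z\<bar> powr (\<alpha> / 2) \<le> \<epsilon> powr (\<alpha> / 2)" using t \<alpha> by (intro powr_mono2) auto
    have "\<bar>A y - A z\<bar> \<le> C * (\<bar>fst y - fst z\<bar> powr (\<alpha> / 2) + norm (snd y - snd z) powr \<alpha>)"
      using C[of "fst y" "snd y" "fst z" "snd z"] K1 K2 by simp
    also have "\<dots> \<le> \<bar>C\<bar> * (\<epsilon> powr (\<alpha> / 2) + N powr \<alpha> * \<epsilon> powr (\<alpha> / 2))"
      using 1 2 by (intro mult_mono add_mono) auto
    finally show "\<bar>A y - A z\<bar> \<le> C' * \<epsilon> powr (\<alpha> / 2)" by (simp add: C'_def algebra_simps)
  qed
qed

lemma mollified_product_integrable:
  fixes A w :: "'a::euclidean_space \<Rightarrow> real"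
  assumes e: "\<epsilon> > 0" and A: "continuous_on UNIV A" and w: "loc_int w"
  shows "integrable lborel (\<lambda>y. (A y * w y) * mollifier \<epsilon> (z - y))"
proof -
  have "integrable lborel (\<lambda>y. w y * (A y * mollifier \<epsilon> (z - y)))"
    by (rule loc_int_times[OF w continuous_on_mult[OF A mollifier_shift_continuous], of "z - \<epsilon> *\<^sub>R One"
      "z + \<epsilon> *\<^sub>R One"])
      (simp add: mollifier_shift_supp[OF e])
  then show ?thesis by (simp add: mult_ac)
qed

text \<open>The coefficient at \<open>z\<close> is a constant under the integral, so the difference
  integrates \<open>A y - A z\<close> against \<open>w\<close> and the kernel, and the kernel is at
  most 1.\<close>

lemma commutator_bound:
  fixes A w :: "'a::euclidean_space \<Rightarrow> real"
  assumes e: "\<epsilon> > 0" and A: "continuous_on UNIV A" and w: "loc_int w"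
    and \<kappa>: "\<And>y. y \<in> cbox (z - \<epsilon> *\<^sub>R One) (z + \<epsilon> *\<^sub>R One) \<Longrightarrow> \<bar>A y - A z\<bar> \<le> \<kappa>"
  shows "\<bar>conv (\<lambda>y. A y * w y) (mollifier \<epsilon>) z - A z * conv w (mollifier \<epsilon>) z\<bar> \<le>
     \<kappa> * (LINT y|lborel. \<bar>w y\<bar> * indicator (cbox (z - \<epsilon> *\<^sub>R One) (z + \<epsilon> *\<^sub>R One)) y)"
proof -
  define C where "C = cbox (z - \<epsilon> *\<^sub>R One) (z + \<epsilon> *\<^sub>R One)"
  have i1': "integrable lborel (\<lambda>y. (A y * w y) * mollifier \<epsilon> (z - y))"
    by (rule mollified_product_integrable[OF e A w])
  have i2: "integrable lborel (\<lambda>y. A z * (w y * mollifier \<epsilon> (z - y)))"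
    by (intro integrable_mult_right conv_mollifier_integrable e w)
  have eq: "(A y * w y) * mollifier \<epsilon> (z - y) - A z * (w y * mollifier \<epsilon> (z - y)) =
      (A y - A z) * w y * mollifier \<epsilon> (z - y)" for y by (simp add: algebra_simps)
  have i3: "integrable lborel (\<lambda>y. (A y - A z) * w y * mollifier \<epsilon> (z - y))"
    using Bochner_Integration.integrable_diff[OF i1' i2] by (simp only: eq)
  have iw: "integrable lborel (\<lambda>y. \<bar>w y\<bar> * indicator C y)"
    unfolding C_def by (rule loc_int_cube[OF w])
  have "conv (\<lambda>y. A y * w y) (mollifier \<epsilon>) z - A z * conv w (mollifier \<epsilon>) z =
     (LINT y|lborel. (A y * w y) * mollifier \<epsilon> (z - y) - A z * (w y * mollifier \<epsilon> (z - y)))"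
    using Bochner_Integration.integral_diff[OF i1' i2] by (simp add: conv_def)
  also have "\<dots> = (LINT y|lborel. (A y - A z) * w y * mollifier \<epsilon> (z - y))"
    by (simp only: eq)
  also have "\<bar>\<dots>\<bar> \<le> (LINT y|lborel. \<bar>(A y - A z) * w y * mollifier \<epsilon> (z - y)\<bar>)"
    using integral_norm_bound[of lborel "\<lambda>y. (A y - A z) * w y * mollifier \<epsilon> (z - y)"] by simp
  also have "\<dots> \<le> (LINT y|lborel. \<kappa> * (\<bar>w y\<bar> * indicator C y))"
  proof (rule integral_mono[OF integrable_abs[OF i3] integrable_mult_right[OF iw]])
    fix y
    show "\<bar>(A y - A z) * w y * mollifier \<epsilon> (z - y)\<bar> \<le> \<kappa> * (\<bar>w y\<bar> * indicator C y)"
    proof (cases "y \<in> C")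
      case True
      then have k: "\<bar>A y - A z\<bar> \<le> \<kappa>" using \<kappa> by (simp add: C_def)
      have "\<bar>A y - A z\<bar> * \<bar>w y\<bar> * mollifier \<epsilon> (z - y) \<le> \<kappa> * \<bar>w y\<bar> * 1"
        using k mollifier_range[of \<epsilon> "z - y"] by (intro mult_mono) (auto intro: order_trans[OF abs_ge_zero k])
      then show ?thesis using True mollifier_range(1)[of \<epsilon> "z - y"] by (simp add: abs_mult)
    next
      case False
      then show ?thesis using mollifier_shift_supp[OF e, of y z] by (simp add: C_def)
    qed
  qed
  also have "\<dots> = \<kappa> * (LINT y|lborel. \<bar>w y\<bar> * indicator C y)" by simp
  finally show "\<bar>conv (\<lambda>y. A y * w y) (mollifier \<epsilon>) z - A z * conv w (mollifier \<epsilon>) z\<bar> \<le>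
     \<kappa> * (LINT y|lborel. \<bar>w y\<bar> * indicator (cbox (z - \<epsilon> *\<^sub>R One) (z + \<epsilon> *\<^sub>R One)) y)" by (simp add: C_def)
qed

text \<open>A Hoelder coefficient gains \<open>\<epsilon>\<^bsup>\<alpha>/2\<^esup>\<close>, while local integrability of \<open>w\<close> to a large power
  loses less than that.  Hence the commutator tends to zero uniformly and not only in the mean.\<close>

lemma commutator_small:
  fixes A w :: "real \<times> (real ^ 'n) \<Rightarrow> real"
  assumes A: "parabolic_holder_loc \<alpha> A" and \<alpha>: "\<alpha> > 0" and w: "loc_int w"
    and q: "Lq_loc (1 + 2 * real DIM(real \<times> (real ^ 'n)) / (\<alpha> / 2)) w" and K: "bounded K" and \<eta>: "\<eta> > 0"
  shows "\<forall>\<^sub>F \<epsilon> in at_right 0. \<forall>z\<in>K. \<bar>conv (\<lambda>y. A y * w y) (mollifier \<epsilon>) z - A z * conv w (mollifier \<epsilon>) z\<bar>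
     \<le> \<eta> * mass \<epsilon> TYPE(real \<times> (real ^ 'n))"
proof -
  obtain C where C: "C \<ge> 0" "\<And>\<epsilon> z y. 0 < \<epsilon> \<Longrightarrow> \<epsilon> \<le> 1 \<Longrightarrow> z \<in> K \<Longrightarrow>
      y \<in> cbox (z - \<epsilon> *\<^sub>R One) (z + \<epsilon> *\<^sub>R One) \<Longrightarrow> \<bar>A y - A z\<bar> \<le> C * \<epsilon> powr (\<alpha> / 2)"
    using holder_cube[OF A \<alpha> K] by auto
  have Ac: "continuous_on UNIV A" by (rule parabolic_holder_loc_continuous[OF A \<alpha>])
  define k where "k = (flat 0 (1 / 2) * flat 0 (1 / 2)) ^ DIM(real \<times> (real ^ 'n))"
  have k: "k > 0" by (simp add: k_def flat_def)
  \<comment> \<open>Compensates the Hoelder constant \<open>C\<close> and the constant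
    \<open>k\<close> of \<open>mass_lower\<close>; \<open>C + 1\<close> because \<open>C\<close> may
    be 0.\<close>
  define \<eta>' where "\<eta>' = \<eta> * k / (C + 1)"
  have \<eta>': "\<eta>' > 0" "C * \<eta>' \<le> \<eta> * k" using \<eta> k C by (auto simp: \<eta>'_def field_simps)
  have "\<alpha> / 2 > 0" using \<alpha> by simp
  from small_average[OF w this q K \<eta>'(1)]
  have "\<forall>\<^sub>F \<epsilon> in at_right 0. \<forall>z\<in>K. \<epsilon> powr (\<alpha> / 2) *
    (LINT y|lborel. \<bar>w y\<bar> * indicator (cbox (z - \<epsilon> *\<^sub>R One) (z + \<epsilon> *\<^sub>R One)) y) \<le>
      \<eta>' * \<epsilon> ^ DIM(real \<times> (real ^ 'n))" .
  moreover have "\<forall>\<^sub>F \<epsilon> in at_right (0::real). \<epsilon> \<in> {0<..<1}" by (rule eventually_at_right_real) simp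
  ultimately show ?thesis
  proof eventually_elim
    case (elim \<epsilon>)
    then have e: "0 < \<epsilon>" "\<epsilon> \<le> 1" by auto
    show ?case
    proof
      fix z assume z: "z \<in> K"
      define I where "I = (LINT y|lborel. \<bar>w y\<bar> * indicator (cbox (z - \<epsilon> *\<^sub>R One) (z + \<epsilon> *\<^sub>R One)) y)"
      have "\<bar>conv (\<lambda>y. A y * w y) (mollifier \<epsilon>) z - A z * conv w (mollifier \<epsilon>) z\<bar> \<le> (C * \<epsilon> powr (\<alpha> / 2)) * I"
        unfolding I_def by (rule commutator_bound[OF e(1) Ac w C(2)[OF e z]])
      also have "\<dots> = C * (\<epsilon> powr (\<alpha> / 2) * I)" by simp
      also have "\<dots> \<le> C * (\<eta>' * \<epsilon> ^ DIM(real \<times> (real ^ 'n)))"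
        using elim(1) z C(1) unfolding I_def by (intro mult_left_mono) blast+
      also have "\<dots> = (C * \<eta>') * \<epsilon> ^ DIM(real \<times> (real ^ 'n))" by simp
      also have "\<dots> \<le> (\<eta> * k) * \<epsilon> ^ DIM(real \<times> (real ^ 'n))" using \<eta>'(2) e by (intro mult_right_mono) auto
      also have "\<dots> \<le> \<eta> * mass \<epsilon> TYPE(real \<times> (real ^ 'n))"
        using mult_left_mono[OF mass_lower[OF e(1), where 'a = "real \<times> (real ^ 'n)"], of \<eta>] \<eta>
        unfolding k_def by (simp add: mult.assoc)
      finally show "\<bar>conv (\<lambda>y. A y * w y) (mollifier \<epsilon>) z - A z * conv w (mollifier \<epsilon>) z\<bar>
         \<le> \<eta> * mass \<epsilon> TYPE(real \<times> (real ^ 'n))" .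
    qed
  qed
qed

lemma mollify_uniform:
  fixes u :: "'a::euclidean_space \<Rightarrow> real"
  assumes u: "continuous_on UNIV u" and K: "bounded K" and \<eta>: "\<eta> > 0"
  shows "\<forall>\<^sub>F \<epsilon> in at_right 0. \<forall>z\<in>K. \<bar>conv u (mollifier \<epsilon>) z / mass \<epsilon> TYPE('a) - u z\<bar> \<le> \<eta>"
proof -
  obtain r where r: "K \<subseteq> cbox (- (r *\<^sub>R One)) (r *\<^sub>R One)" using bounded_subset_cube[OF K] by blast
  define K1 where "K1 = cbox (- ((r + 1) *\<^sub>R One)) ((r + 1) *\<^sub>R One :: 'a)"
  have "uniformly_continuous_on K1 u"
    unfolding K1_def by (intro compact_uniformly_continuous continuous_on_subset[OF u]) auto
  then obtain d where d: "d > 0" "\<And>y z. y \<in> K1 \<Longrightarrow> z \<in> K1 \<Longrightarrow> dist y z < d \<Longrightarrow> dist (u y) (u z) < \<eta>"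
    using \<eta> unfolding uniformly_continuous_on_def by meson
  define D where "D = real DIM('a)"
  have D: "D > 0" by (simp add: D_def)
  have "\<forall>\<^sub>F \<epsilon> in at_right (0::real). \<epsilon> \<in> {0<..<min 1 (d / D)}"
    using d D by (intro eventually_at_right_real) simp
  then show ?thesis
  proof eventually_elim
    case (elim \<epsilon>)
    then have e: "0 < \<epsilon>" "\<epsilon> \<le> 1" "D * \<epsilon> < d" using D by (auto simp: field_simps)
    show ?case
    proof
      fix z assume z: "z \<in> K"
      then have zr: "z \<in> cbox (- (r *\<^sub>R One)) (r *\<^sub>R One)" using r by blast
      show "\<bar>conv u (mollifier \<epsilon>) z / mass \<epsilon> TYPE('a) - u z\<bar> \<le> \<eta>"
      proof (rule mollify_close[OF e(1) u])
        fix y assume y: "y \<in> cbox (z - \<epsilon> *\<^sub>R One) (z + \<epsilon> *\<^sub>R One)"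
        have K1: "y \<in> K1" unfolding K1_def by (rule cube_subset[OF zr e(1,2) y])
        have "z \<in> cbox (z - \<epsilon> *\<^sub>R One) (z + \<epsilon> *\<^sub>R One)" using e
          by (auto simp: mem_box inner_diff_left inner_add_left)
        from cube_subset[OF zr e(1,2) this] have K2: "z \<in> K1" by (simp add: K1_def)
        have "norm (y - z) \<le> (\<Sum>b\<in>Basis. \<bar>(y - z) \<bullet> b\<bar>)" by (rule norm_le_l1)
        also have "\<dots> \<le> (\<Sum>b\<in>(Basis :: 'a set). \<epsilon>)"
        proof (rule sum_mono)
          fix b :: 'a assume "b \<in> Basis"
          then have "z \<bullet> b - \<epsilon> \<le> y \<bullet> b \<and> y \<bullet> b \<le> z \<bullet> b + \<epsilon>"
            using y by (auto simp: mem_box inner_diff_left inner_add_left)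
          then show "\<bar>(y - z) \<bullet> b\<bar> \<le> \<epsilon>" by (simp add: inner_diff_left abs_le_iff)
        qed
        also have "\<dots> = D * \<epsilon>" by (simp add: D_def)
        finally have "dist y z < d" using e by (simp add: dist_norm)
        from d(2)[OF K1 K2 this] show "\<bar>u y - u z\<bar> \<le> \<eta>" by (simp add: dist_norm)
      qed
    qed
  qed
qed

lemma Lq_loc_cong_AE:
  assumes "Lq_loc q f" "AE z in lborel. f z = g z" "g \<in> borel_measurable lborel"
  shows "Lq_loc q g"
  unfolding Lq_loc_def
proof (intro conjI allI impI assms(3))
  fix K :: "'a set" assume K: "compact K"
  then have Ks: "K \<in> sets lborel" by (simp add: borel_compact)
  have fm: "f \<in> borel_measurable lborel" using assms(1) by (simp add: Lq_loc_def)
  have "set_integrable lborel K (\<lambda>z. \<bar>f z\<bar> powr q)" using assms(1) K by (simp add: Lq_loc_def)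
  moreover have "AE z in lborel. indicator K z *\<^sub>R (\<bar>f z\<bar> powr q) = indicator K z *\<^sub>R (\<bar>g z\<bar> powr q)"
    using assms(2) by eventually_elim simp
  ultimately show "set_integrable lborel K (\<lambda>z. \<bar>g z\<bar> powr q)"
    unfolding set_integrable_def using fm assms(3) Ks
    by (subst integrable_cong_AE[symmetric]) (auto, measurable)
qed

subsection \<open>Strong solutions\<close>

lemma e_time_Basis: "e_time \<in> (Basis :: (real \<times> (real ^ 'n)) set)"
  and e_space_Basis: "e_space i \<in> (Basis :: (real \<times> (real ^ 'n)) set)"
  by (auto simp: Basis_prod_def axis_in_Basis_iff)

lemma mollifier_pd_Ck:
  fixes v :: "'a::euclidean_space"
  shows "v \<in> Basis \<Longrightarrow> Ck k (pd v (mollifier \<epsilon>))"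
  using mollifier_Ck[of "Suc k" \<epsilon>, where 'a = 'a] by simp

lemma mollifier_pd_supp:
  "\<epsilon> > 0 \<Longrightarrow> y \<notin> cbox (- (\<epsilon> *\<^sub>R One)) (\<epsilon> *\<^sub>R One) \<Longrightarrow> pd v (mollifier \<epsilon>) y = 0"
  by (rule pd_outside_support[OF mollifier_supp])

lemma mollified_pd:
  fixes u :: "'a::euclidean_space \<Rightarrow> real"
  assumes e: "\<epsilon> > 0" and u: "continuous_on UNIV u" and v: "v \<in> Basis"
  shows "has_pd v (conv u (mollifier \<epsilon>)) z" "pd v (conv u (mollifier \<epsilon>)) = conv u (pd v (mollifier \<epsilon>))"
    "continuous_on UNIV (conv u (mollifier \<epsilon>))" "continuous_on UNIV (conv u (pd v (mollifier \<epsilon>)))"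
proof -
  note * = conv_pd[OF u mollifier_Ck v mollifier_supp[OF e]]
  show "has_pd v (conv u (mollifier \<epsilon>)) z" by (rule *(1))
  show "pd v (conv u (mollifier \<epsilon>)) = conv u (pd v (mollifier \<epsilon>))" by (rule ext) (rule *(2))
  show "continuous_on UNIV (conv u (mollifier \<epsilon>))"
    by (rule conv_continuous[OF u mollifier_continuous mollifier_supp[OF e]])
  show "continuous_on UNIV (conv u (pd v (mollifier \<epsilon>)))"
    by (rule conv_continuous[OF u Ck_continuous[OF mollifier_pd_Ck[OF v, of 0]] mollifier_pd_supp[OF e]])
qed

lemma mollified_pd2:
  fixes u :: "'a::euclidean_space \<Rightarrow> real"
  assumes e: "\<epsilon> > 0" and u: "continuous_on UNIV u" and v: "v \<in> Basis" "v' \<in> Basis"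
  shows "has_pd v' (conv u (pd v (mollifier \<epsilon>))) z"
    "pd v' (conv u (pd v (mollifier \<epsilon>))) = conv u (pd v' (pd v (mollifier \<epsilon>)))"
    "continuous_on UNIV (conv u (pd v' (pd v (mollifier \<epsilon>))))"
proof -
  note * = conv_pd[OF u mollifier_pd_Ck[OF v(1)] v(2) mollifier_pd_supp[OF e]]
  show "has_pd v' (conv u (pd v (mollifier \<epsilon>))) z" by (rule *(1))
  show "pd v' (conv u (pd v (mollifier \<epsilon>))) = conv u (pd v' (pd v (mollifier \<epsilon>)))" by (rule ext) (rule *(2))
  have "Ck (Suc 0) (pd v (mollifier \<epsilon>))" by (rule mollifier_pd_Ck[OF v(1)])
  then have c: "continuous_on UNIV (pd v' (pd v (mollifier \<epsilon>)))" using v(2) by simp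
  show "continuous_on UNIV (conv u (pd v' (pd v (mollifier \<epsilon>))))"
    by (rule conv_continuous[OF u c pd_outside_support[OF mollifier_pd_supp[OF e]]])
qed

lemma conv_sum:
  assumes "\<And>i. i \<in> S \<Longrightarrow> integrable lborel (\<lambda>y. f i y * \<phi> (z - y))"
  shows "conv (\<lambda>y. \<Sum>i\<in>S. f i y) \<phi> z = (\<Sum>i\<in>S. conv (f i) \<phi> z)"
    "integrable lborel (\<lambda>y. (\<Sum>i\<in>S. f i y) * \<phi> (z - y))"
  using assms by (simp_all add: conv_def sum_distrib_right)

context lyapunov_operator
begin

text \<open>The classical derivatives of the mollified function are the mollified weak ones. It
  therefore solves the equation pointwise, with whatever is left over as source.\<close>

lemma mollified_psol:
  assumes e: "\<epsilon> > 0" and u: "continuous_on UNIV u" and jet: "weak_jet u w0 w1 w2"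
  defines "M \<equiv> mollifier \<epsilon>"
  shows "psol s (\<lambda>t x. conv u M (t, x))
    (\<lambda>t x. conv w0 M (t, x) - (\<Sum>i\<in>UNIV. \<Sum>j\<in>UNIV. Q (t, x) $ i $ j * conv (\<lambda>z. w2 z $ j $ i) M (t, x))
       - (\<Sum>i\<in>UNIV. b (t, x) $ i * conv (\<lambda>z. w1 z $ i) M (t, x)))"
proof -
  let ?U = "conv u M"
  have wd: "weak_derivative e_time u w0" "weak_derivative (e_space i) u (\<lambda>z. w1 z $ i)"
    "weak_derivative (e_space i) (\<lambda>z. w1 z $ j) (\<lambda>z. w2 z $ i $ j)" for i j
    using jet by (auto simp: weak_jet_def)
  note s1 = mollified_pd[OF e u, folded M_def]
  note s2 = mollified_pd2[OF e u e_space_Basis e_space_Basis, folded M_def]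
  note ms = mollifier_supp[OF e, folded M_def] mollifier_pd_supp[OF e, folded M_def]
  have pt: "pd e_time ?U z = conv w0 M z" for z
    unfolding s1(2)[OF e_time_Basis] unfolding M_def
    by (rule conv_weak_derivative[OF wd(1) mollifier_Ck e_time_Basis mollifier_supp[OF e]])
  have pi: "pd (e_space i) ?U z = conv (\<lambda>z. w1 z $ i) M z" for i z
    unfolding s1(2)[OF e_space_Basis] unfolding M_def
    by (rule conv_weak_derivative[OF wd(2) mollifier_Ck e_space_Basis mollifier_supp[OF e]])
  \<comment> \<open>The derivative in direction \<open>i\<close> is moved onto \<open>u\<close>
    first and the one in direction \<open>j\<close> onto the resulting gradient component, which is
    why the indices of \<open>w2\<close> appear transposed.\<close>
  have pij: "pd (e_space i) (pd (e_space j) ?U) z = conv (\<lambda>z. w2 z $ j $ i) M z" for i j z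
  proof -
    have "pd (e_space i) (pd (e_space j) ?U) z = conv u (pd (e_space i) (pd (e_space j) M)) z"
      unfolding s1(2)[OF e_space_Basis] s2(2) ..
    also have "\<dots> = conv (\<lambda>z. w1 z $ i) (pd (e_space j) M) z"
      unfolding M_def
      by (rule conv_weak_derivative[OF wd(2) mollifier_pd_Ck[OF e_space_Basis] e_space_Basis
        mollifier_pd_supp[OF e]])
    also have "\<dots> = conv (\<lambda>z. w2 z $ j $ i) M z"
      unfolding M_def
      by (rule conv_weak_derivative[OF wd(3) mollifier_Ck e_space_Basis mollifier_supp[OF e]])
    finally show ?thesis .
  qed
  have C: "C12_on (UNIV \<times> UNIV) ?U"
    unfolding C12_on_def s1(2)[OF e_space_Basis] s1(2)[OF e_time_Basis] s2(2)
    using s1(1,4)[OF e_time_Basis] s1(3)[OF e_time_Basis] s1(1,4)[OF e_space_Basis] s2(1,3) by simp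
  show ?thesis
    unfolding psol_def
  proof (intro conjI allI impI)
    show "continuous_on ({s..} \<times> UNIV) (\<lambda>(t, x). ?U (t, x))"
      using continuous_on_subset[OF s1(3)[OF e_time_Basis]] by (simp add: case_prod_beta')
    fix t x
    define g where "g = grad (\<lambda>y. ?U (t, y)) x"
    define H where "H = hess (\<lambda>y. ?U (t, y)) x"
    have gi: "g $ i = conv (\<lambda>z. w1 z $ i) M (t, x)" for i
      by (simp add: g_def grad_def pd_slice pi)
    have Hij: "H $ i $ j = conv (\<lambda>z. w2 z $ j $ i) M (t, x)" for i j
      by (simp add: H_def hess_def pd_slice[abs_def] pij)
    have QH: "Q (t, x) \<bullet> H = (\<Sum>i\<in>UNIV. \<Sum>j\<in>UNIV. Q (t, x) $ i $ j * conv (\<lambda>z. w2 z $ j $ i) M (t, x))"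
      by (simp add: inner_vec_def Hij)
    have bg: "b (t, x) \<bullet> g = (\<Sum>i\<in>UNIV. b (t, x) $ i * conv (\<lambda>z. w1 z $ i) M (t, x))"
      by (simp add: inner_vec_def gi)
    show "\<exists>ut g H. ((\<lambda>\<tau>. ?U (\<tau>, x)) has_real_derivative ut) (at t) \<and> jet2 (\<lambda>x. ?U (t, x)) x g H \<and>
      ut = Q (t, x) \<bullet> H + b (t, x) \<bullet> g +
       (conv w0 M (t, x) - (\<Sum>i\<in>UNIV. \<Sum>j\<in>UNIV. Q (t, x) $ i $ j * conv (\<lambda>z. w2 z $ j $ i) M (t, x))
       - (\<Sum>i\<in>UNIV. b (t, x) $ i * conv (\<lambda>z. w1 z $ i) M (t, x)))"
    proof (intro exI conjI)
      show "((\<lambda>\<tau>. ?U (\<tau>, x)) has_real_derivative conv w0 M (t, x)) (at t)"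
        using C12_on_jet(2)[OF C UNIV_I, of x t] by (simp add: pt)
      show "jet2 (\<lambda>x. ?U (t, x)) x g H"
        unfolding g_def H_def by (rule C12_on_jet(1)[OF C UNIV_I])
      show "conv w0 M (t, x) = Q (t, x) \<bullet> H + b (t, x) \<bullet> g +
       (conv w0 M (t, x) - (\<Sum>i\<in>UNIV. \<Sum>j\<in>UNIV. Q (t, x) $ i $ j * conv (\<lambda>z. w2 z $ j $ i) M (t, x))
       - (\<Sum>i\<in>UNIV. b (t, x) $ i * conv (\<lambda>z. w1 z $ i) M (t, x)))"
        unfolding QH bg by simp
    qed
  qed
qed

text \<open>Since the equation holds almost everywhere, it may be mollified. What remains of the
  source is one commutator for each entry of \<open>Q\<close> and \<open>b\<close>, that is
  \<open>N * N + N\<close> of them.\<close>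

lemma mollified_error_small:
  assumes jet: "weak_jet u w0 w1 w2"
    and eq: "AE z in lborel. w0 z - ((\<Sum>i\<in>UNIV. \<Sum>j\<in>UNIV. Q z $ i $ j * w2 z $ i $ j) +
            (\<Sum>i\<in>UNIV. b z $ i * w1 z $ i)) = 0"
    and q1: "\<And>i. Lq_loc (1 + 2 * real DIM(real \<times> (real ^ 'n)) / (\<alpha> / 2)) (\<lambda>z. w1 z $ i)"
    and q2: "\<And>i j. Lq_loc (1 + 2 * real DIM(real \<times> (real ^ 'n)) / (\<alpha> / 2)) (\<lambda>z. w2 z $ i $ j)"
    and K: "bounded K" and \<eta>: "\<eta> > 0"
  shows "\<forall>\<^sub>F \<epsilon> in at_right 0. \<forall>z\<in>K. \<bar>conv w0 (mollifier \<epsilon>) z -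
      (\<Sum>i\<in>UNIV. \<Sum>j\<in>UNIV. Q z $ i $ j * conv (\<lambda>z. w2 z $ j $ i) (mollifier \<epsilon>) z)
       - (\<Sum>i\<in>UNIV. b z $ i * conv (\<lambda>z. w1 z $ i) (mollifier \<epsilon>) z)\<bar>
     \<le> \<eta> * mass \<epsilon> TYPE(real \<times> (real ^ 'n))"
proof -
  have l0: "loc_int w0" and l1: "loc_int (\<lambda>z. w1 z $ i)" and l2: "loc_int (\<lambda>z. w2 z $ i $ j)" for i j
    using jet by (auto simp: weak_jet_def weak_derivative_def Lq_loc_1)
  have Qc: "continuous_on UNIV (\<lambda>z. Q z $ i $ j)" for i j
    by (rule parabolic_holder_loc_continuous[OF Q_holder \<alpha>_pos])
  have bc: "continuous_on UNIV (\<lambda>z. b z $ i)" for i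
    by (rule parabolic_holder_loc_continuous[OF b_holder \<alpha>_pos])
  define N where "N = real CARD('n)"
  have N: "N > 0" by (simp add: N_def)
  define \<eta>' where "\<eta>' = \<eta> / (N * N + N)"
  have NN: "N * N + N > 0" using N by (simp add: add_pos_pos)
  have \<eta>': "\<eta>' > 0" "(N * N + N) * \<eta>' = \<eta>" using NN \<eta> unfolding \<eta>'_def by (simp_all add: divide_pos_pos)
  define d2 where "d2 \<epsilon> z i j = conv (\<lambda>y. Q y $ i $ j * w2 y $ j $ i) (mollifier \<epsilon>) z -
      Q z $ i $ j * conv (\<lambda>y. w2 y $ j $ i) (mollifier \<epsilon>) z" for \<epsilon> z i j
  define d1 where "d1 \<epsilon> z i = conv (\<lambda>y. b y $ i * w1 y $ i) (mollifier \<epsilon>) z -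
      b z $ i * conv (\<lambda>y. w1 y $ i) (mollifier \<epsilon>) z" for \<epsilon> z i
  let ?m = "\<lambda>\<epsilon>. mass \<epsilon> TYPE(real \<times> (real ^ 'n))"
  have "\<forall>\<^sub>F \<epsilon> in at_right 0. \<forall>z\<in>K. \<bar>d2 \<epsilon> z i j\<bar> \<le> \<eta>' * ?m \<epsilon>" for i j
    unfolding d2_def by (rule commutator_small[OF Q_holder \<alpha>_pos l2 q2 K \<eta>'(1)])
  then have "\<forall>\<^sub>F \<epsilon> in at_right 0. \<forall>i j. \<forall>z\<in>K. \<bar>d2 \<epsilon> z i j\<bar> \<le> \<eta>' * ?m \<epsilon>"
    by (intro eventually_all_finite)
  moreover have "\<forall>\<^sub>F \<epsilon> in at_right 0. \<forall>z\<in>K. \<bar>d1 \<epsilon> z i\<bar> \<le> \<eta>' * ?m \<epsilon>" for i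
    unfolding d1_def by (rule commutator_small[OF b_holder \<alpha>_pos l1 q1 K \<eta>'(1)])
  then have "\<forall>\<^sub>F \<epsilon> in at_right 0. \<forall>i. \<forall>z\<in>K. \<bar>d1 \<epsilon> z i\<bar> \<le> \<eta>' * ?m \<epsilon>"
    by (intro eventually_all_finite)
  moreover have "\<forall>\<^sub>F \<epsilon> in at_right (0::real). 0 < \<epsilon>" by (rule eventually_at_right_less)
  ultimately show ?thesis
  proof eventually_elim
    case (elim \<epsilon>)
    let ?M = "mollifier \<epsilon> :: real \<times> (real ^ 'n) \<Rightarrow> real"
    show ?case
    proof
      fix z assume z: "z \<in> K"
      have i2: "integrable lborel (\<lambda>y. (Q y $ i $ j * w2 y $ j $ i) * ?M (z - y))" for i j
        by (rule mollified_product_integrable[OF elim(3) Qc l2])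
      have i1: "integrable lborel (\<lambda>y. (b y $ i * w1 y $ i) * ?M (z - y))" for i
        by (rule mollified_product_integrable[OF elim(3) bc l1])
      define F2 where "F2 y = (\<Sum>i\<in>UNIV. \<Sum>j\<in>UNIV. Q y $ i $ j * w2 y $ j $ i)" for y
      define F1 where "F1 y = (\<Sum>i\<in>UNIV. b y $ i * w1 y $ i)" for y
      \<comment> \<open>Symmetry of \<open>Q\<close> undoes the transposition of the indices of
        \<open>w2\<close>.\<close>
      have F2s: "F2 y = (\<Sum>i\<in>UNIV. \<Sum>j\<in>UNIV. Q y $ i $ j * w2 y $ i $ j)" for y
      proof -
        have "Q y $ i $ j = Q y $ j $ i" for i j
          using Q_sym[of y] unfolding transpose_def by (metis vec_lambda_beta)
        then show ?thesis unfolding F2_def by (subst sum.swap) simp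
      qed
      have F2i: "integrable lborel (\<lambda>y. F2 y * ?M (z - y))"
        "conv F2 ?M z = (\<Sum>i\<in>UNIV. \<Sum>j\<in>UNIV. conv (\<lambda>y. Q y $ i $ j * w2 y $ j $ i) ?M z)"
      proof -
        have i: "integrable lborel (\<lambda>y. (\<Sum>j\<in>UNIV. Q y $ i $ j * w2 y $ j $ i) * ?M (z - y))" for i
          by (rule conv_sum(2)[OF i2])
        show "integrable lborel (\<lambda>y. F2 y * ?M (z - y))" unfolding F2_def by (rule conv_sum(2)[OF i])
        show "conv F2 ?M z = (\<Sum>i\<in>UNIV. \<Sum>j\<in>UNIV. conv (\<lambda>y. Q y $ i $ j * w2 y $ j $ i) ?M z)"
          unfolding F2_def[abs_def] conv_sum(1)[OF i] conv_sum(1)[OF i2] ..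
      qed
      have F1i: "integrable lborel (\<lambda>y. F1 y * ?M (z - y))"
        "conv F1 ?M z = (\<Sum>i\<in>UNIV. conv (\<lambda>y. b y $ i * w1 y $ i) ?M z)"
        unfolding F1_def[abs_def] by (rule conv_sum(2)[OF i1], rule conv_sum(1)[OF i1])
      have "conv w0 ?M z = (LINT y|lborel. F2 y * ?M (z - y) + F1 y * ?M (z - y))"
        unfolding conv_def
      proof (rule integral_cong_AE)
        show "(\<lambda>y. w0 y * ?M (z - y)) \<in> borel_measurable lborel"
          using conv_mollifier_integrable[OF elim(3) l0] by (rule borel_measurable_integrable)
        show "(\<lambda>y. F2 y * ?M (z - y) + F1 y * ?M (z - y)) \<in> borel_measurable lborel"
          by (intro borel_measurable_integrable Bochner_Integration.integrable_add F2i(1) F1i(1))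
        show "AE y in lborel. w0 y * ?M (z - y) = F2 y * ?M (z - y) + F1 y * ?M (z - y)"
          using eq
        proof eventually_elim
          case (elim y)
          then have "w0 y = F2 y + F1 y" unfolding F2s F1_def by simp
          then show ?case by (simp add: distrib_right)
        qed
      qed
      also have "\<dots> = conv F2 ?M z + conv F1 ?M z"
        using Bochner_Integration.integral_add[OF F2i(1) F1i(1)] by (simp add: conv_def)
      finally have "conv w0 ?M z = conv F2 ?M z + conv F1 ?M z" .
      then have "conv w0 ?M z - (\<Sum>i\<in>UNIV. \<Sum>j\<in>UNIV. Q z $ i $ j * conv (\<lambda>z. w2 z $ j $ i) ?M z)
         - (\<Sum>i\<in>UNIV. b z $ i * conv (\<lambda>z. w1 z $ i) ?M z) =
         (\<Sum>i\<in>UNIV. \<Sum>j\<in>UNIV. d2 \<epsilon> z i j) + (\<Sum>i\<in>UNIV. d1 \<epsilon> z i)"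
        unfolding F2i(2) F1i(2) d1_def d2_def by (simp add: sum_subtractf)
      also have "\<bar>\<dots>\<bar> \<le> (\<Sum>i\<in>UNIV. \<Sum>j\<in>UNIV. \<bar>d2 \<epsilon> z i j\<bar>) + (\<Sum>i\<in>UNIV. \<bar>d1 \<epsilon> z i\<bar>)"
        by (intro order_trans[OF abs_triangle_ineq] add_mono sum_abs order_trans[OF sum_abs] sum_mono)
      also have "\<dots> \<le> (\<Sum>i\<in>(UNIV :: 'n set). \<Sum>j\<in>(UNIV :: 'n set). \<eta>' * ?m \<epsilon>) + (\<Sum>i\<in>(UNIV :: 'n set). \<eta>' * ?m \<epsilon>)"
        using elim(1,2) z by (intro add_mono sum_mono) auto
      also have "\<dots> = ((N * N + N) * \<eta>') * ?m \<epsilon>" by (simp add: N_def algebra_simps)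
      also have "\<dots> = \<eta> * ?m \<epsilon>" unfolding \<eta>'(2) ..
      finally show "\<bar>conv w0 ?M z - (\<Sum>i\<in>UNIV. \<Sum>j\<in>UNIV. Q z $ i $ j * conv (\<lambda>z. w2 z $ j $ i) ?M z)
         - (\<Sum>i\<in>UNIV. b z $ i * conv (\<lambda>z. w1 z $ i) ?M z)\<bar> \<le> \<eta> * ?m \<epsilon>" .
    qed
  qed
qed

end

context evolution_measures
begin

text \<open>The mollified solution is close to \<open>u\<close> and nearly solves the equation only
  on a bounded set, and the growth bound with margin \<open>\<kappa>\<close> is designed for that:
  elsewhere both functions are bounded by \<open>B\<close> and \<open>\<kappa> * V y\<close> covers
  the difference. All errors are multiples of \<open>\<kappa>\<close> by a constant fixed in
  advance.\<close>

lemma strong_solution_evolution: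
  assumes u: "u \<in> (\<Inter>q\<in>{1..}. W12_loc T q) \<inter> Cb_per T" and sol: "strong_solution Q b u" and st: "s \<le> t"
  shows "u (t, x) = P t s (\<lambda>y. u (s, y)) x"
proof -
  have ub: "u \<in> bcontfun" using u by (simp add: Cb_per_def)
  have uc: "continuous_on UNIV u" using ub by (simp add: mem_bcontfun)
  obtain B where B: "B > 0" "\<And>z. \<bar>u z\<bar> \<le> B" using bcontfun_bound[OF ub] by blast
  obtain w0 w1 w2 where jet: "weak_jet u w0 w1 w2" and
    eq: "AE z in lborel. w0 z - ((\<Sum>i\<in>UNIV. \<Sum>j\<in>UNIV. Q z $ i $ j * w2 z $ i $ j) +
            (\<Sum>i\<in>UNIV. b z $ i * w1 z $ i)) = 0"
    using sol unfolding strong_solution_def by blast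
  \<comment> \<open>The exponent demanded by \<open>small_average\<close> for the Hoelder gain
    \<open>\<alpha> / 2\<close>. The derivatives found at this exponent are then identified with
    those in the equation.\<close>
  define q where "q = 1 + 2 * real DIM(real \<times> (real ^ 'n)) / (\<alpha> / 2)"
  have "q \<ge> 1" using \<alpha>_pos by (simp add: q_def)
  then have "u \<in> W12_loc T q" using u by auto
  then obtain v0 v1 v2 where jet': "weak_jet u v0 v1 v2" and
    v1: "\<And>i. Lq_loc q (\<lambda>z. v1 z $ i)" and v2: "\<And>i j. Lq_loc q (\<lambda>z. v2 z $ i $ j)"
    unfolding W12_loc_def by blast
  have L1: "Lq_loc 1 (\<lambda>z. w1 z $ i)" "Lq_loc 1 (\<lambda>z. w2 z $ i $ j)" for i j
    using jet by (auto simp: weak_jet_def weak_derivative_def)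
  have e1: "AE z in lborel. v1 z $ i = w1 z $ i" for i
    by (rule weak_derivative_unique[of "e_space i" u]) (use jet jet' in \<open>auto simp: weak_jet_def\<close>)
  have e2: "AE z in lborel. v2 z $ i $ j = w2 z $ i $ j" for i j
  proof (rule weak_derivative_unique[of "e_space i"])
    show "weak_derivative (e_space i) (\<lambda>z. w1 z $ j) (\<lambda>z. w2 z $ i $ j)" using jet
      by (auto simp: weak_jet_def)
    have "weak_derivative (e_space i) (\<lambda>z. v1 z $ j) (\<lambda>z. v2 z $ i $ j)" using jet'
      by (auto simp: weak_jet_def)
    then show "weak_derivative (e_space i) (\<lambda>z. w1 z $ j) (\<lambda>z. v2 z $ i $ j)"
      by (rule weak_derivative_cong_AE[OF _ L1(1) e1 e_space_Basis])
  qed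
  have q1: "Lq_loc q (\<lambda>z. w1 z $ i)" for i
    by (rule Lq_loc_cong_AE[OF v1 e1]) (use L1 in \<open>auto simp: Lq_loc_def\<close>)
  have q2: "Lq_loc q (\<lambda>z. w2 z $ i $ j)" for i j
    by (rule Lq_loc_cong_AE[OF v2 e2]) (use L1 in \<open>auto simp: Lq_loc_def\<close>)
  define f where "f = (\<lambda>y. u (s, y))"
  have f: "f \<in> bcontfun" unfolding f_def by (rule slice_bcontfun[OF uc B(2)])
  have PB: "\<bar>P \<tau> s f y\<bar> \<le> B" if "s \<le> \<tau>" for \<tau> y by (rule P_abs_le[OF f _ that]) (simp add: f_def B)
  \<comment> \<open>The 2 accounts for the mollification error once at the initial time and once at
    (\<open>t\<close>, \<open>x\<close>).\<close>
  define D where "D = 2 + (exp (- c * (t - s)) * V x + a / c * (1 - exp (- c * (t - s)))) + (V x + (a +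
    1) * (t - s))"
  have D: "D > 0"
  proof -
    have "exp (- c * (t - s)) \<le> 1" using c_pos st by simp
    then have "0 \<le> exp (- c * (t - s)) * V x + a / c * (1 - exp (- c * (t - s)))"
      using a_pos c_pos V_pos[of x] by (intro add_nonneg_nonneg mult_nonneg_nonneg) auto
    moreover have "0 \<le> V x + (a + 1) * (t - s)" using a_pos V_pos[of x] st
      by (intro add_nonneg_nonneg mult_nonneg_nonneg) auto
    ultimately show ?thesis by (simp add: D_def)
  qed
  have key: "\<bar>u (t, x) - P t s f x\<bar> \<le> \<kappa> * D" if \<kappa>: "\<kappa> > 0" for \<kappa>
  proof -
    \<comment> \<open>The first entry makes the weight exceed \<open>2 * B\<close> outside the
      sublevel set, the second places \<open>x\<close> inside it.\<close>
    define M where "M = max (2 * B / \<kappa>) (V x)"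
    have M: "2 * B \<le> \<kappa> * M" "V x \<le> M"
    proof -
      have "\<kappa> * (2 * B / \<kappa>) \<le> \<kappa> * M" using \<kappa> by (intro mult_left_mono) (auto simp: M_def)
      then show "2 * B \<le> \<kappa> * M" using \<kappa> by simp
    qed (simp add: M_def)
    define K where "K = {s..t} \<times> {x. V x \<le> M}"
    have K: "bounded K" unfolding K_def
      by (intro bounded_Times compact_imp_bounded[OF V_sublevel_compact]) simp
    let ?m = "\<lambda>\<epsilon>. mass \<epsilon> TYPE(real \<times> (real ^ 'n))"
    define E where "E \<epsilon> z = conv w0 (mollifier \<epsilon>) z -
      (\<Sum>i\<in>UNIV. \<Sum>j\<in>UNIV. Q z $ i $ j * conv (\<lambda>z. w2 z $ j $ i) (mollifier \<epsilon>) z)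
       - (\<Sum>i\<in>UNIV. b z $ i * conv (\<lambda>z. w1 z $ i) (mollifier \<epsilon>) z)" for \<epsilon> z
    have "\<forall>\<^sub>F \<epsilon> in at_right 0. (\<forall>z\<in>K. \<bar>conv u (mollifier \<epsilon>) z / ?m \<epsilon> - u z\<bar> \<le> \<kappa>) \<and>
       (\<forall>z\<in>K. \<bar>E \<epsilon> z\<bar> \<le> \<kappa> * ?m \<epsilon>) \<and> 0 < \<epsilon>"
      unfolding E_def
      by (intro eventually_conj mollify_uniform[OF uc K \<kappa>] eventually_at_right_less
          mollified_error_small[OF jet eq q1[unfolded q_def] q2[unfolded q_def] K \<kappa>])
    then have "\<exists>\<epsilon>. (\<forall>z\<in>K. \<bar>conv u (mollifier \<epsilon>) z / ?m \<epsilon> - u z\<bar> \<le> \<kappa>) \<and>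
       (\<forall>z\<in>K. \<bar>E \<epsilon> z\<bar> \<le> \<kappa> * ?m \<epsilon>) \<and> 0 < \<epsilon>"
      by (rule eventually_happens'[OF trivial_limit_at_right_real])
    then obtain \<epsilon> where e: "\<epsilon> > 0" and close: "\<And>z. z \<in> K \<Longrightarrow> \<bar>conv u (mollifier \<epsilon>) z / ?m \<epsilon> - u z\<bar> \<le> \<kappa>"
      and err: "\<And>z. z \<in> K \<Longrightarrow> \<bar>E \<epsilon> z\<bar> \<le> \<kappa> * ?m \<epsilon>" by blast
    have m: "?m \<epsilon> > 0" by (rule mass_pos[OF e])
    define U where "U \<tau> y = 1 / ?m \<epsilon> * conv u (mollifier \<epsilon>) (\<tau>, y)" for \<tau> y
    define G where "G \<tau> y = 1 / ?m \<epsilon> * E \<epsilon> (\<tau>, y)" for \<tau> y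
    have U: "psol s U G"
      unfolding U_def[abs_def] G_def[abs_def] E_def
      by (rule psol_cmult[OF mollified_psol[OF e uc jet]])
    have UB: "\<bar>U \<tau> y\<bar> \<le> B" for \<tau> y
      using mollify_close[OF e uc, of "(\<tau>, y)" 0 B] B(2) by (simp add: U_def)
    have Uc: "\<bar>U \<tau> y - u (\<tau>, y)\<bar> \<le> \<kappa>" if "s \<le> \<tau>" "\<tau> \<le> t" "V y \<le> M" for \<tau> y
      using close[of "(\<tau>, y)"] that by (simp add: U_def K_def)
    have Gb: "\<bar>G \<tau> y\<bar> \<le> \<kappa>" if "s \<le> \<tau>" "\<tau> \<le> t" "V y \<le> M" for \<tau> y
      using err[of "(\<tau>, y)"] that m by (simp add: G_def K_def abs_mult field_simps)
    have init: "\<bar>U s y - f y\<bar> \<le> \<kappa> + \<kappa> * V y" for y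
    proof (cases "V y \<le> M")
      case True
      have "0 \<le> \<kappa> * V y" using \<kappa> V_pos[of y] by simp
      then show ?thesis using Uc[of s y] True st by (simp add: f_def)
    next
      case False
      then have "\<kappa> * M \<le> \<kappa> * V y" using \<kappa> by simp
      then show ?thesis using M(1) UB[of s y] B(2)[of "(s, y)"] \<kappa> unfolding f_def by linarith
    qed
    have ps: "psol s (\<lambda>\<tau> y. U \<tau> y - P \<tau> s f y) G" "psol s (\<lambda>\<tau> y. P \<tau> s f y - U \<tau> y) (\<lambda>\<tau> y. - G \<tau> y)"
      using psol_diff[OF U P_psol[OF f, of s]] psol_diff[OF P_psol[OF f, of s] U] by simp_all
    have bd: "U \<tau> y - P \<tau> s f y \<le> 2 * B" "P \<tau> s f y - U \<tau> y \<le> 2 * B" if "s \<le> \<tau>" for \<tau> y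
      using UB[of \<tau> y] PB[OF that, of y] by linarith+
    have MB: "2 * B - \<kappa> \<le> \<kappa> * M" using M(1) \<kappa> by linarith
    have k0: "\<kappa> \<ge> 0" using \<kappa> by simp
    have "U t x - P t s f x \<le> \<kappa> + \<kappa> * (exp (- c * (t - s)) * V x + a / c * (1 - exp (- c * (t - s)))) +
       \<kappa> * (V x + (a + 1) * (t - s))"
    proof (rule growth_bound_eps[OF ps(1) _ _ k0 \<kappa> MB _ st order_refl])
      show "U \<tau> y - P \<tau> s f y \<le> 2 * B" if "s \<le> \<tau>" "\<tau> \<le> t" for \<tau> y by (rule bd(1)[OF that(1)])
      show "U s y - P s s f y \<le> \<kappa> + \<kappa> * V y" for y unfolding P_init[OF f] using init[of y] by linarith
      show "G \<tau> y \<le> \<kappa>" if "s < \<tau>" "\<tau> \<le> t" "V y \<le> M" for \<tau> y using Gb[of \<tau> y] that by simp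
    qed
    moreover have "P t s f x - U t x \<le>
      \<kappa> + \<kappa> * (exp (- c * (t - s)) * V x + a / c * (1 - exp (- c * (t - s)))) +
       \<kappa> * (V x + (a + 1) * (t - s))"
    proof (rule growth_bound_eps[OF ps(2) _ _ k0 \<kappa> MB _ st order_refl])
      show "P \<tau> s f y - U \<tau> y \<le> 2 * B" if "s \<le> \<tau>" "\<tau> \<le> t" for \<tau> y by (rule bd(2)[OF that(1)])
      show "P s s f y - U s y \<le> \<kappa> + \<kappa> * V y" for y unfolding P_init[OF f] using init[of y] by linarith
      show "- G \<tau> y \<le> \<kappa>" if "s < \<tau>" "\<tau> \<le> t" "V y \<le> M" for \<tau> y using Gb[of \<tau> y] that by simp
    qed
    moreover have "\<bar>U t x - u (t, x)\<bar> \<le> \<kappa>" by (rule Uc[OF st order_refl M(2)])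
    ultimately have "\<bar>u (t, x) - P t s f x\<bar> \<le>
      \<kappa> + (\<kappa> + \<kappa> * (exp (- c * (t - s)) * V x + a / c * (1 - exp (- c * (t - s)))) +
       \<kappa> * (V x + (a + 1) * (t - s)))" by linarith
    also have "\<dots> = \<kappa> * D" by (simp add: D_def algebra_simps)
    finally show ?thesis .
  qed
  have "\<bar>u (t, x) - P t s f x\<bar> \<le> 0"
  proof (rule field_le_epsilon)
    fix e :: real assume "e > 0"
    then show "\<bar>u (t, x) - P t s f x\<bar> \<le> 0 + e" using key[of "e / D"] D by simp
  qed
  then show ?thesis by (simp add: f_def)
qed

text \<open>Periodicity lets \<open>u (s, x)\<close> be read off after arbitrarily many periods,
  when the evolution has forgotten \<open>x\<close>.\<close>

lemma liouville:
  assumes u: "u \<in> (\<Inter>q\<in>{1..}. W12_loc T q) \<inter> Cb_per T" and sol: "strong_solution Q b u"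
  shows "\<exists>k. u = (\<lambda>_. k)"
proof -
  have ub: "u \<in> bcontfun" and per: "time_periodic T u" using u by (auto simp: Cb_per_def)
  have uc: "continuous_on UNIV u" using ub by (simp add: mem_bcontfun)
  obtain B where B: "B > 0" "\<And>z. \<bar>u z\<bar> \<le> B" using bcontfun_bound[OF ub] by blast
  define m where "m s = (LINT y|\<mu> s. u (s, y))" for s
  have m: "u (s, x) = m s" for s x
  proof -
    have "\<bar>u (s, x) - m s\<bar> \<le> 0"
    proof (rule field_le_epsilon)
      fix e :: real assume e: "e > 0"
      obtain t0 where t0: "t0 > 0" and d: "\<forall>s t z f. f \<in> bcontfun \<longrightarrow> (\<forall>x. \<bar>f x\<bar> \<le> B) \<longrightarrow> s + t0 \<le> t \<longrightarrow>
        norm z \<le> norm x \<longrightarrow>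
         \<bar>P t s f z - (LINT y|\<mu> s. f y)\<bar> \<le> e" using mean_decay_eventually[OF e B(1), of "norm x"]
           by (elim exE conjE)
      obtain n :: nat where n: "t0 / T < real n" using reals_Archimedean2 by blast
      then have nT: "t0 \<le> real n * T" using T_pos by (simp add: field_simps)
      have "u (s, x) = u (s + real n * T, x)" by (rule periodic_multiple(1)[OF per, symmetric])
      also have "\<dots> = P (s + real n * T) s (\<lambda>y. u (s, y)) x"
        by (rule strong_solution_evolution[OF u sol]) (use T_pos in simp)
      finally have "u (s, x) = P (s + real n * T) s (\<lambda>y. u (s, y)) x" .
      moreover have "\<bar>P (s + real n * T) s (\<lambda>y. u (s, y)) x - m s\<bar> \<le> e"
        unfolding m_def by (rule d[rule_format, OF slice_bcontfun[OF uc B(2)] B(2)]) (use nT in auto)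
      ultimately show "\<bar>u (s, x) - m s\<bar> \<le> 0 + e" by simp
    qed
    then show ?thesis by simp
  qed
  \<comment> \<open>What is left is a function of time alone; it is constant because the evolution
    fixes spatial constants.\<close>
  have le: "m t = m s" if "s \<le> t" for s t
  proof -
    have "m t = u (t, 0)" by (simp add: m)
    also have "\<dots> = P t s (\<lambda>y. u (s, y)) 0" by (rule strong_solution_evolution[OF u sol that])
    also have "(\<lambda>y. u (s, y)) = (\<lambda>_. m s)" by (simp add: m)
    also have "P t s (\<lambda>_. m s) 0 = m s" by (rule P_const[OF that])
    finally show ?thesis .
  qed
  have "m s = m 0" for s using le[of 0 s] le[of s 0] by (cases "0 \<le> s") auto
  then show ?thesis using m by (intro exI[of _ "m 0"]) (auto simp: fun_eq_iff)
qed

lemma constants_are_solutions: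
  "(\<lambda>_ :: real \<times> (real ^ 'n). k) \<in> (\<Inter>q\<in>{1..}. W12_loc T q) \<inter> Cb_per T" "strong_solution Q b (\<lambda>_. k)"
proof -
  have Lq: "Lq_loc q (\<lambda>_ :: real \<times> (real ^ 'n). l)" for q l
    unfolding Lq_loc_def set_integrable_def
    by (auto simp del: real_scaleR_def intro!: borel_integrable_compact)
  have wd: "weak_derivative v (\<lambda>_. l) (\<lambda>_. 0)" if "v \<in> Basis" for l and v :: "real \<times> (real ^ 'n)"
    using integral_pd_test_function[OF _ that] by (auto simp: weak_derivative_def Lq)
  have jet: "weak_jet (\<lambda>_. k) (\<lambda>_. 0) (\<lambda>_. 0) (\<lambda>_ :: real \<times> (real ^ 'n). 0)"
    using wd[OF e_time_Basis] wd[OF e_space_Basis] by (simp add: weak_jet_def)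
  have "(\<lambda>_ :: real \<times> (real ^ 'n). k) \<in> W12_loc T q" for q
    unfolding W12_loc_def using jet Lq by (auto simp: time_periodic_def intro!: exI[of _ "\<lambda>_. 0"])
  moreover have "(\<lambda>_ :: real \<times> (real ^ 'n). k) \<in> Cb_per T"
    by (auto simp: Cb_per_def time_periodic_def intro!: bcontfunI[of _ "\<bar>k\<bar>"])
  ultimately show "(\<lambda>_ :: real \<times> (real ^ 'n). k) \<in> (\<Inter>q\<in>{1..}. W12_loc T q) \<inter> Cb_per T" by blast
  show "strong_solution Q b (\<lambda>_. k)"
    unfolding strong_solution_def using jet by (intro exI[of _ "\<lambda>_. 0"] conjI) auto
qed

end

theorem proposition4p4:
  fixes T \<alpha> a c :: real
    and Q :: "real \<times> (real ^ 'n) \<Rightarrow> real ^ 'n ^ 'n"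
    and b :: "real \<times> (real ^ 'n) \<Rightarrow> real ^ 'n"
    and \<eta> :: "real \<times> (real ^ 'n) \<Rightarrow> real"
    and V :: "real ^ 'n \<Rightarrow> real"
    and P :: "real \<Rightarrow> real \<Rightarrow> (real ^ 'n \<Rightarrow> real) \<Rightarrow> real ^ 'n \<Rightarrow> real"
    and \<mu> :: "real \<Rightarrow> (real ^ 'n) measure"
  assumes "T > 0"
    and "0 < \<alpha>" and "\<alpha> < 1"
    and "time_periodic T Q" and "time_periodic T b"
    and "\<And>i j. parabolic_holder_loc \<alpha> (\<lambda>z. Q z $ i $ j)"
    and "\<And>i. parabolic_holder_loc \<alpha> (\<lambda>z. b z $ i)"
    and "\<And>z. transpose (Q z) = Q z"
    and "time_periodic T \<eta>"
    and "\<exists>\<delta>>0. \<forall>z. \<delta> \<le> \<eta> z"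
    and "\<And>z \<xi>. (Q z *v \<xi>) \<bullet> \<xi> \<ge> \<eta> z * (norm \<xi>)\<^sup>2"
    and "Ck 2 V" and "\<And>x. V x > 0"
    and "filterlim V at_top at_infinity"
    and "a > 0" and "c > 0"
    and "\<And>s x. ell_op Q b s V x \<le> a - c * V x"
    and "evolution_operator Q b P"
    and "periodic_evolution_system T P \<mu>"
    and "\<And>\<nu>. periodic_evolution_system T P \<nu> \<Longrightarrow> \<nu> = \<mu>"
  shows "tauc_mean_ergodic (Cb_per T) (evolution_semigroup P) \<and>
    (\<forall>s>0. \<forall>f\<in>bcontfun.
       tauc_means_tendsto bcontfun
         (\<lambda>r x. P s (- r) f x - (LINT y|\<mu> (- r). f y)) (\<lambda>_. 0)) \<and>
    {u. u \<in> (\<Inter>q\<in>{1..}. W12_loc T q) \<inter> Cb_per T \<and> strong_solution Q b u} =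
    range (\<lambda>k _. k)"
proof -
  from assms(10) obtain \<delta> where \<delta>: "\<delta> > 0" "\<And>z. \<delta> \<le> \<eta> z" by blast
  have ell: "\<delta> * (norm \<xi>)\<^sup>2 \<le> (Q z *v \<xi>) \<bullet> \<xi>" for z \<xi>
    by (rule order_trans[OF mult_right_mono[OF \<delta>(2)] assms(11)]) simp
  interpret evolution_measures T \<alpha> \<delta> a c Q b V P \<mu>
    by unfold_locales (rule assms \<delta>(1) ell)+
  have "{u. u \<in> (\<Inter>q\<in>{1..}. W12_loc T q) \<inter> Cb_per T \<and> strong_solution Q b u} = range (\<lambda>k _. k)"
  proof (intro set_eqI iffI)
    fix u assume "u \<in> {u. u \<in> (\<Inter>q\<in>{1..}. W12_loc T q) \<inter> Cb_per T \<and> strong_solution Q b u}"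
    then have "\<exists>k. u = (\<lambda>_. k)" using liouville by blast
    then show "u \<in> range (\<lambda>k _. k)" by blast
  next
    fix u :: "real \<times> (real ^ 'n) \<Rightarrow> real" assume "u \<in> range (\<lambda>k _. k)"
    then obtain k where "u = (\<lambda>_. k)" by blast
    then show "u \<in> {u. u \<in> (\<Inter>q\<in>{1..}. W12_loc T q) \<inter> Cb_per T \<and> strong_solution Q b u}"
      using constants_are_solutions by blast
  qed
  then show ?thesis using evolution_semigroup_mean_ergodic backward_means_tendsto by blast
qed

end
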